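(* Let $\mathcal{B}\to\mathcal{A}$ be a non-split expansion of abelian categories and $\Delta$ its associated division ring. Then there are isomorphisms of functors $$D\operatorname{Ext}^1_{\mathcal{A}}(-,S_\rho)\cong\operatorname{Hom}_{\mathcal{A}}(S_\lambda,-)\quad\text{and}\quad D\operatorname{Ext}^1_{\mathcal{A}}(S_\lambda,-)\cong\operatorname{Hom}_{\mathcal{A}}(-,S_\rho),$$ where $D=\operatorname{Hom}_\Delta(-,\Delta)$ denotes the standard duality. In particular, any non-split extension $0\to S_\rho\to E\to S_\lambda\to 0$ is an almost split sequence.
   Context: Perpendicular categories: for a class $\mathcal{C}$ of objects in an abelian category $\mathcal{A}$, $\mathcal{C}^\perp$ (resp. ${}^\perp\mathcal{C}$) is the full subcategory of all $A\in\mathcal{A}$ with $\operatorname{Hom}_{\mathcal{A}}(C,A)=0=\operatorname{Ext}^1_{\mathcal{A}}(C,A)$ (resp. $\operatorname{Hom}_{\mathcal{A}}(A,C)=0=\operatorname{Ext}^1_{\mathcal{A}}(A,C)$) for all $C\in\mathcal{C}$. $\operatorname{Ext}^n$ denotes Yoneda Ext. Expansions: a fully faithful exact functor $\mathcal{B}\to\mathcal{A}$ between abelian categories (with $\mathcal{B}$ identified with its essential image in $\mathcal{A}$) is a left expansion if (E1) it admits an exact left adjoint; (E2) ${}^\perp\mathcal{B}$ is equivalent to $\operatorname{mod}\Delta$, the category of finitely generated right $\Delta$-modules, for some division ring $\Delta$; (E3) $\operatorname{Ext}^2_{\mathcal{A}}(A,B)=0$ for all $A,B\in{}^\perp\mathcal{B}$.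 It is a right expansion if the dual conditions hold: it admits an exact right adjoint, $\mathcal{B}^\perp$ is equivalent to $\operatorname{mod}\Delta$ for some division ring $\Delta$, and $\operatorname{Ext}^2_{\mathcal{A}}(A,B)=0$ for all $A,B\in\mathcal{B}^\perp$. It is an expansion if it is both. An expansion is split if $\mathcal{B}^\perp={}^\perp\mathcal{B}$, and non-split otherwise. Notation: $S_\lambda$ is an indecomposable object of ${}^\perp\mathcal{B}$ and $S_\rho$ an indecomposable object of $\mathcal{B}^\perp$ (each unique up to isomorphism). The associated division ring $\Delta$ is the division ring such that ${}^\perp\mathcal{B}$ and $\mathcal{B}^\perp$ are equivalent to $\operatorname{mod}\Delta$; thus $\Delta\cong\operatorname{End}_{\mathcal{A}}(S_\lambda)\cong\operatorname{End}_{\mathcal{A}}(S_\rho)$, and the Hom and Ext groups in the claim are regarded as (left or right) $\Delta$-modules through these rings, identified via their actions $\operatorname{End}_{\mathcal{A}}(S_\lambda)\cong\operatorname{Ext}^1_{\mathcal{A}}(S_\lambda,S_\rho)\cong\operatorname{End}_{\mathcal{A}}(S_\rho)$ on a non-split extension. An exact sequence $0\to X\to E\to Z\to 0$ is almost split if it is non-split, every morphism $A\to Z$ that is not a split epimorphism factors through $E\to Z$, and every morphism $X\to A$ that is not a split monomorphism factors through $X\to E$. *)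

theory Defs
  imports "HOL-Algebra.QuotRing" "HOL-Algebra.Module"
begin

section \<open>Categories\<close>

text \<open>
  A category is given by a set of objects and a set of arrows.  The fields \<open>Add\<close> and \<open>Zer\<close> carry
  the preadditive structure: addition of parallel arrows and the zero arrow between two objects.
  Composition is written in the usual order, and is only meaningful for composable arrows.
\<close>

record ('o, 'm) cat =
  Obj :: "'o set"
  Arr :: "'m set"
  Dom :: "'m \<Rightarrow> 'o"
  Cod :: "'m \<Rightarrow> 'o"
  Ide :: "'o \<Rightarrow> 'm"
  Comp :: "'m \<Rightarrow> 'm \<Rightarrow> 'm" (infixl \<open>\<cdot>\<index>\<close> 70)
  Add :: "'m \<Rightarrow> 'm \<Rightarrow> 'm"
  Zer :: "'o \<Rightarrow> 'o \<Rightarrow> 'm"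

definition Hom :: "('o, 'm) cat \<Rightarrow> 'o \<Rightarrow> 'o \<Rightarrow> 'm set" where
  "Hom C x y = {f \<in> Arr C. Dom C f = x \<and> Cod C f = y}"

locale category =
  fixes C :: "('o, 'm) cat" (structure)
  assumes Dom_in: "f \<in> Arr C \<Longrightarrow> Dom C f \<in> Obj C"
    and Cod_in: "f \<in> Arr C \<Longrightarrow> Cod C f \<in> Obj C"
    and Ide_in: "x \<in> Obj C \<Longrightarrow> Ide C x \<in> Hom C x x"
    and Comp_in: "\<lbrakk>f \<in> Hom C x y; g \<in> Hom C y z\<rbrakk> \<Longrightarrow> g \<cdot> f \<in> Hom C x z"
    and Comp_Ide: "f \<in> Hom C x y \<Longrightarrow> f \<cdot> Ide C x = f"
    and Ide_Comp: "f \<in> Hom C x y \<Longrightarrow> Ide C y \<cdot> f = f"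
    and Comp_assoc: "\<lbrakk>f \<in> Hom C w x; g \<in> Hom C x y; h \<in> Hom C y z\<rbrakk>
      \<Longrightarrow> (h \<cdot> g) \<cdot> f = h \<cdot> (g \<cdot> f)"

definition full_sub :: "('o, 'm) cat \<Rightarrow> 'o set \<Rightarrow> ('o, 'm) cat" where
  "full_sub C S = C\<lparr>Obj := S, Arr := {f \<in> Arr C. Dom C f \<in> S \<and> Cod C f \<in> S}\<rparr>"

definition op_cat :: "('o, 'm) cat \<Rightarrow> ('o, 'm) cat" where
  "op_cat C = C\<lparr>Dom := Cod C, Cod := Dom C, Comp := (\<lambda>g f. f \<cdot>\<^bsub>C\<^esub> g), Zer := (\<lambda>x y. Zer C y x)\<rparr>"

definition is_iso :: "('o, 'm) cat \<Rightarrow> 'm \<Rightarrow> bool" where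
  "is_iso C f \<longleftrightarrow> f \<in> Arr C \<and> (\<exists>g \<in> Hom C (Cod C f) (Dom C f).
     g \<cdot>\<^bsub>C\<^esub> f = Ide C (Dom C f) \<and> f \<cdot>\<^bsub>C\<^esub> g = Ide C (Cod C f))"

definition is_mono :: "('o, 'm) cat \<Rightarrow> 'm \<Rightarrow> bool" where
  "is_mono C f \<longleftrightarrow> f \<in> Arr C \<and> (\<forall>x \<in> Obj C. \<forall>g \<in> Hom C x (Dom C f). \<forall>h \<in> Hom C x (Dom C f).
     f \<cdot>\<^bsub>C\<^esub> g = f \<cdot>\<^bsub>C\<^esub> h \<longrightarrow> g = h)"

definition is_epi :: "('o, 'm) cat \<Rightarrow> 'm \<Rightarrow> bool" where
  "is_epi C f \<longleftrightarrow> f \<in> Arr C \<and> (\<forall>x \<in> Obj C. \<forall>g \<in> Hom C (Cod C f) x. \<forall>h \<in> Hom C (Cod C f) x.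
     g \<cdot>\<^bsub>C\<^esub> f = h \<cdot>\<^bsub>C\<^esub> f \<longrightarrow> g = h)"

definition split_mono :: "('o, 'm) cat \<Rightarrow> 'm \<Rightarrow> bool" where
  "split_mono C f \<longleftrightarrow> f \<in> Arr C \<and>
     (\<exists>r \<in> Hom C (Cod C f) (Dom C f). r \<cdot>\<^bsub>C\<^esub> f = Ide C (Dom C f))"

definition split_epi :: "('o, 'm) cat \<Rightarrow> 'm \<Rightarrow> bool" where
  "split_epi C f \<longleftrightarrow> f \<in> Arr C \<and>
     (\<exists>s \<in> Hom C (Cod C f) (Dom C f). f \<cdot>\<^bsub>C\<^esub> s = Ide C (Cod C f))"

definition zero_object :: "('o, 'm) cat \<Rightarrow> 'o \<Rightarrow> bool" where
  "zero_object C z \<longleftrightarrow> z \<in> Obj C \<and>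
     (\<forall>x \<in> Obj C. (\<exists>!f. f \<in> Hom C z x) \<and> (\<exists>!f. f \<in> Hom C x z))"


section \<open>Functors, equivalences, adjunctions\<close>

record ('o, 'm, 'p, 'n) func =
  Fobj :: "'o \<Rightarrow> 'p"
  Fmap :: "'m \<Rightarrow> 'n"

definition is_functor :: "('o, 'm) cat \<Rightarrow> ('p, 'n) cat \<Rightarrow> ('o, 'm, 'p, 'n) func \<Rightarrow> bool" where
  "is_functor C D F \<longleftrightarrow>
     (\<forall>x \<in> Obj C. Fobj F x \<in> Obj D \<and> Fmap F (Ide C x) = Ide D (Fobj F x)) \<and>
     (\<forall>x \<in> Obj C. \<forall>y \<in> Obj C. \<forall>f \<in> Hom C x y. Fmap F f \<in> Hom D (Fobj F x) (Fobj F y)) \<and>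
     (\<forall>x \<in> Obj C. \<forall>y \<in> Obj C. \<forall>z \<in> Obj C. \<forall>f \<in> Hom C x y. \<forall>g \<in> Hom C y z.
        Fmap F (g \<cdot>\<^bsub>C\<^esub> f) = Fmap F g \<cdot>\<^bsub>D\<^esub> Fmap F f)"

definition id_func :: "('o, 'm, 'o, 'm) func" where
  "id_func = \<lparr>Fobj = (\<lambda>x. x), Fmap = (\<lambda>f. f)\<rparr>"

definition comp_func ::
  "('p, 'n, 'q, 'l) func \<Rightarrow> ('o, 'm, 'p, 'n) func \<Rightarrow> ('o, 'm, 'q, 'l) func" where
  "comp_func G F = \<lparr>Fobj = Fobj G \<circ> Fobj F, Fmap = Fmap G \<circ> Fmap F\<rparr>"

definition fully_faithful :: "('o, 'm) cat \<Rightarrow> ('p, 'n) cat \<Rightarrow> ('o, 'm, 'p, 'n) func \<Rightarrow> bool" where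
  "fully_faithful C D F \<longleftrightarrow> (\<forall>x \<in> Obj C. \<forall>y \<in> Obj C.
     bij_betw (Fmap F) (Hom C x y) (Hom D (Fobj F x) (Fobj F y)))"

definition nat_isomorphic ::
  "('o, 'm) cat \<Rightarrow> ('p, 'n) cat \<Rightarrow> ('o, 'm, 'p, 'n) func \<Rightarrow> ('o, 'm, 'p, 'n) func \<Rightarrow> bool" where
  "nat_isomorphic C D F G \<longleftrightarrow> (\<exists>\<tau>.
     (\<forall>x \<in> Obj C. \<tau> x \<in> Hom D (Fobj F x) (Fobj G x) \<and> is_iso D (\<tau> x)) \<and>
     (\<forall>x \<in> Obj C. \<forall>y \<in> Obj C. \<forall>f \<in> Hom C x y.
        \<tau> y \<cdot>\<^bsub>D\<^esub> Fmap F f = Fmap G f \<cdot>\<^bsub>D\<^esub> \<tau> x))"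

definition equivalent_cats :: "('o, 'm) cat \<Rightarrow> ('p, 'n) cat \<Rightarrow> bool" where
  "equivalent_cats C D \<longleftrightarrow> (\<exists>F G. is_functor C D F \<and> is_functor D C G \<and>
     nat_isomorphic C C (comp_func G F) id_func \<and> nat_isomorphic D D (comp_func F G) id_func)"

text \<open>\<open>adjunction C D L R\<close>: the functor \<open>L\<close> from \<open>C\<close> to \<open>D\<close> is left adjoint to
  \<open>R\<close> from \<open>D\<close> to \<open>C\<close>.\<close>

definition adjunction :: "('o, 'm) cat \<Rightarrow> ('p, 'n) cat \<Rightarrow>
    ('o, 'm, 'p, 'n) func \<Rightarrow> ('p, 'n, 'o, 'm) func \<Rightarrow> bool" where
  "adjunction C D L R \<longleftrightarrow> is_functor C D L \<and> is_functor D C R \<and> (\<exists>\<phi>.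
     (\<forall>x \<in> Obj C. \<forall>y \<in> Obj D. bij_betw (\<phi> x y) (Hom D (Fobj L x) y) (Hom C x (Fobj R y))) \<and>
     (\<forall>x \<in> Obj C. \<forall>x' \<in> Obj C. \<forall>y \<in> Obj D. \<forall>y' \<in> Obj D.
        \<forall>f \<in> Hom C x' x. \<forall>h \<in> Hom D y y'. \<forall>g \<in> Hom D (Fobj L x) y.
        \<phi> x' y' (h \<cdot>\<^bsub>D\<^esub> g \<cdot>\<^bsub>D\<^esub> Fmap L f) = Fmap R h \<cdot>\<^bsub>C\<^esub> \<phi> x y g \<cdot>\<^bsub>C\<^esub> f))"


section \<open>Abelian categories\<close>

definition Hom_group :: "('o, 'm) cat \<Rightarrow> 'o \<Rightarrow> 'o \<Rightarrow> 'm monoid" where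
  "Hom_group C x y = \<lparr>carrier = Hom C x y, mult = Add C, one = Zer C x y\<rparr>"

locale preadditive_category = category +
  assumes Hom_comm_group: "\<lbrakk>x \<in> Obj C; y \<in> Obj C\<rbrakk> \<Longrightarrow> comm_group (Hom_group C x y)"
    and Comp_Add: "\<lbrakk>f \<in> Hom C x y; g \<in> Hom C y z; g' \<in> Hom C y z\<rbrakk>
      \<Longrightarrow> Add C g g' \<cdot> f = Add C (g \<cdot> f) (g' \<cdot> f)"
    and Add_Comp: "\<lbrakk>f \<in> Hom C x y; f' \<in> Hom C x y; g \<in> Hom C y z\<rbrakk>
      \<Longrightarrow> g \<cdot> Add C f f' = Add C (g \<cdot> f) (g \<cdot> f')"

definition biproduct ::
  "('o, 'm) cat \<Rightarrow> 'o \<Rightarrow> 'o \<Rightarrow> 'o \<Rightarrow> 'm \<Rightarrow> 'm \<Rightarrow> 'm \<Rightarrow> 'm \<Rightarrow> bool" where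
  "biproduct C x y p i1 i2 p1 p2 \<longleftrightarrow>
     p \<in> Obj C \<and> i1 \<in> Hom C x p \<and> i2 \<in> Hom C y p \<and> p1 \<in> Hom C p x \<and> p2 \<in> Hom C p y \<and>
     p1 \<cdot>\<^bsub>C\<^esub> i1 = Ide C x \<and> p2 \<cdot>\<^bsub>C\<^esub> i2 = Ide C y \<and>
     p1 \<cdot>\<^bsub>C\<^esub> i2 = Zer C y x \<and> p2 \<cdot>\<^bsub>C\<^esub> i1 = Zer C x y \<and>
     Add C (i1 \<cdot>\<^bsub>C\<^esub> p1) (i2 \<cdot>\<^bsub>C\<^esub> p2) = Ide C p"

text \<open>\<open>is_kernel C k f\<close>: the arrow \<open>k\<close> is a kernel of \<open>f\<close>.\<close>

definition is_kernel :: "('o, 'm) cat \<Rightarrow> 'm \<Rightarrow> 'm \<Rightarrow> bool" where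
  "is_kernel C k f \<longleftrightarrow> k \<in> Arr C \<and> f \<in> Arr C \<and> Cod C k = Dom C f \<and>
     f \<cdot>\<^bsub>C\<^esub> k = Zer C (Dom C k) (Cod C f) \<and>
     (\<forall>x \<in> Obj C. \<forall>g \<in> Hom C x (Dom C f). f \<cdot>\<^bsub>C\<^esub> g = Zer C x (Cod C f) \<longrightarrow>
        (\<exists>!h. h \<in> Hom C x (Dom C k) \<and> k \<cdot>\<^bsub>C\<^esub> h = g))"

definition is_cokernel :: "('o, 'm) cat \<Rightarrow> 'm \<Rightarrow> 'm \<Rightarrow> bool" where
  "is_cokernel C c f \<longleftrightarrow> c \<in> Arr C \<and> f \<in> Arr C \<and> Dom C c = Cod C f \<and>
     c \<cdot>\<^bsub>C\<^esub> f = Zer C (Dom C f) (Cod C c) \<and>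
     (\<forall>x \<in> Obj C. \<forall>g \<in> Hom C (Cod C f) x. g \<cdot>\<^bsub>C\<^esub> f = Zer C (Dom C f) x \<longrightarrow>
        (\<exists>!h. h \<in> Hom C (Cod C c) x \<and> h \<cdot>\<^bsub>C\<^esub> c = g))"

locale abelian_category = preadditive_category +
  assumes ex_zero_object: "\<exists>z. zero_object C z"
    and ex_biproduct: "\<lbrakk>x \<in> Obj C; y \<in> Obj C\<rbrakk> \<Longrightarrow> \<exists>p i1 i2 p1 p2. biproduct C x y p i1 i2 p1 p2"
    and ex_kernel: "f \<in> Arr C \<Longrightarrow> \<exists>k. is_kernel C k f"
    and ex_cokernel: "f \<in> Arr C \<Longrightarrow> \<exists>c. is_cokernel C c f"
    and mono_is_kernel: "is_mono C f \<Longrightarrow> \<exists>g. is_kernel C f g"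
    and epi_is_cokernel: "is_epi C f \<Longrightarrow> \<exists>g. is_cokernel C f g"

definition short_exact :: "('o, 'm) cat \<Rightarrow> 'm \<Rightarrow> 'm \<Rightarrow> bool" where
  "short_exact C f g \<longleftrightarrow> is_kernel C f g \<and> is_cokernel C g f"

definition exact_functor :: "('o, 'm) cat \<Rightarrow> ('p, 'n) cat \<Rightarrow> ('o, 'm, 'p, 'n) func \<Rightarrow> bool" where
  "exact_functor C D F \<longleftrightarrow> is_functor C D F \<and>
     (\<forall>x \<in> Obj C. \<forall>y \<in> Obj C. \<forall>f \<in> Hom C x y. \<forall>g \<in> Hom C x y.
        Fmap F (Add C f g) = Add D (Fmap F f) (Fmap F g)) \<and>
     (\<forall>f g. short_exact C f g \<longrightarrow> short_exact D (Fmap F f) (Fmap F g))"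

definition indecomposable :: "('o, 'm) cat \<Rightarrow> 'o \<Rightarrow> bool" where
  "indecomposable C s \<longleftrightarrow> s \<in> Obj C \<and> \<not> zero_object C s \<and>
     (\<forall>x \<in> Obj C. \<forall>y \<in> Obj C. (\<exists>i1 i2 p1 p2. biproduct C x y s i1 i2 p1 p2) \<longrightarrow>
        zero_object C x \<or> zero_object C y)"

definition End_ring :: "('o, 'm) cat \<Rightarrow> 'o \<Rightarrow> 'm ring" where
  "End_ring C x =
     \<lparr>carrier = Hom C x x, mult = Comp C, one = Ide C x, zero = Zer C x x, add = Add C\<rparr>"


section \<open>Yoneda Ext\<close>

text \<open>
  An extension \<open>0 \<rightarrow> x \<rightarrow> e \<rightarrow> z \<rightarrow> 0\<close> of \<open>z\<close> by \<open>x\<close> is the pair of its two arrows.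
\<close>

definition extensions :: "('o, 'm) cat \<Rightarrow> 'o \<Rightarrow> 'o \<Rightarrow> ('m \<times> 'm) set" where
  "extensions C z x = {(f, g). short_exact C f g \<and> Dom C f = x \<and> Cod C g = z}"

definition ext_equiv :: "('o, 'm) cat \<Rightarrow> 'o \<Rightarrow> 'o \<Rightarrow> (('m \<times> 'm) \<times> ('m \<times> 'm)) set" where
  "ext_equiv C z x = {((f, g), (f', g')).
     (f, g) \<in> extensions C z x \<and> (f', g') \<in> extensions C z x \<and>
     (\<exists>w \<in> Hom C (Cod C f) (Cod C f'). w \<cdot>\<^bsub>C\<^esub> f = f' \<and> g' \<cdot>\<^bsub>C\<^esub> w = g)}"

definition Ext1 :: "('o, 'm) cat \<Rightarrow> 'o \<Rightarrow> 'o \<Rightarrow> ('m \<times> 'm) set set" where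
  "Ext1 C z x = extensions C z x // ext_equiv C z x"

definition split_ext :: "('o, 'm) cat \<Rightarrow> 'm \<times> 'm \<Rightarrow> bool" where
  "split_ext C e \<longleftrightarrow> split_epi C (snd e)"

text \<open>The split extensions form a single class, the zero element of \<open>Ext1 C z x\<close>.\<close>

definition Ext1_zero :: "('o, 'm) cat \<Rightarrow> 'o \<Rightarrow> 'o \<Rightarrow> ('m \<times> 'm) set" where
  "Ext1_zero C z x = {e \<in> extensions C z x. split_ext C e}"

text \<open>
  The class of the pushout of an extension \<open>(f, g)\<close> along \<open>u\<close> consists of all extensions
  \<open>(f', g')\<close> that receive a morphism \<open>(u, w, id)\<close> from \<open>(f, g)\<close>; dually for pullbacks.
\<close>

definition ext_push :: "('o, 'm) cat \<Rightarrow> 'm \<Rightarrow> ('m \<times> 'm) set \<Rightarrow> ('m \<times> 'm) set" where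
  "ext_push C u \<xi> = {(f', g'). \<exists>(f, g) \<in> \<xi>.
     Dom C f = Dom C u \<and> (f', g') \<in> extensions C (Cod C g) (Cod C u) \<and>
     (\<exists>w \<in> Hom C (Cod C f) (Cod C f'). w \<cdot>\<^bsub>C\<^esub> f = f' \<cdot>\<^bsub>C\<^esub> u \<and> g' \<cdot>\<^bsub>C\<^esub> w = g)}"

definition ext_pull :: "('o, 'm) cat \<Rightarrow> 'm \<Rightarrow> ('m \<times> 'm) set \<Rightarrow> ('m \<times> 'm) set" where
  "ext_pull C v \<xi> = {(f', g'). \<exists>(f, g) \<in> \<xi>.
     Cod C g = Cod C v \<and> (f', g') \<in> extensions C (Dom C v) (Dom C f) \<and>
     (\<exists>w \<in> Hom C (Cod C f') (Cod C f). w \<cdot>\<^bsub>C\<^esub> f' = f \<and> g \<cdot>\<^bsub>C\<^esub> w = v \<cdot>\<^bsub>C\<^esub> g')}"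

text \<open>
  Baer sum: the direct sum of two extensions, pushed out along the codiagonal of \<open>x\<close> and pulled
  back along the diagonal of \<open>z\<close>.  The result does not depend on the biproducts and
  representatives, so that the union over all choices is a single class.
\<close>

definition baer_sum :: "('o, 'm) cat \<Rightarrow> 'o \<Rightarrow> 'o \<Rightarrow>
    ('m \<times> 'm) set \<Rightarrow> ('m \<times> 'm) set \<Rightarrow> ('m \<times> 'm) set" where
  "baer_sum C z x \<xi> \<eta> = {e. \<exists>(f, g) \<in> \<xi>. \<exists>(f', g') \<in> \<eta>.
     \<exists>xx i1 i2 p1 p2 ee k1 k2 r1 r2 zz j1 j2 q1 q2.
       biproduct C x x xx i1 i2 p1 p2 \<and>
       biproduct C (Cod C f) (Cod C f') ee k1 k2 r1 r2 \<and>
       biproduct C z z zz j1 j2 q1 q2 \<and>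
       e \<in> ext_pull C (Add C j1 j2) (ext_push C (Add C p1 p2)
         {(Add C (k1 \<cdot>\<^bsub>C\<^esub> f \<cdot>\<^bsub>C\<^esub> p1) (k2 \<cdot>\<^bsub>C\<^esub> f' \<cdot>\<^bsub>C\<^esub> p2),
           Add C (j1 \<cdot>\<^bsub>C\<^esub> g \<cdot>\<^bsub>C\<^esub> r1) (j2 \<cdot>\<^bsub>C\<^esub> g' \<cdot>\<^bsub>C\<^esub> r2))})}"

text \<open>
  A 2-extension \<open>0 \<rightarrow> x \<rightarrow> e\<^sub>1 \<rightarrow> e\<^sub>2 \<rightarrow> z \<rightarrow> 0\<close> is the triple \<open>(f, g, h)\<close> of its arrows; exactness
  means precisely that \<open>f\<close> is a kernel and \<open>h\<close> a cokernel of \<open>g\<close>.  Two of them are Yoneda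
  equivalent if they are connected by a zigzag of morphisms that are the identity at both ends.
\<close>

definition extensions2 :: "('o, 'm) cat \<Rightarrow> 'o \<Rightarrow> 'o \<Rightarrow> ('m \<times> 'm \<times> 'm) set" where
  "extensions2 C z x = {(f, g, h). is_kernel C f g \<and> is_cokernel C h g \<and>
     Dom C f = x \<and> Cod C h = z}"

definition ext2_mor :: "('o, 'm) cat \<Rightarrow> 'o \<Rightarrow> 'o \<Rightarrow> (('m \<times> 'm \<times> 'm) \<times> ('m \<times> 'm \<times> 'm)) set" where
  "ext2_mor C z x = {((f, g, h), (f', g', h')).
     (f, g, h) \<in> extensions2 C z x \<and> (f', g', h') \<in> extensions2 C z x \<and>
     (\<exists>a \<in> Hom C (Cod C f) (Cod C f'). \<exists>b \<in> Hom C (Cod C g) (Cod C g').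
        a \<cdot>\<^bsub>C\<^esub> f = f' \<and> b \<cdot>\<^bsub>C\<^esub> g = g' \<cdot>\<^bsub>C\<^esub> a \<and> h' \<cdot>\<^bsub>C\<^esub> b = h)}"

definition ext2_equiv :: "('o, 'm) cat \<Rightarrow> 'o \<Rightarrow> 'o \<Rightarrow> (('m \<times> 'm \<times> 'm) \<times> ('m \<times> 'm \<times> 'm)) set" where
  "ext2_equiv C z x = (ext2_mor C z x \<union> (ext2_mor C z x)\<inverse>)\<^sup>*"

definition Ext2 :: "('o, 'm) cat \<Rightarrow> 'o \<Rightarrow> 'o \<Rightarrow> ('m \<times> 'm \<times> 'm) set set" where
  "Ext2 C z x = extensions2 C z x // ext2_equiv C z x"

text \<open>The zero element is the class of \<open>0 \<rightarrow> x \<rightarrow> x \<rightarrow> z \<rightarrow> z \<rightarrow> 0\<close> with zero middle arrow.\<close>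

definition Ext2_zero :: "('o, 'm) cat \<Rightarrow> 'o \<Rightarrow> 'o \<Rightarrow> ('m \<times> 'm \<times> 'm) set" where
  "Ext2_zero C z x = ext2_equiv C z x `` {(Ide C x, Zer C x z, Ide C z)}"

definition almost_split :: "('o, 'm) cat \<Rightarrow> 'm \<times> 'm \<Rightarrow> bool" where
  "almost_split C e \<longleftrightarrow> (case e of (f, g) \<Rightarrow> short_exact C f g \<and> \<not> split_ext C (f, g) \<and>
     (\<forall>a \<in> Obj C. \<forall>h \<in> Hom C a (Cod C g). \<not> split_epi C h \<longrightarrow>
        (\<exists>h' \<in> Hom C a (Dom C g). g \<cdot>\<^bsub>C\<^esub> h' = h)) \<and>
     (\<forall>a \<in> Obj C. \<forall>h \<in> Hom C (Dom C f) a. \<not> split_mono C h \<longrightarrow>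
        (\<exists>h' \<in> Hom C (Cod C f) a. h' \<cdot>\<^bsub>C\<^esub> f = h)))"


section \<open>Modules over division rings\<close>

definition is_division_ring :: "'r ring \<Rightarrow> bool" where
  "is_division_ring R \<longleftrightarrow> ring R \<and> Units R = carrier R - {\<zero>\<^bsub>R\<^esub>}"

text \<open>
  The locale \<open>module\<close> of the library requires a commutative ring; only its record type is used
  here.  In a right module \<open>M\<close>, the term \<open>r \<odot>\<^bsub>M\<^esub> x\<close> stands for the product of \<open>x\<close> with \<open>r\<close> from
  the right.
\<close>

locale right_module =
  R?: ring R + M?: abelian_group M
  for R :: "'r ring" and M :: "('r, 'v) module" (structure) +
  assumes smult_closed: "\<lbrakk>r \<in> carrier R; x \<in> carrier M\<rbrakk> \<Longrightarrow> r \<odot> x \<in> carrier M"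
    and smult_l_distr: "\<lbrakk>r \<in> carrier R; s \<in> carrier R; x \<in> carrier M\<rbrakk>
      \<Longrightarrow> (r \<oplus>\<^bsub>R\<^esub> s) \<odot> x = r \<odot> x \<oplus> s \<odot> x"
    and smult_r_distr: "\<lbrakk>r \<in> carrier R; x \<in> carrier M; y \<in> carrier M\<rbrakk>
      \<Longrightarrow> r \<odot> (x \<oplus> y) = r \<odot> x \<oplus> r \<odot> y"
    and smult_assoc: "\<lbrakk>r \<in> carrier R; s \<in> carrier R; x \<in> carrier M\<rbrakk>
      \<Longrightarrow> (r \<otimes>\<^bsub>R\<^esub> s) \<odot> x = s \<odot> (r \<odot> x)"
    and smult_one: "x \<in> carrier M \<Longrightarrow> \<one>\<^bsub>R\<^esub> \<odot> x = x"

definition fin_gen :: "'r ring \<Rightarrow> ('r, 'v) module \<Rightarrow> bool" where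
  "fin_gen R M \<longleftrightarrow> (\<exists>S. finite S \<and> S \<subseteq> carrier M \<and>
     (\<forall>x \<in> carrier M. \<exists>c \<in> S \<rightarrow> carrier R. x = (\<Oplus>\<^bsub>M\<^esub>s \<in> S. c s \<odot>\<^bsub>M\<^esub> s)))"

definition module_homs :: "'r ring \<Rightarrow> ('r, 'v) module \<Rightarrow> ('r, 'w) module \<Rightarrow> ('v \<Rightarrow> 'w) set" where
  "module_homs R M N = {h \<in> carrier M \<rightarrow>\<^sub>E carrier N.
     (\<forall>x \<in> carrier M. \<forall>y \<in> carrier M. h (x \<oplus>\<^bsub>M\<^esub> y) = h x \<oplus>\<^bsub>N\<^esub> h y) \<and>
     (\<forall>r \<in> carrier R. \<forall>x \<in> carrier M. h (r \<odot>\<^bsub>M\<^esub> x) = r \<odot>\<^bsub>N\<^esub> h x)}"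

text \<open>
  The category of finitely generated right \<open>R\<close>-modules.  Underlying sets range over subsets of
  \<open>'r list\<close>; as a finitely generated module is a quotient of some \<open>R\<^sup>n\<close>, every
  finitely generated module is isomorphic to one of these.
\<close>

type_synonym 'r fg_mod = "('r, 'r list) module"

definition mod_cat ::
  "'r ring \<Rightarrow> ('r fg_mod, 'r fg_mod \<times> ('r list \<Rightarrow> 'r list) \<times> 'r fg_mod) cat" where
  "mod_cat R = \<lparr>
     Obj = {M. right_module R M \<and> fin_gen R M},
     Arr = {(M, h, N). right_module R M \<and> fin_gen R M \<and> right_module R N \<and> fin_gen R N \<and>
              h \<in> module_homs R M N},
     Dom = (\<lambda>(M, h, N). M),
     Cod = (\<lambda>(M, h, N). N),
     Ide = (\<lambda>M. (M, \<lambda>x \<in> carrier M. x, M)),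
     Comp = (\<lambda>(M', k, N') (M, h, N). (M, \<lambda>x \<in> carrier M. k (h x), N')),
     Add = (\<lambda>(M, h, N) (M', k, N'). (M, \<lambda>x \<in> carrier M. h x \<oplus>\<^bsub>N\<^esub> k x, N)),
     Zer = (\<lambda>M N. (M, \<lambda>x \<in> carrier M. \<zero>\<^bsub>N\<^esub>, N))\<rparr>"

text \<open>
  The duality \<open>D = Hom\<^sub>R(-, R)\<close>.  The dual of a left module consists of left linear maps and is a
  right module by right multiplication on the values; symmetrically for right modules.  The
  fields \<open>mult\<close> and \<open>one\<close> of the module record are irrelevant.
\<close>

definition dual_of_left :: "'r ring \<Rightarrow> ('r, 'v) module \<Rightarrow> ('r, 'v \<Rightarrow> 'r) module" where
  "dual_of_left R M = \<lparr>
     carrier = {\<phi> \<in> carrier M \<rightarrow>\<^sub>E carrier R.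
       (\<forall>x \<in> carrier M. \<forall>y \<in> carrier M. \<phi> (x \<oplus>\<^bsub>M\<^esub> y) = \<phi> x \<oplus>\<^bsub>R\<^esub> \<phi> y) \<and>
       (\<forall>r \<in> carrier R. \<forall>x \<in> carrier M. \<phi> (r \<odot>\<^bsub>M\<^esub> x) = r \<otimes>\<^bsub>R\<^esub> \<phi> x)},
     mult = undefined, one = undefined,
     zero = (\<lambda>x \<in> carrier M. \<zero>\<^bsub>R\<^esub>),
     add = (\<lambda>\<phi> \<psi>. \<lambda>x \<in> carrier M. \<phi> x \<oplus>\<^bsub>R\<^esub> \<psi> x),
     smult = (\<lambda>r \<phi>. \<lambda>x \<in> carrier M. \<phi> x \<otimes>\<^bsub>R\<^esub> r)\<rparr>"

definition dual_of_right :: "'r ring \<Rightarrow> ('r, 'v) module \<Rightarrow> ('r, 'v \<Rightarrow> 'r) module" where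
  "dual_of_right R M = \<lparr>
     carrier = {\<phi> \<in> carrier M \<rightarrow>\<^sub>E carrier R.
       (\<forall>x \<in> carrier M. \<forall>y \<in> carrier M. \<phi> (x \<oplus>\<^bsub>M\<^esub> y) = \<phi> x \<oplus>\<^bsub>R\<^esub> \<phi> y) \<and>
       (\<forall>r \<in> carrier R. \<forall>x \<in> carrier M. \<phi> (r \<odot>\<^bsub>M\<^esub> x) = \<phi> x \<otimes>\<^bsub>R\<^esub> r)},
     mult = undefined, one = undefined,
     zero = (\<lambda>x \<in> carrier M. \<zero>\<^bsub>R\<^esub>),
     add = (\<lambda>\<phi> \<psi>. \<lambda>x \<in> carrier M. \<phi> x \<oplus>\<^bsub>R\<^esub> \<psi> x),
     smult = (\<lambda>r \<phi>. \<lambda>x \<in> carrier M. r \<otimes>\<^bsub>R\<^esub> \<phi> x)\<rparr>"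

text \<open>
  Module-valued functors on a category.  They are not packaged as functors into a category of
  modules, since the modules compared below have carriers of different types.
\<close>

record ('o, 'm, 'r, 'v) mod_func =
  Mobj :: "'o \<Rightarrow> ('r, 'v) module"
  Mmap :: "'m \<Rightarrow> 'v \<Rightarrow> 'v"

definition mod_func_iso :: "('o, 'm) cat \<Rightarrow> 'r ring \<Rightarrow>
    ('o, 'm, 'r, 'v) mod_func \<Rightarrow> ('o, 'm, 'r, 'w) mod_func \<Rightarrow> bool" where
  "mod_func_iso C R F G \<longleftrightarrow> (\<exists>\<tau>.
     (\<forall>a \<in> Obj C. \<tau> a \<in> module_homs R (Mobj F a) (Mobj G a) \<and>
        bij_betw (\<tau> a) (carrier (Mobj F a)) (carrier (Mobj G a))) \<and>
     (\<forall>a \<in> Obj C. \<forall>b \<in> Obj C. \<forall>f \<in> Hom C a b. \<forall>x \<in> carrier (Mobj F a).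
        \<tau> b (Mmap F f x) = Mmap G f (\<tau> a x)))"


section \<open>Expansions\<close>

text \<open>
  For a functor \<open>F\<close> from \<open>B\<close> to \<open>A\<close>, these are the object classes of the perpendicular categories
  of the image of \<open>F\<close>.  They coincide with those of its essential image, because Hom and Ext are
  invariant under isomorphism.
\<close>

definition left_perp :: "('p, 'n) cat \<Rightarrow> ('o, 'm) cat \<Rightarrow> ('p, 'n, 'o, 'm) func \<Rightarrow> 'o set" where
  "left_perp B A F = {a \<in> Obj A. \<forall>b \<in> Obj B.
     Hom A a (Fobj F b) = {Zer A a (Fobj F b)} \<and>
     Ext1 A a (Fobj F b) = {Ext1_zero A a (Fobj F b)}}"

definition right_perp :: "('p, 'n) cat \<Rightarrow> ('o, 'm) cat \<Rightarrow> ('p, 'n, 'o, 'm) func \<Rightarrow> 'o set" where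
  "right_perp B A F = {a \<in> Obj A. \<forall>b \<in> Obj B.
     Hom A (Fobj F b) a = {Zer A (Fobj F b) a} \<and>
     Ext1 A (Fobj F b) a = {Ext1_zero A (Fobj F b) a}}"

abbreviation left_perp_cat ::
  "('p, 'n) cat \<Rightarrow> ('o, 'm) cat \<Rightarrow> ('p, 'n, 'o, 'm) func \<Rightarrow> ('o, 'm) cat" where
  "left_perp_cat B A F \<equiv> full_sub A (left_perp B A F)"

abbreviation right_perp_cat ::
  "('p, 'n) cat \<Rightarrow> ('o, 'm) cat \<Rightarrow> ('p, 'n, 'o, 'm) func \<Rightarrow> ('o, 'm) cat" where
  "right_perp_cat B A F \<equiv> full_sub A (right_perp B A F)"

text \<open>
  The existentially quantified division ring below has elements in the type of arrows of \<open>A\<close>.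
  This is no restriction: a ring \<open>\<Delta>\<close> with the perpendicular category equivalent to its module
  category is isomorphic to the endomorphism ring of the object that corresponds to \<open>\<Delta>\<close>.
\<close>

definition left_expansion ::
  "('p, 'n) cat \<Rightarrow> ('o, 'm) cat \<Rightarrow> ('p, 'n, 'o, 'm) func \<Rightarrow> bool" where
  "left_expansion B A F \<longleftrightarrow>
     abelian_category B \<and> abelian_category A \<and> exact_functor B A F \<and> fully_faithful B A F \<and>
     (\<exists>L. exact_functor A B L \<and> adjunction A B L F) \<and>
     (\<exists>\<Delta> :: 'm ring. is_division_ring \<Delta> \<and> equivalent_cats (left_perp_cat B A F) (mod_cat \<Delta>)) \<and>
     (\<forall>a \<in> left_perp B A F. \<forall>b \<in> left_perp B A F. Ext2 A a b = {Ext2_zero A a b})"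

definition right_expansion ::
  "('p, 'n) cat \<Rightarrow> ('o, 'm) cat \<Rightarrow> ('p, 'n, 'o, 'm) func \<Rightarrow> bool" where
  "right_expansion B A F \<longleftrightarrow>
     abelian_category B \<and> abelian_category A \<and> exact_functor B A F \<and> fully_faithful B A F \<and>
     (\<exists>R. exact_functor A B R \<and> adjunction B A F R) \<and>
     (\<exists>\<Delta> :: 'm ring. is_division_ring \<Delta> \<and> equivalent_cats (right_perp_cat B A F) (mod_cat \<Delta>)) \<and>
     (\<forall>a \<in> right_perp B A F. \<forall>b \<in> right_perp B A F. Ext2 A a b = {Ext2_zero A a b})"

definition expansion ::
  "('p, 'n) cat \<Rightarrow> ('o, 'm) cat \<Rightarrow> ('p, 'n, 'o, 'm) func \<Rightarrow> bool" where
  "expansion B A F \<longleftrightarrow> left_expansion B A F \<and> right_expansion B A F"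

definition split_expansion ::
  "('p, 'n) cat \<Rightarrow> ('o, 'm) cat \<Rightarrow> ('p, 'n, 'o, 'm) func \<Rightarrow> bool" where
  "split_expansion B A F \<longleftrightarrow> expansion B A F \<and> right_perp B A F = left_perp B A F"

definition nonsplit_expansion ::
  "('p, 'n) cat \<Rightarrow> ('o, 'm) cat \<Rightarrow> ('p, 'n, 'o, 'm) func \<Rightarrow> bool" where
  "nonsplit_expansion B A F \<longleftrightarrow> expansion B A F \<and> \<not> split_expansion B A F"

definition associated_division_ring ::
  "('p, 'n) cat \<Rightarrow> ('o, 'm) cat \<Rightarrow> ('p, 'n, 'o, 'm) func \<Rightarrow> 'r ring \<Rightarrow> bool" where
  "associated_division_ring B A F \<Delta> \<longleftrightarrow> is_division_ring \<Delta> \<and>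
     equivalent_cats (left_perp_cat B A F) (mod_cat \<Delta>) \<and>
     equivalent_cats (right_perp_cat B A F) (mod_cat \<Delta>)"

text \<open>
  Identifications \<open>\<alpha>\<close> and \<open>\<beta>\<close> of \<open>\<Delta>\<close> with the endomorphism rings of \<open>s_lam\<close> and \<open>s_rho\<close> that agree through
  the actions of these rings on some non-split extension class \<open>\<xi>\<close>, that is
  \<open>\<xi> \<cdot> \<alpha>(d) = \<beta>(d) \<cdot> \<xi>\<close>.
\<close>

definition compatible_identification :: "('o, 'm) cat \<Rightarrow> 'r ring \<Rightarrow> 'o \<Rightarrow> 'o \<Rightarrow>
    ('r \<Rightarrow> 'm) \<Rightarrow> ('r \<Rightarrow> 'm) \<Rightarrow> bool" where
  "compatible_identification A \<Delta> s_lam s_rho \<alpha> \<beta> \<longleftrightarrow>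
     \<alpha> \<in> ring_iso \<Delta> (End_ring A s_lam) \<and> \<beta> \<in> ring_iso \<Delta> (End_ring A s_rho) \<and>
     (\<exists>\<xi> \<in> Ext1 A s_lam s_rho. \<xi> \<noteq> Ext1_zero A s_lam s_rho \<and>
        (\<forall>d \<in> carrier \<Delta>. ext_pull A (\<alpha> d) \<xi> = ext_push A (\<beta> d) \<xi>))"

text \<open>
  Writing \<open>s\<close> for \<open>s_lam\<close> or \<open>s_rho\<close> and \<open>\<alpha>\<close> or \<open>\<beta>\<close> for the corresponding identification:
  \<open>Hom(s_lam, a)\<close> and \<open>Ext\<^sup>1(s_lam, a)\<close> are right modules, while \<open>Hom(a, s_rho)\<close> and \<open>Ext\<^sup>1(a, s_rho)\<close>
  are left modules.
\<close>

definition Hom_from_module :: "('o, 'm) cat \<Rightarrow> ('r \<Rightarrow> 'm) \<Rightarrow> 'o \<Rightarrow> 'o \<Rightarrow> ('r, 'm) module" where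
  "Hom_from_module A \<alpha> s a =
     \<lparr>carrier = Hom A s a, mult = undefined, one = undefined, zero = Zer A s a, add = Add A,
      smult = (\<lambda>d f. f \<cdot>\<^bsub>A\<^esub> \<alpha> d)\<rparr>"

definition Hom_to_module :: "('o, 'm) cat \<Rightarrow> ('r \<Rightarrow> 'm) \<Rightarrow> 'o \<Rightarrow> 'o \<Rightarrow> ('r, 'm) module" where
  "Hom_to_module A \<beta> s a =
     \<lparr>carrier = Hom A a s, mult = undefined, one = undefined, zero = Zer A a s, add = Add A,
      smult = (\<lambda>d f. \<beta> d \<cdot>\<^bsub>A\<^esub> f)\<rparr>"

definition Ext_from_module ::
  "('o, 'm) cat \<Rightarrow> ('r \<Rightarrow> 'm) \<Rightarrow> 'o \<Rightarrow> 'o \<Rightarrow> ('r, ('m \<times> 'm) set) module" where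
  "Ext_from_module A \<alpha> s a =
     \<lparr>carrier = Ext1 A s a, mult = undefined, one = undefined, zero = Ext1_zero A s a,
      add = baer_sum A s a, smult = (\<lambda>d. ext_pull A (\<alpha> d))\<rparr>"

definition Ext_to_module ::
  "('o, 'm) cat \<Rightarrow> ('r \<Rightarrow> 'm) \<Rightarrow> 'o \<Rightarrow> 'o \<Rightarrow> ('r, ('m \<times> 'm) set) module" where
  "Ext_to_module A \<beta> s a =
     \<lparr>carrier = Ext1 A a s, mult = undefined, one = undefined, zero = Ext1_zero A a s,
      add = baer_sum A a s, smult = (\<lambda>d. ext_push A (\<beta> d))\<rparr>"

text \<open>
  The first two functors below are covariant on \<open>A\<close>; the last two are contravariant, so they are
  functors on \<open>op_cat A\<close>, where an arrow \<open>f\<close> leads from \<open>Cod A f\<close> to \<open>Dom A f\<close>.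
\<close>

definition D_Ext_to :: "('o, 'm) cat \<Rightarrow> 'r ring \<Rightarrow> ('r \<Rightarrow> 'm) \<Rightarrow> 'o \<Rightarrow>
    ('o, 'm, 'r, ('m \<times> 'm) set \<Rightarrow> 'r) mod_func" where
  "D_Ext_to A \<Delta> \<beta> s =
     \<lparr>Mobj = (\<lambda>a. dual_of_left \<Delta> (Ext_to_module A \<beta> s a)),
      Mmap = (\<lambda>f \<phi>. \<lambda>\<xi> \<in> Ext1 A (Cod A f) s. \<phi> (ext_pull A f \<xi>))\<rparr>"

definition Hom_from :: "('o, 'm) cat \<Rightarrow> ('r \<Rightarrow> 'm) \<Rightarrow> 'o \<Rightarrow> ('o, 'm, 'r, 'm) mod_func" where
  "Hom_from A \<alpha> s =
     \<lparr>Mobj = Hom_from_module A \<alpha> s, Mmap = (\<lambda>f h. f \<cdot>\<^bsub>A\<^esub> h)\<rparr>"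

definition D_Ext_from :: "('o, 'm) cat \<Rightarrow> 'r ring \<Rightarrow> ('r \<Rightarrow> 'm) \<Rightarrow> 'o \<Rightarrow>
    ('o, 'm, 'r, ('m \<times> 'm) set \<Rightarrow> 'r) mod_func" where
  "D_Ext_from A \<Delta> \<alpha> s =
     \<lparr>Mobj = (\<lambda>a. dual_of_right \<Delta> (Ext_from_module A \<alpha> s a)),
      Mmap = (\<lambda>f \<phi>. \<lambda>\<xi> \<in> Ext1 A s (Dom A f). \<phi> (ext_push A f \<xi>))\<rparr>"

definition Hom_to :: "('o, 'm) cat \<Rightarrow> ('r \<Rightarrow> 'm) \<Rightarrow> 'o \<Rightarrow> ('o, 'm, 'r, 'm) mod_func" where
  "Hom_to A \<beta> s =
     \<lparr>Mobj = Hom_to_module A \<beta> s, Mmap = (\<lambda>f h. h \<cdot>\<^bsub>A\<^esub> f)\<rparr>"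

end

theory Submission
  imports Defs
begin

text \<open>
  Every object \<open>a\<close> has a universal arrow \<open>c a : X a \<rightarrow> a\<close> from an object of \<open>B\<close>, namely the counit
  of the right adjoint, whose kernel \<open>K a\<close> and cokernel are right perpendicular to \<open>B\<close>.  As Hom and
  Ext from \<open>X a\<close> to \<open>S_rho\<close> vanish, \<open>c a\<close> lifts uniquely along any extension of \<open>a\<close> by \<open>S_rho\<close>,
  and restricting the lift to \<open>K a\<close> gives a natural map \<open>Ext(a, S_rho) \<rightarrow> Hom(K a, S_rho)\<close>.  It is
  injective since the right perpendicular category is semisimple, and surjective by the vanishing
  of the second Ext.  As Hom and Ext from \<open>S_lam\<close> to \<open>X a\<close> vanish, \<open>K\<close> induces a bijection
  \<open>Hom(S_lam, a) \<rightarrow> Hom(K S_lam, K a)\<close>, and \<open>K S_lam\<close> is isomorphic to \<open>S_rho\<close>.  So the first claim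
  reduces to the duality between \<open>Hom(S_rho, p)\<close> and \<open>Hom(p, S_rho)\<close> for \<open>p = K a\<close>, which is a
  finite direct sum of copies of \<open>S_rho\<close>.  A morphism \<open>h : a \<rightarrow> S_lam\<close> with \<open>K h \<noteq> 0\<close> is a split
  epimorphism, and it lifts along a non-split extension if \<open>K h = 0\<close>.  The remaining claims follow
  by passing to the opposite categories.
\<close>

section \<open>Preadditive and abelian categories\<close>

text \<open>Two points shape the proof. First, the universal arrow \<open>c a\<close> is in general
  neither mono nor epi, so extension classes cannot be read off from a single short exact sequence:
  the image of \<open>c a\<close> has to be interposed, and the vanishing of the second Ext and
  semisimplicity act on the two short exact sequences on its two sides. That the kernel and cokernel
  of \<open>c a\<close> are perpendicular holds because the right perpendicular class consists
  exactly of the objects annihilated by the exact right adjoint, and this adjoint inverts the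
  counit. Second, non-splitness enters through Hom(S_lam, S_rho) = 0. A nonzero arrow would be epi,
  since subobjects of S_rho are perpendicular too and nonzero ones are everything, and dually it
  would be mono; then each of the two objects lies in both perpendicular classes, and these
  coincide. The vanishing makes \<open>c S_lam\<close> epi, on which the identification of K S_lam
  with S_rho rests. Operations on Ext are computed only after transport to Hom(K a, S_rho), so the
  group axioms of the Baer sum are never proved. Reversing arrows also reverses the multiplication
  of endomorphism rings, so the dual half runs over the opposite of \<Delta>.\<close>

lemma in_Hom [simp]: "f \<in> Hom C x y \<longleftrightarrow> f \<in> Arr C \<and> Dom C f = x \<and> Cod C f = y"
  by (simp add: Hom_def)

section \<open>Passage to the opposite category\<close>

lemma op_cat_simps [simp]:
  "Obj (op_cat C) = Obj C" "Arr (op_cat C) = Arr C" "Dom (op_cat C) = Cod C"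
  "Cod (op_cat C) = Dom C" "Ide (op_cat C) = Ide C" "Comp (op_cat C) g f = f \<cdot>\<^bsub>C\<^esub> g"
  "Add (op_cat C) = Add C" "Zer (op_cat C) x y = Zer C y x" "op_cat (op_cat C) = C"
  by (simp_all add: op_cat_def)

lemma Hom_op [simp]: "Hom (op_cat C) x y = Hom C y x"
  by auto

lemma kernel_op [simp]:
  "is_kernel (op_cat C) k f = is_cokernel C k f" "is_cokernel (op_cat C) k f = is_kernel C k f"
  by (auto simp add: is_kernel_def is_cokernel_def)

lemma mono_op [simp]: "is_mono (op_cat C) f = is_epi C f" "is_epi (op_cat C) f = is_mono C f"
  by (auto simp add: is_mono_def is_epi_def)

lemma split_op [simp]:
  "split_mono (op_cat C) f = split_epi C f" "split_epi (op_cat C) f = split_mono C f"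
  by (auto simp add: split_mono_def split_epi_def)

lemma short_exact_op [simp]: "short_exact (op_cat C) f g = short_exact C g f"
  by (auto simp add: short_exact_def)

lemma zero_object_op [simp]: "zero_object (op_cat C) z = zero_object C z"
  by (auto simp add: zero_object_def)

lemma biproduct_op [simp]:
  "biproduct (op_cat C) x y p i1 i2 p1 p2 = biproduct C x y p p1 p2 i1 i2"
  by (auto simp add: biproduct_def)

section \<open>Composition, monomorphisms and epimorphisms\<close>

context category
begin

lemma arr_simps [simp]:
  "f \<in> Arr C \<Longrightarrow> Dom C f \<in> Obj C" "f \<in> Arr C \<Longrightarrow> Cod C f \<in> Obj C"
  "x \<in> Obj C \<Longrightarrow> Ide C x \<in> Arr C" "x \<in> Obj C \<Longrightarrow> Dom C (Ide C x) = x"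
  "x \<in> Obj C \<Longrightarrow> Cod C (Ide C x) = x"
  using Dom_in Cod_in Ide_in by auto

lemma comp_simps [simp]:
  assumes "f \<in> Arr C" "g \<in> Arr C" "Cod C f = Dom C g"
  shows "g \<cdot> f \<in> Arr C" "Dom C (g \<cdot> f) = Dom C f" "Cod C (g \<cdot> f) = Cod C g"
  using Comp_in[of f "Dom C f" "Cod C f" g "Cod C g"] assms by auto

lemma comp_ide [simp]: "\<lbrakk>f \<in> Arr C; Dom C f = x\<rbrakk> \<Longrightarrow> f \<cdot> Ide C x = f"
  "\<lbrakk>f \<in> Arr C; Cod C f = x\<rbrakk> \<Longrightarrow> Ide C x \<cdot> f = f"
  using Comp_Ide Ide_Comp by auto

lemma comp_assoc [simp]:
  "\<lbrakk>f \<in> Arr C; g \<in> Arr C; h \<in> Arr C; Cod C f = Dom C g; Cod C g = Dom C h\<rbrakk>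
    \<Longrightarrow> (h \<cdot> g) \<cdot> f = h \<cdot> (g \<cdot> f)"
  using Comp_assoc[of f "Dom C f" "Cod C f" g "Cod C g" h "Cod C h"] by auto

text \<open>Simplification brackets composites to the right, so an equation for
  \<open>g \<cdot> f\<close> no longer matches inside \<open>g \<cdot> (f \<cdot> y)\<close>. This
  form applies it there.\<close>

lemma comp_subst:
  assumes "g \<cdot> f = h" "f \<in> Arr C" "g \<in> Arr C" "Cod C f = Dom C g" "y \<in> Arr C" "Cod C y = Dom C f"
  shows "g \<cdot> (f \<cdot> y) = h \<cdot> y"
  using assms by (metis comp_assoc)

lemma op_category: "category (op_cat C)"
  by unfold_locales auto

lemma monoD:
  "\<lbrakk>is_mono C f; f \<cdot> g = f \<cdot> h; g \<in> Arr C; h \<in> Arr C; Cod C g = Dom C f; Cod C h = Dom C f;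
    Dom C g = Dom C h\<rbrakk> \<Longrightarrow> g = h"
  unfolding is_mono_def by (metis in_Hom arr_simps(1))

lemma epiD:
  "\<lbrakk>is_epi C f; g \<cdot> f = h \<cdot> f; g \<in> Arr C; h \<in> Arr C; Dom C g = Cod C f; Dom C h = Cod C f;
    Cod C g = Cod C h\<rbrakk> \<Longrightarrow> g = h"
  unfolding is_epi_def by (metis in_Hom arr_simps(2))

lemma mono_arr: "is_mono C f \<Longrightarrow> f \<in> Arr C" and epi_arr: "is_epi C f \<Longrightarrow> f \<in> Arr C"
  by (auto simp add: is_mono_def is_epi_def)

lemma mono_comp:
  assumes "is_mono C f" "is_mono C g" "Cod C f = Dom C g"
  shows "is_mono C (g \<cdot> f)"
  unfolding is_mono_def
proof (intro conjI ballI impI)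
  note [simp] = mono_arr[OF assms(1)] mono_arr[OF assms(2)] assms(3)
  show "g \<cdot> f \<in> Arr C" by simp
  fix x h k assume "x \<in> Obj C" "h \<in> Hom C x (Dom C (g \<cdot> f))" "k \<in> Hom C x (Dom C (g \<cdot> f))"
    "g \<cdot> f \<cdot> h = g \<cdot> f \<cdot> k"
  moreover from this have "f \<cdot> h = f \<cdot> k"
    by (auto intro!: monoD[OF assms(2), of "f \<cdot> h" "f \<cdot> k"])
  ultimately show "h = k"
    by (auto intro!: monoD[OF assms(1), of h k])
qed

lemma mono_cancel:
  assumes "is_mono C (g \<cdot> f)" "f \<in> Arr C" "g \<in> Arr C" "Cod C f = Dom C g"
  shows "is_mono C f"
  unfolding is_mono_def
proof (intro conjI ballI impI)
  fix x h k assume "x \<in> Obj C" "h \<in> Hom C x (Dom C f)" "k \<in> Hom C x (Dom C f)" "f \<cdot> h = f \<cdot> k"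
  then show "h = k"
    using assms by (auto intro!: monoD[OF assms(1), of h k])
qed fact

end

section \<open>Addition of arrows\<close>

context preadditive_category
begin

lemma zer_simps [simp]:
  assumes "x \<in> Obj C" "y \<in> Obj C"
  shows "Zer C x y \<in> Arr C" "Dom C (Zer C x y) = x" "Cod C (Zer C x y) = y"
proof -
  interpret comm_group "Hom_group C x y" by (rule Hom_comm_group[OF assms])
  show "Zer C x y \<in> Arr C" "Dom C (Zer C x y) = x" "Cod C (Zer C x y) = y"
    using one_closed by (auto simp add: Hom_group_def)
qed

lemma add_simps [simp]:
  assumes "f \<in> Arr C" "g \<in> Arr C" "Dom C f = Dom C g" "Cod C f = Cod C g"
  shows "Add C f g \<in> Arr C" "Dom C (Add C f g) = Dom C g" "Cod C (Add C f g) = Cod C g"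
proof -
  interpret comm_group "Hom_group C (Dom C g) (Cod C g)" by (rule Hom_comm_group) (use assms in auto)
  show "Add C f g \<in> Arr C" "Dom C (Add C f g) = Dom C g" "Cod C (Add C f g) = Cod C g"
    using m_closed[of f g] assms by (auto simp add: Hom_group_def)
qed

lemma add_assoc:
  assumes "f \<in> Arr C" "g \<in> Arr C" "h \<in> Arr C" "Dom C f = Dom C g" "Cod C f = Cod C g"
    "Dom C h = Dom C g" "Cod C h = Cod C g"
  shows "Add C (Add C f g) h = Add C f (Add C g h)"
proof -
  interpret comm_group "Hom_group C (Dom C g) (Cod C g)" by (rule Hom_comm_group) (use assms in auto)
  show ?thesis
    using m_assoc[of f g h] assms by (auto simp add: Hom_group_def)
qed

lemma add_comm:
  assumes "f \<in> Arr C" "g \<in> Arr C" "Dom C f = Dom C g" "Cod C f = Cod C g"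
  shows "Add C f g = Add C g f"
proof -
  interpret comm_group "Hom_group C (Dom C g) (Cod C g)" by (rule Hom_comm_group) (use assms in auto)
  show ?thesis
    using m_comm[of f g] assms by (auto simp add: Hom_group_def)
qed

lemma add_lcomm:
  assumes "f \<in> Arr C" "g \<in> Arr C" "h \<in> Arr C" "Dom C f = Dom C g" "Cod C f = Cod C g"
    "Dom C h = Dom C g" "Cod C h = Cod C g"
  shows "Add C f (Add C g h) = Add C g (Add C f h)"
  using assms by (metis add_assoc add_comm)

lemma add_zer [simp]:
  assumes "f \<in> Arr C" "Dom C f = x" "Cod C f = y"
  shows "Add C f (Zer C x y) = f" "Add C (Zer C x y) f = f"
proof -
  interpret comm_group "Hom_group C x y" by (rule Hom_comm_group) (use assms in auto)
  show "Add C f (Zer C x y) = f" "Add C (Zer C x y) f = f"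
    using r_one[of f] l_one[of f] assms by (auto simp add: Hom_group_def)
qed

lemma add_cancel:
  assumes "Add C f g = Add C f h" "f \<in> Arr C" "g \<in> Arr C" "h \<in> Arr C"
    "Dom C f = Dom C g" "Cod C f = Cod C g" "Dom C h = Dom C g" "Cod C h = Cod C g"
  shows "g = h"
proof -
  interpret comm_group "Hom_group C (Dom C g) (Cod C g)" by (rule Hom_comm_group) (use assms in auto)
  have "Add C g f = Add C f g"
    by (rule add_comm) (use assms(2-) in simp_all)
  also have "\<dots> = Add C f h" by fact
  also have "\<dots> = Add C h f"
    by (rule add_comm) (use assms(2-) in simp_all)
  finally have *: "g \<otimes>\<^bsub>Hom_group C (Dom C g) (Cod C g)\<^esub> f = h \<otimes>\<^bsub>Hom_group C (Dom C g) (Cod C g)\<^esub> f"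
    by (simp add: Hom_group_def)
  have "{f, g, h} \<subseteq> carrier (Hom_group C (Dom C g) (Cod C g))"
    using assms(2-) by (simp add: Hom_group_def)
  then show ?thesis
    using right_cancel[of f g h] * by blast
qed

definition neg :: "'b \<Rightarrow> 'b" where
  "neg f = inv\<^bsub>Hom_group C (Dom C f) (Cod C f)\<^esub> f"

lemma neg_simps [simp]:
  assumes "f \<in> Arr C"
  shows "neg f \<in> Arr C" "Dom C (neg f) = Dom C f" "Cod C (neg f) = Cod C f"
    "Add C f (neg f) = Zer C (Dom C f) (Cod C f)" "Add C (neg f) f = Zer C (Dom C f) (Cod C f)"
proof -
  interpret comm_group "Hom_group C (Dom C f) (Cod C f)" by (rule Hom_comm_group) (use assms in auto)
  show "neg f \<in> Arr C" "Dom C (neg f) = Dom C f" "Cod C (neg f) = Cod C f"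
    "Add C f (neg f) = Zer C (Dom C f) (Cod C f)" "Add C (neg f) f = Zer C (Dom C f) (Cod C f)"
    using inv_closed[of f] r_inv[of f] l_inv[of f] assms by (auto simp add: Hom_group_def neg_def)
qed

lemma diff_eq_zer:
  assumes "Add C f (neg g) = Zer C x y" "f \<in> Arr C" "g \<in> Arr C"
    "Dom C f = x" "Cod C f = y" "Dom C g = x" "Cod C g = y"
  shows "f = g"
proof -
  have "Add C (neg g) f = Add C (neg g) g"
    using assms by (simp add: add_comm[of "neg g" f])
  then show ?thesis
    by (rule add_cancel) (use assms(2-) in simp_all)
qed

lemma comp_add [simp]:
  assumes "f \<in> Arr C" "f' \<in> Arr C" "g \<in> Arr C" "Dom C f = Dom C f'" "Cod C f = Cod C f'"
    "Cod C f' = Dom C g"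
  shows "g \<cdot> Add C f f' = Add C (g \<cdot> f) (g \<cdot> f')"
  using Add_Comp[of f "Dom C f" "Cod C f" f' g "Cod C g"] assms by auto

lemma add_comp [simp]:
  assumes "f \<in> Arr C" "g \<in> Arr C" "g' \<in> Arr C" "Dom C g = Dom C g'" "Cod C g = Cod C g'"
    "Cod C f = Dom C g'"
  shows "Add C g g' \<cdot> f = Add C (g \<cdot> f) (g' \<cdot> f)"
  using Comp_Add[of f "Dom C f" "Cod C f" g "Cod C g" g'] assms by auto

text \<open>In a group only the neutral element is idempotent. Preservation of zero by composition,
  by additive functors and by ring isomorphisms is derived from additivity in this way.\<close>

lemma add_idem_zer:
  assumes "Add C f f = f" "f \<in> Arr C"
  shows "f = Zer C (Dom C f) (Cod C f)"
proof (rule add_cancel[of f])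
  show "Add C f f = Add C f (Zer C (Dom C f) (Cod C f))"
    using assms by simp
qed (use assms in auto)

lemma comp_zer [simp]:
  assumes "f \<in> Arr C" "Cod C f = y" "z \<in> Obj C"
  shows "Zer C y z \<cdot> f = Zer C (Dom C f) z"
proof -
  have "Add C (Zer C y z) (Zer C y z) = Zer C y z"
    using assms by auto
  then have "Add C (Zer C y z \<cdot> f) (Zer C y z \<cdot> f) = Zer C y z \<cdot> f"
    using assms by (metis add_comp arr_simps(2) zer_simps)
  then show ?thesis
    using add_idem_zer assms by (metis arr_simps(2) comp_simps zer_simps)
qed

lemma zer_comp [simp]:
  assumes "f \<in> Arr C" "Dom C f = y" "x \<in> Obj C"
  shows "f \<cdot> Zer C x y = Zer C x (Cod C f)"
proof -
  have "Add C (Zer C x y) (Zer C x y) = Zer C x y"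
    using assms by auto
  then have "Add C (f \<cdot> Zer C x y) (f \<cdot> Zer C x y) = f \<cdot> Zer C x y"
    using assms by (metis comp_add arr_simps(1) zer_simps)
  then show ?thesis
    using add_idem_zer assms by (metis arr_simps(1) comp_simps zer_simps)
qed

lemma neg_unique:
  assumes "Add C f g = Zer C (Dom C f) (Cod C f)" "f \<in> Arr C" "g \<in> Arr C"
    "Dom C f = Dom C g" "Cod C f = Cod C g"
  shows "g = neg f"
  by (rule add_cancel[of f]) (use assms in auto)

lemma comp_neg [simp]:
  assumes "f \<in> Arr C" "g \<in> Arr C" "Cod C f = Dom C g"
  shows "g \<cdot> neg f = neg (g \<cdot> f)" "neg g \<cdot> f = neg (g \<cdot> f)"
proof -
  have "Add C (g \<cdot> f) (g \<cdot> neg f) = g \<cdot> Add C f (neg f)"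
    using assms by (subst comp_add) auto
  then show "g \<cdot> neg f = neg (g \<cdot> f)"
    by (intro neg_unique) (use assms in auto)
  have "Add C (g \<cdot> f) (neg g \<cdot> f) = Add C g (neg g) \<cdot> f"
    using assms by (subst add_comp) auto
  then show "neg g \<cdot> f = neg (g \<cdot> f)"
    by (intro neg_unique) (use assms in auto)
qed

lemma neg_zer [simp]: "\<lbrakk>x \<in> Obj C; y \<in> Obj C\<rbrakk> \<Longrightarrow> neg (Zer C x y) = Zer C x y"
  by (rule neg_unique[symmetric]) auto

lemma op_preadditive: "preadditive_category (op_cat C)"
proof -
  interpret op: category "op_cat C" by (rule op_category)
  have "Hom_group (op_cat C) x y = Hom_group C y x" for x y
    by (simp add: Hom_group_def)
  then show ?thesis
    by (intro preadditive_category.intro op_category preadditive_category_axioms.intro)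
      (simp_all add: Hom_comm_group)
qed

text \<open>Differences of arrows exist, so monicity need only be tested against zero.\<close>

lemma monoI:
  assumes "f \<in> Arr C"
    "\<And>g. \<lbrakk>g \<in> Arr C; Cod C g = Dom C f; f \<cdot> g = Zer C (Dom C g) (Cod C f)\<rbrakk>
      \<Longrightarrow> g = Zer C (Dom C g) (Dom C f)"
  shows "is_mono C f"
  unfolding is_mono_def
proof (intro conjI ballI impI)
  fix x g h assume h: "x \<in> Obj C" "g \<in> Hom C x (Dom C f)" "h \<in> Hom C x (Dom C f)" "f \<cdot> g = f \<cdot> h"
  have "Add C g (neg h) = Zer C x (Dom C f)"
    using h assms(1) assms(2)[of "Add C g (neg h)"] by simp
  then show "g = h"
    by (rule diff_eq_zer) (use h assms in auto)
qed fact

lemma mono_zer: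
  assumes "is_mono C f" "g \<in> Arr C" "Cod C g = Dom C f" "f \<cdot> g = Zer C (Dom C g) (Cod C f)"
  shows "g = Zer C (Dom C g) (Dom C f)"
  by (rule monoD[OF assms(1)]) (use assms mono_arr[OF assms(1)] in auto)

lemma epiI:
  assumes "f \<in> Arr C"
    "\<And>g. \<lbrakk>g \<in> Arr C; Dom C g = Cod C f; g \<cdot> f = Zer C (Dom C f) (Cod C g)\<rbrakk>
      \<Longrightarrow> g = Zer C (Cod C f) (Cod C g)"
  shows "is_epi C f"
proof -
  interpret op: preadditive_category "op_cat C" by (rule op_preadditive)
  show ?thesis
    using op.monoI[of f] assms by simp
qed

lemma epi_zer:
  assumes "is_epi C f" "g \<in> Arr C" "Dom C g = Cod C f" "g \<cdot> f = Zer C (Dom C f) (Cod C g)"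
  shows "g = Zer C (Cod C f) (Cod C g)"
  by (rule epiD[OF assms(1)]) (use assms epi_arr[OF assms(1)] in auto)

section \<open>Kernels, cokernels and biproducts\<close>

lemma kernelD:
  assumes "is_kernel C k f"
  shows "k \<in> Arr C" "f \<in> Arr C" "Cod C k = Dom C f" "f \<cdot> k = Zer C (Dom C k) (Cod C f)" "is_mono C k"
proof -
  show *: "k \<in> Arr C" "f \<in> Arr C" "Cod C k = Dom C f" "f \<cdot> k = Zer C (Dom C k) (Cod C f)"
    using assms by (auto simp add: is_kernel_def)
  show "is_mono C k"
    unfolding is_mono_def
  proof (intro conjI ballI impI *)
    fix x g h assume h: "x \<in> Obj C" "g \<in> Hom C x (Dom C k)" "h \<in> Hom C x (Dom C k)" "k \<cdot> g = k \<cdot> h"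
    have "f \<cdot> (k \<cdot> g) = Zer C x (Cod C f)"
      by (subst comp_subst[OF *(4)]) (use h * in auto)
    moreover have "k \<cdot> g \<in> Hom C x (Dom C f)"
      using h * by auto
    ultimately have "\<exists>!r. r \<in> Hom C x (Dom C k) \<and> k \<cdot> r = k \<cdot> g"
      using assms h(1) unfolding is_kernel_def by blast
    then show "g = h"
      using h by (metis (no_types, lifting))
  qed
qed

lemma kernel_lift:
  assumes "is_kernel C k f" "g \<in> Arr C" "Cod C g = Dom C f" "f \<cdot> g = Zer C (Dom C g) (Cod C f)"
  obtains h where "h \<in> Arr C" "Dom C h = Dom C g" "Cod C h = Dom C k" "k \<cdot> h = g"
proof -
  have "g \<in> Hom C (Dom C g) (Dom C f)" using assms by auto
  then have "\<exists>!r. r \<in> Hom C (Dom C g) (Dom C k) \<and> k \<cdot> r = g"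
    using assms unfolding is_kernel_def by (metis arr_simps(1))
  then show ?thesis using that by auto
qed

lemma kernelI:
  assumes "is_mono C k" "f \<in> Arr C" "Cod C k = Dom C f" "f \<cdot> k = Zer C (Dom C k) (Cod C f)"
    "\<And>g. \<lbrakk>g \<in> Arr C; Cod C g = Dom C f; f \<cdot> g = Zer C (Dom C g) (Cod C f)\<rbrakk>
      \<Longrightarrow> \<exists>h. h \<in> Arr C \<and> Dom C h = Dom C g \<and> Cod C h = Dom C k \<and> k \<cdot> h = g"
  shows "is_kernel C k f"
  unfolding is_kernel_def
proof (intro conjI ballI impI)
  fix x g assume h: "x \<in> Obj C" "g \<in> Hom C x (Dom C f)" "f \<cdot> g = Zer C x (Cod C f)"
  show "\<exists>!h. h \<in> Hom C x (Dom C k) \<and> k \<cdot> h = g"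
  proof (rule ex_ex1I)
    show "\<exists>h. h \<in> Hom C x (Dom C k) \<and> k \<cdot> h = g"
      using assms(5)[of g] h by auto
    show "h = h'" if "h \<in> Hom C x (Dom C k) \<and> k \<cdot> h = g" "h' \<in> Hom C x (Dom C k) \<and> k \<cdot> h' = g" for h h'
      using that assms by (auto intro!: monoD[OF assms(1), of h h'])
  qed
qed (use assms mono_arr in auto)

lemma cokernelD:
  assumes "is_cokernel C c f"
  shows "c \<in> Arr C" "f \<in> Arr C" "Dom C c = Cod C f" "c \<cdot> f = Zer C (Dom C f) (Cod C c)" "is_epi C c"
proof -
  interpret op: preadditive_category "op_cat C" by (rule op_preadditive)
  show "c \<in> Arr C" "f \<in> Arr C" "Dom C c = Cod C f" "c \<cdot> f = Zer C (Dom C f) (Cod C c)" "is_epi C c"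
    using op.kernelD[of c f] assms by auto
qed

lemma cokernel_lift:
  assumes "is_cokernel C c f" "g \<in> Arr C" "Dom C g = Cod C f" "g \<cdot> f = Zer C (Dom C f) (Cod C g)"
  obtains h where "h \<in> Arr C" "Dom C h = Cod C c" "Cod C h = Cod C g" "h \<cdot> c = g"
proof -
  interpret op: preadditive_category "op_cat C" by (rule op_preadditive)
  show ?thesis
    using op.kernel_lift[of c f g] assms that by auto
qed

lemma cokernelI:
  assumes "is_epi C c" "f \<in> Arr C" "Dom C c = Cod C f" "c \<cdot> f = Zer C (Dom C f) (Cod C c)"
    "\<And>g. \<lbrakk>g \<in> Arr C; Dom C g = Cod C f; g \<cdot> f = Zer C (Dom C f) (Cod C g)\<rbrakk>
      \<Longrightarrow> \<exists>h. h \<in> Arr C \<and> Dom C h = Cod C c \<and> Cod C h = Cod C g \<and> h \<cdot> c = g"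
  shows "is_cokernel C c f"
proof -
  interpret op: preadditive_category "op_cat C" by (rule op_preadditive)
  show ?thesis
    using op.kernelI[of c f] assms by auto
qed

lemma biproductD:
  assumes "biproduct C x y p i1 i2 p1 p2"
  shows "p \<in> Obj C" "i1 \<in> Arr C" "Dom C i1 = x" "Cod C i1 = p" "i2 \<in> Arr C" "Dom C i2 = y" "Cod C i2 = p"
    "p1 \<in> Arr C" "Dom C p1 = p" "Cod C p1 = x" "p2 \<in> Arr C" "Dom C p2 = p" "Cod C p2 = y"
    "p1 \<cdot> i1 = Ide C x" "p2 \<cdot> i2 = Ide C y" "p1 \<cdot> i2 = Zer C y x" "p2 \<cdot> i1 = Zer C x y"
    "Add C (i1 \<cdot> p1) (i2 \<cdot> p2) = Ide C p"
  using assms by (auto simp add: biproduct_def)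

text \<open>Reassociated forms of the biproduct identities, for rewriting inside right-nested composites.\<close>

lemma biproduct_red:
  assumes "biproduct C x y p i1 i2 p1 p2" "f \<in> Arr C"
  shows "Cod C f = x \<Longrightarrow> p1 \<cdot> (i1 \<cdot> f) = f" "Cod C f = y \<Longrightarrow> p2 \<cdot> (i2 \<cdot> f) = f"
    "Cod C f = y \<Longrightarrow> p1 \<cdot> (i2 \<cdot> f) = Zer C (Dom C f) x"
    "Cod C f = x \<Longrightarrow> p2 \<cdot> (i1 \<cdot> f) = Zer C (Dom C f) y"
proof -
  note b = biproductD[OF assms(1)]
  show "Cod C f = x \<Longrightarrow> p1 \<cdot> (i1 \<cdot> f) = f" "Cod C f = y \<Longrightarrow> p2 \<cdot> (i2 \<cdot> f) = f"
    "Cod C f = y \<Longrightarrow> p1 \<cdot> (i2 \<cdot> f) = Zer C (Dom C f) x"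
    "Cod C f = x \<Longrightarrow> p2 \<cdot> (i1 \<cdot> f) = Zer C (Dom C f) y"
    using b(1-13) assms(2) arr_simps(1,2)[OF b(2)] arr_simps(1,2)[OF b(5)]
    by (simp_all add: comp_subst[OF b(14)] comp_subst[OF b(15)] comp_subst[OF b(16)] comp_subst[OF b(17)])
qed

text \<open>The identity of \<open>p\<close> is the sum of \<open>i1 \<cdot> p1\<close> and
  \<open>i2 \<cdot> p2\<close>, which recovers an arrow from its two components.\<close>

lemma biproduct_eqI:
  assumes "biproduct C x y p i1 i2 p1 p2" "f \<in> Arr C" "g \<in> Arr C" "Cod C f = p" "Cod C g = p"
    "Dom C f = Dom C g" "p1 \<cdot> f = p1 \<cdot> g" "p2 \<cdot> f = p2 \<cdot> g"
  shows "f = g"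
proof -
  note b = biproductD[OF assms(1)]
  have "h = Add C (i1 \<cdot> (p1 \<cdot> h)) (i2 \<cdot> (p2 \<cdot> h))" if "h \<in> Arr C" "Cod C h = p" for h
  proof -
    have "h = Add C (i1 \<cdot> p1) (i2 \<cdot> p2) \<cdot> h"
      using b(18) that by simp
    also have "\<dots> = Add C (i1 \<cdot> (p1 \<cdot> h)) (i2 \<cdot> (p2 \<cdot> h))"
      using b(1-13) that by (subst add_comp) auto
    finally show ?thesis .
  qed
  then show ?thesis
    using assms by metis
qed

end

section \<open>Exactness, images, pullbacks and the short five lemma\<close>

context abelian_category
begin

text \<open>The axioms are self-dual. Interpreting the locale at \<open>op_cat C\<close> therefore
  yields the dual of every result below, and only one of two dual arguments is ever carried
  out.\<close>

lemma op_abelian: "abelian_category (op_cat C)"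
  by (intro abelian_category.intro op_preadditive abelian_category_axioms.intro)
    (simp_all add: ex_zero_object ex_kernel ex_cokernel mono_is_kernel epi_is_cokernel,
      metis ex_biproduct)

text \<open>The mono is a kernel of some \<open>g\<close>, and \<open>g\<close> factors through the
  cokernel \<open>c\<close>. Hence whatever \<open>c\<close> kills is killed by \<open>g\<close> and
  lifts through \<open>f\<close>.\<close>

lemma kernel_of_cokernel:
  assumes "is_mono C f" "is_cokernel C c f"
  shows "is_kernel C f c"
proof -
  obtain g where g: "is_kernel C f g"
    using mono_is_kernel assms(1) by auto
  note [simp] = kernelD(1-4)[OF g] cokernelD(1-4)[OF assms(2)]
  obtain h where h[simp]: "h \<in> Arr C" "Dom C h = Cod C c" "Cod C h = Cod C g" and hc: "h \<cdot> c = g"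
    by (rule cokernel_lift[OF assms(2), of g]) (assumption | simp)+
  show ?thesis
  proof (rule kernelI)
    fix x assume x: "x \<in> Arr C" "Cod C x = Dom C c" "c \<cdot> x = Zer C (Dom C x) (Cod C c)"
    have "g \<cdot> x = h \<cdot> (c \<cdot> x)"
      by (rule comp_subst[OF hc, symmetric]) (use x(1,2) in auto)
    also have "\<dots> = Zer C (Dom C x) (Cod C g)"
      using x(1) by (simp add: x(3))
    finally show "\<exists>h. h \<in> Arr C \<and> Dom C h = Dom C x \<and> Cod C h = Dom C f \<and> f \<cdot> h = x"
      by - (rule kernel_lift[OF g, of x], simp_all add: x(1,2), blast)
  qed (use assms in auto)
qed

lemma cokernel_of_kernel:
  assumes "is_epi C f" "is_kernel C k f"
  shows "is_cokernel C f k"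
proof -
  interpret op: abelian_category "op_cat C" by (rule op_abelian)
  show ?thesis using op.kernel_of_cokernel[of f k] assms by simp
qed

lemma sesD:
  assumes "short_exact C f g"
  shows "f \<in> Arr C" "g \<in> Arr C" "Cod C f = Dom C g" "g \<cdot> f = Zer C (Dom C f) (Cod C g)"
    "is_mono C f" "is_epi C g" "is_kernel C f g" "is_cokernel C g f"
  using assms kernelD[of f g] cokernelD[of g f] by (auto simp add: short_exact_def)

lemma ses_monoI: "\<lbrakk>is_mono C f; is_cokernel C g f\<rbrakk> \<Longrightarrow> short_exact C f g"
  by (simp add: short_exact_def kernel_of_cokernel)

lemma ses_epiI: "\<lbrakk>is_epi C g; is_kernel C f g\<rbrakk> \<Longrightarrow> short_exact C f g"
  by (simp add: short_exact_def cokernel_of_kernel)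

text \<open>The arrow is a kernel of some \<open>g\<close>, and \<open>g\<close> is zero because
  \<open>f\<close> is epi. So the identity of the codomain lifts through \<open>f\<close>, and the
  lift is the inverse.\<close>

lemma mono_epi_inverse:
  assumes "is_mono C f" "is_epi C f"
  obtains r where "r \<in> Arr C" "Dom C r = Cod C f" "Cod C r = Dom C f"
    "r \<cdot> f = Ide C (Dom C f)" "f \<cdot> r = Ide C (Cod C f)"
proof -
  note [simp] = mono_arr[OF assms(1)]
  obtain g where g: "is_kernel C f g"
    using mono_is_kernel assms(1) by auto
  note [simp] = kernelD(1-4)[OF g]
  have gz: "g = Zer C (Dom C g) (Cod C g)"
    using epi_zer[OF assms(2), of g] by simp
  obtain r where r [simp]: "r \<in> Arr C" "Dom C r = Dom C g" "Cod C r = Dom C f"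
     and fr: "f \<cdot> r = Ide C (Dom C g)"
    by (rule kernel_lift[OF g, of "Ide C (Dom C g)"]) (auto simp add: gz[symmetric])
  have "f \<cdot> (r \<cdot> f) = f \<cdot> Ide C (Dom C f)"
    by (subst comp_subst[OF fr]) auto
  then have "r \<cdot> f = Ide C (Dom C f)"
    by (rule monoD[OF assms(1)]) auto
  then show ?thesis
    using that[of r] fr by simp
qed

text \<open>Monicity of \<open>m\<close>: let \<open>q\<close> be the cokernel of an arrow
  \<open>x\<close> killed by \<open>m\<close>. The epi \<open>q \<cdot> e\<close> is a cokernel of
  some \<open>l\<close>. Since \<open>f\<close> factors through \<open>q \<cdot> e\<close>, the
  arrow \<open>l\<close> factors through the kernel of \<open>f\<close> and is killed by
  \<open>e\<close>. So \<open>e\<close> factors through \<open>q \<cdot> e\<close>, whence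
  \<open>q\<close> is split mono, and \<open>x\<close> is zero because \<open>q\<close> kills
  it.\<close>

lemma image_factor:
  assumes "f \<in> Arr C" "is_kernel C k f" "is_cokernel C e k"
  obtains m where "is_mono C m" "Dom C m = Cod C e" "Cod C m = Cod C f" "m \<cdot> e = f"
proof -
  note [simp] = kernelD(1-4)[OF assms(2)] cokernelD(1-4)[OF assms(3)]
  obtain m where m [simp]: "m \<in> Arr C" "Dom C m = Cod C e" "Cod C m = Cod C f" and me: "m \<cdot> e = f"
    by (rule cokernel_lift[OF assms(3), of f]) (assumption | simp)+
  have "is_mono C m"
  proof (rule monoI)
    fix x assume x [simp]: "x \<in> Arr C" "Cod C x = Dom C m" and mx: "m \<cdot> x = Zer C (Dom C x) (Cod C m)"
    obtain q where q: "is_cokernel C q x" using ex_cokernel x by blast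
    note [simp] = cokernelD(1-4)[OF q]
    obtain m' where m' [simp]: "m' \<in> Arr C" "Dom C m' = Cod C q" "Cod C m' = Cod C m" and mq: "m' \<cdot> q = m"
      by (rule cokernel_lift[OF q, of m]) (assumption | simp add: mx)+
    have qe: "is_epi C (q \<cdot> e)"
    proof (rule epiI)
      fix g assume g [simp]: "g \<in> Arr C" "Dom C g = Cod C (q \<cdot> e)"
        and z: "g \<cdot> (q \<cdot> e) = Zer C (Dom C (q \<cdot> e)) (Cod C g)"
      have "g \<cdot> q = Zer C (Cod C e) (Cod C g)"
        using epi_zer[OF cokernelD(5)[OF assms(3)], of "g \<cdot> q"] z g by simp
      then show "g = Zer C (Cod C (q \<cdot> e)) (Cod C g)"
        using epi_zer[OF cokernelD(5)[OF q], of g] g by simp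
    qed simp
    then obtain l where l: "is_cokernel C (q \<cdot> e) l"
      using epi_is_cokernel by blast
    note l' = cokernelD(1-4)[OF l]
    have [simp]: "l \<in> Arr C" "Cod C l = Dom C e" using l' by auto
    have "q \<cdot> (e \<cdot> l) = Zer C (Dom C l) (Cod C q)" using l' by simp
    then have "m' \<cdot> (q \<cdot> (e \<cdot> l)) = Zer C (Dom C l) (Cod C m)" by simp
    then have "m \<cdot> (e \<cdot> l) = Zer C (Dom C l) (Cod C m)"
      by (subst (asm) comp_subst[OF mq]) auto
    then have "f \<cdot> l = Zer C (Dom C l) (Cod C f)"
      by (subst (asm) comp_subst[OF me]) auto
    then obtain l1 where l1 [simp]: "l1 \<in> Arr C" "Dom C l1 = Dom C l" "Cod C l1 = Dom C k" and kl: "k \<cdot> l1 = l"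
      by - (rule kernel_lift[OF assms(2), of l], (assumption | simp)+)
    have "e \<cdot> (k \<cdot> l1) = Zer C (Dom C l) (Cod C e)"
      by (subst comp_subst[OF cokernelD(4)[OF assms(3)]]) auto
    then have "e \<cdot> l = Zer C (Dom C l) (Cod C e)"
      by (simp only: kl)
    then obtain t where t [simp]: "t \<in> Arr C" "Dom C t = Cod C (q \<cdot> e)" "Cod C t = Cod C e" and te: "t \<cdot> (q \<cdot> e) = e"
      by - (rule cokernel_lift[OF l, of e], (assumption | simp)+)
    have "t \<cdot> q = Ide C (Cod C e)"
      by (rule epiD[OF cokernelD(5)[OF assms(3)]]) (use te in auto)
    then have "t \<cdot> (q \<cdot> x) = x"
      by (subst comp_subst) auto
    then show "x = Zer C (Dom C x) (Dom C m)"
      by simp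
  qed simp
  then show ?thesis using that[of m] me by simp
qed

text \<open>The pullback is the kernel of the difference \<phi> of \<open>g \<cdot> p1\<close> and
  \<open>v \<cdot> p2\<close> on a biproduct. To see that \<open>g'\<close> is epi, note that \<phi>
  is epi because its restriction along \<open>i1\<close> is \<open>g\<close>; hence \<phi> is the
  cokernel of \<open>k\<close>. If \<open>y\<close> kills \<open>g'\<close>, then
  \<open>y \<cdot> p2\<close> factors through \<phi>, and restricting to \<open>i1\<close> shows
  that the factor is zero.\<close>

lemma ses_pullback:
  assumes "short_exact C f g" "v \<in> Arr C" "Cod C v = Cod C g"
  obtains f' g' w where "short_exact C f' g'" "Dom C f' = Dom C f" "Cod C g' = Dom C v"
    "w \<in> Arr C" "Dom C w = Cod C f'" "Cod C w = Cod C f" "w \<cdot> f' = f" "g \<cdot> w = v \<cdot> g'"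
    "\<And>x1 x2. \<lbrakk>x1 \<in> Arr C; x2 \<in> Arr C; Dom C x1 = Dom C x2; Cod C x1 = Cod C f; Cod C x2 = Dom C v;
      g \<cdot> x1 = v \<cdot> x2\<rbrakk> \<Longrightarrow> \<exists>t. t \<in> Arr C \<and> Dom C t = Dom C x2 \<and> Cod C t = Cod C f' \<and> w \<cdot> t = x1 \<and> g' \<cdot> t = x2"
proof -
  note [simp] = sesD(1-4)[OF assms(1)] assms(2,3)
  obtain p i1 i2 p1 p2 where b: "biproduct C (Dom C g) (Dom C v) p i1 i2 p1 p2"
    using ex_biproduct[of "Dom C g" "Dom C v"] by auto
  note [simp] = biproductD(1-17)[OF b] biproduct_red[OF b]
  define \<phi> where "\<phi> = Add C (g \<cdot> p1) (neg (v \<cdot> p2))"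
  have \<phi> [simp]: "\<phi> \<in> Arr C" "Dom C \<phi> = p" "Cod C \<phi> = Cod C g"
    unfolding \<phi>_def by auto
  have \<phi>c: "\<phi> \<cdot> x = Add C (g \<cdot> (p1 \<cdot> x)) (neg (v \<cdot> (p2 \<cdot> x)))" if "x \<in> Arr C" "Cod C x = p" for x
    unfolding \<phi>_def using that by (subst add_comp) auto
  obtain k where k: "is_kernel C k \<phi>" using ex_kernel \<phi> by blast
  note [simp] = kernelD(1-4)[OF k]
  define w where "w = p1 \<cdot> k"
  define g' where "g' = p2 \<cdot> k"
  have w [simp]: "w \<in> Arr C" "Dom C w = Dom C k" "Cod C w = Dom C g"
    and g' [simp]: "g' \<in> Arr C" "Dom C g' = Dom C k" "Cod C g' = Dom C v"
    unfolding w_def g'_def by auto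
  have gw: "g \<cdot> w = v \<cdot> g'"
    by (rule diff_eq_zer[of _ _ "Dom C k" "Cod C g"]) (use \<phi>c[of k] in \<open>auto simp add: w_def g'_def\<close>)
  have U: "\<exists>t. t \<in> Arr C \<and> Dom C t = Dom C x2 \<and> Cod C t = Dom C k \<and> w \<cdot> t = x1 \<and> g' \<cdot> t = x2"
    if x: "x1 \<in> Arr C" "x2 \<in> Arr C" "Dom C x1 = Dom C x2" "Cod C x1 = Dom C g" "Cod C x2 = Dom C v"
      "g \<cdot> x1 = v \<cdot> x2" for x1 x2
  proof -
    let ?s = "Add C (i1 \<cdot> x1) (i2 \<cdot> x2)"
    have s: "?s \<in> Arr C" "Dom C ?s = Dom C x2" "Cod C ?s = p" "p1 \<cdot> ?s = x1" "p2 \<cdot> ?s = x2"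
      using x(1-5) arr_simps(1)[OF x(2)] by auto
    have "\<phi> \<cdot> ?s = Zer C (Dom C x2) (Cod C g)"
      using x s by (subst \<phi>c) auto
    then obtain t where t: "t \<in> Arr C" "Dom C t = Dom C ?s" "Cod C t = Dom C k" "k \<cdot> t = ?s"
      by - (rule kernel_lift[OF k, of ?s], (assumption | simp add: s)+)
    have "w \<cdot> t = p1 \<cdot> (k \<cdot> t)" "g' \<cdot> t = p2 \<cdot> (k \<cdot> t)"
      using t(1-3) by (auto simp add: w_def g'_def)
    with t s show ?thesis by metis
  qed
  have J: "t = t'" if "t \<in> Arr C" "t' \<in> Arr C" "Cod C t = Dom C k" "Cod C t' = Dom C k" "Dom C t = Dom C t'"
    "w \<cdot> t = w \<cdot> t'" "g' \<cdot> t = g' \<cdot> t'" for t t'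
  proof (rule monoD[OF kernelD(5)[OF k]])
    show "k \<cdot> t = k \<cdot> t'"
      by (rule biproduct_eqI[OF b]) (use that in \<open>auto simp add: w_def g'_def\<close>)
  qed (use that in auto)
  obtain f' where f' [simp]: "f' \<in> Arr C" "Dom C f' = Dom C f" "Cod C f' = Dom C k"
    and wf: "w \<cdot> f' = f" and gf: "g' \<cdot> f' = Zer C (Dom C f) (Dom C v)"
    using U[of f "Zer C (Dom C f) (Dom C v)"] by (simp, blast)
  have "is_kernel C f' g'"
  proof (rule kernelI)
    show "is_mono C f'"
      by (rule mono_cancel[of w]) (use sesD(5)[OF assms(1)] wf in auto)
    fix x assume x: "x \<in> Arr C" "Cod C x = Dom C g'" "g' \<cdot> x = Zer C (Dom C x) (Cod C g')"
    have "g \<cdot> (w \<cdot> x) = Zer C (Dom C x) (Cod C g)"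
      by (subst comp_subst[OF gw]) (use x in auto)
    then obtain y where y: "y \<in> Arr C" "Dom C y = Dom C (w \<cdot> x)" "Cod C y = Dom C f" "f \<cdot> y = w \<cdot> x"
      by - (rule kernel_lift[OF sesD(7)[OF assms(1)], of "w \<cdot> x"], (assumption | simp add: x(1,2))+)
    have "f' \<cdot> y = x"
      by (rule J) (use x y arr_simps(1)[OF x(1)] in \<open>auto simp add: comp_subst[OF wf] comp_subst[OF gf]\<close>)
    then show "\<exists>h. h \<in> Arr C \<and> Dom C h = Dom C x \<and> Cod C h = Dom C f' \<and> f' \<cdot> h = x"
      using y by auto
  qed (use gf in auto)
  moreover have "is_epi C g'"
  proof (rule epiI)
    fix y assume y [simp]: "y \<in> Arr C" "Dom C y = Cod C g'" and yz: "y \<cdot> g' = Zer C (Dom C g') (Cod C y)"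
    have \<phi>i: "\<phi> \<cdot> i1 = g"
      by (subst \<phi>c) auto
    have "is_epi C \<phi>"
    proof (rule epiI)
      fix h assume h [simp]: "h \<in> Arr C" "Dom C h = Cod C \<phi>" and z: "h \<cdot> \<phi> = Zer C (Dom C \<phi>) (Cod C h)"
      have "h \<cdot> (\<phi> \<cdot> i1) = Zer C (Dom C g) (Cod C h)"
        by (subst comp_subst[OF z]) auto
      then show "h = Zer C (Cod C \<phi>) (Cod C h)"
        using epi_zer[OF sesD(6)[OF assms(1)], of h] by (simp add: \<phi>i)
    qed simp
    then have c: "is_cokernel C \<phi> k"
      using k by (rule cokernel_of_kernel)
    have "(y \<cdot> p2) \<cdot> k = Zer C (Dom C k) (Cod C y)"
      using yz by (simp add: g'_def)
    then obtain t where t [simp]: "t \<in> Arr C" "Dom C t = Cod C \<phi>" "Cod C t = Cod C (y \<cdot> p2)" and te: "t \<cdot> \<phi> = y \<cdot> p2"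
      by - (rule cokernel_lift[OF c, of "y \<cdot> p2"], (assumption | simp)+)
    have "t \<cdot> (\<phi> \<cdot> i1) = (y \<cdot> p2) \<cdot> i1"
      by (subst comp_subst[OF te]) auto
    then have "t = Zer C (Cod C g) (Cod C y)"
      using epi_zer[OF sesD(6)[OF assms(1)], of t] by (simp add: \<phi>i)
    then have z: "y \<cdot> p2 = Zer C p (Cod C y)"
      using te by simp
    have "y \<cdot> (p2 \<cdot> i2) = Zer C p (Cod C y) \<cdot> i2"
      by (subst comp_subst[OF z]) auto
    then show "y = Zer C (Cod C g') (Cod C y)"
      by simp
  qed simp
  ultimately have "short_exact C f' g'"
    by (intro ses_epiI)
  then show ?thesis
    by (rule that[of f' g' w]) (use wf gw U in \<open>simp_all, blast?\<close>)
qed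

lemma ses_pushout:
  assumes "short_exact C f g" "u \<in> Arr C" "Dom C u = Dom C f"
  obtains f' g' w where "short_exact C f' g'" "Dom C f' = Cod C u" "Cod C g' = Cod C g"
    "w \<in> Arr C" "Dom C w = Cod C f" "Cod C w = Cod C f'" "w \<cdot> f = f' \<cdot> u" "g' \<cdot> w = g"
    "\<And>x1 x2. \<lbrakk>x1 \<in> Arr C; x2 \<in> Arr C; Cod C x1 = Cod C x2; Dom C x1 = Cod C f; Dom C x2 = Cod C u;
      x1 \<cdot> f = x2 \<cdot> u\<rbrakk> \<Longrightarrow> \<exists>t. t \<in> Arr C \<and> Cod C t = Cod C x2 \<and> Dom C t = Cod C f' \<and> t \<cdot> w = x1 \<and> t \<cdot> f' = x2"
proof -
  interpret op: abelian_category "op_cat C" by (rule op_abelian)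
  show ?thesis
  proof (rule op.ses_pullback[of g f u])
    fix g' f' w assume h: "short_exact (op_cat C) g' f'" "Dom (op_cat C) g' = Dom (op_cat C) g"
      "Cod (op_cat C) f' = Dom (op_cat C) u" "w \<in> Arr (op_cat C)" "Dom (op_cat C) w = Cod (op_cat C) g'"
      "Cod (op_cat C) w = Cod (op_cat C) g" "w \<cdot>\<^bsub>op_cat C\<^esub> g' = g" "f \<cdot>\<^bsub>op_cat C\<^esub> w = u \<cdot>\<^bsub>op_cat C\<^esub> f'"
      "\<And>x1 x2. \<lbrakk>x1 \<in> Arr (op_cat C); x2 \<in> Arr (op_cat C); Dom (op_cat C) x1 = Dom (op_cat C) x2;
          Cod (op_cat C) x1 = Cod (op_cat C) g; Cod (op_cat C) x2 = Dom (op_cat C) u;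
          f \<cdot>\<^bsub>op_cat C\<^esub> x1 = u \<cdot>\<^bsub>op_cat C\<^esub> x2\<rbrakk>
        \<Longrightarrow> \<exists>t. t \<in> Arr (op_cat C) \<and> Dom (op_cat C) t = Dom (op_cat C) x2 \<and>
          Cod (op_cat C) t = Cod (op_cat C) g' \<and> w \<cdot>\<^bsub>op_cat C\<^esub> t = x1 \<and> f' \<cdot>\<^bsub>op_cat C\<^esub> t = x2"
    note h' = h[unfolded op_cat_simps short_exact_op]
    note eq = sesD(3)[OF assms(1)] sesD(3)[OF h'(1)]
    show thesis
      by (rule that[of f' g' w]) (use h'(1-8) h'(9) eq in \<open>simp_all only: eq\<close>)
  qed (use assms in simp_all)
qed

text \<open>The short five lemma for morphisms that are the identity at both ends.\<close>

lemma ext_mor_inverse: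
  assumes "short_exact C f g" "short_exact C f' g'" "w \<in> Arr C" "Dom C w = Cod C f" "Cod C w = Cod C f'"
    "w \<cdot> f = f'" "g' \<cdot> w = g"
  obtains r where "r \<in> Arr C" "Dom C r = Cod C f'" "Cod C r = Cod C f" "r \<cdot> f' = f" "g \<cdot> r = g'"
    "r \<cdot> w = Ide C (Cod C f)" "w \<cdot> r = Ide C (Cod C f')"
proof -
  \<comment> \<open>Monicity is proved for an arbitrary category, so that its instance at
    \<open>op_cat C\<close> shows that \<open>w\<close> is epi.\<close>
  have M: "is_mono A w" if "abelian_category A" "short_exact A f g" "short_exact A f' g'" "w \<in> Arr A"
    "Dom A w = Cod A f" "Cod A w = Cod A f'"
    "w \<cdot>\<^bsub>A\<^esub> f = f'" "g' \<cdot>\<^bsub>A\<^esub> w = g" for A :: "('a, 'b) cat" and f g f' g' w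
  proof -
    interpret A: abelian_category A by fact
    note s = A.sesD[OF that(2)] note s' = A.sesD[OF that(3)]
    note [simp] = s(1-4) s'(1-4) that(4-6)
    have [simp]: "Dom A f' = Dom A f"
      unfolding that(7)[symmetric] by simp
    have [simp]: "Cod A g' = Cod A g"
      unfolding that(8)[symmetric] by simp
    show ?thesis
    proof (rule A.monoI)
      fix x assume x [simp]: "x \<in> Arr A" "Cod A x = Dom A w" and z: "w \<cdot>\<^bsub>A\<^esub> x = Zer A (Dom A x) (Cod A w)"
      have "g' \<cdot>\<^bsub>A\<^esub> (w \<cdot>\<^bsub>A\<^esub> x) = Zer A (Dom A x) (Cod A g)"
        unfolding z by simp
      then have "g \<cdot>\<^bsub>A\<^esub> x = Zer A (Dom A x) (Cod A g)"
        by (subst (asm) A.comp_subst[OF that(8)]) auto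
      then obtain y where y: "y \<in> Arr A" "Dom A y = Dom A x" "Cod A y = Dom A f" "f \<cdot>\<^bsub>A\<^esub> y = x"
        by - (rule A.kernel_lift[OF s(7), of x], (assumption | simp)+)
      have "f' \<cdot>\<^bsub>A\<^esub> y = w \<cdot>\<^bsub>A\<^esub> (f \<cdot>\<^bsub>A\<^esub> y)"
        by (subst A.comp_subst[OF that(7)]) (use y in auto)
      then have "f' \<cdot>\<^bsub>A\<^esub> y = Zer A (Dom A y) (Cod A f')"
        using y(2) z by (simp add: y(4))
      then have "y = Zer A (Dom A y) (Dom A f')"
        using A.mono_zer[OF s'(5), of y] y(1-3) by simp
      then have "f \<cdot>\<^bsub>A\<^esub> y = Zer A (Dom A x) (Cod A f)"
        by (metis A.arr_simps(1) A.zer_comp \<open>Dom A f' = Dom A f\<close> s(1) x(1) y(2))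
      then show "x = Zer A (Dom A x) (Dom A w)"
        by (simp add: y(4))
    qed simp
  qed
  note s = sesD(1-4)[OF assms(1)] sesD(1-4)[OF assms(2)] assms(3-5)
  have "is_mono C w"
    using M[OF abelian_category_axioms assms] .
  moreover have "is_epi C w"
    using M[OF op_abelian, of g' f' g f w] assms s by auto
  ultimately obtain r where r: "r \<in> Arr C" "Dom C r = Cod C f'" "Cod C r = Cod C f"
    "r \<cdot> w = Ide C (Cod C f)" "w \<cdot> r = Ide C (Cod C f')"
    using mono_epi_inverse[of w] assms by metis
  have "r \<cdot> (w \<cdot> f) = f" "(g' \<cdot> w) \<cdot> r = g'"
     using s r by (auto simp add: comp_subst[OF r(4)])
  with r assms that show ?thesis by auto
qed

end

section \<open>Extensions\<close>

text \<open>
  \<open>splits2 C f g\<close> expresses that a 2-extension starting with \<open>f\<close> and \<open>g\<close> is trivial: the extension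
  of the image of \<open>g\<close> by \<open>Dom C f\<close> that it contains is the restriction of an extension of \<open>Cod C g\<close>.
\<close>

definition splits2 :: "('o, 'm) cat \<Rightarrow> 'm \<Rightarrow> 'm \<Rightarrow> bool" where
  "splits2 C f g \<longleftrightarrow> (\<exists>f' q i. short_exact C f' q \<and> Dom C f' = Dom C f \<and> Cod C q = Cod C g \<and>
     i \<in> Hom C (Cod C f) (Cod C f') \<and> i \<cdot>\<^bsub>C\<^esub> f = f' \<and> q \<cdot>\<^bsub>C\<^esub> i = g)"

context abelian_category
begin

lemma pullback_ex:
  assumes "short_exact C f g" "v \<in> Arr C" "Cod C v = Cod C g"
  shows "\<exists>f' g' w. short_exact C f' g' \<and> Dom C f' = Dom C f \<and> Cod C g' = Dom C v \<and>
    w \<in> Arr C \<and> Dom C w = Cod C f' \<and> Cod C w = Cod C f \<and> w \<cdot> f' = f \<and> g \<cdot> w = v \<cdot> g'"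
  by (rule ses_pullback[OF assms]) blast

lemma pushout_ex:
  assumes "short_exact C f g" "u \<in> Arr C" "Dom C u = Dom C f"
  shows "\<exists>f' g' w. short_exact C f' g' \<and> Dom C f' = Cod C u \<and> Cod C g' = Cod C g \<and>
    w \<in> Arr C \<and> Dom C w = Cod C f \<and> Cod C w = Cod C f' \<and> w \<cdot> f = f' \<cdot> u \<and> g' \<cdot> w = g"
  by (rule ses_pushout[OF assms]) blast

text \<open>The difference of \<open>x\<close> and \<open>y\<close> is killed by \<open>g'\<close>,
  so it factors through \<open>f'\<close>; there \<open>w\<close> acts as the mono \<open>f\<close>,
  and the difference vanishes. No universal property of the square enters, only the identity on the
  left ends.\<close>

lemma pullback_unique:
  assumes "short_exact C f g" "short_exact C f' g'" "w \<in> Arr C" "Dom C w = Cod C f'" "Cod C w = Cod C f"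
    "w \<cdot> f' = f" "Dom C f' = Dom C f"
    "x \<in> Arr C" "y \<in> Arr C" "Dom C x = Dom C y" "Cod C x = Cod C f'" "Cod C y = Cod C f'"
    "w \<cdot> x = w \<cdot> y" "g' \<cdot> x = g' \<cdot> y"
  shows "x = y"
proof -
  note [simp] = sesD(1-4)[OF assms(1)] sesD(1-4)[OF assms(2)] assms(3-5,7-12)
  let ?z = "Add C x (neg y)"
  have w: "w \<cdot> ?z = Zer C (Dom C y) (Dom C g)" and g: "g' \<cdot> ?z = Zer C (Dom C y) (Cod C g')"
    by (simp_all add: assms(13,14))
  have z: "?z \<in> Arr C" "Dom C ?z = Dom C y" "Cod C ?z = Dom C g'" by simp_all
  obtain t where t: "t \<in> Arr C" "Dom C t = Dom C ?z" "Cod C t = Dom C f'" "f' \<cdot> t = ?z"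
    by (rule kernel_lift[OF sesD(7)[OF assms(2)], of ?z]) (assumption | simp add: z g)+
  have "w \<cdot> (f' \<cdot> t) = f \<cdot> t"
    by (rule comp_subst[OF assms(6)]) (use t in auto)
  then have "f \<cdot> t = Zer C (Dom C y) (Dom C g)"
    by (simp only: t(4) w)
  then have "t = Zer C (Dom C y) (Dom C f)"
    using mono_zer[OF sesD(5)[OF assms(1)], of t] t(1-3) by simp
  then have "?z = Zer C (Dom C y) (Dom C g')"
    using t(4) by simp
  then show ?thesis
    by (rule diff_eq_zer) simp_all
qed

text \<open>Any morphism of extensions that is the identity on the left is a pullback square: it is
  compared with the constructed pullback, and the comparison arrow is invertible by the short five
  lemma.\<close>

lemma ext_mor_pullback:
  assumes "short_exact C f g" "short_exact C f' g'" "w \<in> Arr C" "Dom C w = Cod C f'" "Cod C w = Cod C f"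
    "w \<cdot> f' = f" "g \<cdot> w = v \<cdot> g'" "v \<in> Arr C" "Dom C v = Cod C g'" "Cod C v = Cod C g" "Dom C f' = Dom C f"
    "x1 \<in> Arr C" "x2 \<in> Arr C" "Dom C x1 = Dom C x2" "Cod C x1 = Cod C f" "Cod C x2 = Dom C v" "g \<cdot> x1 = v \<cdot> x2"
  shows "\<exists>t. t \<in> Arr C \<and> Dom C t = Dom C x2 \<and> Cod C t = Cod C f' \<and> w \<cdot> t = x1 \<and> g' \<cdot> t = x2"
proof (rule ses_pullback[OF assms(1,8,10)])
  fix f0 g0 w0
  assume s0: "short_exact C f0 g0" and h: "Dom C f0 = Dom C f" "Cod C g0 = Dom C v"
    "w0 \<in> Arr C" "Dom C w0 = Cod C f0" "Cod C w0 = Cod C f" "w0 \<cdot> f0 = f" "g \<cdot> w0 = v \<cdot> g0" and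
    U: "\<And>x1 x2. \<lbrakk>x1 \<in> Arr C; x2 \<in> Arr C; Dom C x1 = Dom C x2; Cod C x1 = Cod C f; Cod C x2 = Dom C v;
      g \<cdot> x1 = v \<cdot> x2\<rbrakk> \<Longrightarrow> \<exists>t. t \<in> Arr C \<and> Dom C t = Dom C x2 \<and> Cod C t = Cod C f0 \<and> w0 \<cdot> t = x1 \<and> g0 \<cdot> t = x2"
  note [simp] = sesD(1-4)[OF assms(1)] sesD(1-4)[OF assms(2)] assms(3-5,8-11) h(1-5) sesD(1-4)[OF s0]
  obtain r where r [simp]: "r \<in> Arr C" "Dom C r = Dom C g'" "Cod C r = Cod C f0" and wr: "w0 \<cdot> r = w" "g0 \<cdot> r = g'"
    using U[of w g'] assms by auto
  have rf: "r \<cdot> f' = f0"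
    by (rule pullback_unique[OF assms(1) s0, of w0]) (use h assms(6) in \<open>auto simp add: comp_subst[OF wr(1)] comp_subst[OF wr(2)]\<close>)
  obtain r' where r' [simp]: "r' \<in> Arr C" "Dom C r' = Cod C f0" "Cod C r' = Cod C f'" and
     h': "r' \<cdot> f0 = f'" "g' \<cdot> r' = g0" "r' \<cdot> r = Ide C (Cod C f')" "r \<cdot> r' = Ide C (Cod C f0)"
    by (rule ext_mor_inverse[OF assms(2) s0, of r]) (assumption | simp add: rf wr)+
  have wr': "w \<cdot> r' = w0"
  proof -
    have "w0 \<cdot> (r \<cdot> r') = w \<cdot> r'"
      by (rule comp_subst[OF wr(1)]) auto
    then show ?thesis by (simp add: h')
  qed
  obtain t where "t \<in> Arr C" "Dom C t = Dom C x2" "Cod C t = Cod C f0" "w0 \<cdot> t = x1" "g0 \<cdot> t = x2"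
    using U[of x1 x2] assms by auto
  then have "r' \<cdot> t \<in> Arr C" "Dom C (r' \<cdot> t) = Dom C x2" "Cod C (r' \<cdot> t) = Cod C f'" "w \<cdot> (r' \<cdot> t) = x1" "g' \<cdot> (r' \<cdot> t) = x2"
    by (auto simp add: comp_subst[OF wr'] comp_subst[OF h'(2)])
  then show ?thesis by blast
qed

section \<open>Equivalence and splitting of extensions\<close>

lemma extensionsD:
  assumes "(f, g) \<in> extensions C z x"
  shows "short_exact C f g" "Dom C f = x" "Cod C g = z"
  using assms by (auto simp add: extensions_def)

text \<open>Symmetry is the short five lemma; the other properties come from identities and
  composites.\<close>

lemma ext_equiv_equiv: "equiv (extensions C z x) (ext_equiv C z x)"
proof (rule equivI)
  show "ext_equiv C z x \<subseteq> extensions C z x \<times> extensions C z x"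
    by (auto simp add: ext_equiv_def)
  show "refl_on (extensions C z x) (ext_equiv C z x)"
  proof (rule refl_onI)
    fix e assume "e \<in> extensions C z x"
    moreover obtain f g where "e = (f, g)" by force
    ultimately show "(e, e) \<in> ext_equiv C z x"
      using sesD(1-3)[of f g] by (auto simp add: ext_equiv_def extensions_def intro!: bexI[of _ "Ide C (Cod C f)"])
  qed
  show "sym (ext_equiv C z x)"
  proof (rule symI, clarify)
    fix f g f' g' assume "((f, g), (f', g')) \<in> ext_equiv C z x"
    then obtain w where e: "(f, g) \<in> extensions C z x" "(f', g') \<in> extensions C z x"
      and w: "w \<in> Arr C" "Dom C w = Cod C f" "Cod C w = Cod C f'" "w \<cdot> f = f'" "g' \<cdot> w = g"
      by (auto simp add: ext_equiv_def)
    show "((f', g'), (f, g)) \<in> ext_equiv C z x"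
      by (rule ext_mor_inverse[OF extensionsD(1)[OF e(1)] extensionsD(1)[OF e(2)] w])
        (use e in \<open>auto simp add: ext_equiv_def\<close>)
  qed
  show "trans (ext_equiv C z x)"
  proof (rule transI, clarify)
    fix f g f' g' f'' g''
    assume h: "((f, g), (f', g')) \<in> ext_equiv C z x" "((f', g'), (f'', g'')) \<in> ext_equiv C z x"
    then obtain w v where w: "w \<in> Arr C" "Dom C w = Cod C f" "Cod C w = Cod C f'" "w \<cdot> f = f'" "g' \<cdot> w = g"
      and v: "v \<in> Arr C" "Dom C v = Cod C f'" "Cod C v = Cod C f''" "v \<cdot> f' = f''" "g'' \<cdot> v = g'"
      by (auto simp add: ext_equiv_def)
    have e: "(f, g) \<in> extensions C z x" "(f'', g'') \<in> extensions C z x"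
      using h by (auto simp add: ext_equiv_def)
    have "v \<cdot> w \<cdot> f = f''" "g'' \<cdot> (v \<cdot> w) = g"
      using w v sesD(1-3)[OF extensionsD(1)[OF e(1)]] sesD(1-3)[OF extensionsD(1)[OF e(2)]]
      by (auto simp add: comp_subst[OF v(5)])
    then show "((f, g), (f'', g'')) \<in> ext_equiv C z x"
      using e w v by (auto simp add: ext_equiv_def intro!: bexI[of _ "v \<cdot> w"])
  qed
qed

text \<open>The identity minus \<open>s \<cdot> g\<close> is killed by \<open>g\<close>, and its
  lift through \<open>f\<close> is the second projection.\<close>

lemma split_ses_biproduct:
  assumes "short_exact C f g" "split_epi C g"
  obtains s r where "biproduct C (Dom C f) (Cod C g) (Cod C f) f s r g"
proof -
  note [simp] = sesD(1-4)[OF assms(1)]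
  obtain s where s [simp]: "s \<in> Arr C" "Dom C s = Cod C g" "Cod C s = Dom C g" and gs: "g \<cdot> s = Ide C (Cod C g)"
    using assms(2) by (auto simp add: split_epi_def)
  let ?e = "Add C (Ide C (Cod C f)) (neg (s \<cdot> g))"
  have "g \<cdot> ?e = Zer C (Cod C f) (Cod C g)"
    by (simp add: comp_subst[OF gs])
  then obtain r where r0: "r \<in> Arr C" "Dom C r = Dom C ?e" "Cod C r = Dom C f" and fr: "f \<cdot> r = ?e"
    by - (rule kernel_lift[OF sesD(7)[OF assms(1)], of ?e], (assumption | simp)+)
  then have r [simp]: "r \<in> Arr C" "Dom C r = Dom C g" "Cod C r = Dom C f" by simp_all
  have "r \<cdot> f = Ide C (Dom C f)"
    by (rule monoD[OF sesD(5)[OF assms(1)]]) (simp_all add: comp_subst[OF fr])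
  moreover have "r \<cdot> s = Zer C (Cod C g) (Dom C f)"
    by (rule monoD[OF sesD(5)[OF assms(1)]]) (simp_all add: comp_subst[OF fr] gs)
  moreover have "Add C (f \<cdot> r) (s \<cdot> g) = Ide C (Cod C f)"
    by (simp add: fr add_assoc)
  ultimately show ?thesis
    by (intro that[of s r]) (simp add: biproduct_def gs)
qed

lemma biproduct_ses:
  assumes "biproduct C x y p i1 i2 p1 p2"
  shows "short_exact C i1 p2" "split_epi C p2" "split_mono C i1" "x \<in> Obj C" "y \<in> Obj C"
proof -
  note [simp] = biproductD(1-17)[OF assms] biproduct_red[OF assms]
  show [simp]: "x \<in> Obj C" "y \<in> Obj C"
    using arr_simps(1)[of i1] arr_simps(1)[of i2] by auto
  show "split_epi C p2" "split_mono C i1"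
    by (auto simp add: split_epi_def split_mono_def intro: bexI[of _ i2] bexI[of _ p1])
  show "short_exact C i1 p2"
  proof (rule ses_epiI)
    show "is_epi C p2"
    proof (rule epiI)
      fix g assume g: "g \<in> Arr C" "Dom C g = Cod C p2" "g \<cdot> p2 = Zer C (Dom C p2) (Cod C g)"
      have "g \<cdot> (p2 \<cdot> i2) = Zer C (Dom C p2) (Cod C g) \<cdot> i2"
        by (rule comp_subst[OF g(3)]) (use g in auto)
      then show "g = Zer C (Cod C p2) (Cod C g)"
        using g(1,2) by simp
    qed simp
    show "is_kernel C i1 p2"
    proof (rule kernelI)
      show "is_mono C i1"
      proof (rule monoI)
        fix g assume g: "g \<in> Arr C" "Cod C g = Dom C i1" "i1 \<cdot> g = Zer C (Dom C g) (Cod C i1)"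
        have "g = p1 \<cdot> (i1 \<cdot> g)" using g(1,2) by simp
        also have "\<dots> = Zer C (Dom C g) (Dom C i1)" unfolding g(3) using g(1) by simp
        finally show "g = Zer C (Dom C g) (Dom C i1)" .
      qed simp
      fix g assume g: "g \<in> Arr C" "Cod C g = Dom C p2" "p2 \<cdot> g = Zer C (Dom C g) (Cod C p2)"
      have "i1 \<cdot> (p1 \<cdot> g) = g"
        by (rule biproduct_eqI[OF assms]) (use g in auto)
      then show "\<exists>h. h \<in> Arr C \<and> Dom C h = Dom C g \<and> Cod C h = Dom C i1 \<and> i1 \<cdot> h = g"
        using g by (intro exI[of _ "p1 \<cdot> g"]) auto
    qed auto
  qed
qed

lemma split_epi_iff_split_mono:
  assumes "short_exact C f g"
  shows "split_epi C g \<longleftrightarrow> split_mono C f"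
proof
  show "split_mono C f" if "split_epi C g"
    using split_ses_biproduct[OF assms that] biproduct_ses(3) by metis
  interpret op: abelian_category "op_cat C" by (rule op_abelian)
  show "split_epi C g" if "split_mono C f"
    using op.split_ses_biproduct[of g f] assms that op.biproduct_ses(3)[of _ _ _ g]
    by (metis short_exact_op split_op)
qed

lemma split_ext_ex:
  assumes "x \<in> Obj C" "z \<in> Obj C"
  shows "Ext1_zero C z x \<noteq> {}"
proof -
  obtain p i1 i2 p1 p2 where b: "biproduct C x z p i1 i2 p1 p2"
    using ex_biproduct assms by metis
  then have "(i1, p2) \<in> Ext1_zero C z x"
    using biproduct_ses[OF b] biproductD[OF b] by (auto simp add: Ext1_zero_def extensions_def split_ext_def)
  then show ?thesis by blast
qed

text \<open>Splittings turn both middle objects into biproducts of the same ends, and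
  \<open>?w\<close> matches the coordinates. This is what makes \<open>Ext1_zero\<close> a single
  class.\<close>

lemma split_ext_equiv:
  assumes "e \<in> Ext1_zero C z x" "e' \<in> Ext1_zero C z x"
  shows "(e, e') \<in> ext_equiv C z x"
proof -
  obtain f g f' g' where e: "e = (f, g)" "e' = (f', g')" by force
  then have s: "short_exact C f g" "short_exact C f' g'" "split_epi C g" "split_epi C g'"
    and x: "(f, g) \<in> extensions C z x" "(f', g') \<in> extensions C z x"
    using assms by (auto simp add: Ext1_zero_def extensions_def split_ext_def)
  obtain s1 r1 where b: "biproduct C x z (Cod C f) f s1 r1 g"
    using split_ses_biproduct[OF s(1,3)] extensionsD[OF x(1)] by metis
  obtain s2 r2 where b': "biproduct C x z (Cod C f') f' s2 r2 g'"
    using split_ses_biproduct[OF s(2,4)] extensionsD[OF x(2)] by metis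
  note d = biproductD(1-17)[OF b] biproductD(1-17)[OF b'] biproduct_ses(4,5)[OF b]
  let ?w = "Add C (f' \<cdot> r1) (s2 \<cdot> g)"
  have "?w \<in> Hom C (Cod C f) (Cod C f')" "?w \<cdot> f = f'" "g' \<cdot> ?w = g"
    using d biproduct_red[OF b] biproduct_red[OF b'] by simp_all
  then show ?thesis
    unfolding e ext_equiv_def using x by blast
qed

text \<open>Everything is checked on the two components. The cokernel half of the exactness of
  direct sums is this statement in the opposite category.\<close>

lemma biproduct_sum_kernel:
  assumes "is_kernel C f g" "is_kernel C f' g'"
    "biproduct C (Dom C f) (Dom C f') xx i1 i2 p1 p2"
    "biproduct C (Cod C f) (Cod C f') ee k1 k2 r1 r2"
    "biproduct C (Cod C g) (Cod C g') zz j1 j2 q1 q2"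
  shows "is_kernel C (Add C (k1 \<cdot> f \<cdot> p1) (k2 \<cdot> f' \<cdot> p2)) (Add C (j1 \<cdot> g \<cdot> r1) (j2 \<cdot> g' \<cdot> r2))"
proof -
  note b = assms(3-5)
  note [simp] = biproductD(1-17)[OF b(1)] biproductD(1-17)[OF b(2)] biproductD(1-17)[OF b(3)]
    biproduct_red[OF b(1)] biproduct_red[OF b(2)] biproduct_red[OF b(3)] kernelD(1-4)[OF assms(1)] kernelD(1-4)[OF assms(2)]
  let ?F = "Add C (k1 \<cdot> f \<cdot> p1) (k2 \<cdot> f' \<cdot> p2)"
  let ?G = "Add C (j1 \<cdot> g \<cdot> r1) (j2 \<cdot> g' \<cdot> r2)"
  have F: "?F \<in> Arr C" "Dom C ?F = xx" "Cod C ?F = ee" "r1 \<cdot> ?F = f \<cdot> p1" "r2 \<cdot> ?F = f' \<cdot> p2"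
    and G: "?G \<in> Arr C" "Dom C ?G = ee" "Cod C ?G = zz" "q1 \<cdot> ?G = g \<cdot> r1" "q2 \<cdot> ?G = g' \<cdot> r2"
    by auto
  note gf = comp_subst[OF kernelD(4)[OF assms(1)]] comp_subst[OF kernelD(4)[OF assms(2)]]
  note s = comp_subst[OF F(4)] comp_subst[OF F(5)] comp_subst[OF G(4)] comp_subst[OF G(5)]
  show ?thesis
  proof (rule kernelI)
    show "is_mono C ?F"
    proof (rule monoI)
      fix x assume x: "x \<in> Arr C" "Cod C x = Dom C ?F" and z: "?F \<cdot> x = Zer C (Dom C x) (Cod C ?F)"
      have "r1 \<cdot> (?F \<cdot> x) = f \<cdot> (p1 \<cdot> x)" "r2 \<cdot> (?F \<cdot> x) = f' \<cdot> (p2 \<cdot> x)"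
        by (subst s; use x F in \<open>simp del: add_comp comp_add\<close>)+
      then have "f \<cdot> (p1 \<cdot> x) = Zer C (Dom C x) (Cod C f)" "f' \<cdot> (p2 \<cdot> x) = Zer C (Dom C x) (Cod C f')"
        unfolding z using x F by auto
      then have "p1 \<cdot> x = Zer C (Dom C x) (Dom C f)" "p2 \<cdot> x = Zer C (Dom C x) (Dom C f')"
        using mono_zer[OF kernelD(5)[OF assms(1)], of "p1 \<cdot> x"] mono_zer[OF kernelD(5)[OF assms(2)], of "p2 \<cdot> x"] x F
        by auto
      then show "x = Zer C (Dom C x) (Dom C ?F)"
        by - (rule biproduct_eqI[OF b(1)], use x F in auto)
    qed (use F in auto)
    show "?G \<cdot> ?F = Zer C (Dom C ?F) (Cod C ?G)"
      by (simp add: gf)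
    fix x assume x: "x \<in> Arr C" "Cod C x = Dom C ?G" and z: "?G \<cdot> x = Zer C (Dom C x) (Cod C ?G)"
    have x' [simp]: "x \<in> Arr C" "Cod C x = ee" using x by simp_all
    have "q1 \<cdot> (?G \<cdot> x) = g \<cdot> (r1 \<cdot> x)" "q2 \<cdot> (?G \<cdot> x) = g' \<cdot> (r2 \<cdot> x)"
      by (subst s; use G in \<open>simp del: add_comp comp_add\<close>)+
    then have z1: "g \<cdot> (r1 \<cdot> x) = Zer C (Dom C x) (Cod C g)" and z2: "g' \<cdot> (r2 \<cdot> x) = Zer C (Dom C x) (Cod C g')"
      unfolding z using G by auto
    obtain y1 where y1: "y1 \<in> Arr C" "Dom C y1 = Dom C (r1 \<cdot> x)" "Cod C y1 = Dom C f" "f \<cdot> y1 = r1 \<cdot> x"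
      by (rule kernel_lift[OF assms(1), of "r1 \<cdot> x"]) (assumption | simp add: z1)+
    obtain y2 where y2: "y2 \<in> Arr C" "Dom C y2 = Dom C (r2 \<cdot> x)" "Cod C y2 = Dom C f'" "f' \<cdot> y2 = r2 \<cdot> x"
      by (rule kernel_lift[OF assms(2), of "r2 \<cdot> x"]) (assumption | simp add: z2)+
    let ?y = "Add C (i1 \<cdot> y1) (i2 \<cdot> y2)"
    note [simp] = y1(1,3) y2(1,3)
    have [simp]: "Dom C y1 = Dom C x" "Dom C y2 = Dom C x"
      using y1(2) y2(2) by auto
    have "?F \<cdot> ?y = x"
      by (rule biproduct_eqI[OF b(2)]) (simp_all add: y1(4) y2(4))
    then show "\<exists>h. h \<in> Arr C \<and> Dom C h = Dom C x \<and> Cod C h = Dom C ?F \<and> ?F \<cdot> h = x"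
      by (intro exI[of _ ?y]) simp
  qed (use F G in auto)
qed

lemma biproduct_sum_ses:
  assumes "short_exact C f g" "short_exact C f' g'"
    "biproduct C (Dom C f) (Dom C f') xx i1 i2 p1 p2"
    "biproduct C (Cod C f) (Cod C f') ee k1 k2 r1 r2"
    "biproduct C (Cod C g) (Cod C g') zz j1 j2 q1 q2"
  shows "short_exact C (Add C (k1 \<cdot> f \<cdot> p1) (k2 \<cdot> f' \<cdot> p2)) (Add C (j1 \<cdot> g \<cdot> r1) (j2 \<cdot> g' \<cdot> r2))"
proof -
  interpret op: abelian_category "op_cat C" by (rule op_abelian)
  note s = sesD[OF assms(1)] sesD[OF assms(2)]
  \<comment> \<open>In the opposite category the triple composites are bracketed the other way;
    these equations reconcile the two forms.\<close>
  have a: "j1 \<cdot> (g \<cdot> r1) = (j1 \<cdot> g) \<cdot> r1" "j2 \<cdot> (g' \<cdot> r2) = (j2 \<cdot> g') \<cdot> r2"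
    "k1 \<cdot> (f \<cdot> p1) = (k1 \<cdot> f) \<cdot> p1" "k2 \<cdot> (f' \<cdot> p2) = (k2 \<cdot> f') \<cdot> p2"
    using s(1-3,9-11) biproductD(1-13)[OF assms(3)] biproductD(1-13)[OF assms(4)] biproductD(1-13)[OF assms(5)] by auto
  have "is_cokernel C (Add C (j1 \<cdot> (g \<cdot> r1)) (j2 \<cdot> (g' \<cdot> r2))) (Add C (k1 \<cdot> (f \<cdot> p1)) (k2 \<cdot> (f' \<cdot> p2)))"
    using op.biproduct_sum_kernel[of g f g' f' zz q1 q2 j1 j2 ee r1 r2 k1 k2 xx p1 p2 i1 i2]
      assms(3-5) s by simp
  then show ?thesis
    unfolding short_exact_def a using biproduct_sum_kernel[OF s(7,15) assms(3-5)] by blast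
qed

end

section \<open>Trivial 2-extensions\<close>

lemma splits2I:
  "\<lbrakk>short_exact C f' q; Dom C f' = Dom C f; Cod C q = Cod C g; i \<in> Arr C; Dom C i = Cod C f;
    Cod C i = Cod C f'; i \<cdot>\<^bsub>C\<^esub> f = f'; q \<cdot>\<^bsub>C\<^esub> i = g\<rbrakk> \<Longrightarrow> splits2 C f g"
  unfolding splits2_def by (intro exI conjI) auto

context abelian_category
begin

lemma extensions2D:
  assumes "(f, g, h) \<in> extensions2 C z x"
  shows "is_kernel C f g" "is_cokernel C h g" "Dom C f = x" "Cod C h = z"
    "f \<in> Arr C" "g \<in> Arr C" "h \<in> Arr C" "Cod C f = Dom C g" "Dom C h = Cod C g"
    "g \<cdot> f = Zer C x (Cod C g)" "h \<cdot> g = Zer C (Dom C g) z" "is_mono C f" "is_epi C h"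
proof -
  show *: "is_kernel C f g" "is_cokernel C h g" "Dom C f = x" "Cod C h = z"
    using assms by (auto simp add: extensions2_def)
  show "f \<in> Arr C" "g \<in> Arr C" "h \<in> Arr C" "Cod C f = Dom C g" "Dom C h = Cod C g"
    "g \<cdot> f = Zer C x (Cod C g)" "h \<cdot> g = Zer C (Dom C g) z" "is_mono C f" "is_epi C h"
    using kernelD[OF *(1)] cokernelD[OF *(2)] *(3,4) by auto
qed

lemma extensions2_op: "(h, g, f) \<in> extensions2 (op_cat C) x z \<longleftrightarrow> (f, g, h) \<in> extensions2 C z x"
  by (auto simp add: extensions2_def)

text \<open>The middle object of the witnessing extension is filtered with subquotients
  \<open>x\<close>, the image of \<open>g\<close>, and \<open>z\<close>. So it is at the same time
  an extension of \<open>z\<close> by \<open>Cod C f\<close>, with arrows \<open>i\<close> and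
  \<open>h \<cdot> q\<close>, and this second extension is the witness for the opposite
  condition.\<close>

lemma splits2_dual:
  assumes "(f, g, h) \<in> extensions2 C z x" "splits2 C f g"
  shows "splits2 (op_cat C) h g"
proof -
  note e [simp] = extensions2D[OF assms(1)]
  obtain f' q i where s: "short_exact C f' q" "Dom C f' = Dom C f" "Cod C q = Cod C g"
    "i \<in> Arr C" "Dom C i = Cod C f" "Cod C i = Cod C f'" "i \<cdot> f = f'" and qi: "q \<cdot> i = g"
    using assms(2) by (auto simp add: splits2_def)
  note [simp] = sesD(1-4)[OF s(1)] s(2-6)
  have "is_mono C i"
  proof (rule monoI)
    fix x assume x: "x \<in> Arr C" "Cod C x = Dom C i" and ix: "i \<cdot> x = Zer C (Dom C x) (Cod C i)"
    have "q \<cdot> (i \<cdot> x) = g \<cdot> x"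
      by (rule comp_subst[OF qi]) (use x in auto)
    then have "g \<cdot> x = Zer C (Dom C x) (Cod C g)"
      unfolding ix using x by simp
    then obtain y where y: "y \<in> Arr C" "Dom C y = Dom C x" "Cod C y = Dom C f" "f \<cdot> y = x"
      by - (rule kernel_lift[OF e(1), of x], (assumption | simp add: x)+)
    have "i \<cdot> (f \<cdot> y) = f' \<cdot> y"
      by (rule comp_subst[OF s(7)]) (use y in auto)
    then have "y = Zer C (Dom C y) (Dom C f')"
      using mono_zer[OF sesD(5)[OF s(1)], of y] y ix by simp
    then have "f \<cdot> y = Zer C (Dom C y) (Cod C f)"
      by (metis y(1,2) e(3,5) s(2) zer_comp arr_simps(1))
    then show "x = Zer C (Dom C x) (Dom C i)"
      using y by simp
  qed simp
  moreover have "is_epi C (h \<cdot> q)"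
  proof (rule epiI)
    fix x assume x: "x \<in> Arr C" "Dom C x = Cod C (h \<cdot> q)" "x \<cdot> (h \<cdot> q) = Zer C (Dom C (h \<cdot> q)) (Cod C x)"
    have "x \<cdot> h = Zer C (Cod C q) (Cod C x)"
      using epi_zer[OF sesD(6)[OF s(1)], of "x \<cdot> h"] x by simp
    then show "x = Zer C (Cod C (h \<cdot> q)) (Cod C x)"
      using epi_zer[OF e(13), of x] x by simp
  qed simp
  then have "is_cokernel C (h \<cdot> q) i"
  proof (rule cokernelI)
    show "h \<cdot> q \<cdot> i = Zer C (Dom C i) (Cod C (h \<cdot> q))"
      by (simp add: qi)
    fix x assume x: "x \<in> Arr C" "Dom C x = Cod C i" and xi: "x \<cdot> i = Zer C (Dom C i) (Cod C x)"
    have "x \<cdot> (i \<cdot> f) = Zer C (Dom C i) (Cod C x) \<cdot> f"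
      by (rule comp_subst[OF xi]) (use x in auto)
    then have "x \<cdot> f' = Zer C (Dom C f') (Cod C x)"
      using x by (simp add: s(7))
    then obtain y where y: "y \<in> Arr C" "Dom C y = Cod C q" "Cod C y = Cod C x" "y \<cdot> q = x"
      by - (rule cokernel_lift[OF sesD(8)[OF s(1)], of x], (assumption | simp add: x)+)
    have "y \<cdot> (q \<cdot> i) = x \<cdot> i"
      by (rule comp_subst[OF y(4)]) (use y in auto)
    then have "y \<cdot> g = Zer C (Dom C g) (Cod C y)"
      using y xi by (simp add: qi)
    then obtain t where t: "t \<in> Arr C" "Dom C t = Cod C h" "Cod C t = Cod C y" "t \<cdot> h = y"
      by - (rule cokernel_lift[OF e(2), of y], (assumption | simp add: y)+)
    have "t \<cdot> (h \<cdot> q) = x"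
      using comp_subst[OF t(4), of q] t y by simp
    then show "\<exists>t. t \<in> Arr C \<and> Dom C t = Cod C (h \<cdot> q) \<and> Cod C t = Cod C x \<and> t \<cdot> (h \<cdot> q) = x"
      using t y by (intro exI[of _ t]) simp
  qed simp_all
  ultimately have "short_exact C i (h \<cdot> q)"
    by (intro ses_monoI)
  then show ?thesis
    by (intro splits2I[of _ "h \<cdot> q" i _ _ q]) (simp_all add: qi)
qed

text \<open>A witness for the target of a morphism of 2-extensions is pulled back along its
  component \<open>b\<close>; the universal property supplies the embedding of
  \<open>Cod C f\<close>.\<close>

lemma splits2_pullback:
  assumes "((f, g, h), (f', g', h')) \<in> ext2_mor C z x" "splits2 C f' g'"
  shows "splits2 C f g"
proof -
  obtain a b where e: "(f, g, h) \<in> extensions2 C z x" "(f', g', h') \<in> extensions2 C z x"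
    and [simp]: "a \<in> Arr C" "Dom C a = Cod C f" "Cod C a = Cod C f'" "b \<in> Arr C" "Dom C b = Cod C g" "Cod C b = Cod C g'"
    and af: "a \<cdot> f = f'" and bg: "b \<cdot> g = g' \<cdot> a"
    using assms(1) by (auto simp add: ext2_mor_def)
  note [simp] = extensions2D(3-11)[OF e(1)] extensions2D(3-11)[OF e(2)]
  obtain p q' i where s: "short_exact C p q'" "Dom C p = Dom C f'" "Cod C q' = Cod C g'"
    "i \<in> Arr C" "Dom C i = Cod C f'" "Cod C i = Cod C p" "i \<cdot> f' = p" and qi: "q' \<cdot> i = g'"
    using assms(2) by (auto simp add: splits2_def)
  note [simp] = sesD(1-4)[OF s(1)] s(2-6)
  show ?thesis
  proof (rule ses_pullback[OF s(1), of b])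
    fix p1 q w assume s1: "short_exact C p1 q" and h: "Dom C p1 = Dom C p" "Cod C q = Dom C b"
      "w \<in> Arr C" "Dom C w = Cod C p1" "Cod C w = Cod C p" and wp: "w \<cdot> p1 = p" and qw: "q' \<cdot> w = b \<cdot> q"
      and U: "\<And>x1 x2. \<lbrakk>x1 \<in> Arr C; x2 \<in> Arr C; Dom C x1 = Dom C x2; Cod C x1 = Cod C p; Cod C x2 = Dom C b;
        q' \<cdot> x1 = b \<cdot> x2\<rbrakk> \<Longrightarrow> \<exists>t. t \<in> Arr C \<and> Dom C t = Dom C x2 \<and> Cod C t = Cod C p1 \<and> w \<cdot> t = x1 \<and> q \<cdot> t = x2"
    note [simp] = h sesD(1-4)[OF s1]
    have "\<exists>t. t \<in> Arr C \<and> Dom C t = Dom C g \<and> Cod C t = Cod C p1 \<and> w \<cdot> t = i \<cdot> a \<and> q \<cdot> t = g"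
      by (rule U) (simp_all add: bg comp_subst[OF qi])
    then obtain t where t: "t \<in> Arr C" "Dom C t = Dom C g" "Cod C t = Cod C p1" "w \<cdot> t = i \<cdot> a" "q \<cdot> t = g"
      by blast
    have "t \<cdot> f = p1"
      by (rule pullback_unique[OF s(1) s1, of w])
        (use t in \<open>simp_all add: wp comp_subst[OF t(4)] comp_subst[OF t(5)] af s(7)\<close>)
    then show "splits2 C f g"
      by (intro splits2I[OF s1, of _ _ t]) (use t in simp_all)
  qed simp_all
qed

lemma ext2_mor_op:
  assumes "((f, g, h), (f', g', h')) \<in> ext2_mor C z x"
  shows "((h', g', f'), (h, g, f)) \<in> ext2_mor (op_cat C) x z"
proof -
  obtain a b where e: "(f, g, h) \<in> extensions2 C z x" "(f', g', h') \<in> extensions2 C z x"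
    and "a \<in> Arr C" "Dom C a = Cod C f" "Cod C a = Cod C f'" "b \<in> Arr C" "Dom C b = Cod C g" "Cod C b = Cod C g'"
    and "a \<cdot> f = f'" and "b \<cdot> g = g' \<cdot> a" "h' \<cdot> b = h"
    using assms by (auto simp add: ext2_mor_def)
  then have h: "b \<in> Hom C (Dom C h) (Dom C h')" "a \<in> Hom C (Dom C g) (Dom C g')"
    "a \<cdot> f = f'" "g' \<cdot> a = b \<cdot> g" "h' \<cdot> b = h"
    using extensions2D(8,9)[OF e(1)] extensions2D(8,9)[OF e(2)] by simp_all
  have "(h', g', f') \<in> extensions2 (op_cat C) x z" "(h, g, f) \<in> extensions2 (op_cat C) x z"
    using e by (simp_all add: extensions2_op)
  with h show ?thesis
    unfolding ext2_mor_def by (simp del: in_Hom) blast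
qed

text \<open>Since triviality is self-dual, the opposite direction along a morphism is the pullback
  argument in \<open>op_cat C\<close>. Both directions are needed because Yoneda equivalence is a
  zigzag.\<close>

lemma splits2_pushout:
  assumes "((f, g, h), (f', g', h')) \<in> ext2_mor C z x" "splits2 C f g"
  shows "splits2 C f' g'"
proof -
  interpret op: abelian_category "op_cat C" by (rule op_abelian)
  have e: "(f, g, h) \<in> extensions2 C z x" "(f', g', h') \<in> extensions2 C z x"
    using assms(1) by (auto simp add: ext2_mor_def)
  have "splits2 (op_cat C) h' g'"
    using op.splits2_pullback[OF ext2_mor_op[OF assms(1)] splits2_dual[OF e(1) assms(2)]] .
  then show ?thesis
    using op.splits2_dual[of h' g' f' x z] e by (simp add: extensions2_op)
qed

lemma splits2_trivial:
  assumes "x \<in> Obj C" "z \<in> Obj C"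
  shows "splits2 C (Ide C x) (Zer C x z)"
proof -
  obtain p i1 i2 p1 p2 where b: "biproduct C x z p i1 i2 p1 p2"
    using ex_biproduct assms by metis
  show ?thesis
    by (rule splits2I[OF biproduct_ses(1)[OF b], of _ _ i1]) (use biproductD[OF b] assms in auto)
qed

text \<open>Invariance of \<open>splits2\<close> along a zigzag, starting from the trivial 2-extension.\<close>

lemma Ext2_zero_splits2:
  assumes "Ext2 C z x = {Ext2_zero C z x}" "(f, g, h) \<in> extensions2 C z x"
  shows "splits2 C f g"
proof -
  let ?t = "(Ide C x, Zer C x z, Ide C z)"
  have "ext2_equiv C z x `` {(f, g, h)} \<in> Ext2 C z x"
    using assms(2) by (auto simp add: Ext2_def intro: quotientI)
  moreover have "(f, g, h) \<in> ext2_equiv C z x `` {(f, g, h)}"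
    by (simp add: ext2_equiv_def)
  ultimately have "(?t, (f, g, h)) \<in> ext2_equiv C z x"
    using assms(1) by (auto simp add: Ext2_zero_def)
  then have "(?t, (f, g, h)) \<in> (ext2_mor C z x \<union> (ext2_mor C z x)\<inverse>)\<^sup>*"
    by (simp add: ext2_equiv_def)
  \<comment> \<open>The case expression lets the induction along the zigzag treat the triple as one
    variable.\<close>
  then have "case (f, g, h) of (f, g, h) \<Rightarrow> splits2 C f g"
  proof (induction rule: rtrancl_induct)
    case base
    show ?case
      using splits2_trivial extensions2D(3-7)[OF assms(2)] by auto
  next
    case (step e e')
    obtain f1 g1 h1 f2 g2 h2 where "e = (f1, g1, h1)" "e' = (f2, g2, h2)"
      by (metis prod_cases3)
    with step show ?case
      using splits2_pullback[of f2 g2 h2 f1 g1 h1 z x] splits2_pushout[of f1 g1 h1 f2 g2 h2 z x] by auto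
  qed
  then show ?thesis by simp
qed

section \<open>Extensions, their classes and Baer sums in the opposite category\<close>

lemma extensions_op: "extensions (op_cat C) z x = (extensions C x z)\<inverse>"
  by (auto simp add: extensions_def)

lemma ext_equiv_op: "((g, f), (g', f')) \<in> ext_equiv (op_cat C) z x \<longleftrightarrow> ((f', g'), (f, g)) \<in> ext_equiv C x z"
proof -
  have "Cod C a = Dom C b" if "(a, b) \<in> extensions C x z" for a b
    using that sesD(3) by (auto simp add: extensions_def)
  then show ?thesis
    by (auto simp add: ext_equiv_def extensions_op)
qed

text \<open>Reversing arrows exchanges the two components of an extension, so a class of extensions,
  being a set of pairs, turns into its converse relation.\<close>

lemma Ext1_op: "Ext1 (op_cat C) z x = converse ` Ext1 C x z"
proof -
  have "ext_equiv (op_cat C) z x `` {(b, a)} = (ext_equiv C x z `` {(a, b)})\<inverse>" for a b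
    using ext_equiv_equiv[of x z] by (auto simp add: ext_equiv_op equiv_def dest: symD)
  then show ?thesis
    unfolding Ext1_def quotient_def extensions_op by (auto 4 4 simp add: image_iff)
qed

lemma Ext1_zero_op: "Ext1_zero (op_cat C) z x = (Ext1_zero C x z)\<inverse>"
  using split_epi_iff_split_mono
  by (auto simp add: Ext1_zero_def extensions_op split_ext_def extensions_def)

lemma ext_pushI:
  "\<lbrakk>(f, g) \<in> \<xi>; Dom C f = Dom C u; (f', g') \<in> extensions C (Cod C g) (Cod C u);
    w \<in> Arr C; Dom C w = Cod C f; Cod C w = Cod C f'; w \<cdot> f = f' \<cdot> u; g' \<cdot> w = g\<rbrakk>
    \<Longrightarrow> (f', g') \<in> ext_push C u \<xi>"
  unfolding ext_push_def by fastforce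

lemma ext_pushE:
  assumes "(f', g') \<in> ext_push C u \<xi>"
  obtains f g w where "(f, g) \<in> \<xi>" "Dom C f = Dom C u" "(f', g') \<in> extensions C (Cod C g) (Cod C u)"
    "w \<in> Arr C" "Dom C w = Cod C f" "Cod C w = Cod C f'" "w \<cdot> f = f' \<cdot> u" "g' \<cdot> w = g"
  using assms unfolding ext_push_def by fastforce

lemma ext_pullI:
  "\<lbrakk>(f, g) \<in> \<xi>; Cod C g = Cod C v; (f', g') \<in> extensions C (Dom C v) (Dom C f);
    w \<in> Arr C; Dom C w = Cod C f'; Cod C w = Cod C f; w \<cdot> f' = f; g \<cdot> w = v \<cdot> g'\<rbrakk>
    \<Longrightarrow> (f', g') \<in> ext_pull C v \<xi>"
  unfolding ext_pull_def by fastforce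

lemma ext_pullE:
  assumes "(f', g') \<in> ext_pull C v \<xi>"
  obtains f g w where "(f, g) \<in> \<xi>" "Cod C g = Cod C v" "(f', g') \<in> extensions C (Dom C v) (Dom C f)"
    "w \<in> Arr C" "Dom C w = Cod C f'" "Cod C w = Cod C f" "w \<cdot> f' = f" "g \<cdot> w = v \<cdot> g'"
  using assms unfolding ext_pull_def by fastforce

lemma extensions_Cod: "(f, g) \<in> extensions C z x \<Longrightarrow> Cod C f = Dom C g"
  using extensionsD(1) sesD(3) by blast

lemma ext_push_op_iff:
  assumes "\<xi> \<subseteq> extensions C z x"
  shows "(g, f) \<in> ext_push (op_cat C) u (\<xi>\<inverse>) \<longleftrightarrow> (f, g) \<in> ext_pull C u \<xi>"
proof
  interpret op: abelian_category "op_cat C" by (rule op_abelian)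
  assume "(g, f) \<in> ext_push (op_cat C) u (\<xi>\<inverse>)"
  then show "(f, g) \<in> ext_pull C u \<xi>"
  proof (rule op.ext_pushE)
    fix g1 f1 w assume h: "(g1, f1) \<in> \<xi>\<inverse>" "Dom (op_cat C) g1 = Dom (op_cat C) u"
      "(g, f) \<in> extensions (op_cat C) (Cod (op_cat C) f1) (Cod (op_cat C) u)"
      "w \<in> Arr (op_cat C)" "Dom (op_cat C) w = Cod (op_cat C) g1" "Cod (op_cat C) w = Cod (op_cat C) g"
      "w \<cdot>\<^bsub>op_cat C\<^esub> g1 = g \<cdot>\<^bsub>op_cat C\<^esub> u" "f \<cdot>\<^bsub>op_cat C\<^esub> w = f1"
    then have "(f1, g1) \<in> \<xi>" "(f, g) \<in> extensions C (Dom C u) (Dom C f1)"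
      by (simp_all add: extensions_op)
    then show ?thesis
      using h assms extensions_Cod by (intro ext_pullI[of f1 g1 _ _ _ _ w]) auto
  qed
next
  interpret op: abelian_category "op_cat C" by (rule op_abelian)
  assume "(f, g) \<in> ext_pull C u \<xi>"
  then show "(g, f) \<in> ext_push (op_cat C) u (\<xi>\<inverse>)"
  proof (rule ext_pullE)
    fix f1 g1 w assume h: "(f1, g1) \<in> \<xi>" "Cod C g1 = Cod C u" "(f, g) \<in> extensions C (Dom C u) (Dom C f1)"
      "w \<in> Arr C" "Dom C w = Cod C f" "Cod C w = Cod C f1" "w \<cdot> f = f1" "g1 \<cdot> w = u \<cdot> g"
    then show ?thesis
      using assms extensions_Cod by (intro op.ext_pushI[of g1 f1 _ _ _ _ w]) (auto simp add: extensions_op)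
  qed
qed

lemma ext_push_op:
  assumes "\<xi> \<subseteq> extensions C z x"
  shows "ext_push (op_cat C) u (\<xi>\<inverse>) = (ext_pull C u \<xi>)\<inverse>"
  using ext_push_op_iff[OF assms] by auto

lemma ext_pull_op:
  assumes "\<xi> \<subseteq> extensions C z x"
  shows "ext_pull (op_cat C) u (\<xi>\<inverse>) = (ext_push C u \<xi>)\<inverse>"
proof -
  interpret op: abelian_category "op_cat C" by (rule op_abelian)
  show ?thesis
    using op.ext_push_op[of "\<xi>\<inverse>" x z u] assms by (auto simp add: extensions_op)
qed

lemma ext_pull_subset: "\<xi> \<subseteq> extensions C z x \<Longrightarrow> ext_pull C u \<xi> \<subseteq> extensions C (Dom C u) x"
  by (auto elim!: ext_pullE) (metis extensionsD(2) subsetD)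

text \<open>Needed for the self-duality of the Baer sum, which is defined as a pullback of a
  pushout. Pulling the original extension back first gives \<open>(f1, g1)\<close>; the universal
  property of the other pullback produces the arrow \<open>t\<close> from it to the given extension,
  and \<open>t\<close> induces \<open>c\<close> on the left ends.\<close>

lemma ext_pull_push_commute:
  assumes "(f0, g0) \<in> extensions C z x" "c \<in> Arr C" "d \<in> Arr C"
    "(f, g) \<in> ext_pull C d (ext_push C c {(f0, g0)})"
  shows "(f, g) \<in> ext_push C c (ext_pull C d {(f0, g0)})"
proof -
  from assms(4) obtain fy gy w' where y: "(fy, gy) \<in> ext_push C c {(f0, g0)}"
    and e: "Cod C gy = Cod C d" "(f, g) \<in> extensions C (Dom C d) (Dom C fy)"
      "w' \<in> Arr C" "Dom C w' = Cod C f" "Cod C w' = Cod C fy" "w' \<cdot> f = fy" "gy \<cdot> w' = d \<cdot> g"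
    by (rule ext_pullE)
  obtain w where c: "Dom C f0 = Dom C c" "(fy, gy) \<in> extensions C (Cod C g0) (Cod C c)"
    "w \<in> Arr C" "Dom C w = Cod C f0" "Cod C w = Cod C fy" "w \<cdot> f0 = fy \<cdot> c" "gy \<cdot> w = g0"
    using y by (rule ext_pushE) auto
  note ey = extensionsD[OF c(2)] note ee = extensionsD[OF e(2)] note e0 = extensionsD[OF assms(1)]
  note [simp] = sesD(1-4)[OF ey(1)] sesD(1-4)[OF ee(1)] sesD(1-4)[OF e0(1)]
  have [simp]: "Cod C gy = Cod C d" "Cod C g0 = Cod C d" "Dom C fy = Cod C c" "Dom C f = Cod C c" "Cod C g = Dom C d"
    "Dom C f0 = Dom C c"
    using e(1) ey ee e0 c(1) by auto
  note [simp] = assms(2,3) e(3-5) c(3-5)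
  obtain f1 g1 v where s1: "short_exact C f1 g1" and [simp]: "Dom C f1 = Dom C f0" "Cod C g1 = Dom C d"
    "v \<in> Arr C" "Dom C v = Cod C f1" "Cod C v = Cod C f0" and vf: "v \<cdot> f1 = f0" and gv: "g0 \<cdot> v = d \<cdot> g1"
    using pullback_ex[OF e0(1), of d] by auto
  note [simp] = sesD(1-4)[OF s1]
  have "\<exists>t. t \<in> Arr C \<and> Dom C t = Dom C g1 \<and> Cod C t = Cod C f \<and> w' \<cdot> t = w \<cdot> v \<and> g \<cdot> t = g1"
    by (rule ext_mor_pullback[OF ey(1) ee(1) e(3-5) _ e(7)])
      (simp_all add: e(6) comp_subst[OF c(7)] gv)
  then obtain t where t [simp]: "t \<in> Arr C" "Dom C t = Dom C g1" "Cod C t = Cod C f" and wt: "w' \<cdot> t = w \<cdot> v" and gt: "g \<cdot> t = g1"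
    by blast
  have tf: "t \<cdot> f1 = f \<cdot> c"
    by (rule pullback_unique[OF ey(1) ee(1) e(3-5), of "t \<cdot> f1" "f \<cdot> c"])
      (simp_all add: comp_subst[OF wt] comp_subst[OF gt] e(6) comp_subst[OF e(6)] comp_subst[OF sesD(4)[OF ee(1)]] vf c(6))
  have "(f1, g1) \<in> ext_pull C d {(f0, g0)}"
    by (rule ext_pullI[of f0 g0 _ _ _ _ v]) (use s1 vf gv in \<open>simp_all add: extensions_def\<close>)
  then show ?thesis
    by (rule ext_pushI[of f1 g1 _ _ _ _ t]) (use e(2) tf gt in simp_all)
qed

lemma baer_sumI:
  assumes "(f, g) \<in> \<xi>" "(f', g') \<in> \<eta>" "biproduct C x x xx i1 i2 p1 p2"
    "biproduct C (Cod C f) (Cod C f') ee k1 k2 r1 r2" "biproduct C z z zz j1 j2 q1 q2"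
    "e \<in> ext_pull C (Add C j1 j2) (ext_push C (Add C p1 p2)
       {(Add C (k1 \<cdot> f \<cdot> p1) (k2 \<cdot> f' \<cdot> p2), Add C (j1 \<cdot> g \<cdot> r1) (j2 \<cdot> g' \<cdot> r2))})"
  shows "e \<in> baer_sum C z x \<xi> \<eta>"
  unfolding baer_sum_def using assms by blast

lemma baer_sumE:
  assumes "e \<in> baer_sum C z x \<xi> \<eta>"
  obtains f g f' g' xx i1 i2 p1 p2 ee k1 k2 r1 r2 zz j1 j2 q1 q2
  where "(f, g) \<in> \<xi>" "(f', g') \<in> \<eta>" "biproduct C x x xx i1 i2 p1 p2"
    "biproduct C (Cod C f) (Cod C f') ee k1 k2 r1 r2" "biproduct C z z zz j1 j2 q1 q2"
    "e \<in> ext_pull C (Add C j1 j2) (ext_push C (Add C p1 p2)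
       {(Add C (k1 \<cdot> f \<cdot> p1) (k2 \<cdot> f' \<cdot> p2), Add C (j1 \<cdot> g \<cdot> r1) (j2 \<cdot> g' \<cdot> r2))})"
  using assms unfolding baer_sum_def by blast

text \<open>Reversing arrows turns a pullback of a pushout into a pushout of a pullback and
  exchanges diagonal and codiagonal; \<open>ext_pull_push_commute\<close> restores the order. The
  converse inclusion is this statement for the opposite category.\<close>

lemma baer_sum_op_subset:
  assumes "\<xi> \<subseteq> extensions C z x" "\<eta> \<subseteq> extensions C z x" "(u, v) \<in> baer_sum C z x \<xi> \<eta>"
  shows "(v, u) \<in> baer_sum (op_cat C) x z (\<xi>\<inverse>) (\<eta>\<inverse>)"
  using assms(3)
proof (rule baer_sumE)
  interpret op: abelian_category "op_cat C" by (rule op_abelian)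
  fix f g f' g' xx i1 i2 p1 p2 ee k1 k2 r1 r2 zz j1 j2 q1 q2
  assume h: "(f, g) \<in> \<xi>" "(f', g') \<in> \<eta>" "biproduct C x x xx i1 i2 p1 p2"
    "biproduct C (Cod C f) (Cod C f') ee k1 k2 r1 r2" "biproduct C z z zz j1 j2 q1 q2"
    and uv: "(u, v) \<in> ext_pull C (Add C j1 j2) (ext_push C (Add C p1 p2)
       {(Add C (k1 \<cdot> f \<cdot> p1) (k2 \<cdot> f' \<cdot> p2), Add C (j1 \<cdot> g \<cdot> r1) (j2 \<cdot> g' \<cdot> r2))})"
  let ?F = "Add C (k1 \<cdot> f \<cdot> p1) (k2 \<cdot> f' \<cdot> p2)" and ?G = "Add C (j1 \<cdot> g \<cdot> r1) (j2 \<cdot> g' \<cdot> r2)"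
  have e: "(f, g) \<in> extensions C z x" "(f', g') \<in> extensions C z x"
    using h assms by auto
  note d = extensionsD[OF e(1)] extensionsD[OF e(2)]
  note b = biproductD(1-13)[OF h(3)] biproductD(1-13)[OF h(4)] biproductD(1-13)[OF h(5)]
  note s = sesD(1-3)[OF d(1)] sesD(1-3)[OF d(4)]
  have FG: "short_exact C ?F ?G"
    by (rule biproduct_sum_ses[OF d(1) d(4)]) (use h d in simp_all)
  have 0: "(?F, ?G) \<in> extensions C zz xx"
    using FG s b d by (simp add: extensions_def)
  have "(u, v) \<in> ext_push C (Add C p1 p2) (ext_pull C (Add C j1 j2) {(?F, ?G)})"
    by (rule ext_pull_push_commute[OF 0]) (use uv b in simp_all)
  then have "(v, u) \<in> (ext_push C (Add C p1 p2) (ext_pull C (Add C j1 j2) {(?F, ?G)}))\<inverse>"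
    by (rule converseI)
  moreover have cv: "{(?F, ?G)}\<inverse> = {(?G, ?F)}"
    by auto
  moreover have "(ext_push C (Add C p1 p2) (ext_pull C (Add C j1 j2) {(?F, ?G)}))\<inverse>
      = ext_pull (op_cat C) (Add C p1 p2) (ext_push (op_cat C) (Add C j1 j2) ({(?F, ?G)}\<inverse>))"
    using 0 ext_push_op[of "{(?F, ?G)}"] ext_pull_op[OF ext_pull_subset[of "{(?F, ?G)}"]] by simp
  ultimately have "(v, u) \<in> ext_pull (op_cat C) (Add C p1 p2) (ext_push (op_cat C) (Add C j1 j2) {(?G, ?F)})"
    by (simp only: cv)
  then show ?thesis
    by (intro op.baer_sumI[of g f "\<xi>\<inverse>" g' f' "\<eta>\<inverse>" z zz q1 q2 j1 j2 ee r1 r2 k1 k2 x xx p1 p2 i1 i2])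
      (use h s b d in simp_all)
qed

lemma baer_sum_op:
  assumes "\<xi> \<subseteq> extensions C z x" "\<eta> \<subseteq> extensions C z x"
  shows "baer_sum (op_cat C) x z (\<xi>\<inverse>) (\<eta>\<inverse>) = (baer_sum C z x \<xi> \<eta>)\<inverse>"
proof -
  interpret op: abelian_category "op_cat C" by (rule op_abelian)
  have "(u, v) \<in> baer_sum C z x \<xi> \<eta>" if "(v, u) \<in> baer_sum (op_cat C) x z (\<xi>\<inverse>) (\<eta>\<inverse>)" for u v
    using op.baer_sum_op_subset[OF _ _ that] assms by (simp add: extensions_op)
  then show ?thesis
    using baer_sum_op_subset[OF assms] by auto
qed

end

section \<open>Universal arrows from a subcategory\<close>

text \<open>
  \<open>thru C T p p (Ide C p)\<close> replaces the statement that \<open>p\<close> is a finite direct sum of copies of \<open>T\<close>;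
  unlike the latter, it is visibly invariant under passing to the opposite category.
\<close>

inductive thru :: "('o, 'm) cat \<Rightarrow> 'o \<Rightarrow> 'o \<Rightarrow> 'o \<Rightarrow> 'm \<Rightarrow> bool" for C T p q where
  thru_Zer: "thru C T p q (Zer C p q)"
| thru_Add: "\<lbrakk>thru C T p q h; f \<in> Hom C p T; g \<in> Hom C T q\<rbrakk> \<Longrightarrow> thru C T p q (Add C h (g \<cdot>\<^bsub>C\<^esub> f))"

context abelian_category
begin

lemma epi_comp: "\<lbrakk>is_epi C f; is_epi C g; Cod C f = Dom C g\<rbrakk> \<Longrightarrow> is_epi C (g \<cdot> f)"
proof -
  interpret op: abelian_category "op_cat C" by (rule op_abelian)
  show "\<lbrakk>is_epi C f; is_epi C g; Cod C f = Dom C g\<rbrakk> \<Longrightarrow> is_epi C (g \<cdot> f)"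
    using op.mono_comp[of g f] by simp
qed

lemma epi_cancel: "\<lbrakk>is_epi C (g \<cdot> f); f \<in> Arr C; g \<in> Arr C; Cod C f = Dom C g\<rbrakk> \<Longrightarrow> is_epi C g"
proof -
  interpret op: abelian_category "op_cat C" by (rule op_abelian)
  show "\<lbrakk>is_epi C (g \<cdot> f); f \<in> Arr C; g \<in> Arr C; Cod C f = Dom C g\<rbrakk> \<Longrightarrow> is_epi C g"
    using op.mono_cancel[of f g] by simp
qed

end

lemma (in preadditive_category) thru_arr:
  assumes "thru C T p q h" "p \<in> Obj C" "q \<in> Obj C"
  shows "h \<in> Hom C p q"
  using assms by (induction rule: thru.induct) auto

text \<open>\<open>c a\<close> is the universal arrow to \<open>a\<close> from an object of \<open>Bs\<close>.\<close>

locale perp_resolution = abelian_category A for A :: "('o, 'm) cat" (structure) +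
  fixes Bs P :: "'o set" and c k :: "'o \<Rightarrow> 'm" and T :: 'o
  assumes c_arr: "a \<in> Obj A \<Longrightarrow> c a \<in> Arr A" "a \<in> Obj A \<Longrightarrow> Cod A (c a) = a" "a \<in> Obj A \<Longrightarrow> Dom A (c a) \<in> Bs"
    and c_lift: "\<lbrakk>f \<in> Arr A; Dom A f \<in> Bs\<rbrakk> \<Longrightarrow>
      \<exists>g. g \<in> Arr A \<and> Dom A g = Dom A f \<and> Cod A g = Dom A (c (Cod A f)) \<and> c (Cod A f) \<cdot> g = f"
    and c_unique: "\<lbrakk>a \<in> Obj A; g \<in> Arr A; g' \<in> Arr A; Dom A g = Dom A g'; Dom A g' \<in> Bs; Cod A g = Dom A (c a);
      Cod A g' = Dom A (c a); c a \<cdot> g = c a \<cdot> g'\<rbrakk> \<Longrightarrow> g = g'"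
    and k_ker: "a \<in> Obj A \<Longrightarrow> is_kernel A (k a) (c a)"
    and K_P: "a \<in> Obj A \<Longrightarrow> Dom A (k a) \<in> P"
    and coker_P: "\<lbrakk>a \<in> Obj A; is_cokernel A h (c a)\<rbrakk> \<Longrightarrow> Cod A h \<in> P"
    and Hom_Bs_P: "\<lbrakk>f \<in> Arr A; Dom A f \<in> Bs; Cod A f \<in> P\<rbrakk> \<Longrightarrow> f = Zer A (Dom A f) (Cod A f)"
    and Ext_Bs_P: "\<lbrakk>short_exact A f g; Cod A g \<in> Bs; Dom A f \<in> P\<rbrakk> \<Longrightarrow> split_epi A g"
    and P_obj: "P \<subseteq> Obj A"
    and P_ext: "\<lbrakk>short_exact A f g; Dom A f \<in> P; Cod A g \<in> P\<rbrakk> \<Longrightarrow> Cod A f \<in> P"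
    and Ext2_P: "\<lbrakk>p \<in> P; q \<in> P; (f, g, h) \<in> extensions2 A p q\<rbrakk> \<Longrightarrow> splits2 A f g"
    and T_P: "T \<in> P"
    and T_thru: "p \<in> P \<Longrightarrow> thru A T p p (Ide A p)"
    and T_nonzero: "Ide A T \<noteq> Zer A T T"
    and T_division: "\<lbrakk>t \<in> Hom A T T; t \<noteq> Zer A T T\<rbrakk> \<Longrightarrow>
      \<exists>t' \<in> Hom A T T. t' \<cdot> t = Ide A T \<and> t \<cdot> t' = Ide A T"
begin

abbreviation X :: "'o \<Rightarrow> 'o" where "X a \<equiv> Dom A (c a)"
abbreviation K :: "'o \<Rightarrow> 'o" where "K a \<equiv> Dom A (k a)"

lemma k_arr:
  assumes "a \<in> Obj A"
  shows "k a \<in> Arr A" "Cod A (k a) = X a" "c a \<cdot> k a = Zer A (K a) a" "is_mono A (k a)"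
  using kernelD[OF k_ker[OF assms]] c_arr assms by auto

lemma T_obj [simp]: "T \<in> Obj A"
  using T_P P_obj by auto

lemma X_obj [simp]: "a \<in> Obj A \<Longrightarrow> X a \<in> Obj A"
  using c_arr by auto

lemma K_obj [simp]: "a \<in> Obj A \<Longrightarrow> K a \<in> Obj A"
  using k_arr by auto

text \<open>Compose \<open>f\<close> with the identity of its source, which is a finite sum of
  arrows through \<open>T\<close>; each summand is killed.\<close>

lemma zero_by_T_sources:
  assumes "f \<in> Arr A" "Dom A f \<in> P" "\<And>g. g \<in> Hom A T (Dom A f) \<Longrightarrow> f \<cdot> g = Zer A T (Cod A f)"
  shows "f = Zer A (Dom A f) (Cod A f)"
proof -
  have p: "Dom A f \<in> Obj A" using assms P_obj by auto
  have "h \<in> Hom A (Dom A f) (Dom A f) \<and> f \<cdot> h = Zer A (Dom A f) (Cod A f)" if "thru A T (Dom A f) (Dom A f) h" for h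
    using that
  proof (induction rule: thru.induct)
    case (thru_Add h u g)
    then have "f \<cdot> (g \<cdot> u) = Zer A T (Cod A f) \<cdot> u"
      by (intro comp_subst[OF assms(3)]) (use assms in auto)
    then show ?case
      using thru_Add assms(1) by auto
  qed (use p assms(1) in auto)
  from this[OF T_thru[OF assms(2)]] assms(1) show ?thesis by simp
qed

lemma zero_by_T_targets:
  assumes "f \<in> Arr A" "Cod A f \<in> P" "\<And>g. g \<in> Hom A (Cod A f) T \<Longrightarrow> g \<cdot> f = Zer A (Dom A f) T"
  shows "f = Zer A (Dom A f) (Cod A f)"
proof -
  have p: "Cod A f \<in> Obj A" using assms P_obj by auto
  have "h \<in> Hom A (Cod A f) (Cod A f) \<and> h \<cdot> f = Zer A (Dom A f) (Cod A f)" if "thru A T (Cod A f) (Cod A f) h" for h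
    using that
  proof (induction rule: thru.induct)
    case (thru_Add h u g)
    then show ?case
      using assms(1) assms(3)[of u] by auto
  qed (use p assms(1) in auto)
  from this[OF T_thru[OF assms(2)]] assms(1) show ?thesis by simp
qed

text \<open>Arrows to \<open>T\<close> detect nonzero arrows into objects of \<open>P\<close>, so
  some composite is a nonzero endomorphism of \<open>T\<close>, which is invertible. This is the
  semisimplicity of \<open>P\<close> in the form used below.\<close>

lemma from_T_split:
  assumes "f \<in> Arr A" "Dom A f = T" "Cod A f \<in> P" "f \<noteq> Zer A T (Cod A f)"
  obtains r where "r \<in> Arr A" "Dom A r = Cod A f" "Cod A r = T" "r \<cdot> f = Ide A T"
proof -
  obtain g where g: "g \<in> Hom A (Cod A f) T" "g \<cdot> f \<noteq> Zer A T T"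
    using zero_by_T_targets[OF assms(1,3)] assms(2,4) by auto
  moreover have "g \<cdot> f \<in> Hom A T T" using g assms by auto
  ultimately obtain t where "t \<in> Hom A T T" "t \<cdot> (g \<cdot> f) = Ide A T"
    using T_division by blast
  then show ?thesis
    using g assms by (intro that[of "t \<cdot> g"]) auto
qed

lemma to_T_split:
  assumes "f \<in> Arr A" "Cod A f = T" "Dom A f \<in> P" "f \<noteq> Zer A (Dom A f) T"
  obtains s where "s \<in> Arr A" "Dom A s = T" "Cod A s = Dom A f" "f \<cdot> s = Ide A T"
proof -
  obtain g where g: "g \<in> Hom A T (Dom A f)" "f \<cdot> g \<noteq> Zer A T T"
    using zero_by_T_sources[OF assms(1,3)] assms(2,4) by auto
  moreover have "f \<cdot> g \<in> Hom A T T" using g assms by auto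
  ultimately obtain t where "t \<in> Hom A T T" "(f \<cdot> g) \<cdot> t = Ide A T"
    using T_division by blast
  then show ?thesis
    using g assms by (intro that[of "g \<cdot> t"]) auto
qed

section \<open>The functors X and K on arrows\<close>

definition Xm :: "'m \<Rightarrow> 'm" where
  "Xm h = (SOME g. g \<in> Hom A (X (Dom A h)) (X (Cod A h)) \<and> c (Cod A h) \<cdot> g = h \<cdot> c (Dom A h))"

definition Km :: "'m \<Rightarrow> 'm" where
  "Km h = (SOME u. u \<in> Hom A (K (Dom A h)) (K (Cod A h)) \<and> k (Cod A h) \<cdot> u = Xm h \<cdot> k (Dom A h))"

lemma Xm:
  assumes "h \<in> Arr A"
  shows "Xm h \<in> Arr A" "Dom A (Xm h) = X (Dom A h)" "Cod A (Xm h) = X (Cod A h)"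
    "c (Cod A h) \<cdot> Xm h = h \<cdot> c (Dom A h)"
proof -
  have "h \<cdot> c (Dom A h) \<in> Arr A" "Dom A (h \<cdot> c (Dom A h)) \<in> Bs" "Cod A (h \<cdot> c (Dom A h)) = Cod A h"
    "Dom A (h \<cdot> c (Dom A h)) = X (Dom A h)"
    using assms c_arr by auto
  then have "\<exists>g. g \<in> Hom A (X (Dom A h)) (X (Cod A h)) \<and> c (Cod A h) \<cdot> g = h \<cdot> c (Dom A h)"
    using c_lift[of "h \<cdot> c (Dom A h)"] by auto
  from someI_ex[OF this]
  show "Xm h \<in> Arr A" "Dom A (Xm h) = X (Dom A h)" "Cod A (Xm h) = X (Cod A h)"
    "c (Cod A h) \<cdot> Xm h = h \<cdot> c (Dom A h)"
    unfolding Xm_def by auto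
qed

lemma Km:
  assumes "h \<in> Arr A"
  shows "Km h \<in> Arr A" "Dom A (Km h) = K (Dom A h)" "Cod A (Km h) = K (Cod A h)"
    "k (Cod A h) \<cdot> Km h = Xm h \<cdot> k (Dom A h)"
proof -
  have d: "Dom A h \<in> Obj A" "Cod A h \<in> Obj A" using assms by auto
  note [simp] = assms Xm(1-3)[OF assms] k_arr[OF d(1)] k_arr[OF d(2)] c_arr[OF d(1)] c_arr[OF d(2)]
  have "c (Cod A h) \<cdot> (Xm h \<cdot> k (Dom A h)) = Zer A (K (Dom A h)) (Cod A h)"
    by (subst comp_subst[OF Xm(4)]) simp_all
  then obtain u where "u \<in> Arr A" "Dom A u = Dom A (Xm h \<cdot> k (Dom A h))" "Cod A u = K (Cod A h)"
    "k (Cod A h) \<cdot> u = Xm h \<cdot> k (Dom A h)"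
    by - (rule kernel_lift[OF k_ker, of "Cod A h" "Xm h \<cdot> k (Dom A h)"], (assumption | simp)+)
  then have "\<exists>u. u \<in> Hom A (K (Dom A h)) (K (Cod A h)) \<and> k (Cod A h) \<cdot> u = Xm h \<cdot> k (Dom A h)"
    by auto
  from someI_ex[OF this]
  show "Km h \<in> Arr A" "Dom A (Km h) = K (Dom A h)" "Cod A (Km h) = K (Cod A h)"
    "k (Cod A h) \<cdot> Km h = Xm h \<cdot> k (Dom A h)"
    unfolding Km_def by auto
qed

text \<open>Lifts along \<open>c\<close> are unique and \<open>k\<close> is mono, so the choices
  made in \<open>Xm\<close> and \<open>Km\<close> were forced. Functoriality and additivity reduce
  to exhibiting some pair of compatible arrows.\<close>

lemma Km_unique:
  assumes "h \<in> Arr A" "x \<in> Arr A" "Dom A x = X (Dom A h)" "Cod A x = X (Cod A h)" "c (Cod A h) \<cdot> x = h \<cdot> c (Dom A h)"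
    "u \<in> Arr A" "Dom A u = K (Dom A h)" "Cod A u = K (Cod A h)" "k (Cod A h) \<cdot> u = x \<cdot> k (Dom A h)"
  shows "u = Km h" "x = Xm h"
proof -
  note Xm [OF assms(1)] Km[OF assms(1)]
  show x: "x = Xm h"
    by (rule c_unique[of "Cod A h"]) (use assms Xm[OF assms(1)] c_arr in auto)
  show "u = Km h"
    by (rule monoD[OF k_arr(4), of "Cod A h"]) (use assms Km[OF assms(1)] x k_arr in auto)
qed

lemma Km_comp:
  assumes "f \<in> Arr A" "g \<in> Arr A" "Cod A f = Dom A g"
  shows "Km (g \<cdot> f) = Km g \<cdot> Km f"
proof (rule Km_unique(1)[symmetric, where x = "Xm g \<cdot> Xm f"])
  have d: "Dom A f \<in> Obj A" "Cod A f \<in> Obj A" "Dom A g \<in> Obj A" "Cod A g \<in> Obj A" using assms by auto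
  note s = Xm(1-3)[OF assms(1)] Xm(1-3)[OF assms(2)] Km(1-3)[OF assms(1)] Km(1-3)[OF assms(2)] assms
    k_arr[OF d(1)] k_arr[OF d(2)] k_arr[OF d(4)] c_arr[OF d(1)] c_arr[OF d(2)] c_arr[OF d(4)]
  show "c (Cod A (g \<cdot> f)) \<cdot> (Xm g \<cdot> Xm f) = g \<cdot> f \<cdot> c (Dom A (g \<cdot> f))"
    using s Xm(4)[OF assms(1)] by (simp add: comp_subst[OF Xm(4)[OF assms(2)]])
  show "k (Cod A (g \<cdot> f)) \<cdot> (Km g \<cdot> Km f) = Xm g \<cdot> Xm f \<cdot> k (Dom A (g \<cdot> f))"
    using s Km(4)[OF assms(1)] by (simp add: comp_subst[OF Km(4)[OF assms(2)]])
qed (use assms Xm(1-3)[OF assms(1)] Xm(1-3)[OF assms(2)] Km(1-3)[OF assms(1)] Km(1-3)[OF assms(2)] in simp_all)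

lemma Km_Add:
  assumes "f \<in> Arr A" "g \<in> Arr A" "Dom A f = Dom A g" "Cod A f = Cod A g"
  shows "Km (Add A f g) = Add A (Km f) (Km g)"
proof (rule Km_unique(1)[symmetric, where x = "Add A (Xm f) (Xm g)"])
  have d: "Dom A g \<in> Obj A" "Cod A g \<in> Obj A" using assms by auto
  note s = Xm(1-3)[OF assms(1)] Xm(1-3)[OF assms(2)] Km(1-3)[OF assms(1)] Km(1-3)[OF assms(2)] assms
    k_arr[OF d(1)] k_arr[OF d(2)] c_arr[OF d(1)] c_arr[OF d(2)]
  show "c (Cod A (Add A f g)) \<cdot> Add A (Xm f) (Xm g) = Add A f g \<cdot> c (Dom A (Add A f g))"
    using s Xm(4)[OF assms(1)] Xm(4)[OF assms(2)] by simp
  show "k (Cod A (Add A f g)) \<cdot> Add A (Km f) (Km g) = Add A (Xm f) (Xm g) \<cdot> k (Dom A (Add A f g))"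
    using s Km(4)[OF assms(1)] Km(4)[OF assms(2)] by simp
qed (use assms Xm(1-3)[OF assms(1)] Xm(1-3)[OF assms(2)] Km(1-3)[OF assms(1)] Km(1-3)[OF assms(2)] in simp_all)

lemma Km_Ide: "a \<in> Obj A \<Longrightarrow> Km (Ide A a) = Ide A (K a)"
  by (rule Km_unique(1)[symmetric, where x = "Ide A (X a)"]) (use c_arr k_arr in simp_all)

lemma Km_Zer: "\<lbrakk>a \<in> Obj A; b \<in> Obj A\<rbrakk> \<Longrightarrow> Km (Zer A a b) = Zer A (K a) (K b)"
  by (rule Km_unique(1)[symmetric, where x = "Zer A (X a) (X b)"]) (use c_arr k_arr in simp_all)

text \<open>\<open>th (f, g) u\<close>: the arrow \<open>c a\<close> lifts along \<open>g\<close>, and \<open>u\<close> is what the lift induces on kernels.\<close>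

definition th :: "'m \<times> 'm \<Rightarrow> 'm \<Rightarrow> bool" where
  "th e u \<longleftrightarrow> (case e of (f, g) \<Rightarrow> u \<in> Hom A (K (Cod A g)) T \<and>
     (\<exists>l \<in> Hom A (X (Cod A g)) (Cod A f). g \<cdot> l = c (Cod A g) \<and> l \<cdot> k (Cod A g) = f \<cdot> u))"

section \<open>Lifting the universal arrow along an extension\<close>

lemma thI:
  assumes "Cod A g = a" "u \<in> Arr A" "Dom A u = K a" "Cod A u = T" "l \<in> Arr A" "Dom A l = X a" "Cod A l = Cod A f"
    "g \<cdot> l = c a" "l \<cdot> k a = f \<cdot> u"
  shows "th (f, g) u"
  using assms unfolding th_def by auto

lemma thE:
  assumes "th (f, g) u" "Cod A g = a"
  obtains l where "u \<in> Arr A" "Dom A u = K a" "Cod A u = T" "l \<in> Arr A" "Dom A l = X a" "Cod A l = Cod A f"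
    "g \<cdot> l = c a" "l \<cdot> k a = f \<cdot> u"
  using assms unfolding th_def by auto

text \<open>Two lifts differ by an arrow from an object of \<open>Bs\<close> to the kernel, which
  lies in \<open>P\<close>; such arrows vanish.\<close>

lemma lift_unique:
  assumes "short_exact A f g" "Dom A f \<in> P" "l \<in> Arr A" "l' \<in> Arr A" "Dom A l = Dom A l'" "Dom A l' \<in> Bs"
    "Cod A l = Dom A g" "Cod A l' = Dom A g" "g \<cdot> l = g \<cdot> l'"
  shows "l = l'"
proof -
  note [simp] = sesD(1-4)[OF assms(1)] assms(3-8)
  let ?z = "Add A l (neg l')"
  have z: "?z \<in> Arr A" "Dom A ?z = Dom A l'" "Cod A ?z = Dom A g" by simp_all
  have g: "g \<cdot> ?z = Zer A (Dom A l') (Cod A g)" by (simp add: assms(9))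
  obtain t where t: "t \<in> Arr A" "Dom A t = Dom A ?z" "Cod A t = Dom A f" "f \<cdot> t = ?z"
    by (rule kernel_lift[OF sesD(7)[OF assms(1)], of ?z]) (assumption | simp add: z g)+
  have "t = Zer A (Dom A l') (Dom A f)"
    using Hom_Bs_P[of t] t z assms(2) by simp
  then have "?z = Zer A (Dom A l') (Dom A g)"
    using t(4) by simp
  then show ?thesis
    by (rule diff_eq_zer) simp_all
qed

text \<open>Pulling the extension back along \<open>c a\<close> gives an extension of an object of
  \<open>Bs\<close> by \<open>T\<close>, which splits. A section followed by the projection
  \<open>w\<close> is the lift; on \<open>K a\<close> it is killed by \<open>g\<close> and therefore
  lands in the kernel \<open>T\<close>.\<close>

lemma th_ex:
  assumes "(f, g) \<in> extensions A a T" "a \<in> Obj A"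
  shows "\<exists>u. th (f, g) u"
proof -
  note e = extensionsD[OF assms(1)]
  note [simp] = sesD(1-4)[OF e(1)] e(2,3) k_arr[OF assms(2)] c_arr[OF assms(2)] assms(2)
  obtain f' g' w where s: "short_exact A f' g'" and h [simp]: "Dom A f' = Dom A f" "Cod A g' = Dom A (c a)"
    "w \<in> Arr A" "Dom A w = Cod A f'" "Cod A w = Cod A f" and gw: "g \<cdot> w = c a \<cdot> g'"
    using pullback_ex[OF e(1), of "c a"] by auto
  note [simp] = sesD(1-4)[OF s]
  have "split_epi A g'"
    by (rule Ext_Bs_P[OF s]) (simp_all add: T_P)
  then obtain r where r [simp]: "r \<in> Arr A" "Dom A r = X a" "Cod A r = Dom A g'" and gr: "g' \<cdot> r = Ide A (X a)"
    by (auto simp add: split_epi_def)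
  let ?l = "w \<cdot> r"
  have gl: "g \<cdot> ?l = c a"
    by (simp add: comp_subst[OF gw] gr)
  have "g \<cdot> (?l \<cdot> k a) = c a \<cdot> k a"
    by (rule comp_subst[OF gl]) simp_all
  then obtain u where "u \<in> Arr A" "Dom A u = Dom A (?l \<cdot> k a)" "Cod A u = Dom A f" "f \<cdot> u = ?l \<cdot> k a"
    by - (rule kernel_lift[OF sesD(7)[OF e(1)], of "?l \<cdot> k a"], (assumption | simp)+)
  then show ?thesis
    using gl by (intro exI[of _ u] thI[of _ a _ ?l]) simp_all
qed

lemma th_unique:
  assumes "(f, g) \<in> extensions A a T" "a \<in> Obj A" "th (f, g) u" "th (f, g) u'"
  shows "u = u'"
proof -
  note e = extensionsD[OF assms(1)]
  note [simp] = sesD(1-4)[OF e(1)] e(2,3) k_arr[OF assms(2)] c_arr[OF assms(2)] assms(2)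
  obtain l where l: "u \<in> Arr A" "Dom A u = K a" "Cod A u = T" "l \<in> Arr A" "Dom A l = X a" "Cod A l = Cod A f"
    "g \<cdot> l = c a" "l \<cdot> k a = f \<cdot> u"
    using assms(3) e(3) by (rule thE)
  obtain l' where l': "u' \<in> Arr A" "Dom A u' = K a" "Cod A u' = T" "l' \<in> Arr A" "Dom A l' = X a" "Cod A l' = Cod A f"
    "g \<cdot> l' = c a" "l' \<cdot> k a = f \<cdot> u'"
    using assms(4) e(3) by (rule thE)
  have "l = l'"
    by (rule lift_unique[OF e(1)]) (use l(4-7) l'(4-7) T_P in simp_all)
  then show ?thesis
    using l l' by (intro monoD[OF sesD(5)[OF e(1)], of u u']) simp_all
qed

text \<open>Both \<open>w \<cdot> l'\<close> and \<open>l \<cdot> Xm v\<close> lift the same arrow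
  along \<open>g\<close>, so they agree by uniqueness of lifts. Restriction to \<open>K b\<close>
  then gives the formula.\<close>

lemma th_pull:
  assumes "(f, g) \<in> extensions A a T" "a \<in> Obj A" "(f', g') \<in> extensions A b T" "v \<in> Arr A" "Dom A v = b" "Cod A v = a"
    "w \<in> Arr A" "Dom A w = Cod A f'" "Cod A w = Cod A f" "w \<cdot> f' = f" "g \<cdot> w = v \<cdot> g'" "th (f, g) u"
  shows "th (f', g') (u \<cdot> Km v)"
proof -
  have b: "b \<in> Obj A" using assms by auto
  note e = extensionsD[OF assms(1)] and e' = extensionsD[OF assms(3)]
  note [simp] = sesD(1-4)[OF e(1)] e(2,3) k_arr[OF assms(2)] c_arr[OF assms(2)] assms(2)
    sesD(1-4)[OF e'(1)] e'(2,3) k_arr[OF b] c_arr[OF b] assms(4-9) b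
    Km(1-3)[OF assms(4)] Xm(1-3)[OF assms(4)]
  obtain l where l: "u \<in> Arr A" "Dom A u = K a" "Cod A u = T" "l \<in> Arr A" "Dom A l = X a" "Cod A l = Cod A f"
    and gl: "g \<cdot> l = c a" and lk: "l \<cdot> k a = f \<cdot> u"
    using assms(12) e(3) by (rule thE)
  obtain u' where u': "th (f', g') u'" using th_ex[OF assms(3) b] by blast
  then obtain l' where l': "u' \<in> Arr A" "Dom A u' = K b" "Cod A u' = T" "l' \<in> Arr A" "Dom A l' = X b" "Cod A l' = Cod A f'"
    and gl': "g' \<cdot> l' = c b" and lk': "l' \<cdot> k b = f' \<cdot> u'"
    using e'(3) by (rule thE)
  note [simp] = l l'
  have wl: "w \<cdot> l' = l \<cdot> Xm v"
    by (rule lift_unique[OF e(1)])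
      (use Xm(4)[OF assms(4)] T_P in \<open>simp_all add: comp_subst[OF assms(11)] comp_subst[OF gl] gl'\<close>)
  have "w \<cdot> (f' \<cdot> u') = l \<cdot> (Xm v \<cdot> k b)"
    unfolding lk'[symmetric] by (simp add: comp_subst[OF wl])
  also have "Xm v \<cdot> k b = k a \<cdot> Km v"
    using Km(4)[OF assms(4)] by simp
  also have "l \<cdot> (k a \<cdot> Km v) = f \<cdot> (u \<cdot> Km v)"
    by (simp add: comp_subst[OF lk])
  finally have "f \<cdot> u' = f \<cdot> (u \<cdot> Km v)"
    by (simp add: comp_subst[OF assms(10)])
  then have "u' = u \<cdot> Km v"
    by - (rule monoD[OF sesD(5)[OF e(1)]], simp_all)
  then show ?thesis
    using u' by simp
qed

lemma th_push:
  assumes "(f, g) \<in> extensions A a T" "a \<in> Obj A" "(f', g') \<in> extensions A a T" "t \<in> Arr A" "Dom A t = T" "Cod A t = T"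
    "w \<in> Arr A" "Dom A w = Cod A f" "Cod A w = Cod A f'" "w \<cdot> f = f' \<cdot> t" "g' \<cdot> w = g" "th (f, g) u"
  shows "th (f', g') (t \<cdot> u)"
proof -
  note e = extensionsD[OF assms(1)] and e' = extensionsD[OF assms(3)]
  note [simp] = sesD(1-4)[OF e(1)] e(2,3) k_arr[OF assms(2)] c_arr[OF assms(2)] assms(2)
    sesD(1-4)[OF e'(1)] e'(2,3) assms(4-9)
  obtain l where l: "u \<in> Arr A" "Dom A u = K a" "Cod A u = T" "l \<in> Arr A" "Dom A l = X a" "Cod A l = Cod A f"
    and gl: "g \<cdot> l = c a" and lk: "l \<cdot> k a = f \<cdot> u"
    using assms(12) e(3) by (rule thE)
  note [simp] = l
  show ?thesis
    by (rule thI[of _ a _ "w \<cdot> l"]) (simp_all add: comp_subst[OF assms(11)] gl lk comp_subst[OF assms(10)])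
qed

lemma th_equiv:
  assumes "((f, g), (f', g')) \<in> ext_equiv A a T" "a \<in> Obj A" "th (f, g) u"
  shows "th (f', g') u"
proof -
  obtain w where e: "(f, g) \<in> extensions A a T" "(f', g') \<in> extensions A a T"
    and w: "w \<in> Arr A" "Dom A w = Cod A f" "Cod A w = Cod A f'" "w \<cdot> f = f'" "g' \<cdot> w = g"
    using assms(1) by (auto simp add: ext_equiv_def)
  have u: "u \<in> Arr A" "Cod A u = T"
    using assms(3) by (auto simp add: th_def)
  have "th (f', g') (Ide A T \<cdot> u)"
    by (rule th_push[OF e(1) assms(2) e(2) _ _ _ w(1-3) _ w(5) assms(3)])
      (use w(4) extensionsD[OF e(2)] sesD(1)[of f' g'] in simp_all)
  then show ?thesis using u by simp
qed

end

section \<open>Bijectivity of the map from Ext to Hom, and its additivity\<close>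

context perp_resolution
begin

text \<open>The image of \<open>c a\<close> cuts the resolution into two short exact sequences:
  \<open>K a\<close> in \<open>X a\<close> with quotient the image, and the image in
  \<open>a\<close> with quotient in \<open>P\<close>. The cokernel of the inclusion of the image is
  the cokernel of \<open>c a\<close> itself.\<close>

lemma c_factor:
  assumes "a \<in> Obj A"
  obtains e m h where "is_cokernel A e (k a)" "is_mono A m" "Dom A m = Cod A e" "Cod A m = a" "m \<cdot> e = c a"
    "is_cokernel A h m" "Cod A h \<in> P"
proof -
  note [simp] = assms k_arr[OF assms] c_arr[OF assms]
  obtain e where e: "is_cokernel A e (k a)"
    using ex_cokernel[of "k a"] by auto
  note [simp] = cokernelD(1-4)[OF e]
  obtain m where m: "is_mono A m" "Dom A m = Cod A e" "Cod A m = Cod A (c a)" "m \<cdot> e = c a"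
    by (rule image_factor[of "c a" "k a" e, OF _ k_ker[OF assms] e]) (assumption | simp)+
  note [simp] = m(2,3) mono_arr[OF m(1)]
  obtain h where h: "is_cokernel A h m"
    using ex_cokernel[of m] by auto
  note [simp] = cokernelD(1-4)[OF h]
  have "is_cokernel A h (c a)"
  proof (rule cokernelI[OF cokernelD(5)[OF h]])
    show "h \<cdot> c a = Zer A (Dom A (c a)) (Cod A h)"
      unfolding m(4)[symmetric] by (subst comp_subst[OF cokernelD(4)[OF h]]) simp_all
    fix x assume x: "x \<in> Arr A" "Dom A x = Cod A (c a)" "x \<cdot> c a = Zer A (Dom A (c a)) (Cod A x)"
    have "x \<cdot> m = Zer A (Cod A e) (Cod A x)"
      using epi_zer[OF cokernelD(5)[OF e], of "x \<cdot> m"] x m(4) by simp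
    then obtain y where "y \<in> Arr A" "Dom A y = Cod A h" "Cod A y = Cod A x" "y \<cdot> h = x"
      by - (rule cokernel_lift[OF h, of x], (assumption | simp add: x(1,2))+)
    then show "\<exists>y. y \<in> Arr A \<and> Dom A y = Cod A h \<and> Cod A y = Cod A x \<and> y \<cdot> h = x" by blast
  qed simp_all
  then have "Cod A h \<in> P"
    by (rule coker_P[OF assms])
  with e m h show ?thesis
    by (intro that[of e m h]) simp_all
qed

text \<open>The obstruction to extending \<open>u\<close> is the 2-extension spliced from the pushout along \<open>u\<close>.\<close>

lemma th_surj:
  assumes "a \<in> Obj A" "u \<in> Arr A" "Dom A u = K a" "Cod A u = T"
  shows "\<exists>e \<in> extensions A a T. th e u"
proof (rule c_factor[OF assms(1)])
  fix e m h assume e: "is_cokernel A e (k a)" and m: "is_mono A m" "Dom A m = Cod A e" "Cod A m = a" "m \<cdot> e = c a"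
    and h: "is_cokernel A h m" and hP: "Cod A h \<in> P"
  note [simp] = assms k_arr[OF assms(1)] c_arr[OF assms(1)] cokernelD(1-4)[OF e] cokernelD(1-4)[OF h]
    m(2,3) mono_arr[OF m(1)]
  have ke: "short_exact A (k a) e"
    by (rule ses_monoI[OF _ e]) simp
  \<comment> \<open>Pushing out along \<open>u\<close> realises the required value on
    \<open>K a\<close>, but only by an extension of the image of \<open>c a\<close>.\<close>
  obtain f1 g1 w where s: "short_exact A f1 g1" and f1 [simp]: "Dom A f1 = T" "Cod A g1 = Cod A e"
    "w \<in> Arr A" "Dom A w = Cod A (k a)" "Cod A w = Cod A f1" and wk: "w \<cdot> k a = f1 \<cdot> u" and gw: "g1 \<cdot> w = e"
    using pushout_ex[OF ke, of u] by auto
  note [simp] = sesD(1-4)[OF s]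
  have ker: "is_kernel A f1 (m \<cdot> g1)"
  proof (rule kernelI[OF sesD(5)[OF s]])
    fix x assume x: "x \<in> Arr A" "Cod A x = Dom A (m \<cdot> g1)" "m \<cdot> g1 \<cdot> x = Zer A (Dom A x) (Cod A (m \<cdot> g1))"
    have "g1 \<cdot> x = Zer A (Dom A x) (Cod A g1)"
      using mono_zer[OF m(1), of "g1 \<cdot> x"] x by simp
    then obtain y where "y \<in> Arr A" "Dom A y = Dom A x" "Cod A y = Dom A f1" "f1 \<cdot> y = x"
      using x by - (rule kernel_lift[OF sesD(7)[OF s], of x], (assumption | simp)+)
    then show "\<exists>h. h \<in> Arr A \<and> Dom A h = Dom A x \<and> Cod A h = Dom A f1 \<and> f1 \<cdot> h = x" by blast
  qed simp_all
  have coker: "is_cokernel A h (m \<cdot> g1)"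
  proof (rule cokernelI[OF cokernelD(5)[OF h]])
    show "h \<cdot> (m \<cdot> g1) = Zer A (Dom A (m \<cdot> g1)) (Cod A h)"
      by (subst comp_subst[OF cokernelD(4)[OF h]]) simp_all
    fix x assume x: "x \<in> Arr A" "Dom A x = Cod A (m \<cdot> g1)" "x \<cdot> (m \<cdot> g1) = Zer A (Dom A (m \<cdot> g1)) (Cod A x)"
    have "x \<cdot> m = Zer A (Cod A e) (Cod A x)"
      using epi_zer[OF sesD(6)[OF s], of "x \<cdot> m"] x by simp
    then obtain y where "y \<in> Arr A" "Dom A y = Cod A h" "Cod A y = Cod A x" "y \<cdot> h = x"
      using x by - (rule cokernel_lift[OF h, of x], (assumption | simp)+)
    then show "\<exists>y. y \<in> Arr A \<and> Dom A y = Cod A h \<and> Cod A y = Cod A x \<and> y \<cdot> h = x" by blast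
  qed simp_all
  have "(f1, m \<cdot> g1, h) \<in> extensions2 A (Cod A h) T"
    using ker coker by (simp add: extensions2_def)
  \<comment> \<open>Both ends of the spliced 2-extension lie in \<open>P\<close>. Its triviality
    prolongs the pushout to an extension of all of \<open>a\<close>, in which
    \<open>i \<cdot> w\<close> lifts \<open>c a\<close> and induces \<open>u\<close>.\<close>
  from Ext2_P[OF hP T_P this]
  obtain f' q i where s': "short_exact A f' q" and i [simp]: "Dom A f' = T" "Cod A q = a" "i \<in> Arr A"
    "Dom A i = Dom A g1" "Cod A i = Cod A f'" and fi: "i \<cdot> f1 = f'" and qi: "q \<cdot> i = m \<cdot> g1"
    by (auto simp add: splits2_def)
  note [simp] = sesD(1-4)[OF s']
  have "th (f', q) u"
    by (rule thI[of _ a _ "i \<cdot> w"]) (simp_all add: comp_subst[OF qi] gw m(4) wk comp_subst[OF fi])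
  then show ?thesis
    using s' by (intro bexI[of _ "(f', q)"]) (simp_all add: extensions_def)
qed

text \<open>A lift that vanishes on \<open>K a\<close> descends to an arrow \<open>s\<close> from
  the image of \<open>c a\<close>, lying over its inclusion in \<open>a\<close>. Dividing the middle
  object by this copy of the image leaves an extension of the cokernel of \<open>c a\<close> by
  \<open>T\<close>. Both ends are in \<open>P\<close>, so the quotient is in \<open>P\<close>, where
  the nonzero arrow \<open>p \<cdot> f\<close> from \<open>T\<close> splits. Its retraction,
  composed with \<open>p\<close>, retracts \<open>f\<close>.\<close>

lemma th_zero_split:
  assumes "(f, g) \<in> extensions A a T" "a \<in> Obj A" "l \<in> Arr A" "Dom A l = X a" "Cod A l = Dom A g"
    "g \<cdot> l = c a" "l \<cdot> k a = Zer A (K a) (Dom A g)"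
  shows "split_epi A g"
proof (rule c_factor[OF assms(2)])
  fix e m h assume e: "is_cokernel A e (k a)" and m: "is_mono A m" "Dom A m = Cod A e" "Cod A m = a" "m \<cdot> e = c a"
    and h: "is_cokernel A h m" and hP: "Cod A h \<in> P"
  note E = extensionsD[OF assms(1)]
  note [simp] = assms(2-5) k_arr[OF assms(2)] c_arr[OF assms(2)] cokernelD(1-4)[OF e] cokernelD(1-4)[OF h]
    m(2,3) mono_arr[OF m(1)] sesD(1-4)[OF E(1)] E(2,3)
  obtain s where s: "s \<in> Arr A" "Dom A s = Cod A e" "Cod A s = Cod A l" "s \<cdot> e = l"
    using assms(7) by - (rule cokernel_lift[OF e, of l], (assumption | simp)+)
  note [simp] = s(1-3)
  have gs: "g \<cdot> s = m"
    by (rule epiD[OF cokernelD(5)[OF e]]) (simp_all add: s(4) m(4) assms(6))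
  have ms: "is_mono A s"
    by (rule mono_cancel[of g]) (use gs m(1) in simp_all)
  obtain p where p: "is_cokernel A p s"
    using ex_cokernel[of s] by auto
  note [simp] = cokernelD(1-4)[OF p]
  have sp: "is_kernel A s p"
    by (rule kernel_of_cokernel[OF ms p])
  obtain v where v: "v \<in> Arr A" "Dom A v = Cod A p" "Cod A v = Cod A (h \<cdot> g)" "v \<cdot> p = h \<cdot> g"
    by (rule cokernel_lift[OF p, of "h \<cdot> g"]) (assumption | simp add: gs)+
  have [simp]: "v \<in> Arr A" "Dom A v = Cod A p" "Cod A v = Cod A h" using v by simp_all
  have "is_epi A (h \<cdot> g)"
    by (rule epi_comp) (use sesD(6)[OF E(1)] cokernelD(5)[OF h] in simp_all)
  then have ve: "is_epi A v"
    by - (rule epi_cancel[of v p], simp_all add: v(4))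
  have mono: "is_mono A (p \<cdot> f)"
  proof (rule monoI)
    fix y assume y: "y \<in> Arr A" "Cod A y = Dom A (p \<cdot> f)" "p \<cdot> f \<cdot> y = Zer A (Dom A y) (Cod A (p \<cdot> f))"
    then obtain z where z: "z \<in> Arr A" "Dom A z = Dom A (f \<cdot> y)" "Cod A z = Dom A s" "s \<cdot> z = f \<cdot> y"
      by - (rule kernel_lift[OF sp, of "f \<cdot> y"], (assumption | simp)+)
    have "m \<cdot> z = g \<cdot> (s \<cdot> z)"
      by (rule comp_subst[OF gs, symmetric]) (use z y in simp_all)
    also have "\<dots> = Zer A (Dom A y) a"
      unfolding z(4) by (subst comp_subst[OF sesD(4)[OF E(1)]]) (use y in simp_all)
    finally have "z = Zer A (Dom A y) (Dom A m)"
      using mono_zer[OF m(1), of z] z y by simp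
    then have "f \<cdot> y = Zer A (Dom A y) (Dom A g)"
      using z(4) y by simp
    then show "y = Zer A (Dom A y) (Dom A (p \<cdot> f))"
      using mono_zer[OF sesD(5)[OF E(1)], of y] y by simp
  qed simp
  have "is_cokernel A v (p \<cdot> f)"
  proof (rule cokernelI[OF ve])
    show "v \<cdot> (p \<cdot> f) = Zer A (Dom A (p \<cdot> f)) (Cod A v)"
      by (simp add: comp_subst[OF v(4)])
    fix x assume x: "x \<in> Arr A" "Dom A x = Cod A (p \<cdot> f)" "x \<cdot> (p \<cdot> f) = Zer A (Dom A (p \<cdot> f)) (Cod A x)"
    then obtain y where y: "y \<in> Arr A" "Dom A y = Cod A g" "Cod A y = Cod A (x \<cdot> p)" "y \<cdot> g = x \<cdot> p"
      by - (rule cokernel_lift[OF sesD(8)[OF E(1)], of "x \<cdot> p"], (assumption | simp)+)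
    have "y \<cdot> (g \<cdot> s) = (x \<cdot> p) \<cdot> s"
      by (rule comp_subst[OF y(4)]) (use x y in simp_all)
    then have "y \<cdot> m = Zer A (Dom A m) (Cod A y)"
      using x y by (simp add: gs)
    then obtain z where z: "z \<in> Arr A" "Dom A z = Cod A h" "Cod A z = Cod A y" "z \<cdot> h = y"
      using y x by - (rule cokernel_lift[OF h, of y], (assumption | simp)+)
    have "(z \<cdot> v) \<cdot> p = x \<cdot> p"
      using comp_subst[OF z(4), of g] z v y x by simp
    then have "z \<cdot> v = x"
      by (rule epiD[OF cokernelD(5)[OF p]]) (use x y z in simp_all)
    then show "\<exists>z. z \<in> Arr A \<and> Dom A z = Cod A v \<and> Cod A z = Cod A x \<and> z \<cdot> v = x"
      using z y x by (intro exI[of _ z]) simp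
  qed simp_all
  with mono have "short_exact A (p \<cdot> f) v"
    by (rule ses_monoI)
  then have "Cod A (p \<cdot> f) \<in> P"
    by (rule P_ext) (simp_all add: hP T_P)
  moreover have "p \<cdot> f \<noteq> Zer A T (Cod A (p \<cdot> f))"
    using mono_zer[OF mono, of "Ide A T"] T_nonzero by auto
  ultimately obtain r where r: "r \<in> Arr A" "Dom A r = Cod A (p \<cdot> f)" "Cod A r = T" "r \<cdot> (p \<cdot> f) = Ide A T"
    by - (rule from_T_split[of "p \<cdot> f"], (assumption | simp)+)
  then have "split_mono A f"
    by (auto simp add: split_mono_def intro!: bexI[of _ "r \<cdot> p"])
  then show "split_epi A g"
    using split_epi_iff_split_mono[OF E(1)] by simp
qed

text \<open>The Baer difference of the two extensions splits by \<open>th_zero_split\<close>.\<close>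

lemma th_inj:
  assumes "(f, g) \<in> extensions A a T" "(f', g') \<in> extensions A a T" "a \<in> Obj A" "th (f, g) u" "th (f', g') u"
  shows "((f, g), (f', g')) \<in> ext_equiv A a T"
proof -
  note E = extensionsD[OF assms(1)] and E' = extensionsD[OF assms(2)]
  note [simp] = assms(3) k_arr[OF assms(3)] c_arr[OF assms(3)] sesD(1-4)[OF E(1)] E(2,3) sesD(1-4)[OF E'(1)] E'(2,3)
  obtain l where l: "u \<in> Arr A" "Dom A u = K a" "Cod A u = T" "l \<in> Arr A" "Dom A l = X a" "Cod A l = Cod A f"
    and gl: "g \<cdot> l = c a" and lk: "l \<cdot> k a = f \<cdot> u"
    using assms(4) E(3) by (rule thE)
  obtain l' where l': "l' \<in> Arr A" "Dom A l' = X a" "Cod A l' = Cod A f'"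
    and gl': "g' \<cdot> l' = c a" and lk': "l' \<cdot> k a = f' \<cdot> u"
    using assms(5) E'(3) by (rule thE)
  note [simp] = l l'
  show ?thesis
  proof (rule ses_pullback[OF E'(1), of g])
    fix i2 p1 p2 assume s: "short_exact A i2 p1" and h [simp]: "Dom A i2 = Dom A f'" "Cod A p1 = Dom A g"
      "p2 \<in> Arr A" "Dom A p2 = Cod A i2" "Cod A p2 = Cod A f'" and p2i2: "p2 \<cdot> i2 = f'" and gp: "g' \<cdot> p2 = g \<cdot> p1"
      and U: "\<And>x1 x2. \<lbrakk>x1 \<in> Arr A; x2 \<in> Arr A; Dom A x1 = Dom A x2; Cod A x1 = Cod A f'; Cod A x2 = Dom A g;
        g' \<cdot> x1 = g \<cdot> x2\<rbrakk> \<Longrightarrow> \<exists>t. t \<in> Arr A \<and> Dom A t = Dom A x2 \<and> Cod A t = Cod A i2 \<and> p2 \<cdot> t = x1 \<and> p1 \<cdot> t = x2"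
    note [simp] = sesD(1-4)[OF s]
    have p1i2: "p1 \<cdot> i2 = Zer A T (Cod A f)" by simp
    obtain i1 where i1 [simp]: "i1 \<in> Arr A" "Dom A i1 = T" "Cod A i1 = Dom A p1"
      and p2i1: "p2 \<cdot> i1 = Zer A T (Cod A f')" and p1i1: "p1 \<cdot> i1 = f"
      using U[of "Zer A T (Cod A f')" f] by (simp, blast)
    obtain y where y [simp]: "y \<in> Arr A" "Dom A y = X a" "Cod A y = Dom A p1" and p2y: "p2 \<cdot> y = l'" and p1y: "p1 \<cdot> y = l"
      using U[of l' l] by (simp add: gl gl', blast)
    \<comment> \<open>\<open>d\<close> embeds \<open>T\<close> diagonally into the fibre product of
      the two middle objects, with components \<open>f\<close> and \<open>f'\<close>. The cokernel
      of \<open>d\<close> carries the Baer difference, whose kernel is the image of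
      \<open>i1\<close>.\<close>
    define d where "d = Add A i1 i2"
    have d [simp]: "d \<in> Arr A" "Dom A d = T" "Cod A d = Dom A p1"
      by (simp_all add: d_def)
    have p2d: "p2 \<cdot> d = f'" and p1d: "p1 \<cdot> d = f"
      by (simp_all add: d_def p2i2 p1i2 p2i1 p1i1)
    have dm: "is_mono A d"
      by (rule mono_cancel[of p2]) (use p2d sesD(5)[OF E'(1)] in simp_all)
    obtain q where q: "is_cokernel A q d"
      using ex_cokernel[of d] by auto
    note [simp] = cokernelD(1-4)[OF q]
    have dk: "is_kernel A d q"
      by (rule kernel_of_cokernel[OF dm q])
    obtain v where v: "v \<in> Arr A" "Dom A v = Cod A q" "Cod A v = Cod A (g \<cdot> p1)" and vq: "v \<cdot> q = g \<cdot> p1"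
      by (rule cokernel_lift[OF q, of "g \<cdot> p1"]) (assumption | simp add: p1d)+
    have [simp]: "v \<in> Arr A" "Dom A v = Cod A q" "Cod A v = a" using v by simp_all
    have qi: "Add A (q \<cdot> i1) (q \<cdot> i2) = Zer A T (Cod A q)"
      using cokernelD(4)[OF q] by (simp add: d_def)
    have mono: "is_mono A (q \<cdot> i1)"
    proof (rule monoI)
      fix x assume x: "x \<in> Arr A" "Cod A x = Dom A (q \<cdot> i1)" "q \<cdot> i1 \<cdot> x = Zer A (Dom A x) (Cod A (q \<cdot> i1))"
      then obtain z where z: "z \<in> Arr A" "Dom A z = Dom A (i1 \<cdot> x)" "Cod A z = Dom A d" "d \<cdot> z = i1 \<cdot> x"
        by - (rule kernel_lift[OF dk, of "i1 \<cdot> x"], (assumption | simp)+)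
      have "f' \<cdot> z = p2 \<cdot> (d \<cdot> z)"
        by (rule comp_subst[OF p2d, symmetric]) (use z x in simp_all)
      also have "\<dots> = Zer A (Dom A x) (Cod A f')"
        unfolding z(4) by (subst comp_subst[OF p2i1]) (use x in simp_all)
      finally have "z = Zer A (Dom A x) T"
        using mono_zer[OF sesD(5)[OF E'(1)], of z] z x by simp
      then have "i1 \<cdot> x = Zer A (Dom A x) (Dom A p1)"
        using z(4) x by simp
      then have "p1 \<cdot> (i1 \<cdot> x) = Zer A (Dom A x) (Dom A g)"
        using x by simp
      then have "f \<cdot> x = Zer A (Dom A x) (Dom A g)"
        by (subst (asm) comp_subst[OF p1i1]) (use x in simp_all)
      then show "x = Zer A (Dom A x) (Dom A (q \<cdot> i1))"
        using mono_zer[OF sesD(5)[OF E(1)], of x] x by simp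
    qed simp
    have ve: "is_epi A v"
    proof (rule epi_cancel[of v q])
      show "is_epi A (v \<cdot> q)"
        unfolding vq by (rule epi_comp) (use sesD(6)[OF s] sesD(6)[OF E(1)] in simp_all)
    qed simp_all
    have "is_cokernel A v (q \<cdot> i1)"
    proof (rule cokernelI[OF ve])
      show "v \<cdot> (q \<cdot> i1) = Zer A (Dom A (q \<cdot> i1)) (Cod A v)"
        by (simp add: comp_subst[OF vq] p1i1)
      fix x assume x: "x \<in> Arr A" "Dom A x = Cod A (q \<cdot> i1)" and xz: "x \<cdot> (q \<cdot> i1) = Zer A (Dom A (q \<cdot> i1)) (Cod A x)"
      have "x \<cdot> Add A (q \<cdot> i1) (q \<cdot> i2) = Zer A T (Cod A x)"
        unfolding qi using x by simp
      then have xz2: "x \<cdot> (q \<cdot> i2) = Zer A T (Cod A x)"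
        using x xz by simp
      then obtain y1 where y1: "y1 \<in> Arr A" "Dom A y1 = Cod A p1" "Cod A y1 = Cod A (x \<cdot> q)" "y1 \<cdot> p1 = x \<cdot> q"
        using x by - (rule cokernel_lift[OF sesD(8)[OF s], of "x \<cdot> q"], (assumption | simp)+)
      have "y1 \<cdot> (p1 \<cdot> i1) = (x \<cdot> q) \<cdot> i1"
        by (rule comp_subst[OF y1(4)]) (use y1 x in simp_all)
      then have "y1 \<cdot> f = Zer A (Dom A f) (Cod A y1)"
        using y1 x xz by (simp add: p1i1)
      then obtain y2 where y2: "y2 \<in> Arr A" "Dom A y2 = Cod A g" "Cod A y2 = Cod A y1" "y2 \<cdot> g = y1"
        using y1 by - (rule cokernel_lift[OF sesD(8)[OF E(1)], of y1], (assumption | simp)+)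
      have "(y2 \<cdot> v) \<cdot> q = x \<cdot> q"
        using comp_subst[OF y2(4), of p1] y1 y2 x by (simp add: vq)
      then have "y2 \<cdot> v = x"
        by (rule epiD[OF cokernelD(5)[OF q]]) (use x y1 y2 in simp_all)
      then show "\<exists>z. z \<in> Arr A \<and> Dom A z = Cod A v \<and> Cod A z = Cod A x \<and> z \<cdot> v = x"
        using y1 y2 x by (intro exI[of _ y2]) simp
    qed simp_all
    with mono have D: "short_exact A (q \<cdot> i1) v"
      by (rule ses_monoI)
    \<comment> \<open>The joint lift \<open>y\<close> sends \<open>K a\<close> into the diagonal
      because both lifts induce the same \<open>u\<close>. So the lift to the quotient vanishes on
      \<open>K a\<close>, which is the situation of \<open>th_zero_split\<close>.\<close>
    have yk: "y \<cdot> k a = d \<cdot> u"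
      by (rule pullback_unique[OF E'(1) s, of p2])
        (simp_all add: p2i2 comp_subst[OF p2y] comp_subst[OF p1y] comp_subst[OF p2d] comp_subst[OF p1d] lk lk')
    have "split_epi A v"
    proof (rule th_zero_split[where l = "q \<cdot> y"])
      show "(q \<cdot> i1, v) \<in> extensions A a T"
        using D by (simp add: extensions_def)
      show "v \<cdot> (q \<cdot> y) = c a"
        by (simp add: comp_subst[OF vq] p1y gl)
      have "q \<cdot> (d \<cdot> u) = Zer A (K a) (Cod A q)"
        by (subst comp_subst[OF cokernelD(4)[OF q]]) simp_all
      then show "q \<cdot> y \<cdot> k a = Zer A (K a) (Dom A v)"
        by (simp add: yk)
    qed simp_all
    then have "split_mono A (q \<cdot> i1)"
      using split_epi_iff_split_mono[OF D] by simp
    then obtain r where r [simp]: "r \<in> Arr A" "Dom A r = Cod A q" "Cod A r = T" and ri: "r \<cdot> (q \<cdot> i1) = Ide A T"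
      by (auto simp add: split_mono_def)
    have "r \<cdot> Add A (q \<cdot> i1) (q \<cdot> i2) = Zer A T T"
      unfolding qi by simp
    then have "Add A (Ide A T) (r \<cdot> (q \<cdot> i2)) = Zer A T T"
      by (simp add: ri)
    then have ri2: "r \<cdot> (q \<cdot> i2) = neg (Ide A T)"
      by - (rule neg_unique, simp_all)
    \<comment> \<open>The retraction \<open>r \<cdot> q\<close> is the identity on the first copy of
      \<open>T\<close> and its negative on the second. Adding
      \<open>f' \<cdot> (r \<cdot> q)\<close> to \<open>p2\<close> therefore kills
      \<open>i2\<close>, and the sum descends along \<open>p1\<close> to a morphism from the first
      extension to the second.\<close>
    let ?w = "Add A p2 (f' \<cdot> (r \<cdot> q))"
    have "?w \<cdot> i2 = Zer A (Dom A i2) (Cod A ?w)"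
      by (simp add: p2i2 ri2)
    then obtain w where w: "w \<in> Arr A" "Dom A w = Cod A p1" "Cod A w = Cod A ?w" "w \<cdot> p1 = ?w"
      by - (rule cokernel_lift[OF sesD(8)[OF s], of ?w], (assumption | simp)+)
    have "w \<cdot> (p1 \<cdot> i1) = ?w \<cdot> i1"
      by (rule comp_subst[OF w(4)]) (use w in simp_all)
    then have wf: "w \<cdot> f = f'"
      by (simp add: p1i1 p2i1 ri)
    have "g' \<cdot> w = g"
    proof (rule epiD[OF sesD(6)[OF s]])
      have "g' \<cdot> ?w = g \<cdot> p1"
        by (simp add: gp comp_subst[OF sesD(4)[OF E'(1)]])
      then show "(g' \<cdot> w) \<cdot> p1 = g \<cdot> p1"
        using w by simp
    qed (use w in simp_all)
    with wf w show ?thesis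
      using assms(1,2) by (auto simp add: ext_equiv_def intro!: bexI[of _ w])
  qed simp_all
qed

lemma th_split_iff:
  assumes "(f, g) \<in> extensions A a T" "a \<in> Obj A"
  shows "split_epi A g \<longleftrightarrow> th (f, g) (Zer A (K a) T)"
proof
  note E = extensionsD[OF assms(1)]
  note [simp] = assms(2) k_arr[OF assms(2)] c_arr[OF assms(2)] sesD(1-4)[OF E(1)] E(2,3)
  show "th (f, g) (Zer A (K a) T)" if "split_epi A g"
  proof -
    obtain s where [simp]: "s \<in> Arr A" "Dom A s = a" "Cod A s = Dom A g" and gs: "g \<cdot> s = Ide A a"
      using \<open>split_epi A g\<close> by (auto simp add: split_epi_def)
    show ?thesis
      by (rule thI[of _ a _ "s \<cdot> c a"]) (simp_all add: comp_subst[OF gs])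
  qed
  show "split_epi A g" if "th (f, g) (Zer A (K a) T)"
    using that E(3)
  proof (rule thE)
    fix l assume "l \<in> Arr A" "Dom A l = X a" "Cod A l = Cod A f" "g \<cdot> l = c a" "l \<cdot> k a = f \<cdot> Zer A (K a) T"
    then show ?thesis
      by (intro th_zero_split[OF assms, of l]) simp_all
  qed
qed

text \<open>The direct sum of the two lifts, carried over by the pushout arrow \<open>w\<close>, and
  the lift for the Baer sum, carried over by the pullback arrow \<open>w'\<close>, lie over the same
  arrow into \<open>zz\<close>. Uniqueness of lifts identifies them; on \<open>K a\<close> the
  codiagonal adds the two values.\<close>

lemma th_baer_sum:
  assumes "a \<in> Obj A" "\<xi> \<subseteq> extensions A a T" "\<eta> \<subseteq> extensions A a T" "\<And>e. e \<in> \<xi> \<Longrightarrow> th e u" "\<And>e. e \<in> \<eta> \<Longrightarrow> th e u'"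
    "(f0, g0) \<in> baer_sum A a T \<xi> \<eta>"
  shows "th (f0, g0) (Add A u u')"
  using assms(6)
proof (rule baer_sumE)
  fix f g f' g' xx i1 i2 p1 p2 ee k1 k2 r1 r2 zz j1 j2 q1 q2
  assume h: "(f, g) \<in> \<xi>" "(f', g') \<in> \<eta>" "biproduct A T T xx i1 i2 p1 p2"
    "biproduct A (Cod A f) (Cod A f') ee k1 k2 r1 r2" "biproduct A a a zz j1 j2 q1 q2"
    and b: "(f0, g0) \<in> ext_pull A (Add A j1 j2) (ext_push A (Add A p1 p2)
       {(Add A (k1 \<cdot> f \<cdot> p1) (k2 \<cdot> f' \<cdot> p2), Add A (j1 \<cdot> g \<cdot> r1) (j2 \<cdot> g' \<cdot> r2))})"
  let ?F = "Add A (k1 \<cdot> f \<cdot> p1) (k2 \<cdot> f' \<cdot> p2)" and ?G = "Add A (j1 \<cdot> g \<cdot> r1) (j2 \<cdot> g' \<cdot> r2)"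
  have e1: "(f, g) \<in> extensions A a T" and e2: "(f', g') \<in> extensions A a T" using h assms by auto
  note E1 = extensionsD[OF e1] and E2 = extensionsD[OF e2]
  obtain fy gy w' where y: "(fy, gy) \<in> ext_push A (Add A p1 p2) {(?F, ?G)}"
    and p: "Cod A gy = Cod A (Add A j1 j2)" "(f0, g0) \<in> extensions A (Dom A (Add A j1 j2)) (Dom A fy)"
      "w' \<in> Arr A" "Dom A w' = Cod A f0" "Cod A w' = Cod A fy" "w' \<cdot> f0 = fy" "gy \<cdot> w' = Add A j1 j2 \<cdot> g0"
    using b by (rule ext_pullE)
  obtain w where q: "(fy, gy) \<in> extensions A (Cod A ?G) (Cod A (Add A p1 p2))"
    "w \<in> Arr A" "Dom A w = Cod A ?F" "Cod A w = Cod A fy" "w \<cdot> ?F = fy \<cdot> Add A p1 p2" "gy \<cdot> w = ?G"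
    using y by (rule ext_pushE) auto
  note [simp] = biproductD(1-17)[OF h(3)] biproductD(1-17)[OF h(4)] biproductD(1-17)[OF h(5)]
    biproduct_red[OF h(3)] biproduct_red[OF h(4)] biproduct_red[OF h(5)]
    assms(1) k_arr[OF assms(1)] c_arr[OF assms(1)] sesD(1-4)[OF E1(1)] E1(2,3) sesD(1-4)[OF E2(1)] E2(2,3)
  have e3: "(fy, gy) \<in> extensions A zz T" and e0: "(f0, g0) \<in> extensions A a T"
    using q(1) p(2) extensionsD(2)[OF q(1)] by simp_all
  note E3 = extensionsD[OF e3] and E0 = extensionsD[OF e0]
  note [simp] = sesD(1-4)[OF E3(1)] E3(2,3) sesD(1-4)[OF E0(1)] E0(2,3) p(3-5) q(2,4)
  have [simp]: "Dom A w = ee" using q(3) by simp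
  have gw: "gy \<cdot> w = Add A (j1 \<cdot> (g \<cdot> r1)) (j2 \<cdot> (g' \<cdot> r2))" using q(6) by simp
  obtain l where l: "u \<in> Arr A" "Dom A u = K a" "Cod A u = T" "l \<in> Arr A" "Dom A l = X a" "Cod A l = Cod A f"
    and gl: "g \<cdot> l = c a" and lk: "l \<cdot> k a = f \<cdot> u"
    using assms(4)[OF h(1)] E1(3) by (rule thE)
  obtain l' where l': "u' \<in> Arr A" "Dom A u' = K a" "Cod A u' = T" "l' \<in> Arr A" "Dom A l' = X a" "Cod A l' = Cod A f'"
    and gl': "g' \<cdot> l' = c a" and lk': "l' \<cdot> k a = f' \<cdot> u'"
    using assms(5)[OF h(2)] E2(3) by (rule thE)
  note [simp] = l l'
  obtain u0 where u0: "th (f0, g0) u0" using th_ex[OF e0] by auto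
  then obtain l0 where l0: "u0 \<in> Arr A" "Dom A u0 = K a" "Cod A u0 = T" "l0 \<in> Arr A" "Dom A l0 = X a" "Cod A l0 = Cod A f0"
    and gl0: "g0 \<cdot> l0 = c a" and lk0: "l0 \<cdot> k a = f0 \<cdot> u0"
    using E0(3) by (rule thE)
  note [simp] = l0
  let ?l = "Add A (k1 \<cdot> l) (k2 \<cdot> l')"
  have "gy \<cdot> (w \<cdot> ?l) = Add A (j1 \<cdot> (g \<cdot> r1)) (j2 \<cdot> (g' \<cdot> r2)) \<cdot> ?l"
    by (rule comp_subst[OF gw]) simp_all
  also have "\<dots> = Add A (j1 \<cdot> c a) (j2 \<cdot> c a)"
    by (simp add: gl gl')
  also have "\<dots> = (Add A j1 j2 \<cdot> g0) \<cdot> l0"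
    by (simp add: gl0)
  also have "\<dots> = gy \<cdot> (w' \<cdot> l0)"
    by (rule comp_subst[OF p(7), symmetric]) simp_all
  finally have 1: "gy \<cdot> (w \<cdot> ?l) = gy \<cdot> (w' \<cdot> l0)" .
  have wl: "w \<cdot> ?l = w' \<cdot> l0"
    by (rule lift_unique[OF E3(1)]) (use 1 T_P in simp_all)
  have "fy \<cdot> u0 = w' \<cdot> (l0 \<cdot> k a)"
    unfolding lk0 by (rule comp_subst[OF p(6), symmetric]) simp_all
  also have "\<dots> = w \<cdot> (?l \<cdot> k a)"
    by (rule trans[OF comp_subst[OF wl[symmetric]]]) simp_all
  also have "?l \<cdot> k a = ?F \<cdot> Add A (i1 \<cdot> u) (i2 \<cdot> u')"
    by (simp add: lk lk')
  also have "w \<cdot> (?F \<cdot> Add A (i1 \<cdot> u) (i2 \<cdot> u')) = fy \<cdot> Add A p1 p2 \<cdot> Add A (i1 \<cdot> u) (i2 \<cdot> u')"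
    by (rule comp_subst[OF q(5)]) simp_all
  also have "\<dots> = fy \<cdot> Add A u u'"
    by simp
  finally have "u0 = Add A u u'"
    by - (rule monoD[OF sesD(5)[OF E3(1)]], simp_all)
  then show ?thesis using u0 by simp
qed

end

section \<open>Ext computed as Hom from K\<close>

context perp_resolution
begin

text \<open>For fixed \<open>a\<close> this inverts the bijection from Ext to
  \<open>Hom A (K a) T\<close> that \<open>th\<close> induces.\<close>

definition Cl :: "'o \<Rightarrow> 'm \<Rightarrow> ('m \<times> 'm) set" where
  "Cl a u = {e \<in> extensions A a T. th e u}"

lemma Cl_subset: "Cl a u \<subseteq> extensions A a T"
  by (auto simp add: Cl_def)

lemma ext_class_eq_Cl:
  assumes "e \<in> extensions A a T" "a \<in> Obj A" "th e u"
  shows "ext_equiv A a T `` {e} = Cl a u"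
proof -
  obtain f g where e: "e = (f, g)" by force
  have "(f', g') \<in> Cl a u" if "(e, (f', g')) \<in> ext_equiv A a T" for f' g'
    using th_equiv[of f g f' g' a u] that assms unfolding e Cl_def by (auto simp add: ext_equiv_def)
  moreover have "(e, (f', g')) \<in> ext_equiv A a T" if "(f', g') \<in> Cl a u" for f' g'
    using th_inj[of f g a f' g' u] that assms unfolding e Cl_def by auto
  ultimately show ?thesis by auto
qed

lemma th_arr: "\<lbrakk>(f, g) \<in> extensions A a T; th (f, g) u\<rbrakk> \<Longrightarrow> u \<in> Hom A (K a) T"
  by (auto simp add: th_def extensions_def)

lemma Ext1_eq_Cl:
  assumes "a \<in> Obj A"
  shows "Ext1 A a T = Cl a ` Hom A (K a) T"
proof (intro Set.set_eqI iffI)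
  fix \<xi> assume "\<xi> \<in> Ext1 A a T"
  then obtain e where e: "e \<in> extensions A a T" "\<xi> = ext_equiv A a T `` {e}"
    by (auto simp add: Ext1_def elim: quotientE)
  obtain f g where fg: "e = (f, g)" by force
  obtain u where "th (f, g) u" using th_ex[of f g a] e fg assms by auto
  then show "\<xi> \<in> Cl a ` Hom A (K a) T"
    using ext_class_eq_Cl[of e a u] e fg assms th_arr[of f g a u] by (intro image_eqI[of _ _ u]) simp_all
next
  fix \<xi> assume "\<xi> \<in> Cl a ` Hom A (K a) T"
  then obtain u where u: "u \<in> Hom A (K a) T" "\<xi> = Cl a u" by auto
  obtain e where e: "e \<in> extensions A a T" "th e u" using th_surj[of a u] u assms by auto
  show "\<xi> \<in> Ext1 A a T"
    unfolding Ext1_def u(2) ext_class_eq_Cl[OF e(1) assms e(2), symmetric] by (rule quotientI[OF e(1)])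
qed

lemma Cl_inj:
  assumes "a \<in> Obj A" "u \<in> Hom A (K a) T" "u' \<in> Hom A (K a) T" "Cl a u = Cl a u'"
  shows "u = u'"
proof -
  obtain f g where "(f, g) \<in> extensions A a T" "th (f, g) u" using th_surj[of a u] assms by auto
  then show ?thesis
    using assms th_unique[of f g a u u'] unfolding Cl_def by auto
qed

lemma Ext1_zero_eq_Cl:
  assumes "a \<in> Obj A"
  shows "Ext1_zero A a T = Cl a (Zer A (K a) T)"
  using th_split_iff[OF _ assms] unfolding Cl_def Ext1_zero_def split_ext_def by auto

text \<open>One inclusion is naturality of \<open>th\<close>. For the other, a single pullback of a
  representative has the right value; by \<open>th_inj\<close> every member of the class is
  equivalent to it, and composing with the equivalence exhibits that member as a pullback
  too.\<close>

lemma ext_pull_Cl: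
  assumes "v \<in> Arr A" "Dom A v = b" "Cod A v = a" "u \<in> Hom A (K a) T"
  shows "ext_pull A v (Cl a u) = Cl b (u \<cdot> Km v)"
proof (intro Set.set_eqI iffI; clarify)
  have ab: "a \<in> Obj A" "b \<in> Obj A" using assms by auto
  fix f' g'
  show "(f', g') \<in> Cl b (u \<cdot> Km v)" if "(f', g') \<in> ext_pull A v (Cl a u)"
    using that
  proof (rule ext_pullE)
    fix f g w assume h: "(f, g) \<in> Cl a u" "Cod A g = Cod A v" "(f', g') \<in> extensions A (Dom A v) (Dom A f)"
      "w \<in> Arr A" "Dom A w = Cod A f'" "Cod A w = Cod A f" "w \<cdot> f' = f" "g \<cdot> w = v \<cdot> g'"
    then have e: "(f, g) \<in> extensions A a T" "th (f, g) u" by (auto simp add: Cl_def)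
    then have e': "(f', g') \<in> extensions A b T"
      using h(3) assms(2) extensionsD(2) by auto
    have "th (f', g') (u \<cdot> Km v)"
      by (rule th_pull[OF e(1) ab(1) e' assms(1-3) h(4-8) e(2)])
    with e' show ?thesis by (simp add: Cl_def)
  qed
  show "(f', g') \<in> ext_pull A v (Cl a u)" if "(f', g') \<in> Cl b (u \<cdot> Km v)"
  proof -
    obtain f g where e: "(f, g) \<in> extensions A a T" "th (f, g) u" using th_surj[of a u] assms ab by auto
    note E = extensionsD[OF e(1)]
    obtain f1 g1 w where s: "short_exact A f1 g1" and w: "Dom A f1 = Dom A f" "Cod A g1 = Dom A v"
     "w \<in> Arr A" "Dom A w = Cod A f1" "Cod A w = Cod A f" "w \<cdot> f1 = f" "g \<cdot> w = v \<cdot> g1"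
      using pullback_ex[OF E(1) assms(1)] assms E by auto
    have e1: "(f1, g1) \<in> extensions A b T" using s w E assms by (simp add: extensions_def)
    have "th (f1, g1) (u \<cdot> Km v)"
      by (rule th_pull[OF e(1) ab(1) e1 assms(1-3) w(3-7) e(2)])
    then have "((f', g'), (f1, g1)) \<in> ext_equiv A b T"
      using that e1 ab by (intro th_inj) (auto simp add: Cl_def)
    then obtain w' where w': "w' \<in> Arr A" "Dom A w' = Cod A f'" "Cod A w' = Cod A f1" "w' \<cdot> f' = f1" "g1 \<cdot> w' = g'"
      and e': "(f', g') \<in> extensions A b T"
      by (auto simp add: ext_equiv_def)
    note E' = extensionsD[OF e']
    note ss = sesD(1-3)[OF E(1)] sesD(1-3)[OF s] sesD(1-3)[OF E'(1)] E E' w(1-5) w'(1-3) assms(1-3)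
    show ?thesis
    proof (rule ext_pullI[of f g _ _ _ _ "w \<cdot> w'"])
      show "g \<cdot> (w \<cdot> w') = v \<cdot> g'"
        using ss by (simp add: comp_subst[OF w(7)] w'(5))
      show "w \<cdot> w' \<cdot> f' = f"
        using ss by (simp add: w'(4) w(6))
    qed (use e e' ss in \<open>simp_all add: Cl_def\<close>)
  qed
qed

lemma ext_push_Cl:
  assumes "a \<in> Obj A" "t \<in> Hom A T T" "u \<in> Hom A (K a) T"
  shows "ext_push A t (Cl a u) = Cl a (t \<cdot> u)"
proof (intro Set.set_eqI iffI; clarify)
  have t: "t \<in> Arr A" "Dom A t = T" "Cod A t = T" using assms by auto
  fix f' g'
  show "(f', g') \<in> Cl a (t \<cdot> u)" if "(f', g') \<in> ext_push A t (Cl a u)"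
    using that
  proof (rule ext_pushE)
    fix f g w assume h: "(f, g) \<in> Cl a u" "Dom A f = Dom A t" "(f', g') \<in> extensions A (Cod A g) (Cod A t)"
      "w \<in> Arr A" "Dom A w = Cod A f" "Cod A w = Cod A f'" "w \<cdot> f = f' \<cdot> t" "g' \<cdot> w = g"
    then have e: "(f, g) \<in> extensions A a T" "th (f, g) u" by (auto simp add: Cl_def)
    then have e': "(f', g') \<in> extensions A a T"
      using h(3) t extensionsD(3) by auto
    have "th (f', g') (t \<cdot> u)"
      by (rule th_push[OF e(1) assms(1) e' t h(4-8) e(2)])
    with e' show ?thesis by (simp add: Cl_def)
  qed
  show "(f', g') \<in> ext_push A t (Cl a u)" if "(f', g') \<in> Cl a (t \<cdot> u)"
  proof -
    obtain f g where e: "(f, g) \<in> extensions A a T" "th (f, g) u" using th_surj[of a u] assms by auto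
    note E = extensionsD[OF e(1)]
    obtain f1 g1 w where s: "short_exact A f1 g1" and w: "Dom A f1 = Cod A t" "Cod A g1 = Cod A g"
     "w \<in> Arr A" "Dom A w = Cod A f" "Cod A w = Cod A f1" "w \<cdot> f = f1 \<cdot> t" "g1 \<cdot> w = g"
      using pushout_ex[OF E(1) t(1)] t E by auto
    have e1: "(f1, g1) \<in> extensions A a T" using s w E t by (simp add: extensions_def)
    have "th (f1, g1) (t \<cdot> u)"
      by (rule th_push[OF e(1) assms(1) e1 t w(3-7) e(2)])
    then have "((f1, g1), (f', g')) \<in> ext_equiv A a T"
      using that e1 assms by (intro th_inj) (auto simp add: Cl_def)
    then obtain w' where w': "w' \<in> Arr A" "Dom A w' = Cod A f1" "Cod A w' = Cod A f'" "w' \<cdot> f1 = f'" "g' \<cdot> w' = g1"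
      and e': "(f', g') \<in> extensions A a T"
      by (auto simp add: ext_equiv_def)
    note E' = extensionsD[OF e']
    note ss = sesD(1-3)[OF E(1)] sesD(1-3)[OF s] sesD(1-3)[OF E'(1)] E E' w(1-5) w'(1-3) t
    show ?thesis
    proof (rule ext_pushI[of f g _ _ _ _ "w' \<cdot> w"])
      show "g' \<cdot> (w' \<cdot> w) = g"
        using ss by (simp add: comp_subst[OF w'(5)] w(7))
      show "w' \<cdot> w \<cdot> f = f' \<cdot> t"
        using ss by (simp add: w(6) comp_subst[OF w'(4)])
    qed (use e e' ss in \<open>simp_all add: Cl_def\<close>)
  qed
qed

text \<open>As for pullbacks and pushouts, one member of the Baer sum is constructed, and the others
  are reached from it through equivalences. The biproducts chosen for that member serve for
  all.\<close>

lemma baer_sum_Cl: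
  assumes "a \<in> Obj A" "u \<in> Hom A (K a) T" "u' \<in> Hom A (K a) T"
  shows "baer_sum A a T (Cl a u) (Cl a u') = Cl a (Add A u u')"
proof (intro Set.set_eqI iffI; clarify)
  fix f0 g0
  have th0: "(f0, g0) \<in> extensions A a T \<and> th (f0, g0) (Add A u u')" if "(f0, g0) \<in> baer_sum A a T (Cl a u) (Cl a u')" for f0 g0
  proof
    show "th (f0, g0) (Add A u u')"
      by (rule th_baer_sum[OF assms(1) Cl_subset Cl_subset _ _ that]) (auto simp add: Cl_def)
    from that show "(f0, g0) \<in> extensions A a T"
    proof (rule baer_sumE)
      fix f g f' g' xx i1 i2 p1 p2 ee k1 k2 r1 r2 zz j1 j2 q1 q2
      assume h: "biproduct A T T xx i1 i2 p1 p2" "biproduct A a a zz j1 j2 q1 q2"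
        "(f0, g0) \<in> ext_pull A (Add A j1 j2) (ext_push A (Add A p1 p2)
          {(Add A (k1 \<cdot> f \<cdot> p1) (k2 \<cdot> f' \<cdot> p2), Add A (j1 \<cdot> g \<cdot> r1) (j2 \<cdot> g' \<cdot> r2))})"
      note b = biproductD(1-13)[OF h(1)] biproductD(1-13)[OF h(2)]
      show "(f0, g0) \<in> extensions A a T"
        using h(3)
      proof (rule ext_pullE)
        fix fy gy assume y: "(fy, gy) \<in> ext_push A (Add A p1 p2)
          {(Add A (k1 \<cdot> f \<cdot> p1) (k2 \<cdot> f' \<cdot> p2), Add A (j1 \<cdot> g \<cdot> r1) (j2 \<cdot> g' \<cdot> r2))}"
          and e: "(f0, g0) \<in> extensions A (Dom A (Add A j1 j2)) (Dom A fy)"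
        from y have "Dom A fy = T"
          by (rule ext_pushE) (use b in \<open>auto dest: extensionsD(2)\<close>)
        then show ?thesis using e b by simp
      qed
    qed
  qed
  then show "(f0, g0) \<in> Cl a (Add A u u')" if "(f0, g0) \<in> baer_sum A a T (Cl a u) (Cl a u')"
    using that by (simp add: Cl_def)
  assume t: "(f0, g0) \<in> Cl a (Add A u u')"
  obtain f g where e: "(f, g) \<in> extensions A a T" "th (f, g) u" using th_surj[of a u] assms by auto
  obtain f' g' where e': "(f', g') \<in> extensions A a T" "th (f', g') u'" using th_surj[of a u'] assms by auto
  note E = extensionsD[OF e(1)] and E' = extensionsD[OF e'(1)]
  have o: "Cod A f \<in> Obj A" "Cod A f' \<in> Obj A" using sesD(1)[OF E(1)] sesD(1)[OF E'(1)] by auto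
  obtain xx i1 i2 p1 p2 where b1: "biproduct A T T xx i1 i2 p1 p2" using ex_biproduct[of T T] by auto
  obtain ee k1 k2 r1 r2 where b2: "biproduct A (Cod A f) (Cod A f') ee k1 k2 r1 r2" using ex_biproduct[OF o] by auto
  obtain zz j1 j2 q1 q2 where b3: "biproduct A a a zz j1 j2 q1 q2" using ex_biproduct[OF assms(1) assms(1)] by auto
  let ?F = "Add A (k1 \<cdot> f \<cdot> p1) (k2 \<cdot> f' \<cdot> p2)" and ?G = "Add A (j1 \<cdot> g \<cdot> r1) (j2 \<cdot> g' \<cdot> r2)"
  note b = biproductD(1-13)[OF b1] biproductD(1-13)[OF b2] biproductD(1-13)[OF b3]
  note s = sesD(1-3)[OF E(1)] sesD(1-3)[OF E'(1)]
  have FG: "short_exact A ?F ?G"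
    by (rule biproduct_sum_ses[OF E(1) E'(1)]) (use b1 b2 b3 E E' in simp_all)
  have d: "Dom A ?F = xx" "Cod A ?G = zz" using b s E E' by simp_all
  have pj: "Add A p1 p2 \<in> Arr A" "Dom A (Add A p1 p2) = xx" "Cod A (Add A p1 p2) = T"
    "Add A j1 j2 \<in> Arr A" "Dom A (Add A j1 j2) = a" "Cod A (Add A j1 j2) = zz" using b by simp_all
  obtain fy gy w where y: "short_exact A fy gy" "Dom A fy = Cod A (Add A p1 p2)" "Cod A gy = Cod A ?G"
    "w \<in> Arr A" "Dom A w = Cod A ?F" "Cod A w = Cod A fy" "w \<cdot> ?F = fy \<cdot> Add A p1 p2" "gy \<cdot> w = ?G"
    using pushout_ex[OF FG pj(1)] d pj by auto
  have ey: "(fy, gy) \<in> extensions A (Cod A ?G) (Cod A (Add A p1 p2))"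
    using y(1-3) by (simp add: extensions_def)
  have Y: "(fy, gy) \<in> ext_push A (Add A p1 p2) {(?F, ?G)}"
    by (rule ext_pushI[OF _ _ ey y(4-8)]) (use d pj in simp_all)
  obtain f1 g1 w1 where p: "short_exact A f1 g1" "Dom A f1 = Dom A fy" "Cod A g1 = Dom A (Add A j1 j2)"
    "w1 \<in> Arr A" "Dom A w1 = Cod A f1" "Cod A w1 = Cod A fy" "w1 \<cdot> f1 = fy" "gy \<cdot> w1 = Add A j1 j2 \<cdot> g1"
    using pullback_ex[OF y(1) pj(4)] y(3) d pj by auto
  have cl: "(f, g) \<in> Cl a u" "(f', g') \<in> Cl a u'" using e e' by (auto simp add: Cl_def)
  have e1': "(f1, g1) \<in> extensions A (Dom A (Add A j1 j2)) (Dom A fy)"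
    using p(1-3) by (simp add: extensions_def)
  have "(f1, g1) \<in> ext_pull A (Add A j1 j2) (ext_push A (Add A p1 p2) {(?F, ?G)})"
    by (rule ext_pullI[OF Y _ e1' p(4-8)]) (use y(3) d pj in simp_all)
  then have "(f1, g1) \<in> baer_sum A a T (Cl a u) (Cl a u')"
    by (rule baer_sumI[OF cl b1 b2 b3])
  then have e1: "(f1, g1) \<in> extensions A a T" "th (f1, g1) (Add A u u')"
    using th0 by auto
  then have "((f0, g0), (f1, g1)) \<in> ext_equiv A a T"
    using t assms by (intro th_inj) (auto simp add: Cl_def)
  then obtain w' where w': "w' \<in> Arr A" "Dom A w' = Cod A f0" "Cod A w' = Cod A f1" "w' \<cdot> f0 = f1" "g1 \<cdot> w' = g0"
    and e0: "(f0, g0) \<in> extensions A a T"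
    by (auto simp add: ext_equiv_def)
  note E0 = extensionsD[OF e0]
  note ss = sesD(1-3)[OF y(1)] sesD(1-3)[OF p(1)] sesD(1-3)[OF E0(1)] E0 y(1-3) p(2-6) w'(1-3) pj
  have "(f0, g0) \<in> ext_pull A (Add A j1 j2) (ext_push A (Add A p1 p2) {(?F, ?G)})"
  proof (rule ext_pullI[OF Y, of _ _ _ "w1 \<cdot> w'"])
    have "gy \<cdot> (w1 \<cdot> w') = (Add A j1 j2 \<cdot> g1) \<cdot> w'"
      by (rule comp_subst[OF p(8)]) (use ss in simp_all)
    also have "\<dots> = Add A j1 j2 \<cdot> (g1 \<cdot> w')"
      by (rule comp_assoc) (use ss in simp_all)
    finally show "gy \<cdot> (w1 \<cdot> w') = Add A j1 j2 \<cdot> g0" by (simp only: w'(5))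
    show "w1 \<cdot> w' \<cdot> f0 = fy"
      using ss by (simp add: w'(4) p(7))
    show "(f0, g0) \<in> extensions A (Dom A (Add A j1 j2)) (Dom A fy)"
      unfolding y(2) pj(3) pj(5) by fact
    show "Cod A gy = Cod A (Add A j1 j2)" unfolding y(3) pj(6) by (rule d)
  qed (use ss in simp_all)
  then show "(f0, g0) \<in> baer_sum A a T (Cl a u) (Cl a u')"
    by (rule baer_sumI[OF cl b1 b2 b3])
qed

end

section \<open>Comparing S with T through K\<close>

locale perp_pairing = perp_resolution +
  fixes S
  assumes S_obj [simp]: "S \<in> Obj A"
    and Hom_S_Bs: "\<lbrakk>f \<in> Arr A; Dom A f = S; Cod A f \<in> Bs\<rbrakk> \<Longrightarrow> f = Zer A S (Cod A f)"
    and Ext_S_Bs: "\<lbrakk>short_exact A f g; Cod A g = S; Dom A f \<in> Bs\<rbrakk> \<Longrightarrow> split_epi A g"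
    and Hom_S_P: "\<lbrakk>f \<in> Arr A; Dom A f = S; Cod A f \<in> P\<rbrakk> \<Longrightarrow> f = Zer A S (Cod A f)"
    and S_nonzero: "Ide A S \<noteq> Zer A S S"
    and S_division: "\<lbrakk>t \<in> Hom A S S; t \<noteq> Zer A S S\<rbrakk> \<Longrightarrow>
      \<exists>t' \<in> Hom A S S. t' \<cdot> t = Ide A S \<and> t \<cdot> t' = Ide A S"
begin

text \<open>The cokernel of \<open>c S\<close> is an arrow from \<open>S\<close> to an object of
  \<open>P\<close>, hence zero; so \<open>c S\<close> is epi and the resolution of \<open>S\<close>
  is a short exact sequence.\<close>

lemma S_ses: "short_exact A (k S) (c S)"
proof (rule ses_epiI)
  note [simp] = k_arr[OF S_obj] c_arr[OF S_obj]
  show "is_kernel A (k S) (c S)" by (rule k_ker) simp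
  obtain h where h: "is_cokernel A h (c S)" using ex_cokernel[of "c S"] by auto
  note [simp] = cokernelD(1-4)[OF h]
  have hz: "h = Zer A S (Cod A h)"
    using Hom_S_P[of h] coker_P[OF _ h] by simp
  show "is_epi A (c S)"
  proof (rule epiI)
    fix g assume g: "g \<in> Arr A" "Dom A g = Cod A (c S)" "g \<cdot> c S = Zer A (Dom A (c S)) (Cod A g)"
    then obtain y where y: "y \<in> Arr A" "Dom A y = Cod A h" "Cod A y = Cod A g" "y \<cdot> h = g"
      by - (rule cokernel_lift[OF h, of g], (assumption | simp)+)
    have "y \<cdot> Zer A S (Cod A h) = g" using y(4) hz by metis
    then show "g = Zer A (Cod A (c S)) (Cod A g)"
      using y(1-3) by simp
  qed simp
qed

text \<open>If \<open>Km h\<close> and \<open>Km h'\<close> agree, the difference of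
  \<open>Xm h\<close> and \<open>Xm h'\<close> vanishes on \<open>K S\<close> and factors through an
  arrow from \<open>S\<close> to an object of \<open>Bs\<close>, which is zero. As
  \<open>c S\<close> is epi, \<open>h\<close> and \<open>h'\<close> agree.\<close>

lemma Km_inj:
  assumes "h \<in> Arr A" "h' \<in> Arr A" "Dom A h = S" "Dom A h' = S" "Cod A h = Cod A h'" "Km h = Km h'"
  shows "h = h'"
proof -
  have a: "Cod A h' \<in> Obj A" using assms by auto
  note [simp] = assms(1-5) k_arr[OF S_obj] c_arr[OF S_obj] k_arr[OF a] c_arr[OF a]
    Xm(1-3)[OF assms(1)] Xm(1-3)[OF assms(2)] Km(1-3)[OF assms(1)] Km(1-3)[OF assms(2)]
  let ?x = "Add A (Xm h) (neg (Xm h'))"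
  have "?x \<cdot> k S = Zer A (K S) (X (Cod A h'))"
    using Km(4)[OF assms(1)] Km(4)[OF assms(2)] assms(6) by simp
  then obtain y where y: "y \<in> Arr A" "Dom A y = Cod A (c S)" "Cod A y = Cod A ?x" "y \<cdot> c S = ?x"
    by - (rule cokernel_lift[OF sesD(8)[OF S_ses], of ?x], (assumption | simp)+)
  then have "y = Zer A S (X (Cod A h'))"
    using Hom_S_Bs[of y] by simp
  then have "?x = Zer A (X S) (X (Cod A h'))"
    using y(4) by simp
  then have "Xm h = Xm h'"
    by (rule diff_eq_zer) simp_all
  then have "h \<cdot> c S = h' \<cdot> c S"
    using Xm(4)[OF assms(1)] Xm(4)[OF assms(2)] by simp
  then show "h = h'"
    by (rule epiD[OF sesD(6)[OF S_ses]]) simp_all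
qed

text \<open>Push the resolution of \<open>S\<close> out along \<open>k a \<cdot> \<kappa>\<close>.
  The result is an extension of \<open>S\<close> by an object of \<open>Bs\<close> and splits, so
  \<open>k a \<cdot> \<kappa>\<close> extends to an arrow from \<open>X S\<close> to
  \<open>X a\<close>. After \<open>c a\<close> this extension kills \<open>K S\<close> and descends
  to \<open>S\<close>.\<close>

lemma Km_surj:
  assumes "a \<in> Obj A" "\<kappa> \<in> Arr A" "Dom A \<kappa> = K S" "Cod A \<kappa> = K a"
  obtains h where "h \<in> Arr A" "Dom A h = S" "Cod A h = a" "Km h = \<kappa>"
proof -
  note [simp] = assms k_arr[OF S_obj] c_arr[OF S_obj] k_arr[OF assms(1)] c_arr[OF assms(1)]
  obtain f' g' w where s: "short_exact A f' g'" and w [simp]: "Dom A f' = X a" "Cod A g' = S"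
    "w \<in> Arr A" "Dom A w = X S" "Cod A w = Cod A f'" and wk: "w \<cdot> k S = f' \<cdot> (k a \<cdot> \<kappa>)" and gw: "g' \<cdot> w = c S"
    using pushout_ex[OF S_ses, of "k a \<cdot> \<kappa>"] by auto
  note [simp] = sesD(1-4)[OF s]
  have "split_epi A g'"
    by (rule Ext_S_Bs[OF s]) simp_all
  then have "split_mono A f'"
    using split_epi_iff_split_mono[OF s] by simp
  then obtain r where r [simp]: "r \<in> Arr A" "Dom A r = Dom A g'" "Cod A r = X a" and rf: "r \<cdot> f' = Ide A (X a)"
    by (auto simp add: split_mono_def)
  let ?x = "r \<cdot> w"
  have xk: "?x \<cdot> k S = k a \<cdot> \<kappa>"
    by (simp add: wk comp_subst[OF rf])
  have "c a \<cdot> (k a \<cdot> \<kappa>) = Zer A (K S) a"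
    by (subst comp_subst[OF k_arr(3)]) simp_all
  then have "(c a \<cdot> ?x) \<cdot> k S = Zer A (K S) a"
    using xk by simp
  then obtain h where h: "h \<in> Arr A" "Dom A h = Cod A (c S)" "Cod A h = Cod A (c a \<cdot> ?x)" "h \<cdot> c S = c a \<cdot> ?x"
    by - (rule cokernel_lift[OF sesD(8)[OF S_ses], of "c a \<cdot> ?x"], (assumption | simp)+)
  have "\<kappa> = Km h"
    by (rule Km_unique(1)[of h ?x]) (use h xk in simp_all)
  then show ?thesis
    using that[of h] h by simp
qed

text \<open>\<open>K S\<close> is a nonzero object of \<open>P\<close>, so \<open>T\<close> is a
  direct summand of it. The projector \<open>j \<cdot> r\<close> is \<open>Km h\<close> for a
  nonzero endomorphism \<open>h\<close> of \<open>S\<close>, which is invertible; an idempotent with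
  a right inverse is the identity.\<close>

lemma K_S_iso_T:
  obtains j r where "j \<in> Hom A T (K S)" "r \<in> Hom A (K S) T" "r \<cdot> j = Ide A T" "j \<cdot> r = Ide A (K S)"
proof -
  note [simp] = k_arr[OF S_obj] c_arr[OF S_obj]
  have n: "Ide A (K S) \<noteq> Zer A (K S) (K S)"
  proof
    assume "Ide A (K S) = Zer A (K S) (K S)"
    then have "Km (Ide A S) = Km (Zer A S S)"
      by (simp add: Km_Ide Km_Zer)
    then have "Ide A S = Zer A S S"
      by - (rule Km_inj, simp_all)
    then show False using S_nonzero by simp
  qed
  then obtain j where "j \<in> Hom A T (K S)" "Ide A (K S) \<cdot> j \<noteq> Zer A T (K S)"
    using zero_by_T_sources[of "Ide A (K S)"] K_P[of S] by auto
  then have j [simp]: "j \<in> Arr A" "Dom A j = T" "Cod A j = K S" and jn: "j \<noteq> Zer A T (K S)" by auto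
  obtain r where r: "r \<in> Arr A" "Dom A r = Cod A j" "Cod A r = T" "r \<cdot> j = Ide A T"
    using jn by - (rule from_T_split[of j], (assumption | simp add: K_P)+)
  note [simp] = r(1-3)
  obtain h where h [simp]: "h \<in> Arr A" "Dom A h = S" "Cod A h = S" and Kh: "Km h = j \<cdot> r"
    by (rule Km_surj[of S "j \<cdot> r"]) (assumption | simp)+
  have "h \<noteq> Zer A S S"
  proof
    assume "h = Zer A S S"
    then have z: "j \<cdot> r = Zer A (K S) (K S)"
      using Kh Km_Zer[of S S] by simp
    have "j \<cdot> (r \<cdot> j) = Zer A (K S) (K S) \<cdot> j"
      by (rule comp_subst[OF z]) simp_all
    then show False using jn r(4) by simp
  qed
  then obtain h' where h': "h' \<in> Arr A" "Dom A h' = S" "Cod A h' = S" "h \<cdot> h' = Ide A S"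
    using S_division[of h] by auto
  note [simp] = h'(1-3) Km(1-3)[OF h'(1)]
  have e: "(j \<cdot> r) \<cdot> Km h' = Ide A (K S)"
    using Km_comp[of h' h] h'(4) Kh by (simp add: Km_Ide)
  have "(j \<cdot> r) \<cdot> (j \<cdot> r) = j \<cdot> r"
    by (simp add: comp_subst[OF r(4)])
  then have "((j \<cdot> r) \<cdot> (j \<cdot> r)) \<cdot> Km h' = Ide A (K S)"
    using e by simp
  then have "(j \<cdot> r) \<cdot> ((j \<cdot> r) \<cdot> Km h') = Ide A (K S)"
    by simp
  then have "j \<cdot> r = Ide A (K S)"
    unfolding e by simp
  then show ?thesis
    using that[of j r] r by simp
qed

lemma nonzero_K_S_T_iso:
  assumes "u \<in> Hom A (K S) T" "u \<noteq> Zer A (K S) T"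
  obtains v where "v \<in> Hom A T (K S)" "u \<cdot> v = Ide A T" "v \<cdot> u = Ide A (K S)"
proof (rule K_S_iso_T)
  fix j r assume j: "j \<in> Hom A T (K S)" "r \<in> Hom A (K S) T" "r \<cdot> j = Ide A T" "j \<cdot> r = Ide A (K S)"
  have n: "u \<cdot> j \<noteq> Zer A T T"
  proof
    assume z: "u \<cdot> j = Zer A T T"
    have "u \<cdot> (j \<cdot> r) = Zer A T T \<cdot> r"
      by (rule comp_subst[OF z]) (use j assms in simp_all)
    then show False using assms j by simp
  qed
  have "u \<cdot> j \<in> Hom A T T" using assms j by simp
  then obtain t where t: "t \<in> Hom A T T" "t \<cdot> (u \<cdot> j) = Ide A T" "(u \<cdot> j) \<cdot> t = Ide A T"
    using T_division[OF _ n] by auto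
  have "(j \<cdot> t) \<cdot> u = j \<cdot> (t \<cdot> (u \<cdot> (j \<cdot> r)))"
    using j assms t by simp
  also have "\<dots> = j \<cdot> ((t \<cdot> (u \<cdot> j)) \<cdot> r)"
    using j(1,2) assms t(1) by simp
  also have "\<dots> = Ide A (K S)"
    unfolding t(2) using j by simp
  finally show ?thesis
    using j assms t by (intro that[of "j \<cdot> t"]) simp_all
qed

lemma almost_split_right:
  assumes "(f, g) \<in> extensions A S T" "\<not> split_epi A g" "h \<in> Arr A" "Cod A h = S" "\<not> split_epi A h"
  shows "\<exists>h' \<in> Hom A (Dom A h) (Dom A g). g \<cdot> h' = h"
proof -
  note E = extensionsD[OF assms(1)]
  have a: "Dom A h \<in> Obj A" using assms by auto
  obtain u where u: "th (f, g) u" using th_ex[OF assms(1)] by auto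
  have u': "u \<in> Hom A (K S) T" using th_arr[OF assms(1) u] .
  have "u \<noteq> Zer A (K S) T"
    using u assms(2) th_split_iff[OF assms(1)] by auto
  then obtain v where v: "v \<in> Hom A T (K S)" "u \<cdot> v = Ide A T" "v \<cdot> u = Ide A (K S)"
    using nonzero_K_S_T_iso[OF u'] by metis
  note [simp] = assms(3,4) k_arr[OF a] c_arr[OF a] Km(1-3)[OF assms(3)] sesD(1-4)[OF E(1)] E(2,3)
  have [simp]: "u \<in> Arr A" "Dom A u = K S" "Cod A u = T" "v \<in> Arr A" "Dom A v = T" "Cod A v = K S"
    using u' v(1) by simp_all
  have z: "u \<cdot> Km h = Zer A (K (Dom A h)) T"
  proof (rule ccontr)
    assume "u \<cdot> Km h \<noteq> Zer A (K (Dom A h)) T"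
    then obtain s where s: "s \<in> Arr A" "Dom A s = T" "Cod A s = Dom A (u \<cdot> Km h)" "(u \<cdot> Km h) \<cdot> s = Ide A T"
      by - (rule to_T_split[of "u \<cdot> Km h"], (assumption | simp add: K_P a)+)
    have [simp]: "s \<in> Arr A" "Dom A s = T" "Cod A s = K (Dom A h)" using s by simp_all
    \<comment> \<open>The arrow \<open>s \<cdot> u\<close> from \<open>K S\<close> comes from an
      arrow \<open>t\<close> out of \<open>S\<close>. As \<open>Km\<close> sends
      \<open>h \<cdot> t\<close> to the identity, \<open>t\<close> would be a section of
      \<open>h\<close>.\<close>
    obtain t where t [simp]: "t \<in> Arr A" "Dom A t = S" "Cod A t = Dom A h" and Kt: "Km t = s \<cdot> u"
      by (rule Km_surj[OF a, of "s \<cdot> u"]) (assumption | simp)+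
    have "Km h \<cdot> (s \<cdot> u) = (v \<cdot> u) \<cdot> (Km h \<cdot> (s \<cdot> u))"
      unfolding v(3) by simp
    also have "\<dots> = v \<cdot> (((u \<cdot> Km h) \<cdot> s) \<cdot> u)"
      by simp
    also have "\<dots> = Ide A (K S)"
      unfolding s(4) by (simp add: v(3))
    finally have "Km (h \<cdot> t) = Km (Ide A S)"
      by (simp add: Km_comp Kt Km_Ide)
    then have "h \<cdot> t = Ide A S"
      by - (rule Km_inj, simp_all)
    then show False
      using assms(5) by (auto simp add: split_epi_def)
  qed
  obtain f' g' w where s: "short_exact A f' g'" and w [simp]: "Dom A f' = T" "Cod A g' = Dom A h"
    "w \<in> Arr A" "Dom A w = Cod A f'" "Cod A w = Dom A g" and wf: "w \<cdot> f' = f" and gw: "g \<cdot> w = h \<cdot> g'"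
    using pullback_ex[OF E(1), of h] by auto
  note [simp] = sesD(1-4)[OF s]
  have e': "(f', g') \<in> extensions A (Dom A h) T"
    using s by (simp add: extensions_def)
  \<comment> \<open>Pulling back along \<open>h\<close> replaces \<open>u\<close> by
    \<open>u \<cdot> Km h\<close>, which is zero. So the pullback splits, and its section followed
    by \<open>w\<close> lifts \<open>h\<close>.\<close>
  have "th (f', g') (u \<cdot> Km h)"
    by (rule th_pull[OF assms(1) S_obj e' _ _ _ _ _ _ wf gw u]) simp_all
  then have "split_epi A g'"
    using th_split_iff[OF e' a] z by simp
  then obtain r where r [simp]: "r \<in> Arr A" "Dom A r = Dom A h" "Cod A r = Dom A g'" "g' \<cdot> r = Ide A (Dom A h)"
    by (auto simp add: split_epi_def)
  show ?thesis
    by (rule bexI[of _ "w \<cdot> r"]) (simp_all add: comp_subst[OF gw])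
qed

end

section \<open>The duality\<close>

lemma End_ring_simps [simp]:
  "carrier (End_ring C x) = Hom C x x" "mult (End_ring C x) = Comp C" "one (End_ring C x) = Ide C x"
  "zero (End_ring C x) = Zer C x x" "add (End_ring C x) = Add C"
  by (simp_all add: End_ring_def)

lemma ring_iso_EndD:
  assumes "\<alpha> \<in> ring_iso \<Delta> (End_ring C x)"
  shows "d \<in> carrier \<Delta> \<Longrightarrow> \<alpha> d \<in> Arr C" "d \<in> carrier \<Delta> \<Longrightarrow> Dom C (\<alpha> d) = x"
    "d \<in> carrier \<Delta> \<Longrightarrow> Cod C (\<alpha> d) = x"
    "\<lbrakk>d \<in> carrier \<Delta>; e \<in> carrier \<Delta>\<rbrakk> \<Longrightarrow> \<alpha> (d \<otimes>\<^bsub>\<Delta>\<^esub> e) = \<alpha> d \<cdot>\<^bsub>C\<^esub> \<alpha> e"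
    "\<lbrakk>d \<in> carrier \<Delta>; e \<in> carrier \<Delta>\<rbrakk> \<Longrightarrow> \<alpha> (d \<oplus>\<^bsub>\<Delta>\<^esub> e) = Add C (\<alpha> d) (\<alpha> e)"
    "\<alpha> \<one>\<^bsub>\<Delta>\<^esub> = Ide C x"
    "\<lbrakk>\<alpha> d = \<alpha> e; d \<in> carrier \<Delta>; e \<in> carrier \<Delta>\<rbrakk> \<Longrightarrow> d = e"
    "t \<in> Hom C x x \<Longrightarrow> \<exists>d \<in> carrier \<Delta>. \<alpha> d = t"
proof -
  have h: "\<alpha> \<in> ring_hom \<Delta> (End_ring C x)" "bij_betw \<alpha> (carrier \<Delta>) (Hom C x x)"
    using assms by (simp_all add: ring_iso_def)
  show "d \<in> carrier \<Delta> \<Longrightarrow> \<alpha> d \<in> Arr C" "d \<in> carrier \<Delta> \<Longrightarrow> Dom C (\<alpha> d) = x"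
    "d \<in> carrier \<Delta> \<Longrightarrow> Cod C (\<alpha> d) = x"
    "\<lbrakk>d \<in> carrier \<Delta>; e \<in> carrier \<Delta>\<rbrakk> \<Longrightarrow> \<alpha> (d \<otimes>\<^bsub>\<Delta>\<^esub> e) = \<alpha> d \<cdot>\<^bsub>C\<^esub> \<alpha> e"
    "\<lbrakk>d \<in> carrier \<Delta>; e \<in> carrier \<Delta>\<rbrakk> \<Longrightarrow> \<alpha> (d \<oplus>\<^bsub>\<Delta>\<^esub> e) = Add C (\<alpha> d) (\<alpha> e)"
    "\<alpha> \<one>\<^bsub>\<Delta>\<^esub> = Ide C x"
    using ring_hom_closed[OF h(1)] ring_hom_mult[OF h(1)] ring_hom_add[OF h(1)] ring_hom_one[OF h(1)] by auto
  show "\<lbrakk>\<alpha> d = \<alpha> e; d \<in> carrier \<Delta>; e \<in> carrier \<Delta>\<rbrakk> \<Longrightarrow> d = e"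
    using h(2) by (auto simp add: bij_betw_def inj_on_def)
  show "\<exists>d \<in> carrier \<Delta>. \<alpha> d = t" if "t \<in> Hom C x x"
  proof -
    have "t \<in> \<alpha> ` carrier \<Delta>"
      using h(2) that by (simp only: bij_betw_def)
    then show ?thesis by blast
  qed
qed

lemma ring_iso_EndI:
  assumes "\<And>d. d \<in> carrier \<Delta> \<Longrightarrow> \<alpha> d \<in> Hom C x x"
    "\<And>d e. \<lbrakk>d \<in> carrier \<Delta>; e \<in> carrier \<Delta>\<rbrakk> \<Longrightarrow> \<alpha> (d \<otimes>\<^bsub>\<Delta>\<^esub> e) = \<alpha> d \<cdot>\<^bsub>C\<^esub> \<alpha> e"
    "\<And>d e. \<lbrakk>d \<in> carrier \<Delta>; e \<in> carrier \<Delta>\<rbrakk> \<Longrightarrow> \<alpha> (d \<oplus>\<^bsub>\<Delta>\<^esub> e) = Add C (\<alpha> d) (\<alpha> e)"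
    "\<alpha> \<one>\<^bsub>\<Delta>\<^esub> = Ide C x"
    "\<And>d e. \<lbrakk>d \<in> carrier \<Delta>; e \<in> carrier \<Delta>; \<alpha> d = \<alpha> e\<rbrakk> \<Longrightarrow> d = e"
    "\<And>t. t \<in> Hom C x x \<Longrightarrow> \<exists>d \<in> carrier \<Delta>. \<alpha> d = t"
  shows "\<alpha> \<in> ring_iso \<Delta> (End_ring C x)"
proof -
  have "\<alpha> ` carrier \<Delta> = Hom C x x"
    using assms(1,6) by (blast intro: Set.set_eqI)
  then have "bij_betw \<alpha> (carrier \<Delta>) (Hom C x x)"
    unfolding bij_betw_def inj_on_def using assms(5) by blast
  moreover have "\<alpha> \<in> ring_hom \<Delta> (End_ring C x)"
    by (rule ring_hom_memI) (use assms(1-4) in simp_all)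
  ultimately show ?thesis
    by (simp add: ring_iso_def)
qed

text \<open>Here \<open>u\<close> is the arrow representing the non-split class of a compatible
  identification; being nonzero, it is invertible with inverse \<open>v\<close>. Read through
  \<open>Cl\<close>, the compatibility of \<alpha> and \<beta> on that class becomes
  \<open>u_comm\<close>.\<close>

locale perp_duality = perp_pairing +
  fixes \<Delta> :: "'r ring" and \<alpha> \<beta> :: "'r \<Rightarrow> 'b" and u v :: 'b
  assumes ring_\<Delta>: "ring \<Delta>"
    and \<alpha>_iso: "\<alpha> \<in> ring_iso \<Delta> (End_ring A S)"
    and \<beta>_iso: "\<beta> \<in> ring_iso \<Delta> (End_ring A T)"
    and u: "u \<in> Hom A (K S) T" and v: "v \<in> Hom A T (K S)"
    and uv: "u \<cdot> v = Ide A T" and vu: "v \<cdot> u = Ide A (K S)"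
    and u_comm: "d \<in> carrier \<Delta> \<Longrightarrow> u \<cdot> Km (\<alpha> d) = \<beta> d \<cdot> u"
begin

lemma uv_simps [simp]: "u \<in> Arr A" "Dom A u = K S" "Cod A u = T" "v \<in> Arr A" "Dom A v = T" "Cod A v = K S"
  using u v by simp_all

lemmas \<alpha>_simps = ring_iso_EndD(1-6)[OF \<alpha>_iso]
lemmas \<beta>_simps = ring_iso_EndD(1-6)[OF \<beta>_iso]
lemmas \<beta>_inj = ring_iso_EndD(7)[OF \<beta>_iso]
lemmas \<beta>_surj = ring_iso_EndD(8)[OF \<beta>_iso]

abbreviation D :: "'a \<Rightarrow> (('b \<times> 'b) set \<Rightarrow> 'r) set" where
  "D a \<equiv> carrier (dual_of_left \<Delta> (Ext_to_module A \<beta> T a))"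

lemma D_iff: "\<phi> \<in> D a \<longleftrightarrow> \<phi> \<in> Ext1 A a T \<rightarrow>\<^sub>E carrier \<Delta> \<and>
    (\<forall>x \<in> Ext1 A a T. \<forall>y \<in> Ext1 A a T. \<phi> (baer_sum A a T x y) = \<phi> x \<oplus>\<^bsub>\<Delta>\<^esub> \<phi> y) \<and>
    (\<forall>r \<in> carrier \<Delta>. \<forall>x \<in> Ext1 A a T. \<phi> (ext_push A (\<beta> r) x) = r \<otimes>\<^bsub>\<Delta>\<^esub> \<phi> x)"
  by (simp add: dual_of_left_def Ext_to_module_def)

lemma Cl_Ext1: "\<lbrakk>a \<in> Obj A; w \<in> Hom A (K a) T\<rbrakk> \<Longrightarrow> Cl a w \<in> Ext1 A a T"
  by (simp add: Ext1_eq_Cl)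

lemma D_Cl:
  assumes "\<phi> \<in> D a" "a \<in> Obj A" "w \<in> Hom A (K a) T" "w' \<in> Hom A (K a) T" "d \<in> carrier \<Delta>"
  shows "\<phi> (Cl a w) \<in> carrier \<Delta>" "\<phi> (Cl a (Add A w w')) = \<phi> (Cl a w) \<oplus>\<^bsub>\<Delta>\<^esub> \<phi> (Cl a w')"
    "\<phi> (Cl a (\<beta> d \<cdot> w)) = d \<otimes>\<^bsub>\<Delta>\<^esub> \<phi> (Cl a w)"
proof -
  note c = Cl_Ext1[OF assms(2,3)] Cl_Ext1[OF assms(2,4)]
  show "\<phi> (Cl a w) \<in> carrier \<Delta>"
    using assms(1) c unfolding D_iff by blast
  show "\<phi> (Cl a (Add A w w')) = \<phi> (Cl a w) \<oplus>\<^bsub>\<Delta>\<^esub> \<phi> (Cl a w')"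
    using assms(1) c unfolding D_iff baer_sum_Cl[OF assms(2-4), symmetric] by blast
  have b: "\<beta> d \<in> Hom A T T" using \<beta>_simps assms(5) by simp
  show "\<phi> (Cl a (\<beta> d \<cdot> w)) = d \<otimes>\<^bsub>\<Delta>\<^esub> \<phi> (Cl a w)"
    using assms(1,5) c unfolding D_iff ext_push_Cl[OF assms(2) b assms(3), symmetric] by blast
qed

text \<open>\<open>rep a \<phi> h\<close>: under the bijections \<open>Cl a\<close> and \<open>Km\<close>, the functional \<open>\<phi>\<close> is the pairing with \<open>h\<close>.\<close>

definition rep :: "'a \<Rightarrow> (('b \<times> 'b) set \<Rightarrow> 'r) \<Rightarrow> 'b \<Rightarrow> bool" where
  "rep a \<phi> h \<longleftrightarrow> h \<in> Hom A S a \<and> (\<forall>w \<in> Hom A (K a) T. \<beta> (\<phi> (Cl a w)) \<cdot> u = w \<cdot> Km h)"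

text \<open>A dual basis argument. Write the identity of \<open>K a\<close> as a sum of composites
  \<open>g \<cdot> f\<close> through \<open>T\<close>. For \<open>w\<close> from \<open>K a\<close>
  to \<open>T\<close>, the endomorphism \<open>w \<cdot> g\<close> of \<open>T\<close> is a scalar
  \<open>\<beta> d\<close>, so linearity turns \<phi> at \<open>w \<cdot> g \<cdot> f\<close> into
  \<open>d\<close> times its value at \<open>f\<close>. Summing the composites of \<open>g\<close>
  with the values at \<open>f\<close> gives one arrow \<open>j\<close> with which every
  \<open>w\<close> is paired.\<close>

lemma rep_ex:
  assumes "a \<in> Obj A" "\<phi> \<in> D a"
  shows "\<exists>h. rep a \<phi> h"
proof -
  interpret ring \<Delta> by (rule ring_\<Delta>)
  note k = k_arr[OF assms(1)]
  have dz: "\<zero>\<^bsub>\<Delta>\<^esub> \<in> carrier \<Delta>" by simp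
  have \<beta>\<phi>: "\<beta> (\<phi> (Cl a w)) \<in> Arr A" "Dom A (\<beta> (\<phi> (Cl a w))) = T" "Cod A (\<beta> (\<phi> (Cl a w))) = T"
    if "w \<in> Hom A (K a) T" for w
    using D_Cl(1)[OF assms(2,1) that that dz] \<beta>_simps by simp_all
  have add: "\<beta> (\<phi> (Cl a (Add A w w'))) = Add A (\<beta> (\<phi> (Cl a w))) (\<beta> (\<phi> (Cl a w')))"
    if "w \<in> Hom A (K a) T" "w' \<in> Hom A (K a) T" for w w'
    unfolding D_Cl(2)[OF assms(2,1) that dz]
    using D_Cl(1)[OF assms(2,1) that dz] D_Cl(1)[OF assms(2,1) that(2,1) dz] \<beta>_simps by simp
  have "\<exists>j \<in> Hom A T (K a). \<forall>w \<in> Hom A (K a) T. \<beta> (\<phi> (Cl a (w \<cdot> h))) = w \<cdot> j" if "thru A T (K a) (K a) h" for h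
    using that
  proof (induction rule: thru.induct)
    case thru_Zer
    let ?z = "Zer A (K a) T"
    have "?z \<in> Hom A (K a) T" "Add A ?z ?z = ?z" using assms(1) by simp_all
    then have "\<beta> (\<phi> (Cl a ?z)) = Zer A T T"
      using add[of ?z ?z] \<beta>\<phi>[of ?z] add_idem_zer[of "\<beta> (\<phi> (Cl a ?z))"] by simp
    then show ?case
      using assms(1) by (intro bexI[of _ "Zer A T (K a)"]) simp_all
  next
    case (thru_Add h f g)
    then obtain j where j: "j \<in> Hom A T (K a)" "\<And>w. w \<in> Hom A (K a) T \<Longrightarrow> \<beta> (\<phi> (Cl a (w \<cdot> h))) = w \<cdot> j"
      by blast
    have h: "h \<in> Hom A (K a) (K a)"
      by (rule thru_arr[OF thru_Add(1)]) (use assms(1) in simp_all)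
    have f: "f \<in> Hom A (K a) T" and g: "g \<in> Hom A T (K a)" using thru_Add by simp_all
    show ?case
    proof (intro bexI[of _ "Add A j (g \<cdot> \<beta> (\<phi> (Cl a f)))"] ballI)
      show "Add A j (g \<cdot> \<beta> (\<phi> (Cl a f))) \<in> Hom A T (K a)"
        using j(1) g \<beta>\<phi>[OF f] by simp
      fix w assume w: "w \<in> Hom A (K a) T"
      have "w \<cdot> g \<in> Hom A T T" using w g by simp
      then obtain d where d: "d \<in> carrier \<Delta>" "\<beta> d = w \<cdot> g" using \<beta>_surj by blast
      have "w \<cdot> Add A h (g \<cdot> f) = Add A (w \<cdot> h) (\<beta> d \<cdot> f)"
        using w g f h by (simp add: d(2))
      moreover have "w \<cdot> h \<in> Hom A (K a) T" "\<beta> d \<cdot> f \<in> Hom A (K a) T"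
        using w g f h by (simp_all add: d(2))
      ultimately have "\<beta> (\<phi> (Cl a (w \<cdot> Add A h (g \<cdot> f)))) = Add A (w \<cdot> j) (\<beta> (\<phi> (Cl a (\<beta> d \<cdot> f))))"
        using add j(2)[OF w] by simp
      also have "\<phi> (Cl a (\<beta> d \<cdot> f)) = d \<otimes>\<^bsub>\<Delta>\<^esub> \<phi> (Cl a f)"
        by (rule D_Cl(3)[OF assms(2,1) f f d(1)])
      also have "\<beta> \<dots> = (w \<cdot> g) \<cdot> \<beta> (\<phi> (Cl a f))"
        using \<beta>_simps(4)[OF d(1)] D_Cl(1)[OF assms(2,1) f f d(1)] by (simp add: d(2))
      also have "Add A (w \<cdot> j) ((w \<cdot> g) \<cdot> \<beta> (\<phi> (Cl a f))) = w \<cdot> Add A j (g \<cdot> \<beta> (\<phi> (Cl a f)))"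
        using w j(1) g \<beta>\<phi>[OF f] by simp
      finally show "\<beta> (\<phi> (Cl a (w \<cdot> Add A h (g \<cdot> f)))) = w \<cdot> Add A j (g \<cdot> \<beta> (\<phi> (Cl a f)))" .
    qed
  qed
  from this[OF T_thru[OF K_P[OF assms(1)]]]
  obtain j where j: "j \<in> Hom A T (K a)" "\<And>w. w \<in> Hom A (K a) T \<Longrightarrow> \<beta> (\<phi> (Cl a w)) = w \<cdot> j"
    by fastforce
  \<comment> \<open>The arrow \<open>j\<close> starts at \<open>T\<close>; \<open>u\<close>
    identifies \<open>K S\<close> with \<open>T\<close>, and only arrows from \<open>K S\<close>
    come from arrows out of \<open>S\<close>.\<close>
  obtain h where h: "h \<in> Arr A" "Dom A h = S" "Cod A h = a" "Km h = j \<cdot> u"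
    by (rule Km_surj[OF assms(1), of "j \<cdot> u"]) (assumption | use j in simp)+
  have "rep a \<phi> h"
    unfolding rep_def
  proof (intro conjI ballI)
    fix w assume w: "w \<in> Hom A (K a) T"
    show "\<beta> (\<phi> (Cl a w)) \<cdot> u = w \<cdot> Km h"
      using w j(1) by (simp add: j(2)[OF w] h(4))
  qed (use h in simp)
  then show ?thesis ..
qed

text \<open>Arrows into the object \<open>K a\<close> of \<open>P\<close> are separated by arrows to
  \<open>T\<close>, and \<open>Km\<close> is injective on arrows out of \<open>S\<close>.\<close>

lemma rep_unique:
  assumes "a \<in> Obj A" "rep a \<phi> h" "rep a \<phi> h'"
  shows "h = h'"
proof (rule Km_inj)
  have h: "h \<in> Arr A" "Dom A h = S" "Cod A h = a" "h' \<in> Arr A" "Dom A h' = S" "Cod A h' = a"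
    using assms by (auto simp add: rep_def)
  then show "h \<in> Arr A" "Dom A h = S" "h' \<in> Arr A" "Dom A h' = S" "Cod A h = Cod A h'"
    by simp_all
  note s = h Km(1-3)[OF h(1)] Km(1-3)[OF h(4)]
  let ?z = "Add A (Km h) (neg (Km h'))"
  have z: "?z \<in> Arr A" "Dom A ?z = K S" "Cod A ?z = K a"
    using s by simp_all
  have "g \<cdot> ?z = Zer A (K S) T" if "g \<in> Hom A (K a) T" for g
  proof -
    have "g \<cdot> Km h = g \<cdot> Km h'"
      using assms(2,3) that unfolding rep_def by metis
    then show ?thesis using that s by simp
  qed
  then have "?z = Zer A (K S) (K a)"
    using zero_by_T_targets[of ?z] z K_P[OF assms(1)] by simp
  then show "Km h = Km h'"
    by (rule diff_eq_zer) (use s in simp_all)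
qed

lemma \<beta>_cancel_u:
  assumes "\<beta> d \<cdot> u = \<beta> e \<cdot> u" "d \<in> carrier \<Delta>" "e \<in> carrier \<Delta>"
  shows "d = e"
proof -
  have "(\<beta> d \<cdot> u) \<cdot> v = (\<beta> e \<cdot> u) \<cdot> v"
    using assms(1) by simp
  then have "\<beta> d = \<beta> e"
    using assms(2,3) \<beta>_simps uv by simp
  then show ?thesis
    using \<beta>_inj assms by blast
qed

text \<open>Additivity and linearity need not be imposed on a represented function: they hold for
  composition with \<open>Km h\<close>, and both \<open>u\<close> and \<beta> can be
  cancelled.\<close>

lemma rep_in_D:
  assumes "a \<in> Obj A" "\<phi> \<in> Ext1 A a T \<rightarrow>\<^sub>E carrier \<Delta>" "rep a \<phi> h"
  shows "\<phi> \<in> D a"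
proof -
  interpret ring \<Delta> by (rule ring_\<Delta>)
  have h: "h \<in> Arr A" "Dom A h = S" "Cod A h = a" and r: "\<And>w. w \<in> Hom A (K a) T \<Longrightarrow> \<beta> (\<phi> (Cl a w)) \<cdot> u = w \<cdot> Km h"
    using assms(3) by (auto simp add: rep_def)
  have c: "\<phi> (Cl a w) \<in> carrier \<Delta>" if "w \<in> Hom A (K a) T" for w
    using assms(2) Cl_Ext1[OF assms(1) that] by blast
  note s = h Km(1-3)[OF h(1)]
  have add: "\<phi> (Cl a (Add A w w')) = \<phi> (Cl a w) \<oplus>\<^bsub>\<Delta>\<^esub> \<phi> (Cl a w')" if w: "w \<in> Hom A (K a) T" "w' \<in> Hom A (K a) T" for w w'
  proof (rule \<beta>_cancel_u)
    have ww: "Add A w w' \<in> Hom A (K a) T" using w by simp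
    show "\<phi> (Cl a (Add A w w')) \<in> carrier \<Delta>" by (rule c[OF ww])
    have "\<beta> (\<phi> (Cl a w) \<oplus>\<^bsub>\<Delta>\<^esub> \<phi> (Cl a w')) \<cdot> u = Add A (w \<cdot> Km h) (w' \<cdot> Km h)"
      using c[OF w(1)] c[OF w(2)] \<beta>_simps r[OF w(1)] r[OF w(2)] by simp
    then show "\<beta> (\<phi> (Cl a (Add A w w'))) \<cdot> u = \<beta> (\<phi> (Cl a w) \<oplus>\<^bsub>\<Delta>\<^esub> \<phi> (Cl a w')) \<cdot> u"
      using r[OF ww] w s by simp
  qed (use c w in simp)
  have smult: "\<phi> (Cl a (\<beta> d \<cdot> w)) = d \<otimes>\<^bsub>\<Delta>\<^esub> \<phi> (Cl a w)" if w: "w \<in> Hom A (K a) T" and d: "d \<in> carrier \<Delta>" for w d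
  proof (rule \<beta>_cancel_u)
    have ww: "\<beta> d \<cdot> w \<in> Hom A (K a) T" using w \<beta>_simps(1-3)[OF d] by simp
    show "\<phi> (Cl a (\<beta> d \<cdot> w)) \<in> carrier \<Delta>" by (rule c[OF ww])
    have "\<beta> (d \<otimes>\<^bsub>\<Delta>\<^esub> \<phi> (Cl a w)) \<cdot> u = \<beta> d \<cdot> (w \<cdot> Km h)"
      using c[OF w] d \<beta>_simps r[OF w] by simp
    then show "\<beta> (\<phi> (Cl a (\<beta> d \<cdot> w))) \<cdot> u = \<beta> (d \<otimes>\<^bsub>\<Delta>\<^esub> \<phi> (Cl a w)) \<cdot> u"
      using r[OF ww] w s \<beta>_simps(1-3)[OF d] by simp
  qed (use c w d in simp)
  have "\<beta> d \<in> Hom A T T" if "d \<in> carrier \<Delta>" for d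
    using \<beta>_simps(1-3)[OF that] by simp
  then show ?thesis
    unfolding D_iff using assms(2) add smult
    by (auto simp only: Ext1_eq_Cl[OF assms(1)] baer_sum_Cl[OF assms(1)] ext_push_Cl[OF assms(1)])
qed

lemma rep_unique_functional:
  assumes "a \<in> Obj A" "\<phi> \<in> Ext1 A a T \<rightarrow>\<^sub>E carrier \<Delta>" "\<psi> \<in> Ext1 A a T \<rightarrow>\<^sub>E carrier \<Delta>" "rep a \<phi> h" "rep a \<psi> h"
  shows "\<phi> = \<psi>"
proof (rule PiE_ext[OF assms(2,3)])
  fix \<xi> assume x: "\<xi> \<in> Ext1 A a T"
  then obtain w where w: "w \<in> Hom A (K a) T" "\<xi> = Cl a w"
    using Ext1_eq_Cl[OF assms(1)] by auto
  show "\<phi> \<xi> = \<psi> \<xi>"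
    using assms(4,5) w(1) x assms(2,3) unfolding rep_def w(2) by (intro \<beta>_cancel_u) (auto simp del: in_Hom)
qed

lemma rep_functional_ex:
  assumes "h \<in> Arr A" "Dom A h = S" "Cod A h = a"
  shows "\<exists>\<phi> \<in> D a. rep a \<phi> h"
proof -
  have a: "a \<in> Obj A" using assms by auto
  note s = assms Km(1-3)[OF assms(1)]
  \<comment> \<open>The value \<open>d\<close> solves
    \<open>\<beta> d \<cdot> u = w \<cdot> Km h\<close> by means of the inverse \<open>v\<close> of
    \<open>u\<close>. By \<open>Cl_inj\<close> exactly one \<open>w\<close> belongs to a given
    class, so the condition can be met.\<close>
  define Q where "Q \<xi> d \<longleftrightarrow> d \<in> carrier \<Delta> \<and> (\<forall>w \<in> Hom A (K a) T. \<xi> = Cl a w \<longrightarrow> \<beta> d = w \<cdot> Km h \<cdot> v)" for \<xi> d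
  define \<phi> where "\<phi> = (\<lambda>\<xi> \<in> Ext1 A a T. SOME d. Q \<xi> d)"
  have ex: "Q \<xi> (\<phi> \<xi>)" if x: "\<xi> \<in> Ext1 A a T" for \<xi>
  proof -
    obtain w where w: "w \<in> Hom A (K a) T" "\<xi> = Cl a w"
      using Ext1_eq_Cl[OF a] x by auto
    have "w \<cdot> Km h \<cdot> v \<in> Hom A T T"
      using w(1) s by simp
    then obtain d where "d \<in> carrier \<Delta>" "\<beta> d = w \<cdot> Km h \<cdot> v"
      using \<beta>_surj by blast
    then have "\<exists>d. Q \<xi> d"
      unfolding Q_def using Cl_inj[OF a _ w(1)] w(2) by blast
    moreover have "\<phi> \<xi> = (SOME d. Q \<xi> d)"
      unfolding \<phi>_def by (rule restrict_apply'[OF x])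
    ultimately show ?thesis
      using someI_ex[of "Q \<xi>"] by simp
  qed
  have \<phi>: "\<phi> \<in> Ext1 A a T \<rightarrow>\<^sub>E carrier \<Delta>"
  proof (rule PiE_I)
    show "\<phi> x \<in> carrier \<Delta>" if "x \<in> Ext1 A a T" for x
      using ex[OF that] unfolding Q_def by blast
  qed (simp add: \<phi>_def)
  have "rep a \<phi> h"
    unfolding rep_def
  proof (intro conjI ballI)
    fix w assume w: "w \<in> Hom A (K a) T"
    have "\<beta> (\<phi> (Cl a w)) = w \<cdot> Km h \<cdot> v"
      using ex[OF Cl_Ext1[OF a w]] w unfolding Q_def by blast
    then show "\<beta> (\<phi> (Cl a w)) \<cdot> u = w \<cdot> Km h"
      using w s vu by simp
  qed (use assms in simp)
  with rep_in_D[OF a \<phi>] show ?thesis by blast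
qed

lemma rep_add:
  assumes "a \<in> Obj A" "\<phi> \<in> D a" "\<psi> \<in> D a" "rep a \<phi> h" "rep a \<psi> h'"
  shows "(\<lambda>x \<in> Ext1 A a T. \<phi> x \<oplus>\<^bsub>\<Delta>\<^esub> \<psi> x) \<in> Ext1 A a T \<rightarrow>\<^sub>E carrier \<Delta>"
    "rep a (\<lambda>x \<in> Ext1 A a T. \<phi> x \<oplus>\<^bsub>\<Delta>\<^esub> \<psi> x) (Add A h h')"
proof -
  interpret ring \<Delta> by (rule ring_\<Delta>)
  have c: "\<phi> x \<in> carrier \<Delta>" "\<psi> x \<in> carrier \<Delta>" if "x \<in> Ext1 A a T" for x
    using assms(2,3) that unfolding D_iff by blast+
  show "(\<lambda>x \<in> Ext1 A a T. \<phi> x \<oplus>\<^bsub>\<Delta>\<^esub> \<psi> x) \<in> Ext1 A a T \<rightarrow>\<^sub>E carrier \<Delta>"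
    using c by auto
  have h: "h \<in> Arr A" "Dom A h = S" "Cod A h = a" "h' \<in> Arr A" "Dom A h' = S" "Cod A h' = a"
    using assms by (auto simp add: rep_def)
  note s = h Km(1-3)[OF h(1)] Km(1-3)[OF h(4)]
  show "rep a (\<lambda>x \<in> Ext1 A a T. \<phi> x \<oplus>\<^bsub>\<Delta>\<^esub> \<psi> x) (Add A h h')"
    unfolding rep_def
  proof (intro conjI ballI)
    fix w assume w: "w \<in> Hom A (K a) T"
    have r: "\<beta> (\<phi> (Cl a w)) \<cdot> u = w \<cdot> Km h" "\<beta> (\<psi> (Cl a w)) \<cdot> u = w \<cdot> Km h'"
      using assms(4,5) w unfolding rep_def by blast+
    have "Km (Add A h h') = Add A (Km h) (Km h')"
      by (rule Km_Add) (use s in simp_all)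
    then show "\<beta> ((\<lambda>x \<in> Ext1 A a T. \<phi> x \<oplus>\<^bsub>\<Delta>\<^esub> \<psi> x) (Cl a w)) \<cdot> u = w \<cdot> Km (Add A h h')"
      using r w s Cl_Ext1[OF assms(1) w] c[OF Cl_Ext1[OF assms(1) w]] \<beta>_simps by simp
  qed (use s in simp)
qed

text \<open>The point where compatibility of \<alpha> and \<beta> is used: the right factor
  \<open>\<beta> r\<close> in front of \<open>u\<close> moves across \<open>u\<close> and becomes
  precomposition with \<open>\<alpha> r\<close>.\<close>

lemma rep_smult:
  assumes "a \<in> Obj A" "\<phi> \<in> D a" "rep a \<phi> h" "r \<in> carrier \<Delta>"
  shows "(\<lambda>x \<in> Ext1 A a T. \<phi> x \<otimes>\<^bsub>\<Delta>\<^esub> r) \<in> Ext1 A a T \<rightarrow>\<^sub>E carrier \<Delta>"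
    "rep a (\<lambda>x \<in> Ext1 A a T. \<phi> x \<otimes>\<^bsub>\<Delta>\<^esub> r) (h \<cdot> \<alpha> r)"
proof -
  interpret ring \<Delta> by (rule ring_\<Delta>)
  have c: "\<phi> x \<in> carrier \<Delta>" if "x \<in> Ext1 A a T" for x
    using assms(2) that unfolding D_iff by blast
  show "(\<lambda>x \<in> Ext1 A a T. \<phi> x \<otimes>\<^bsub>\<Delta>\<^esub> r) \<in> Ext1 A a T \<rightarrow>\<^sub>E carrier \<Delta>"
    using c assms(4) by auto
  have h: "h \<in> Arr A" "Dom A h = S" "Cod A h = a"
    using assms by (auto simp add: rep_def)
  note \<alpha>r = \<alpha>_simps(1-3)[OF assms(4)]
  note s = h Km(1-3)[OF h(1)] \<alpha>r Km(1-3)[OF \<alpha>r(1)]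
  show "rep a (\<lambda>x \<in> Ext1 A a T. \<phi> x \<otimes>\<^bsub>\<Delta>\<^esub> r) (h \<cdot> \<alpha> r)"
    unfolding rep_def
  proof (intro conjI ballI)
    fix w assume w: "w \<in> Hom A (K a) T"
    have r: "\<beta> (\<phi> (Cl a w)) \<cdot> u = w \<cdot> Km h"
      using assms(3) w unfolding rep_def by blast
    have K: "Km (h \<cdot> \<alpha> r) = Km h \<cdot> Km (\<alpha> r)"
      by (rule Km_comp) (use s in simp_all)
    have b: "\<beta> (\<phi> (Cl a w)) \<in> Arr A" "Dom A (\<beta> (\<phi> (Cl a w))) = T" "Cod A (\<beta> (\<phi> (Cl a w))) = T"
      using \<beta>_simps c[OF Cl_Ext1[OF assms(1) w]] by simp_all
    have "\<beta> (\<phi> (Cl a w) \<otimes>\<^bsub>\<Delta>\<^esub> r) \<cdot> u = \<beta> (\<phi> (Cl a w)) \<cdot> (\<beta> r \<cdot> u)"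
      using b \<beta>_simps assms(4) c[OF Cl_Ext1[OF assms(1) w]] by simp
    also have "\<dots> = \<beta> (\<phi> (Cl a w)) \<cdot> (u \<cdot> Km (\<alpha> r))"
      using u_comm[OF assms(4)] by simp
    also have "\<dots> = (w \<cdot> Km h) \<cdot> Km (\<alpha> r)"
      by (rule comp_subst[OF r]) (use b s in simp_all)
    finally show "\<beta> ((\<lambda>x \<in> Ext1 A a T. \<phi> x \<otimes>\<^bsub>\<Delta>\<^esub> r) (Cl a w)) \<cdot> u = w \<cdot> Km (h \<cdot> \<alpha> r)"
      using w s Cl_Ext1[OF assms(1) w] by (simp add: K)
  qed (use s in simp)
qed

lemma rep_Mmap:
  assumes "f \<in> Arr A" "Dom A f = a" "Cod A f = b" "\<phi> \<in> D a" "rep a \<phi> h"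
  shows "(\<lambda>\<xi> \<in> Ext1 A b T. \<phi> (ext_pull A f \<xi>)) \<in> Ext1 A b T \<rightarrow>\<^sub>E carrier \<Delta>"
    "rep b (\<lambda>\<xi> \<in> Ext1 A b T. \<phi> (ext_pull A f \<xi>)) (f \<cdot> h)"
proof -
  have ab: "a \<in> Obj A" "b \<in> Obj A" using assms by auto
  have h: "h \<in> Arr A" "Dom A h = S" "Cod A h = a"
    using assms by (auto simp add: rep_def)
  note s = h Km(1-3)[OF h(1)] assms(1-3) Km(1-3)[OF assms(1)]
  have pw: "w \<cdot> Km f \<in> Hom A (K a) T" if "w \<in> Hom A (K b) T" for w
    using that s by simp
  show "(\<lambda>\<xi> \<in> Ext1 A b T. \<phi> (ext_pull A f \<xi>)) \<in> Ext1 A b T \<rightarrow>\<^sub>E carrier \<Delta>"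
  proof (rule restrict_PiE_iff[THEN iffD2], rule ballI)
    fix \<xi> assume "\<xi> \<in> Ext1 A b T"
    then obtain w where w: "w \<in> Hom A (K b) T" "\<xi> = Cl b w"
      using Ext1_eq_Cl[OF ab(2)] by auto
    have "ext_pull A f \<xi> \<in> Ext1 A a T"
      unfolding w(2) ext_pull_Cl[OF assms(1-3) w(1)] by (rule Cl_Ext1[OF ab(1) pw[OF w(1)]])
    then show "\<phi> (ext_pull A f \<xi>) \<in> carrier \<Delta>"
      using assms(4) unfolding D_iff by blast
  qed
  show "rep b (\<lambda>\<xi> \<in> Ext1 A b T. \<phi> (ext_pull A f \<xi>)) (f \<cdot> h)"
    unfolding rep_def
  proof (intro conjI ballI)
    fix w assume w: "w \<in> Hom A (K b) T"
    have r: "\<beta> (\<phi> (Cl a (w \<cdot> Km f))) \<cdot> u = (w \<cdot> Km f) \<cdot> Km h"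
      using assms(5) pw[OF w] unfolding rep_def by blast
    have "Km (f \<cdot> h) = Km f \<cdot> Km h"
      by (rule Km_comp) (use s in simp_all)
    then show "\<beta> ((\<lambda>\<xi> \<in> Ext1 A b T. \<phi> (ext_pull A f \<xi>)) (Cl b w)) \<cdot> u = w \<cdot> Km (f \<cdot> h)"
      using r w s Cl_Ext1[OF ab(2) w] ext_pull_Cl[OF assms(1-3) w] by simp
  qed (use s in simp)
qed

text \<open>Closure of the dual is read off from representability: each operation produces a
  represented function, to which \<open>rep_in_D\<close> applies. The dual functor is thereby well
  defined without module axioms for Ext.\<close>

lemma D_closed:
  assumes "a \<in> Obj A" "\<phi> \<in> D a"
  shows "\<psi> \<in> D a \<Longrightarrow> (\<lambda>x \<in> Ext1 A a T. \<phi> x \<oplus>\<^bsub>\<Delta>\<^esub> \<psi> x) \<in> D a"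
    "r \<in> carrier \<Delta> \<Longrightarrow> (\<lambda>x \<in> Ext1 A a T. \<phi> x \<otimes>\<^bsub>\<Delta>\<^esub> r) \<in> D a"
    "f \<in> Hom A a b \<Longrightarrow> (\<lambda>\<xi> \<in> Ext1 A b T. \<phi> (ext_pull A f \<xi>)) \<in> D b"
proof -
  obtain h where h: "rep a \<phi> h" using rep_ex[OF assms] ..
  show "(\<lambda>x \<in> Ext1 A a T. \<phi> x \<oplus>\<^bsub>\<Delta>\<^esub> \<psi> x) \<in> D a" if p: "\<psi> \<in> D a"
  proof -
    obtain h' where "rep a \<psi> h'" using rep_ex[OF assms(1) p] ..
    from rep_add[OF assms p h this] show ?thesis by (rule rep_in_D[OF assms(1)])
  qed
  show "(\<lambda>x \<in> Ext1 A a T. \<phi> x \<otimes>\<^bsub>\<Delta>\<^esub> r) \<in> D a" if "r \<in> carrier \<Delta>"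
    using rep_smult[OF assms h that] by (rule rep_in_D[OF assms(1)])
  show "(\<lambda>\<xi> \<in> Ext1 A b T. \<phi> (ext_pull A f \<xi>)) \<in> D b" if "f \<in> Hom A a b"
  proof -
    have f: "f \<in> Arr A" "Dom A f = a" "Cod A f = b" and b: "b \<in> Obj A" using that by auto
    show ?thesis
      using rep_Mmap[OF f assms(2) h] by (rule rep_in_D[OF b])
  qed
qed

text \<open>Functionals on Ext(a, T) and arrows from \<open>S\<close> to \<open>a\<close> represent
  each other uniquely. Taking the representing arrow is the isomorphism, and linearity and
  naturality are the \<open>rep\<close> lemmas.\<close>

theorem D_Ext_to_iso_Hom_from: "mod_func_iso A \<Delta> (D_Ext_to A \<Delta> \<beta> T) (Hom_from A \<alpha> S)"
proof -
  define \<tau> where "\<tau> = (\<lambda>a. \<lambda>\<phi> \<in> D a. THE h. rep a \<phi> h)"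
  have \<tau>I: "\<tau> a \<phi> = h" if "a \<in> Obj A" "\<phi> \<in> D a" "rep a \<phi> h" for a \<phi> h
    unfolding \<tau>_def restrict_apply'[OF that(2)]
    by (rule the_equality, rule that(3), rule rep_unique[OF that(1) _ that(3)])
  have \<tau>R: "rep a \<phi> (\<tau> a \<phi>)" if ap: "a \<in> Obj A" "\<phi> \<in> D a" for a \<phi>
  proof -
    obtain h where "rep a \<phi> h" using rep_ex[OF ap] ..
    with \<tau>I[OF ap this] show ?thesis by (simp only:)
  qed
  have \<tau>H: "\<tau> a \<phi> \<in> Hom A S a" if "a \<in> Obj A" "\<phi> \<in> D a" for a \<phi>
    using \<tau>R[OF that] unfolding rep_def by blast
  have DE: "\<phi> \<in> Ext1 A a T \<rightarrow>\<^sub>E carrier \<Delta>" if "\<phi> \<in> D a" for a \<phi>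
    using that unfolding D_iff by blast
  show ?thesis
    unfolding mod_func_iso_def
  proof (intro exI[of _ \<tau>] conjI ballI)
    fix a assume a: "a \<in> Obj A"
    show "\<tau> a \<in> module_homs \<Delta> (Mobj (D_Ext_to A \<Delta> \<beta> T) a) (Mobj (Hom_from A \<alpha> S) a)"
      unfolding module_homs_def
    proof (intro CollectI conjI ballI)
      show "\<tau> a \<in> carrier (Mobj (D_Ext_to A \<Delta> \<beta> T) a) \<rightarrow>\<^sub>E carrier (Mobj (Hom_from A \<alpha> S) a)"
      proof (rule PiE_I)
        show "\<tau> a \<phi> \<in> carrier (Mobj (Hom_from A \<alpha> S) a)" if "\<phi> \<in> carrier (Mobj (D_Ext_to A \<Delta> \<beta> T) a)" for \<phi>
          using \<tau>H[OF a, of \<phi>] that by (simp add: D_Ext_to_def Hom_from_def Hom_from_module_def)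
        show "\<tau> a \<phi> = undefined" if "\<phi> \<notin> carrier (Mobj (D_Ext_to A \<Delta> \<beta> T) a)" for \<phi>
          using that by (simp add: D_Ext_to_def \<tau>_def)
      qed
    next
      fix \<phi> \<psi> assume "\<phi> \<in> carrier (Mobj (D_Ext_to A \<Delta> \<beta> T) a)" "\<psi> \<in> carrier (Mobj (D_Ext_to A \<Delta> \<beta> T) a)"
      then have p: "\<phi> \<in> D a" "\<psi> \<in> D a" by (simp_all add: D_Ext_to_def)
      have "\<tau> a (\<lambda>x \<in> Ext1 A a T. \<phi> x \<oplus>\<^bsub>\<Delta>\<^esub> \<psi> x) = Add A (\<tau> a \<phi>) (\<tau> a \<psi>)"
        using rep_add[OF a p \<tau>R[OF a p(1)] \<tau>R[OF a p(2)]] rep_in_D[OF a] \<tau>I[OF a] by blast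
      then show "\<tau> a (\<phi> \<oplus>\<^bsub>Mobj (D_Ext_to A \<Delta> \<beta> T) a\<^esub> \<psi>) = \<tau> a \<phi> \<oplus>\<^bsub>Mobj (Hom_from A \<alpha> S) a\<^esub> \<tau> a \<psi>"
        by (simp add: D_Ext_to_def Hom_from_def Hom_from_module_def dual_of_left_def Ext_to_module_def)
    next
      fix r \<phi> assume r: "r \<in> carrier \<Delta>" and "\<phi> \<in> carrier (Mobj (D_Ext_to A \<Delta> \<beta> T) a)"
      then have p: "\<phi> \<in> D a" by (simp add: D_Ext_to_def)
      have "\<tau> a (\<lambda>x \<in> Ext1 A a T. \<phi> x \<otimes>\<^bsub>\<Delta>\<^esub> r) = \<tau> a \<phi> \<cdot> \<alpha> r"
        using rep_smult[OF a p \<tau>R[OF a p] r] rep_in_D[OF a] \<tau>I[OF a] by blast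
      then show "\<tau> a (r \<odot>\<^bsub>Mobj (D_Ext_to A \<Delta> \<beta> T) a\<^esub> \<phi>) = r \<odot>\<^bsub>Mobj (Hom_from A \<alpha> S) a\<^esub> \<tau> a \<phi>"
        by (simp add: D_Ext_to_def Hom_from_def Hom_from_module_def dual_of_left_def Ext_to_module_def)
    qed
    have "inj_on (\<tau> a) (D a)"
    proof (rule inj_onI)
      fix \<phi> \<psi> assume p: "\<phi> \<in> D a" "\<psi> \<in> D a" "\<tau> a \<phi> = \<tau> a \<psi>"
      show "\<phi> = \<psi>"
        by (rule rep_unique_functional[OF a DE[OF p(1)] DE[OF p(2)] \<tau>R[OF a p(1)]]) (use \<tau>R[OF a p(2)] p(3) in simp)
    qed
    moreover have "\<tau> a ` D a = Hom A S a"
    proof (intro subset_antisym subsetI)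
      show "h \<in> Hom A S a" if "h \<in> \<tau> a ` D a" for h
        using that \<tau>H[OF a] by blast
      show "h \<in> \<tau> a ` D a" if "h \<in> Hom A S a" for h
        using rep_functional_ex[of h a] that \<tau>I[OF a] by (auto simp add: image_iff) metis
    qed
    ultimately show "bij_betw (\<tau> a) (carrier (Mobj (D_Ext_to A \<Delta> \<beta> T) a)) (carrier (Mobj (Hom_from A \<alpha> S) a))"
      by (simp add: bij_betw_def D_Ext_to_def Hom_from_def Hom_from_module_def)
  next
    fix a b f \<phi> assume f: "a \<in> Obj A" "b \<in> Obj A" "f \<in> Hom A a b" and "\<phi> \<in> carrier (Mobj (D_Ext_to A \<Delta> \<beta> T) a)"
    then have p: "\<phi> \<in> D a" by (simp add: D_Ext_to_def)
    have "\<tau> b (\<lambda>\<xi> \<in> Ext1 A b T. \<phi> (ext_pull A f \<xi>)) = f \<cdot> \<tau> a \<phi>"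
      using rep_Mmap[of f a b, OF _ _ _ p \<tau>R[OF f(1) p]] rep_in_D[OF f(2)] \<tau>I[OF f(2)] f(3) by (metis in_Hom)
    then show "\<tau> b (Mmap (D_Ext_to A \<Delta> \<beta> T) f \<phi>) = Mmap (Hom_from A \<alpha> S) f (\<tau> a \<phi>)"
      using f(3) by (simp add: D_Ext_to_def Hom_from_def)
  qed
qed

end

section \<open>Compatible identifications of the endomorphism rings\<close>

context perp_pairing
begin

lemma compatible_perp_duality:
  assumes "ring \<Delta>" "compatible_identification A \<Delta> S T \<alpha> \<beta>"
  obtains u v where "perp_duality A Bs P c k T S \<Delta> \<alpha> \<beta> u v"
proof -
  obtain \<xi> where iso: "\<alpha> \<in> ring_iso \<Delta> (End_ring A S)" "\<beta> \<in> ring_iso \<Delta> (End_ring A T)"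
    and \<xi>: "\<xi> \<in> Ext1 A S T" "\<xi> \<noteq> Ext1_zero A S T" "\<And>d. d \<in> carrier \<Delta> \<Longrightarrow> ext_pull A (\<alpha> d) \<xi> = ext_push A (\<beta> d) \<xi>"
    using assms(2) unfolding compatible_identification_def by blast
  obtain u where u: "u \<in> Hom A (K S) T" "\<xi> = Cl S u"
    using \<xi>(1) Ext1_eq_Cl[OF S_obj] by auto
  have "u \<noteq> Zer A (K S) T"
    using \<xi>(2) u(2) Ext1_zero_eq_Cl[OF S_obj] by auto
  then obtain v where v: "v \<in> Hom A T (K S)" "u \<cdot> v = Ide A T" "v \<cdot> u = Ide A (K S)"
    using nonzero_K_S_T_iso[OF u(1)] by metis
  have "u \<cdot> Km (\<alpha> d) = \<beta> d \<cdot> u" if d: "d \<in> carrier \<Delta>" for d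
  proof (rule Cl_inj[OF S_obj])
    note s = ring_iso_EndD(1-3)[OF iso(1) d] ring_iso_EndD(1-3)[OF iso(2) d] Km(1-3)[OF ring_iso_EndD(1)[OF iso(1) d]]
    show "u \<cdot> Km (\<alpha> d) \<in> Hom A (K S) T" "\<beta> d \<cdot> u \<in> Hom A (K S) T"
      using u(1) s by simp_all
    show "Cl S (u \<cdot> Km (\<alpha> d)) = Cl S (\<beta> d \<cdot> u)"
      using ext_pull_Cl[of "\<alpha> d" S S u] ext_push_Cl[of S "\<beta> d" u] s u \<xi>(3)[OF d] by simp
  qed
  then have "perp_duality A Bs P c k T S \<Delta> \<alpha> \<beta> u v"
    by (intro perp_duality.intro perp_duality_axioms.intro perp_pairing_axioms assms(1) iso u v)
  then show ?thesis by (rule that)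
qed

text \<open>Endomorphisms of \<open>T\<close> become endomorphisms of \<open>K S\<close> by
  conjugation with the isomorphism \<open>j\<close>, and then endomorphisms of \<open>S\<close> by
  inverting \<open>Km\<close>. Composing \<beta> with these gives \<alpha>, and the class of
  \<open>r\<close> is the one on which both agree.\<close>

lemma compatible_identification_ex:
  assumes "\<beta> \<in> ring_iso \<Delta> (End_ring A T)" "ring \<Delta>"
  shows "\<exists>\<alpha>. compatible_identification A \<Delta> S T \<alpha> \<beta>"
proof (rule K_S_iso_T)
  interpret ring \<Delta> by fact
  fix j r assume "j \<in> Hom A T (K S)" "r \<in> Hom A (K S) T" and rj: "r \<cdot> j = Ide A T" and jr: "j \<cdot> r = Ide A (K S)"
  then have [simp]: "j \<in> Arr A" "Dom A j = T" "Cod A j = K S" "r \<in> Arr A" "Dom A r = K S" "Cod A r = T"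
    by simp_all
  note \<beta> = ring_iso_EndD[OF assms(1)]
  define \<alpha> where "\<alpha> d = (SOME h. h \<in> Hom A S S \<and> Km h = j \<cdot> \<beta> d \<cdot> r)" for d
  have ex: "\<alpha> d \<in> Hom A S S \<and> Km (\<alpha> d) = j \<cdot> \<beta> d \<cdot> r" if d: "d \<in> carrier \<Delta>" for d
  proof -
    obtain h where "h \<in> Arr A" "Dom A h = S" "Cod A h = S" "Km h = j \<cdot> \<beta> d \<cdot> r"
      by (rule Km_surj[of S "j \<cdot> \<beta> d \<cdot> r"]) (assumption | use \<beta>(1-3)[OF d] in simp)+
    then have "\<exists>h. h \<in> Hom A S S \<and> Km h = j \<cdot> \<beta> d \<cdot> r" by auto
    from someI_ex[OF this] show ?thesis unfolding \<alpha>_def .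
  qed
  have eqI: "h = h'" if "h \<in> Hom A S S" "h' \<in> Hom A S S" "Km h = Km h'" for h h'
    using Km_inj[of h h'] that by simp
  have iso: "\<alpha> \<in> ring_iso \<Delta> (End_ring A S)"
  proof (rule ring_iso_EndI)
    show a: "\<alpha> d \<in> Hom A S S" if "d \<in> carrier \<Delta>" for d using ex[OF that] by blast
    show "\<alpha> (d \<otimes>\<^bsub>\<Delta>\<^esub> e) = \<alpha> d \<cdot> \<alpha> e" if d: "d \<in> carrier \<Delta>" "e \<in> carrier \<Delta>" for d e
    proof (rule eqI)
      have de: "d \<otimes>\<^bsub>\<Delta>\<^esub> e \<in> carrier \<Delta>" using d by simp
      show "\<alpha> (d \<otimes>\<^bsub>\<Delta>\<^esub> e) \<in> Hom A S S" by (rule a[OF de])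
      show "\<alpha> d \<cdot> \<alpha> e \<in> Hom A S S" using a[OF d(1)] a[OF d(2)] by simp
      have "Km (\<alpha> d \<cdot> \<alpha> e) = (j \<cdot> \<beta> d \<cdot> r) \<cdot> (j \<cdot> \<beta> e \<cdot> r)"
        using Km_comp[of "\<alpha> e" "\<alpha> d"] a[OF d(1)] a[OF d(2)] ex[OF d(1)] ex[OF d(2)] by simp
      also have "\<dots> = j \<cdot> \<beta> (d \<otimes>\<^bsub>\<Delta>\<^esub> e) \<cdot> r"
        using \<beta>(1-3)[OF d(1)] \<beta>(1-3)[OF d(2)] \<beta>(4)[OF d] by (simp add: comp_subst[OF rj])
      finally show "Km (\<alpha> (d \<otimes>\<^bsub>\<Delta>\<^esub> e)) = Km (\<alpha> d \<cdot> \<alpha> e)"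
        using ex[OF de] by simp
    qed
    show "\<alpha> (d \<oplus>\<^bsub>\<Delta>\<^esub> e) = Add A (\<alpha> d) (\<alpha> e)" if d: "d \<in> carrier \<Delta>" "e \<in> carrier \<Delta>" for d e
    proof (rule eqI)
      have de: "d \<oplus>\<^bsub>\<Delta>\<^esub> e \<in> carrier \<Delta>" using d by simp
      show "\<alpha> (d \<oplus>\<^bsub>\<Delta>\<^esub> e) \<in> Hom A S S" by (rule a[OF de])
      show "Add A (\<alpha> d) (\<alpha> e) \<in> Hom A S S" using a[OF d(1)] a[OF d(2)] by simp
      have "Km (Add A (\<alpha> d) (\<alpha> e)) = Add A (j \<cdot> \<beta> d \<cdot> r) (j \<cdot> \<beta> e \<cdot> r)"
        using Km_Add[of "\<alpha> d" "\<alpha> e"] a[OF d(1)] a[OF d(2)] ex[OF d(1)] ex[OF d(2)] by simp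
      also have "\<dots> = j \<cdot> \<beta> (d \<oplus>\<^bsub>\<Delta>\<^esub> e) \<cdot> r"
        using \<beta>(1-3)[OF d(1)] \<beta>(1-3)[OF d(2)] \<beta>(5)[OF d] by simp
      finally show "Km (\<alpha> (d \<oplus>\<^bsub>\<Delta>\<^esub> e)) = Km (Add A (\<alpha> d) (\<alpha> e))"
        using ex[OF de] by simp
    qed
    show "\<alpha> \<one>\<^bsub>\<Delta>\<^esub> = Ide A S"
    proof (rule eqI)
      show "Km (\<alpha> \<one>\<^bsub>\<Delta>\<^esub>) = Km (Ide A S)"
        using ex[of "\<one>\<^bsub>\<Delta>\<^esub>"] \<beta>(6) jr by (simp add: Km_Ide)
    qed (use a[of "\<one>\<^bsub>\<Delta>\<^esub>"] in simp_all)
    have recover: "r \<cdot> (Km (\<alpha> d) \<cdot> j) = \<beta> d" if "d \<in> carrier \<Delta>" for d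
      using ex[OF that] \<beta>(1-3)[OF that] by (simp add: rj comp_subst[OF rj])
    show "d = e" if d: "d \<in> carrier \<Delta>" "e \<in> carrier \<Delta>" "\<alpha> d = \<alpha> e" for d e
      using recover[OF d(1)] recover[OF d(2)] d(3) \<beta>(7)[OF _ d(1,2)] by simp
    show "\<exists>d \<in> carrier \<Delta>. \<alpha> d = t" if t: "t \<in> Hom A S S" for t
    proof -
      have tt: "t \<in> Arr A" "Dom A t = S" "Cod A t = S" using t by simp_all
      note [simp] = tt Km(1-3)[OF tt(1)]
      have "r \<cdot> (Km t \<cdot> j) \<in> Hom A T T" by simp
      then obtain d where d: "d \<in> carrier \<Delta>" "\<beta> d = r \<cdot> (Km t \<cdot> j)" using \<beta>(8) by blast
      have "\<alpha> d = t"
        by (rule eqI) (use a[OF d(1)] t ex[OF d(1)] in \<open>simp_all add: d(2) jr comp_subst[OF jr]\<close>)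
      with d(1) show ?thesis by blast
    qed
  qed
  have "r \<in> Hom A (K S) T" by simp
  moreover have "r \<noteq> Zer A (K S) T"
    using rj T_nonzero by auto
  moreover have "Zer A (K S) T \<in> Hom A (K S) T" by simp
  ultimately have "Cl S r \<in> Ext1 A S T" "Cl S r \<noteq> Ext1_zero A S T"
    using Ext1_eq_Cl[OF S_obj] Ext1_zero_eq_Cl[OF S_obj] Cl_inj[OF S_obj, of r "Zer A (K S) T"] by blast+
  moreover have "ext_pull A (\<alpha> d) (Cl S r) = ext_push A (\<beta> d) (Cl S r)" if d: "d \<in> carrier \<Delta>" for d
    using ext_pull_Cl[of "\<alpha> d" S S r] ext_push_Cl[of S "\<beta> d" r] ex[OF d] \<beta>(1-3)[OF d]
    by (simp add: comp_subst[OF rj])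
  ultimately have "compatible_identification A \<Delta> S T \<alpha> \<beta>"
    unfolding compatible_identification_def using iso assms(1) by blast
  then show ?thesis by blast
qed

end

text \<open>Endomorphism rings computed in the opposite category have the reversed multiplication,
  so an identification with \<Delta> in \<open>op_cat A\<close> is one with
  \<open>op_ring \<Delta>\<close> in \<open>A\<close>.\<close>

definition op_ring :: "'r ring \<Rightarrow> 'r ring" where
  "op_ring R = R\<lparr>mult := (\<lambda>x y. y \<otimes>\<^bsub>R\<^esub> x)\<rparr>"

lemma op_ring_simps [simp]:
  "carrier (op_ring R) = carrier R" "x \<otimes>\<^bsub>op_ring R\<^esub> y = y \<otimes>\<^bsub>R\<^esub> x" "\<one>\<^bsub>op_ring R\<^esub> = \<one>\<^bsub>R\<^esub>"
  "\<zero>\<^bsub>op_ring R\<^esub> = \<zero>\<^bsub>R\<^esub>" "x \<oplus>\<^bsub>op_ring R\<^esub> y = x \<oplus>\<^bsub>R\<^esub> y"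
  by (simp_all add: op_ring_def)

lemma ring_op_ring:
  assumes "ring R"
  shows "ring (op_ring R)"
proof -
  interpret ring R by fact
  have "abelian_group (op_ring R)"
  proof (rule abelian_groupI)
    fix x assume "x \<in> carrier (op_ring R)"
    then show "\<exists>y \<in> carrier (op_ring R). y \<oplus>\<^bsub>op_ring R\<^esub> x = \<zero>\<^bsub>op_ring R\<^esub>"
      by (intro bexI[of _ "\<ominus>\<^bsub>R\<^esub> x"]) (simp_all add: l_neg)
  qed (simp_all add: a_ac)
  moreover have "monoid (op_ring R)"
    by (rule monoidI) (auto simp add: m_assoc)
  ultimately show ?thesis
    by (intro ringI) (auto simp add: l_distr r_distr)
qed

lemma ring_iso_op_End:
  assumes "\<alpha> \<in> ring_iso \<Delta> (End_ring C x)"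
  shows "\<alpha> \<in> ring_iso (op_ring \<Delta>) (End_ring (op_cat C) x)"
  using ring_iso_EndD[OF assms] by (intro ring_iso_EndI) (simp_all del: in_Hom, simp)

context abelian_category
begin

lemma Ext1_subset: "\<xi> \<in> Ext1 C z x \<Longrightarrow> \<xi> \<subseteq> extensions C z x"
  using equiv_type[OF ext_equiv_equiv[of z x]] by (auto simp add: Ext1_def quotient_def)

lemma converse_Ext1_op: "\<xi> \<in> Ext1 (op_cat C) z x \<longleftrightarrow> \<xi>\<inverse> \<in> Ext1 C x z"
  unfolding Ext1_op by (auto simp add: image_iff)

lemma compatible_identification_op:
  assumes "compatible_identification C \<Delta> S T \<alpha> \<beta>"
  shows "compatible_identification (op_cat C) (op_ring \<Delta>) T S \<beta> \<alpha>"
proof -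
  obtain \<xi> where iso: "\<alpha> \<in> ring_iso \<Delta> (End_ring C S)" "\<beta> \<in> ring_iso \<Delta> (End_ring C T)"
    and \<xi>: "\<xi> \<in> Ext1 C S T" "\<xi> \<noteq> Ext1_zero C S T" "\<And>d. d \<in> carrier \<Delta> \<Longrightarrow> ext_pull C (\<alpha> d) \<xi> = ext_push C (\<beta> d) \<xi>"
    using assms unfolding compatible_identification_def by blast
  note s = Ext1_subset[OF \<xi>(1)]
  have "\<xi>\<inverse> \<in> Ext1 (op_cat C) T S"
    using \<xi>(1) by (simp add: converse_Ext1_op)
  moreover have "\<xi>\<inverse> \<noteq> Ext1_zero (op_cat C) T S"
    using \<xi>(2) by (simp add: Ext1_zero_op)
  moreover have "ext_pull (op_cat C) (\<beta> d) (\<xi>\<inverse>) = ext_push (op_cat C) (\<alpha> d) (\<xi>\<inverse>)" if "d \<in> carrier \<Delta>" for d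
    using \<xi>(3)[OF that] by (simp add: ext_pull_op[OF s] ext_push_op[OF s])
  ultimately show ?thesis
    unfolding compatible_identification_def op_ring_simps using ring_iso_op_End[OF iso(1)] ring_iso_op_End[OF iso(2)]
    by blast
qed

end

section \<open>The second duality isomorphism\<close>

context perp_pairing
begin

lemma Ext1_closed:
  assumes "a \<in> Obj A"
  shows "\<lbrakk>x \<in> Ext1 A a T; y \<in> Ext1 A a T\<rbrakk> \<Longrightarrow> baer_sum A a T x y \<in> Ext1 A a T"
    "\<lbrakk>x \<in> Ext1 A a T; t \<in> Hom A T T\<rbrakk> \<Longrightarrow> ext_push A t x \<in> Ext1 A a T"
    "\<lbrakk>x \<in> Ext1 A a T; f \<in> Hom A b a\<rbrakk> \<Longrightarrow> ext_pull A f x \<in> Ext1 A b T"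
proof -
  have *: "\<exists>w. w \<in> Hom A (K a) T \<and> x = Cl a w" if "x \<in> Ext1 A a T" for x
    using that Ext1_eq_Cl[OF assms] by blast
  have cl: "Cl b w \<in> Ext1 A b T" if "b \<in> Obj A" "w \<in> Hom A (K b) T" for b w
    using that by (simp add: Ext1_eq_Cl)
  show "baer_sum A a T x y \<in> Ext1 A a T" if t: "x \<in> Ext1 A a T" "y \<in> Ext1 A a T"
  proof -
    obtain w w' where w: "w \<in> Hom A (K a) T" "w' \<in> Hom A (K a) T" "x = Cl a w" "y = Cl a w'"
      using *[OF t(1)] *[OF t(2)] by blast
    show ?thesis
      unfolding w(3,4) baer_sum_Cl[OF assms w(1,2)] by (rule cl[OF assms]) (use w(1,2) in simp)
  qed
  show "ext_push A t x \<in> Ext1 A a T" if t: "x \<in> Ext1 A a T" "t \<in> Hom A T T"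
  proof -
    obtain w where w: "w \<in> Hom A (K a) T" "x = Cl a w"
      using *[OF t(1)] by blast
    show ?thesis
      unfolding w(2) ext_push_Cl[OF assms t(2) w(1)] by (rule cl[OF assms]) (use w(1) t(2) in simp)
  qed
  show "ext_pull A f x \<in> Ext1 A b T" if t: "x \<in> Ext1 A a T" "f \<in> Hom A b a"
  proof -
    obtain w where w: "w \<in> Hom A (K a) T" "x = Cl a w"
      using *[OF t(1)] by blast
    have f: "f \<in> Arr A" "Dom A f = b" "Cod A f = a" using t(2) by simp_all
    show ?thesis
      unfolding w(2) ext_pull_Cl[OF f w(1)] by (rule cl) (use w(1) f Km(1-3)[OF f(1)] in auto)
  qed
qed

text \<open>The second isomorphism for \<open>op_cat A\<close>, obtained from the first one for
  \<open>A\<close> over the opposite ring. It is stated with \<open>op_cat A\<close> in the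
  arguments so that, when \<open>A\<close> is itself an opposite category, the double opposite
  disappears.\<close>

theorem D_Ext_from_op_iso_Hom_to_op:
  assumes "ring \<Delta>" "compatible_identification (op_cat A) \<Delta> T S \<beta> \<alpha>"
  shows "mod_func_iso A \<Delta> (D_Ext_from (op_cat A) \<Delta> \<beta> T) (Hom_to (op_cat A) \<alpha> S)"
proof -
  interpret op: abelian_category "op_cat A" by (rule op_abelian)
  have c: "compatible_identification A (op_ring \<Delta>) S T \<alpha> \<beta>"
    using op.compatible_identification_op[OF assms(2)] by simp
  then have \<beta>: "\<beta> \<in> ring_iso (op_ring \<Delta>) (End_ring A T)"
    by (simp add: compatible_identification_def)
  have \<beta>T: "\<beta> r \<in> Hom A T T" if "r \<in> carrier \<Delta>" for r
    using ring_iso_EndD(1-3)[OF \<beta>, of r] that by simp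
  \<comment> \<open>The Hom modules coincide literally after reversing arrows; only the Ext side has
    to be transported.\<close>
  have G: "Hom_to (op_cat A) \<alpha> S = Hom_from A \<alpha> S"
    by (simp add: Hom_to_def Hom_from_def Hom_to_module_def Hom_from_module_def fun_eq_iff)
  obtain u v where pd: "perp_duality A Bs P c k T S (op_ring \<Delta>) \<alpha> \<beta> u v"
    by (rule compatible_perp_duality[OF ring_op_ring[OF assms(1)] c])
  let ?F1 = "D_Ext_from (op_cat A) \<Delta> \<beta> T" and ?F2 = "D_Ext_to A (op_ring \<Delta>) \<beta> T" and ?G = "Hom_from A \<alpha> S"
  obtain \<tau> where \<tau>: "\<And>a. a \<in> Obj A \<Longrightarrow> \<tau> a \<in> module_homs (op_ring \<Delta>) (Mobj ?F2 a) (Mobj ?G a)"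
    "\<And>a. a \<in> Obj A \<Longrightarrow> bij_betw (\<tau> a) (carrier (Mobj ?F2 a)) (carrier (Mobj ?G a))"
    "\<And>a b f x. \<lbrakk>a \<in> Obj A; b \<in> Obj A; f \<in> Hom A a b; x \<in> carrier (Mobj ?F2 a)\<rbrakk> \<Longrightarrow> \<tau> b (Mmap ?F2 f x) = Mmap ?G f (\<tau> a x)"
    using perp_duality.D_Ext_to_iso_Hom_from[OF pd] unfolding mod_func_iso_def by blast
  define D1 where "D1 a = carrier (Mobj ?F1 a)" for a
  define D2 where "D2 a = carrier (Mobj ?F2 a)" for a
  define E1 where "E1 a = Ext1 A a T" for a
  define E2 where "E2 a = Ext1 (op_cat A) T a" for a
  have E: "x \<in> E2 a \<longleftrightarrow> x\<inverse> \<in> E1 a" for x a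
    by (simp add: E1_def E2_def converse_Ext1_op)
  have E1s: "x \<subseteq> extensions A a T" if "x \<in> E1 a" for x a
    using that Ext1_subset by (simp add: E1_def)
  have D1_iff: "\<phi> \<in> D1 a \<longleftrightarrow> \<phi> \<in> E2 a \<rightarrow>\<^sub>E carrier \<Delta> \<and>
    (\<forall>x \<in> E2 a. \<forall>y \<in> E2 a. \<phi> (baer_sum (op_cat A) T a x y) = \<phi> x \<oplus>\<^bsub>\<Delta>\<^esub> \<phi> y) \<and>
    (\<forall>r \<in> carrier \<Delta>. \<forall>x \<in> E2 a. \<phi> (ext_pull (op_cat A) (\<beta> r) x) = \<phi> x \<otimes>\<^bsub>\<Delta>\<^esub> r)" for \<phi> a
    by (simp add: D1_def E2_def D_Ext_from_def dual_of_right_def Ext_from_module_def)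
  have D2_iff: "\<phi> \<in> D2 a \<longleftrightarrow> \<phi> \<in> E1 a \<rightarrow>\<^sub>E carrier \<Delta> \<and>
    (\<forall>x \<in> E1 a. \<forall>y \<in> E1 a. \<phi> (baer_sum A a T x y) = \<phi> x \<oplus>\<^bsub>\<Delta>\<^esub> \<phi> y) \<and>
    (\<forall>r \<in> carrier \<Delta>. \<forall>x \<in> E1 a. \<phi> (ext_push A (\<beta> r) x) = \<phi> x \<otimes>\<^bsub>\<Delta>\<^esub> r)" for \<phi> a
    by (simp add: D2_def E1_def D_Ext_to_def dual_of_left_def Ext_to_module_def)
  have D2_add: "(\<lambda>x \<in> E1 a. \<phi> x \<oplus>\<^bsub>\<Delta>\<^esub> \<psi> x) \<in> D2 a" if "a \<in> Obj A" "\<phi> \<in> D2 a" "\<psi> \<in> D2 a" for a \<phi> \<psi>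
    using perp_duality.D_closed(1)[OF pd that(1), of \<phi> \<psi>] that(2,3) by (simp add: D2_def E1_def D_Ext_to_def)
  have D2_smult: "(\<lambda>x \<in> E1 a. r \<otimes>\<^bsub>\<Delta>\<^esub> \<phi> x) \<in> D2 a" if "a \<in> Obj A" "\<phi> \<in> D2 a" "r \<in> carrier \<Delta>" for a \<phi> r
    using perp_duality.D_closed(2)[OF pd that(1), of \<phi> r] that(2,3) by (simp add: D2_def E1_def D_Ext_to_def)
  have D2_Mmap: "(\<lambda>\<xi> \<in> E1 b. \<phi> (ext_pull A f \<xi>)) \<in> D2 b" if "a \<in> Obj A" "\<phi> \<in> D2 a" "f \<in> Hom A a b" for a b \<phi> f
    using perp_duality.D_closed(3)[OF pd that(1), of \<phi> f b] that(2,3) by (simp add: D2_def E1_def D_Ext_to_def)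
  have bs: "baer_sum (op_cat A) T a (x\<inverse>) (y\<inverse>) = (baer_sum A a T x y)\<inverse>" if "x \<in> E1 a" "y \<in> E1 a" for x y a
    by (rule baer_sum_op[OF E1s[OF that(1)] E1s[OF that(2)]])
  have pl: "ext_pull (op_cat A) t (x\<inverse>) = (ext_push A t x)\<inverse>" if "x \<in> E1 a" for x a t
    by (rule ext_pull_op[OF E1s[OF that]])
  have ps: "ext_push (op_cat A) t (x\<inverse>) = (ext_pull A t x)\<inverse>" if "x \<in> E1 a" for x a t
    by (rule ext_push_op[OF E1s[OF that]])
  \<comment> \<open>Precomposition with the converse, the bijection between extension classes of
    \<open>A\<close> and of \<open>op_cat A\<close>. The linearity conditions match because left
    linearity over \<open>op_ring \<Delta>\<close> is right linearity over \<Delta>.\<close>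
  define \<sigma> where "\<sigma> a \<phi> = (\<lambda>x \<in> E1 a. \<phi> (x\<inverse>))" for a and \<phi> :: "('b \<times> 'b) set \<Rightarrow> 'c"
  define \<sigma>' where "\<sigma>' a \<phi> = (\<lambda>x \<in> E2 a. \<phi> (x\<inverse>))" for a and \<phi> :: "('b \<times> 'b) set \<Rightarrow> 'c"
  have \<sigma>x: "\<sigma> a \<phi> x = \<phi> (x\<inverse>)" if "x \<in> E1 a" for a \<phi> x
    unfolding \<sigma>_def by (rule restrict_apply'[OF that])
  have \<sigma>'x: "\<sigma>' a \<phi> x = \<phi> (x\<inverse>)" if "x \<in> E2 a" for a \<phi> x
    unfolding \<sigma>'_def by (rule restrict_apply'[OF that])
  have E': "x\<inverse> \<in> E2 a" if "x \<in> E1 a" for x a using that by (simp add: E)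
  have closed: "baer_sum A a T x y \<in> E1 a" "r \<in> carrier \<Delta> \<Longrightarrow> ext_push A (\<beta> r) x \<in> E1 a"
    if "a \<in> Obj A" "x \<in> E1 a" "y \<in> E1 a" for a x y r
    using Ext1_closed(1,2)[OF that(1)] that(2,3) \<beta>T unfolding E1_def by blast+
  have \<sigma>D: "\<sigma> a \<phi> \<in> D2 a" if a: "a \<in> Obj A" and p: "\<phi> \<in> D1 a" for a \<phi>
    unfolding D2_iff
  proof (intro conjI ballI)
    note p' = p[unfolded D1_iff]
    show "\<sigma> a \<phi> \<in> E1 a \<rightarrow>\<^sub>E carrier \<Delta>"
      unfolding \<sigma>_def by (rule restrict_PiE_iff[THEN iffD2]) (use p' E' in blast)
    show "\<sigma> a \<phi> (baer_sum A a T x y) = \<sigma> a \<phi> x \<oplus>\<^bsub>\<Delta>\<^esub> \<sigma> a \<phi> y" if xy: "x \<in> E1 a" "y \<in> E1 a" for x y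
      unfolding \<sigma>x[OF closed(1)[OF a xy]] \<sigma>x[OF xy(1)] \<sigma>x[OF xy(2)] bs[OF xy, symmetric]
      using p' E'[OF xy(1)] E'[OF xy(2)] by blast
    show "\<sigma> a \<phi> (ext_push A (\<beta> r) x) = \<sigma> a \<phi> x \<otimes>\<^bsub>\<Delta>\<^esub> r" if r: "r \<in> carrier \<Delta>" and x: "x \<in> E1 a" for r x
      unfolding \<sigma>x[OF closed(2)[OF a x x r]] \<sigma>x[OF x] pl[OF x, symmetric]
      using p' E'[OF x] r by blast
  qed
  have \<sigma>'D: "\<sigma>' a \<phi> \<in> D1 a" if a: "a \<in> Obj A" and p: "\<phi> \<in> D2 a" for a \<phi>
    unfolding D1_iff
  proof (intro conjI ballI)
    note p' = p[unfolded D2_iff]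
    have e: "\<exists>x'. x' \<in> E1 a \<and> x = x'\<inverse>" if "x \<in> E2 a" for x
      using that by (intro exI[of _ "x\<inverse>"]) (simp add: E)
    show "\<sigma>' a \<phi> \<in> E2 a \<rightarrow>\<^sub>E carrier \<Delta>"
      unfolding \<sigma>'_def by (rule restrict_PiE_iff[THEN iffD2]) (use p' E in blast)
    show "\<sigma>' a \<phi> (baer_sum (op_cat A) T a x y) = \<sigma>' a \<phi> x \<oplus>\<^bsub>\<Delta>\<^esub> \<sigma>' a \<phi> y" if xy: "x \<in> E2 a" "y \<in> E2 a" for x y
    proof -
      obtain x' y' where x': "x' \<in> E1 a" "x = x'\<inverse>" "y' \<in> E1 a" "y = y'\<inverse>" using e xy by metis
      have "\<phi> (baer_sum A a T x' y') = \<phi> x' \<oplus>\<^bsub>\<Delta>\<^esub> \<phi> y'" using p' x' by blast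
      then show ?thesis
        unfolding x'(2,4) bs[OF x'(1,3)] using closed(1)[OF a x'(1,3)] x' by (simp add: \<sigma>'x E)
    qed
    show "\<sigma>' a \<phi> (ext_pull (op_cat A) (\<beta> r) x) = \<sigma>' a \<phi> x \<otimes>\<^bsub>\<Delta>\<^esub> r" if r: "r \<in> carrier \<Delta>" and x: "x \<in> E2 a" for r x
    proof -
      obtain x' where x': "x' \<in> E1 a" "x = x'\<inverse>" using e x by metis
      have "\<phi> (ext_push A (\<beta> r) x') = \<phi> x' \<otimes>\<^bsub>\<Delta>\<^esub> r" using p' x' r by blast
      then show ?thesis
        unfolding x'(2) pl[OF x'(1)] using closed(2)[OF a x'(1) x'(1) r] x' by (simp add: \<sigma>'x E)
    qed
  qed
  have \<sigma>\<sigma>': "\<sigma> a (\<sigma>' a \<phi>) = \<phi>" if "\<phi> \<in> E1 a \<rightarrow>\<^sub>E carrier \<Delta>" for a \<phi>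
  proof
    fix x show "\<sigma> a (\<sigma>' a \<phi>) x = \<phi> x"
      using that by (cases "x \<in> E1 a") (auto simp add: \<sigma>_def \<sigma>'_def E PiE_def extensional_def)
  qed
  have \<sigma>'\<sigma>: "\<sigma>' a (\<sigma> a \<phi>) = \<phi>" if "\<phi> \<in> E2 a \<rightarrow>\<^sub>E carrier \<Delta>" for a \<phi>
  proof
    fix x show "\<sigma>' a (\<sigma> a \<phi>) x = \<phi> x"
      using that by (cases "x \<in> E2 a") (auto simp add: \<sigma>_def \<sigma>'_def E PiE_def extensional_def)
  qed
  have \<sigma>_bij: "bij_betw (\<sigma> a) (D1 a) (D2 a)" if a: "a \<in> Obj A" for a
  proof (rule bij_betwI[of _ _ _ "\<sigma>' a"])
    show "\<sigma> a \<in> D1 a \<rightarrow> D2 a" using \<sigma>D[OF a] by blast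
    show "\<sigma>' a \<in> D2 a \<rightarrow> D1 a" using \<sigma>'D[OF a] by blast
    show "\<sigma>' a (\<sigma> a x) = x" if "x \<in> D1 a" for x using that \<sigma>'\<sigma> unfolding D1_iff by blast
    show "\<sigma> a (\<sigma>' a y) = y" if "y \<in> D2 a" for y using that \<sigma>\<sigma>' unfolding D2_iff by blast
  qed
  define \<tau>' where "\<tau>' a = (\<lambda>\<phi> \<in> D1 a. \<tau> a (\<sigma> a \<phi>))" for a
  have \<tau>'x: "\<tau>' a \<phi> = \<tau> a (\<sigma> a \<phi>)" if "\<phi> \<in> D1 a" for a \<phi>
    unfolding \<tau>'_def by (rule restrict_apply'[OF that])
  have smult1: "r \<odot>\<^bsub>Mobj ?F1 a\<^esub> \<phi> = (\<lambda>x \<in> E2 a. r \<otimes>\<^bsub>\<Delta>\<^esub> \<phi> x)" and add1: "\<phi> \<oplus>\<^bsub>Mobj ?F1 a\<^esub> \<psi> = (\<lambda>x \<in> E2 a. \<phi> x \<oplus>\<^bsub>\<Delta>\<^esub> \<psi> x)"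
    and smult2: "r \<odot>\<^bsub>Mobj ?F2 a\<^esub> \<phi> = (\<lambda>x \<in> E1 a. r \<otimes>\<^bsub>\<Delta>\<^esub> \<phi> x)" and add2: "\<phi> \<oplus>\<^bsub>Mobj ?F2 a\<^esub> \<psi> = (\<lambda>x \<in> E1 a. \<phi> x \<oplus>\<^bsub>\<Delta>\<^esub> \<psi> x)"
    for r \<phi> \<psi> a
    by (simp_all add: D_Ext_from_def D_Ext_to_def dual_of_right_def dual_of_left_def Ext_from_module_def Ext_to_module_def E1_def E2_def)
  have Mm1: "Mmap ?F1 f \<phi> = (\<lambda>\<xi> \<in> E2 (Cod A f). \<phi> (ext_push (op_cat A) f \<xi>))"
    and Mm2: "Mmap ?F2 f \<phi> = (\<lambda>\<xi> \<in> E1 (Cod A f). \<phi> (ext_pull A f \<xi>))" for f \<phi>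
    by (simp_all add: D_Ext_from_def D_Ext_to_def E1_def E2_def)
  \<comment> \<open>In this way \<open>D1\<close> inherits closure under the operations from
    \<open>D2\<close>, where it is known from representability.\<close>
  have inD1: "\<phi> \<in> D1 a" if "a \<in> Obj A" "\<phi> \<in> E2 a \<rightarrow>\<^sub>E carrier \<Delta>" "\<sigma> a \<phi> \<in> D2 a" for a \<phi>
    using \<sigma>'D[OF that(1,3)] \<sigma>'\<sigma>[OF that(2)] by simp
  have \<tau>'_undefined: "\<tau>' a \<phi> = undefined" if "\<phi> \<notin> D1 a" for a \<phi>
    using that by (simp add: \<tau>'_def)
  show ?thesis
    unfolding G mod_func_iso_def
  proof (intro exI[of _ \<tau>'] conjI ballI)
    fix a assume a: "a \<in> Obj A"
    note hom = \<tau>(1)[OF a, unfolded module_homs_def]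
    have hom1: "\<tau> a (\<phi> \<oplus>\<^bsub>Mobj ?F2 a\<^esub> \<psi>) = \<tau> a \<phi> \<oplus>\<^bsub>Mobj ?G a\<^esub> \<tau> a \<psi>" if "\<phi> \<in> D2 a" "\<psi> \<in> D2 a" for \<phi> \<psi>
      using hom that unfolding D2_def by blast
    have hom2: "\<tau> a (r \<odot>\<^bsub>Mobj ?F2 a\<^esub> \<phi>) = r \<odot>\<^bsub>Mobj ?G a\<^esub> \<tau> a \<phi>" if "r \<in> carrier \<Delta>" "\<phi> \<in> D2 a" for r \<phi>
      using hom that unfolding D2_def by simp
    have homc: "\<tau> a \<phi> \<in> carrier (Mobj ?G a)" if "\<phi> \<in> D2 a" for \<phi>
      using hom that unfolding D2_def by blast
    interpret ring \<Delta> by fact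
    have \<sigma>_add: "\<sigma> a (\<lambda>x \<in> E2 a. \<phi> x \<oplus>\<^bsub>\<Delta>\<^esub> \<psi> x) = (\<lambda>x \<in> E1 a. \<sigma> a \<phi> x \<oplus>\<^bsub>\<Delta>\<^esub> \<sigma> a \<psi> x)" for \<phi> \<psi>
      by (auto simp add: \<sigma>_def E fun_eq_iff)
    have \<sigma>_smult: "\<sigma> a (\<lambda>x \<in> E2 a. r \<otimes>\<^bsub>\<Delta>\<^esub> \<phi> x) = (\<lambda>x \<in> E1 a. r \<otimes>\<^bsub>\<Delta>\<^esub> \<sigma> a \<phi> x)" for r \<phi>
      by (auto simp add: \<sigma>_def E fun_eq_iff)
    have D1c: "\<phi> x \<in> carrier \<Delta>" if "\<phi> \<in> D1 a" "x \<in> E2 a" for \<phi> x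
      using that unfolding D1_iff by blast
    have cl1: "(\<lambda>x \<in> E2 a. \<phi> x \<oplus>\<^bsub>\<Delta>\<^esub> \<psi> x) \<in> D1 a" if p: "\<phi> \<in> D1 a" "\<psi> \<in> D1 a" for \<phi> \<psi>
    proof (rule inD1[OF a])
      show "(\<lambda>x \<in> E2 a. \<phi> x \<oplus>\<^bsub>\<Delta>\<^esub> \<psi> x) \<in> E2 a \<rightarrow>\<^sub>E carrier \<Delta>"
        by (rule restrict_PiE_iff[THEN iffD2]) (use D1c[OF p(1)] D1c[OF p(2)] in blast)
    qed (simp only: \<sigma>_add D2_add[OF a \<sigma>D[OF a p(1)] \<sigma>D[OF a p(2)]])
    have cl2: "(\<lambda>x \<in> E2 a. r \<otimes>\<^bsub>\<Delta>\<^esub> \<phi> x) \<in> D1 a" if r: "r \<in> carrier \<Delta>" and p: "\<phi> \<in> D1 a" for \<phi> r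
    proof (rule inD1[OF a])
      show "(\<lambda>x \<in> E2 a. r \<otimes>\<^bsub>\<Delta>\<^esub> \<phi> x) \<in> E2 a \<rightarrow>\<^sub>E carrier \<Delta>"
        by (rule restrict_PiE_iff[THEN iffD2]) (use D1c[OF p] r in blast)
    qed (simp only: \<sigma>_smult D2_smult[OF a \<sigma>D[OF a p] r])
    have "\<tau>' a \<in> D1 a \<rightarrow>\<^sub>E carrier (Mobj ?G a)"
      by (rule PiE_I) (use homc \<sigma>D[OF a] \<tau>'x \<tau>'_undefined in simp_all)
    moreover have "\<tau>' a (\<phi> \<oplus>\<^bsub>Mobj ?F1 a\<^esub> \<psi>) = \<tau>' a \<phi> \<oplus>\<^bsub>Mobj ?G a\<^esub> \<tau>' a \<psi>" if "\<phi> \<in> D1 a" "\<psi> \<in> D1 a" for \<phi> \<psi>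
    proof -
      have "\<sigma> a (\<lambda>x \<in> E2 a. \<phi> x \<oplus>\<^bsub>\<Delta>\<^esub> \<psi> x) = \<sigma> a \<phi> \<oplus>\<^bsub>Mobj ?F2 a\<^esub> \<sigma> a \<psi>"
        unfolding add2 by (rule \<sigma>_add)
      then show ?thesis
        unfolding add1 \<tau>'x[OF cl1[OF that]] \<tau>'x[OF that(1)] \<tau>'x[OF that(2)]
        using hom1[OF \<sigma>D[OF a that(1)] \<sigma>D[OF a that(2)]] by simp
    qed
    moreover have "\<tau>' a (r \<odot>\<^bsub>Mobj ?F1 a\<^esub> \<phi>) = r \<odot>\<^bsub>Mobj ?G a\<^esub> \<tau>' a \<phi>" if "r \<in> carrier \<Delta>" "\<phi> \<in> D1 a" for r \<phi>
    proof -
      have "\<sigma> a (\<lambda>x \<in> E2 a. r \<otimes>\<^bsub>\<Delta>\<^esub> \<phi> x) = r \<odot>\<^bsub>Mobj ?F2 a\<^esub> \<sigma> a \<phi>"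
        unfolding smult2 by (rule \<sigma>_smult)
      then show ?thesis
        unfolding smult1 \<tau>'x[OF cl2[OF that]] \<tau>'x[OF that(2)]
        using hom2[OF that(1) \<sigma>D[OF a that(2)]] by simp
    qed
    ultimately show "\<tau>' a \<in> module_homs \<Delta> (Mobj ?F1 a) (Mobj ?G a)"
      unfolding module_homs_def D1_def by blast
    have "bij_betw (\<tau> a \<circ> \<sigma> a) (D1 a) (carrier (Mobj ?G a))"
      using bij_betw_trans[OF \<sigma>_bij[OF a]] \<tau>(2)[OF a] unfolding D2_def by blast
    then have "bij_betw (\<tau>' a) (D1 a) (carrier (Mobj ?G a))"
      by (rule bij_betw_cong[THEN iffD1, rotated]) (simp add: \<tau>'x)
    then show "bij_betw (\<tau>' a) (carrier (Mobj ?F1 a)) (carrier (Mobj ?G a))"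
      unfolding D1_def .
  next
    fix a b f \<phi> assume a: "a \<in> Obj A" "b \<in> Obj A" and f: "f \<in> Hom A a b" and "\<phi> \<in> carrier (Mobj ?F1 a)"
    then have p: "\<phi> \<in> D1 a" by (simp only: D1_def)
    have f': "f \<in> Arr A" "Dom A f = a" "Cod A f = b" using f by simp_all
    have pc: "ext_pull A f x \<in> E1 a" if "x \<in> E1 b" for x
      using Ext1_closed(3)[OF a(2) _ f] that by (simp add: E1_def)
    have s: "\<sigma> b (Mmap ?F1 f \<phi>) = Mmap ?F2 f (\<sigma> a \<phi>)"
    proof
      fix x show "\<sigma> b (Mmap ?F1 f \<phi>) x = Mmap ?F2 f (\<sigma> a \<phi>) x"
        unfolding Mm1 Mm2 f'(3) using pc ps[of x b f] by (cases "x \<in> E1 b") (simp_all add: \<sigma>_def E)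
    qed
    have "Mmap ?F2 f (\<sigma> a \<phi>) \<in> D2 b"
      unfolding Mm2 f'(3) by (rule D2_Mmap[OF a(1) \<sigma>D[OF a(1) p] f])
    have "Mmap ?F1 f \<phi> \<in> D1 b"
    proof (rule inD1[OF a(2)])
      show "Mmap ?F1 f \<phi> \<in> E2 b \<rightarrow>\<^sub>E carrier \<Delta>"
        unfolding Mm1 f'(3)
      proof (rule restrict_PiE_iff[THEN iffD2], rule ballI)
        fix x assume x: "x \<in> E2 b"
        then have "ext_push (op_cat A) f x \<in> E2 a"
          using pc[of "x\<inverse>"] ps[of "x\<inverse>" b f] by (simp add: E)
        then show "\<phi> (ext_push (op_cat A) f x) \<in> carrier \<Delta>"
          using p unfolding D1_iff by blast
      qed
      show "\<sigma> b (Mmap ?F1 f \<phi>) \<in> D2 b"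
        unfolding s by fact
    qed
    then have "\<tau>' b (Mmap ?F1 f \<phi>) = \<tau> b (Mmap ?F2 f (\<sigma> a \<phi>))"
      using \<tau>'x s by simp
    also have "\<dots> = Mmap ?G f (\<tau> a (\<sigma> a \<phi>))"
      by (rule \<tau>(3)[OF a f]) (use \<sigma>D[OF a(1) p] in \<open>simp only: D2_def\<close>)
    finally show "\<tau>' b (Mmap ?F1 f \<phi>) = Mmap ?G f (\<tau>' a \<phi>)"
      by (simp only: \<tau>'x[OF p])
  qed
qed

end

section \<open>Vanishing objects, trivial Ext and functors\<close>

context preadditive_category
begin

text \<open>Vanishing of an object is expressed by \<open>Ide\<close> being \<open>Zer\<close>, a
  form that functors preserving zero transport directly.\<close>

lemma Zer_Ide_imp:
  assumes "Ide C x = Zer C x x" "x \<in> Obj C" "f \<in> Arr C"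
  shows "Cod C f = x \<Longrightarrow> f = Zer C (Dom C f) x" "Dom C f = x \<Longrightarrow> f = Zer C x (Cod C f)"
proof -
  show "f = Zer C (Dom C f) x" if "Cod C f = x"
    using comp_zer[of f x x] comp_ide(2)[of f x] assms that by simp
  show "f = Zer C x (Cod C f)" if "Dom C f = x"
    using zer_comp[of f x x] comp_ide(1)[of f x] assms that by simp
qed

end

context abelian_category
begin

text \<open>The bridge between the definition of the perpendicular classes and the splitting
  conditions in the locales above. Existence of a split extension keeps the quotient from being
  empty.\<close>

lemma Ext1_trivial_iff:
  assumes "x \<in> Obj C" "z \<in> Obj C"
  shows "Ext1 C z x = {Ext1_zero C z x} \<longleftrightarrow> (\<forall>f g. (f, g) \<in> extensions C z x \<longrightarrow> split_epi C g)"
proof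
  note eq = ext_equiv_equiv[of z x]
  show "\<forall>f g. (f, g) \<in> extensions C z x \<longrightarrow> split_epi C g" if h: "Ext1 C z x = {Ext1_zero C z x}"
  proof (intro allI impI)
    fix f g assume e: "(f, g) \<in> extensions C z x"
    have "ext_equiv C z x `` {(f, g)} \<in> Ext1 C z x"
      unfolding Ext1_def by (rule quotientI[OF e])
    then have "ext_equiv C z x `` {(f, g)} = Ext1_zero C z x"
      using h by blast
    then have "(f, g) \<in> Ext1_zero C z x"
      using equiv_class_self[OF eq e] by blast
    then show "split_epi C g"
      by (simp add: Ext1_zero_def split_ext_def)
  qed
  show "Ext1 C z x = {Ext1_zero C z x}" if h: "\<forall>f g. (f, g) \<in> extensions C z x \<longrightarrow> split_epi C g"
  proof -
    have all: "extensions C z x = Ext1_zero C z x"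
      using h by (auto simp add: Ext1_zero_def split_ext_def)
    have "ext_equiv C z x `` {e} = Ext1_zero C z x" if "e \<in> extensions C z x" for e
      using split_ext_equiv[of e z x] that all equiv_type[OF eq] by blast
    moreover have "extensions C z x \<noteq> {}"
      using split_ext_ex[OF assms] all by simp
    ultimately show ?thesis
      unfolding Ext1_def quotient_def by blast
  qed
qed

end

context category
begin

lemma functorD:
  assumes "is_functor C D F"
  shows "x \<in> Obj C \<Longrightarrow> Fobj F x \<in> Obj D" "x \<in> Obj C \<Longrightarrow> Fmap F (Ide C x) = Ide D (Fobj F x)"
    "f \<in> Arr C \<Longrightarrow> Fmap F f \<in> Arr D" "f \<in> Arr C \<Longrightarrow> Dom D (Fmap F f) = Fobj F (Dom C f)"
    "f \<in> Arr C \<Longrightarrow> Cod D (Fmap F f) = Fobj F (Cod C f)"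
    "\<lbrakk>f \<in> Arr C; g \<in> Arr C; Cod C f = Dom C g\<rbrakk> \<Longrightarrow> Fmap F (g \<cdot> f) = Fmap F g \<cdot>\<^bsub>D\<^esub> Fmap F f"
proof -
  show "x \<in> Obj C \<Longrightarrow> Fobj F x \<in> Obj D" "x \<in> Obj C \<Longrightarrow> Fmap F (Ide C x) = Ide D (Fobj F x)"
    using assms unfolding is_functor_def by blast+
  have "Fmap F f \<in> Hom D (Fobj F (Dom C f)) (Fobj F (Cod C f))" if f: "f \<in> Arr C"
  proof -
    have "f \<in> Hom C (Dom C f) (Cod C f)" "Dom C f \<in> Obj C" "Cod C f \<in> Obj C" using f by simp_all
    then show ?thesis using assms unfolding is_functor_def by blast
  qed
  then show "f \<in> Arr C \<Longrightarrow> Fmap F f \<in> Arr D" "f \<in> Arr C \<Longrightarrow> Dom D (Fmap F f) = Fobj F (Dom C f)"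
    "f \<in> Arr C \<Longrightarrow> Cod D (Fmap F f) = Fobj F (Cod C f)"
    by simp_all
  show "Fmap F (g \<cdot> f) = Fmap F g \<cdot>\<^bsub>D\<^esub> Fmap F f" if "f \<in> Arr C" "g \<in> Arr C" "Cod C f = Dom C g"
  proof -
    have "f \<in> Hom C (Dom C f) (Dom C g)" "g \<in> Hom C (Dom C g) (Cod C g)"
      "Dom C f \<in> Obj C" "Dom C g \<in> Obj C" "Cod C g \<in> Obj C" using that by simp_all
    then show ?thesis using assms unfolding is_functor_def by blast
  qed
qed

end

section \<open>Adjoints and perpendicular categories\<close>

lemma functor_op: "is_functor (op_cat C) (op_cat D) F \<longleftrightarrow> is_functor C D F"
  unfolding is_functor_def by (simp del: in_Hom) blast

lemma exact_functor_op: "exact_functor C D F \<Longrightarrow> exact_functor (op_cat C) (op_cat D) F"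
  unfolding exact_functor_def functor_op by (simp del: in_Hom)

lemma fully_faithful_op: "fully_faithful C D F \<Longrightarrow> fully_faithful (op_cat C) (op_cat D) F"
  unfolding fully_faithful_def by (simp del: in_Hom)

text \<open>Only an exact right adjoint is treated. An exact left adjoint becomes one between the
  opposite categories, see \<open>adjoint_pair_op\<close>.\<close>

locale adjoint_pair =
  A: abelian_category A + B: abelian_category B
  for A :: "('o, 'm) cat" and B :: "('p, 'n) cat" +
  fixes F :: "('p, 'n, 'o, 'm) func" and R :: "('o, 'm, 'p, 'n) func" and \<phi> :: "'p \<Rightarrow> 'o \<Rightarrow> 'm \<Rightarrow> 'n"
  assumes F_functor: "is_functor B A F" and F_ff: "fully_faithful B A F" and R_exact: "exact_functor A B R"
    and \<phi>_bij: "\<lbrakk>x \<in> Obj B; y \<in> Obj A\<rbrakk> \<Longrightarrow> bij_betw (\<phi> x y) (Hom A (Fobj F x) y) (Hom B x (Fobj R y))"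
    and \<phi>_nat: "\<lbrakk>x \<in> Obj B; x' \<in> Obj B; y \<in> Obj A; y' \<in> Obj A; f \<in> Hom B x' x; h \<in> Hom A y y'; g \<in> Hom A (Fobj F x) y\<rbrakk>
      \<Longrightarrow> \<phi> x' y' (h \<cdot>\<^bsub>A\<^esub> g \<cdot>\<^bsub>A\<^esub> Fmap F f) = Fmap R h \<cdot>\<^bsub>B\<^esub> \<phi> x y g \<cdot>\<^bsub>B\<^esub> f"
begin

lemmas F_simps [simp] = B.functorD(1-5)[OF F_functor]
lemmas F_comp = B.functorD(6)[OF F_functor]

lemma R_functor: "is_functor A B R"
  using R_exact by (simp add: exact_functor_def)

lemmas R_simps [simp] = A.functorD(1-5)[OF R_functor]
lemmas R_comp = A.functorD(6)[OF R_functor]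

lemma R_add: "\<lbrakk>f \<in> Arr A; g \<in> Arr A; Dom A f = Dom A g; Cod A f = Cod A g\<rbrakk> \<Longrightarrow>
    Fmap R (Add A f g) = Add B (Fmap R f) (Fmap R g)"
  using R_exact unfolding exact_functor_def by (metis in_Hom A.arr_simps(1,2))

lemma R_zer: 
  assumes "x \<in> Obj A" "y \<in> Obj A"
  shows "Fmap R (Zer A x y) = Zer B (Fobj R x) (Fobj R y)"
proof -
  have "Add B (Fmap R (Zer A x y)) (Fmap R (Zer A x y)) = Fmap R (Zer A x y)"
    using R_add[of "Zer A x y" "Zer A x y"] assms by simp
  then show ?thesis
    using B.add_idem_zer[of "Fmap R (Zer A x y)"] assms by simp
qed

lemma R_ses: "short_exact A f g \<Longrightarrow> short_exact B (Fmap R f) (Fmap R g)"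
  using R_exact by (simp add: exact_functor_def)

lemma F_full:
  assumes "g \<in> Arr A" "Dom A g = Fobj F x" "Cod A g = Fobj F y" "x \<in> Obj B" "y \<in> Obj B"
  obtains t where "t \<in> Hom B x y" "Fmap F t = g"
proof -
  have "bij_betw (Fmap F) (Hom B x y) (Hom A (Fobj F x) (Fobj F y))"
    using F_ff assms(4,5) unfolding fully_faithful_def by blast
  moreover have "g \<in> Hom A (Fobj F x) (Fobj F y)" using assms by simp
  ultimately have "g \<in> Fmap F ` Hom B x y" by (simp only: bij_betw_def)
  then show ?thesis using that by blast
qed

lemma F_faithful:
  assumes "Fmap F t = Fmap F t'" "t \<in> Hom B x y" "t' \<in> Hom B x y" "x \<in> Obj B" "y \<in> Obj B"
  shows "t = t'"
proof -
  have "inj_on (Fmap F) (Hom B x y)"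
    using F_ff assms(4,5) unfolding fully_faithful_def bij_betw_def by blast
  then show ?thesis using assms(1-3) by (rule inj_onD)
qed

lemma \<phi>_in: "\<lbrakk>x \<in> Obj B; y \<in> Obj A; g \<in> Hom A (Fobj F x) y\<rbrakk> \<Longrightarrow> \<phi> x y g \<in> Hom B x (Fobj R y)"
  using \<phi>_bij[of x y] bij_betwE by blast

lemma \<phi>_inj: "\<lbrakk>\<phi> x y g = \<phi> x y g'; x \<in> Obj B; y \<in> Obj A; g \<in> Hom A (Fobj F x) y; g' \<in> Hom A (Fobj F x) y\<rbrakk> \<Longrightarrow> g = g'"
  using \<phi>_bij[of x y] unfolding bij_betw_def by (meson inj_onD)

lemma \<phi>_surj:
  assumes "x \<in> Obj B" "y \<in> Obj A" "t \<in> Hom B x (Fobj R y)"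
  obtains g where "g \<in> Hom A (Fobj F x) y" "\<phi> x y g = t"
proof -
  have "t \<in> \<phi> x y ` Hom A (Fobj F x) y"
    using \<phi>_bij[OF assms(1,2)] assms(3) by (simp only: bij_betw_def)
  then show ?thesis using that by blast
qed

definition counit :: "'o \<Rightarrow> 'm" where
  "counit a = (SOME g. g \<in> Hom A (Fobj F (Fobj R a)) a \<and> \<phi> (Fobj R a) a g = Ide B (Fobj R a))"

lemma counit:
  assumes "a \<in> Obj A"
  shows "counit a \<in> Arr A" "Dom A (counit a) = Fobj F (Fobj R a)" "Cod A (counit a) = a"
    "\<phi> (Fobj R a) a (counit a) = Ide B (Fobj R a)"
proof -
  have r: "Fobj R a \<in> Obj B" "Ide B (Fobj R a) \<in> Hom B (Fobj R a) (Fobj R a)" using assms by simp_all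
  have "\<exists>g. g \<in> Hom A (Fobj F (Fobj R a)) a \<and> \<phi> (Fobj R a) a g = Ide B (Fobj R a)"
    by (rule \<phi>_surj[OF r(1) assms r(2)]) blast
  from someI_ex[OF this]
  show "counit a \<in> Arr A" "Dom A (counit a) = Fobj F (Fobj R a)" "Cod A (counit a) = a"
    "\<phi> (Fobj R a) a (counit a) = Ide B (Fobj R a)"
    unfolding counit_def by simp_all
qed

text \<open>By naturality, the inverse of the adjunction bijection applies \<open>F\<close> and
  composes with the counit.\<close>

lemma \<phi>_counit_comp:
  assumes "a \<in> Obj A" "t \<in> Hom B x (Fobj R a)" "x \<in> Obj B"
  shows "\<phi> x a (counit a \<cdot>\<^bsub>A\<^esub> Fmap F t) = t"
proof -
  note c = counit[OF assms(1)]
  have t: "t \<in> Arr B" "Dom B t = x" "Cod B t = Fobj R a" using assms(2) by simp_all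
  have "\<phi> x a (Ide A a \<cdot>\<^bsub>A\<^esub> counit a \<cdot>\<^bsub>A\<^esub> Fmap F t) = Fmap R (Ide A a) \<cdot>\<^bsub>B\<^esub> \<phi> (Fobj R a) a (counit a) \<cdot>\<^bsub>B\<^esub> t"
    by (rule \<phi>_nat) (use assms c t in simp_all)
  then show ?thesis
    using c t assms(1) by simp
qed

lemma counit_lift:
  assumes "f \<in> Arr A" "Dom A f = Fobj F x" "x \<in> Obj B"
  shows "\<exists>g. g \<in> Arr A \<and> Dom A g = Dom A f \<and> Cod A g = Dom A (counit (Cod A f)) \<and> counit (Cod A f) \<cdot>\<^bsub>A\<^esub> g = f"
proof -
  let ?a = "Cod A f"
  have a: "?a \<in> Obj A" using assms by simp
  have f: "f \<in> Hom A (Fobj F x) ?a" using assms by simp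
  let ?t = "\<phi> x ?a f"
  have t: "?t \<in> Hom B x (Fobj R ?a)" by (rule \<phi>_in[OF assms(3) a f])
  have "counit ?a \<cdot>\<^bsub>A\<^esub> Fmap F ?t = f"
    by (rule \<phi>_inj[OF \<phi>_counit_comp[OF a t assms(3)] assms(3) a]) (use t counit[OF a] assms in simp_all)
  then show ?thesis
    using t counit[OF a] assms by (intro exI[of _ "Fmap F ?t"]) simp
qed

lemma counit_unique:
  assumes "a \<in> Obj A" "g \<in> Arr A" "g' \<in> Arr A" "Dom A g = Dom A g'" "Dom A g' = Fobj F x" "x \<in> Obj B"
    "Cod A g = Dom A (counit a)" "Cod A g' = Dom A (counit a)" "counit a \<cdot>\<^bsub>A\<^esub> g = counit a \<cdot>\<^bsub>A\<^esub> g'"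
  shows "g = g'"
proof -
  note c = counit[OF assms(1)]
  have r: "Fobj R a \<in> Obj B" using assms(1) by simp
  obtain t where t: "t \<in> Hom B x (Fobj R a)" "Fmap F t = g"
    by (rule F_full[of g x "Fobj R a"]) (use assms c r in \<open>simp_all del: in_Hom\<close>)
  obtain t' where t': "t' \<in> Hom B x (Fobj R a)" "Fmap F t' = g'"
    by (rule F_full[of g' x "Fobj R a"]) (use assms c r in \<open>simp_all del: in_Hom\<close>)
  have "t = t'"
    using \<phi>_counit_comp[OF assms(1) t(1) assms(6)] \<phi>_counit_comp[OF assms(1) t'(1) assms(6)]
    unfolding t(2) t'(2) assms(9) by (rule trans[OF sym])
  then show ?thesis using t(2) t'(2) by simp
qed

definition unit :: "'p \<Rightarrow> 'n" where
  "unit x = \<phi> x (Fobj F x) (Ide A (Fobj F x))"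

lemma unit:
  assumes "x \<in> Obj B"
  shows "unit x \<in> Arr B" "Dom B (unit x) = x" "Cod B (unit x) = Fobj R (Fobj F x)"
  using \<phi>_in[of x "Fobj F x" "Ide A (Fobj F x)"] assms by (simp_all add: unit_def)

lemma counit_F_unit:
  assumes "x \<in> Obj B"
  shows "counit (Fobj F x) \<cdot>\<^bsub>A\<^esub> Fmap F (unit x) = Ide A (Fobj F x)"
proof -
  have Fx: "Fobj F x \<in> Obj A" using assms by simp
  have u: "unit x \<in> Hom B x (Fobj R (Fobj F x))" using unit[OF assms] by simp
  have "\<phi> x (Fobj F x) (counit (Fobj F x) \<cdot>\<^bsub>A\<^esub> Fmap F (unit x)) = \<phi> x (Fobj F x) (Ide A (Fobj F x))"
    using \<phi>_counit_comp[OF Fx u assms] by (simp only: unit_def)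
  then show ?thesis
    by (rule \<phi>_inj[OF _ assms Fx]) (use u assms counit[OF Fx] in simp_all)
qed

text \<open>As \<open>F\<close> is full, the counit at \<open>Fobj F x\<close> is the image of some
  \<open>t\<close>. The triangle identity and faithfulness make \<open>t\<close> a left inverse of
  the unit, and naturality of the adjunction makes it a right inverse.\<close>

lemma unit_inverse:
  assumes "x \<in> Obj B"
  obtains t where "t \<in> Hom B (Fobj R (Fobj F x)) x" "t \<cdot>\<^bsub>B\<^esub> unit x = Ide B x" "unit x \<cdot>\<^bsub>B\<^esub> t = Ide B (Fobj R (Fobj F x))"
proof -
  have Fx: "Fobj F x \<in> Obj A" and RFx: "Fobj R (Fobj F x) \<in> Obj B" using assms by simp_all
  note c = counit[OF Fx] and u = unit[OF assms]
  obtain t where t: "t \<in> Hom B (Fobj R (Fobj F x)) x" "Fmap F t = counit (Fobj F x)"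
    by (rule F_full[OF c(1-3) RFx assms])
  have t': "t \<in> Arr B" "Dom B t = Fobj R (Fobj F x)" "Cod B t = x" using t(1) by simp_all
  have "t \<cdot>\<^bsub>B\<^esub> unit x = Ide B x"
  proof (rule F_faithful[OF _ _ _ assms assms])
    show "Fmap F (t \<cdot>\<^bsub>B\<^esub> unit x) = Fmap F (Ide B x)"
      using F_comp[of "unit x" t] t' u t(2) counit_F_unit[OF assms] assms by simp
  qed (use t' u assms in simp_all)
  moreover have "\<phi> (Fobj R (Fobj F x)) (Fobj F x) (Ide A (Fobj F x) \<cdot>\<^bsub>A\<^esub> Ide A (Fobj F x) \<cdot>\<^bsub>A\<^esub> Fmap F t)
      = Fmap R (Ide A (Fobj F x)) \<cdot>\<^bsub>B\<^esub> \<phi> x (Fobj F x) (Ide A (Fobj F x)) \<cdot>\<^bsub>B\<^esub> t"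
    by (rule \<phi>_nat) (use Fx RFx assms t(1) in simp_all)
  then have "unit x \<cdot>\<^bsub>B\<^esub> t = Ide B (Fobj R (Fobj F x))"
    using t t' Fx u c assms by (simp add: unit_def)
  ultimately show ?thesis
    using that t(1) by blast
qed

text \<open>By the other triangle identity, \<open>R\<close> sends the counit to a left inverse of
  the unit at \<open>Fobj R a\<close>, which is invertible. So the image of the counit is the
  two-sided inverse \<open>t\<close>.\<close>

lemma R_counit_mono_epi:
  assumes "a \<in> Obj A"
  shows "is_mono B (Fmap R (counit a))" "is_epi B (Fmap R (counit a))"
proof -
  note c = counit[OF assms]
  have r: "Fobj R a \<in> Obj B" and Fr: "Fobj F (Fobj R a) \<in> Obj A" using assms by simp_all
  note u = unit[OF r]
  obtain t where t: "t \<in> Hom B (Fobj R (Fobj F (Fobj R a))) (Fobj R a)" "t \<cdot>\<^bsub>B\<^esub> unit (Fobj R a) = Ide B (Fobj R a)"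
    "unit (Fobj R a) \<cdot>\<^bsub>B\<^esub> t = Ide B (Fobj R (Fobj F (Fobj R a)))"
    by (rule unit_inverse[OF r])
  have t': "t \<in> Arr B" "Dom B t = Fobj R (Fobj F (Fobj R a))" "Cod B t = Fobj R a" using t(1) by simp_all
  have "\<phi> (Fobj R a) a (counit a \<cdot>\<^bsub>A\<^esub> Ide A (Fobj F (Fobj R a)) \<cdot>\<^bsub>A\<^esub> Fmap F (Ide B (Fobj R a)))
      = Fmap R (counit a) \<cdot>\<^bsub>B\<^esub> \<phi> (Fobj R a) (Fobj F (Fobj R a)) (Ide A (Fobj F (Fobj R a))) \<cdot>\<^bsub>B\<^esub> Ide B (Fobj R a)"
    by (rule \<phi>_nat) (use r assms c Fr in simp_all)
  then have cu: "Fmap R (counit a) \<cdot>\<^bsub>B\<^esub> unit (Fobj R a) = Ide B (Fobj R a)"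
    using c r Fr u assms by (simp flip: unit_def)
  have "(Fmap R (counit a) \<cdot>\<^bsub>B\<^esub> unit (Fobj R a)) \<cdot>\<^bsub>B\<^esub> t = t"
    unfolding cu using t' by simp
  then have e: "Fmap R (counit a) = t"
    using c u t' t(3) assms by simp
  show "is_mono B (Fmap R (counit a))"
    unfolding e
  proof (rule B.monoI)
    fix g assume g: "g \<in> Arr B" "Cod B g = Dom B t" "t \<cdot>\<^bsub>B\<^esub> g = Zer B (Dom B g) (Cod B t)"
    have "unit (Fobj R a) \<cdot>\<^bsub>B\<^esub> (t \<cdot>\<^bsub>B\<^esub> g) = g"
      by (subst B.comp_subst[OF t(3)]) (use u t' g in simp_all)
    then show "g = Zer B (Dom B g) (Dom B t)"
      unfolding g(3) using t' u g by simp
  qed (rule t')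
  show "is_epi B (Fmap R (counit a))"
    unfolding e
  proof (rule B.epiI)
    fix g assume g: "g \<in> Arr B" "Dom B g = Cod B t" "g \<cdot>\<^bsub>B\<^esub> t = Zer B (Dom B t) (Cod B g)"
    have "g \<cdot>\<^bsub>B\<^esub> (t \<cdot>\<^bsub>B\<^esub> unit (Fobj R a)) = Zer B (Dom B t) (Cod B g) \<cdot>\<^bsub>B\<^esub> unit (Fobj R a)"
      by (rule B.comp_subst[OF g(3)]) (use u t' g in simp_all)
    then show "g = Zer B (Cod B t) (Cod B g)"
      using t' u g by (simp add: t(2))
  qed (rule t')
qed

text \<open>The objects annihilated by \<open>R\<close>; they turn out to be the right perpendicular
  class. In this description closure under subobjects, quotients and extensions follows from
  exactness of \<open>R\<close>.\<close>

definition null :: "'o set" where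
  "null = {a \<in> Obj A. Ide B (Fobj R a) = Zer B (Fobj R a) (Fobj R a)}"

lemma null_ses:
  assumes "short_exact A f g"
  shows "Cod A f \<in> null \<longleftrightarrow> Dom A f \<in> null \<and> Cod A g \<in> null"
proof -
  note s = A.sesD[OF assms] and r = R_ses[OF assms]
  note s' = B.sesD[OF r]
  note [simp] = s(1-4) s'(1-4)
  have o: "Dom A f \<in> Obj A" "Dom A g \<in> Obj A" "Cod A g \<in> Obj A" by simp_all
  show ?thesis
  proof
    assume "Cod A f \<in> null"
    then have z: "Ide B (Fobj R (Dom A g)) = Zer B (Fobj R (Dom A g)) (Fobj R (Dom A g))"
      by (simp add: null_def)
    have "Fmap R f = Zer B (Fobj R (Dom A f)) (Fobj R (Dom A g))"
      using B.Zer_Ide_imp(1)[OF z, of "Fmap R f"] by simp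
    then have "Ide B (Fobj R (Dom A f)) = Zer B (Fobj R (Dom A f)) (Fobj R (Dom A f))"
      using B.mono_zer[OF s'(5), of "Ide B (Fobj R (Dom A f))"] by simp
    moreover have "Fmap R g = Zer B (Fobj R (Dom A g)) (Fobj R (Cod A g))"
      using B.Zer_Ide_imp(2)[OF z, of "Fmap R g"] by simp
    then have "Ide B (Fobj R (Cod A g)) = Zer B (Fobj R (Cod A g)) (Fobj R (Cod A g))"
      using B.epi_zer[OF s'(6), of "Ide B (Fobj R (Cod A g))"] by simp
    ultimately show "Dom A f \<in> null \<and> Cod A g \<in> null"
      by (simp add: null_def)
  next
    assume "Dom A f \<in> null \<and> Cod A g \<in> null"
    then have z: "Ide B (Fobj R (Dom A f)) = Zer B (Fobj R (Dom A f)) (Fobj R (Dom A f))"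
        "Ide B (Fobj R (Cod A g)) = Zer B (Fobj R (Cod A g)) (Fobj R (Cod A g))"
      by (simp_all add: null_def)
    let ?i = "Ide B (Fobj R (Dom A g))"
    have gz: "Fmap R g = Zer B (Fobj R (Dom A g)) (Fobj R (Cod A g))"
      using B.Zer_Ide_imp(1)[OF z(2), of "Fmap R g"] by simp
    obtain y where y: "y \<in> Arr B" "Dom B y = Dom B ?i" "Cod B y = Dom B (Fmap R f)" "Fmap R f \<cdot>\<^bsub>B\<^esub> y = ?i"
      by (rule B.kernel_lift[OF s'(7), of ?i]) (assumption | simp add: gz)+
    have "y = Zer B (Fobj R (Dom A g)) (Fobj R (Dom A f))"
      using B.Zer_Ide_imp(1)[OF z(1), of y] y by simp
    then have "?i = Zer B (Fobj R (Dom A g)) (Fobj R (Dom A g))"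
      using y(4) by simp
    then show "Cod A f \<in> null"
      by (simp add: null_def)
  qed
qed

text \<open>Factor the counit through its image as \<open>e\<close> followed by \<open>m\<close>.
  Since \<open>R\<close> makes the counit mono and epi, \<open>R e\<close> is mono and
  \<open>R m\<close> is epi. Hence the mono \<open>R k\<close> and the epi \<open>R h\<close> are
  zero, and with them the images of the kernel and of the cokernel object.\<close>

lemma counit_null:
  assumes "a \<in> Obj A"
  shows "is_kernel A k (counit a) \<Longrightarrow> Dom A k \<in> null" "is_cokernel A h (counit a) \<Longrightarrow> Cod A h \<in> null"
proof -
  note c [simp] = counit(1-3)[OF assms]
  obtain k' where k: "is_kernel A k' (counit a)" using A.ex_kernel[OF c(1)] by auto
  note [simp] = A.kernelD(1-4)[OF k]
  obtain e where e: "is_cokernel A e k'" using A.ex_cokernel[of k'] by auto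
  note [simp] = A.cokernelD(1-4)[OF e]
  obtain m where m: "is_mono A m" "Dom A m = Cod A e" "Cod A m = Cod A (counit a)" "m \<cdot>\<^bsub>A\<^esub> e = counit a"
    by (rule A.image_factor[of "counit a" k' e, OF _ k e]) (assumption | simp)+
  note [simp] = m(2,3) A.mono_arr[OF m(1)]
  have rc: "Fmap R m \<cdot>\<^bsub>B\<^esub> Fmap R e = Fmap R (counit a)"
    using R_comp[of e m] m(4) by simp
  have zero_by_mono: "x \<in> null" if "x \<in> Obj A" "is_mono B f" "Dom B f = Fobj R x" "f = Zer B (Dom B f) (Cod B f)" for x f
  proof -
    have f: "f \<in> Arr B" by (rule B.mono_arr[OF that(2)])
    have "f \<cdot>\<^bsub>B\<^esub> Ide B (Fobj R x) = Zer B (Fobj R x) (Cod B f)"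
      using f that(3,4) by simp
    then have "Ide B (Fobj R x) = Zer B (Fobj R x) (Fobj R x)"
      using B.mono_zer[OF that(2), of "Ide B (Fobj R x)"] that(1,3) by simp
    then show ?thesis using that(1) by (simp add: null_def)
  qed
  have zero_by_epi: "x \<in> null" if "x \<in> Obj A" "is_epi B f" "Cod B f = Fobj R x" "f = Zer B (Dom B f) (Cod B f)" for x f
  proof -
    have f: "f \<in> Arr B" by (rule B.epi_arr[OF that(2)])
    have "Ide B (Fobj R x) \<cdot>\<^bsub>B\<^esub> f = Zer B (Dom B f) (Fobj R x)"
      using f that(3,4) by simp
    then have "Ide B (Fobj R x) = Zer B (Fobj R x) (Fobj R x)"
      using B.epi_zer[OF that(2), of "Ide B (Fobj R x)"] that(1,3) by simp
    then show ?thesis using that(1) by (simp add: null_def)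
  qed
  show "Dom A k \<in> null" if k: "is_kernel A k (counit a)"
  proof -
    note [simp] = A.kernelD(1-3)[OF k]
    obtain e where e: "is_cokernel A e k" using A.ex_cokernel[of k] by auto
    note [simp] = A.cokernelD(1-4)[OF e]
    obtain m where m: "is_mono A m" "Dom A m = Cod A e" "Cod A m = Cod A (counit a)" "m \<cdot>\<^bsub>A\<^esub> e = counit a"
      by (rule A.image_factor[of "counit a" k e, OF _ k e]) (assumption | simp)+
    note [simp] = m(2,3) A.mono_arr[OF m(1)]
    have s: "short_exact A k e"
      by (rule A.ses_monoI[OF A.kernelD(5)[OF k] e])
    note s' = B.sesD[OF R_ses[OF s]]
    have "is_mono B (Fmap R e)"
      by (rule B.mono_cancel[of "Fmap R m"]) (use R_comp[of e m] m(4) R_counit_mono_epi(1)[OF assms] in simp_all)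
    then have "Fmap R k = Zer B (Fobj R (Dom A k)) (Fobj R (Cod A k))"
      using B.mono_zer[of "Fmap R e" "Fmap R k"] s'(4) by simp
    then show ?thesis
      by (intro zero_by_mono[OF _ s'(5)]) (simp_all add: assms)
  qed
  show "Cod A h \<in> null" if h: "is_cokernel A h (counit a)"
  proof -
    note [simp] = A.cokernelD(1-3)[OF h]
    have "is_cokernel A h m"
    proof (rule A.cokernelI[OF A.cokernelD(5)[OF h]])
      show "h \<cdot>\<^bsub>A\<^esub> m = Zer A (Dom A m) (Cod A h)"
        using A.epi_zer[OF A.cokernelD(5)[OF e], of "h \<cdot>\<^bsub>A\<^esub> m"] A.cokernelD(4)[OF h] m(4) by simp
      fix x assume x: "x \<in> Arr A" "Dom A x = Cod A m" and xm: "x \<cdot>\<^bsub>A\<^esub> m = Zer A (Dom A m) (Cod A x)"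
      have "x \<cdot>\<^bsub>A\<^esub> (m \<cdot>\<^bsub>A\<^esub> e) = Zer A (Dom A m) (Cod A x) \<cdot>\<^bsub>A\<^esub> e"
        by (rule A.comp_subst[OF xm]) (use x in simp_all)
      then have "x \<cdot>\<^bsub>A\<^esub> counit a = Zer A (Dom A (counit a)) (Cod A x)"
        using x by (simp add: m(4))
      then obtain y where "y \<in> Arr A" "Dom A y = Cod A h" "Cod A y = Cod A x" "y \<cdot>\<^bsub>A\<^esub> h = x"
        using x by - (rule A.cokernel_lift[OF h, of x], (assumption | simp)+)
      then show "\<exists>y. y \<in> Arr A \<and> Dom A y = Cod A h \<and> Cod A y = Cod A x \<and> y \<cdot>\<^bsub>A\<^esub> h = x" by blast
    qed simp_all
    then have s: "short_exact A m h"
      by (rule A.ses_monoI[OF m(1)])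
    note s' = B.sesD[OF R_ses[OF s]]
    have "is_epi B (Fmap R m)"
      by (rule B.epi_cancel[of _ "Fmap R e"]) (use rc R_counit_mono_epi(2)[OF assms] in simp_all)
    then have "Fmap R h = Zer B (Fobj R (Dom A h)) (Fobj R (Cod A h))"
      using B.epi_zer[of "Fmap R m" "Fmap R h"] s'(4) by simp
    then show ?thesis
      by (intro zero_by_epi[OF _ s'(6)]) (simp_all add: assms)
  qed
qed

text \<open>The adjunction turns Hom(F x, a) into Hom(x, R a), which vanishes for all
  \<open>x\<close> exactly when it does so for \<open>x\<close> equal to \<open>R a\<close>, that
  is, when \<open>R a\<close> is zero. The vanishing of Ext then follows from exactness of
  \<open>R\<close>.\<close>

lemma null_eq_right_perp: "right_perp B A F = null"
proof (intro Set.set_eqI iffI)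
  fix a assume "a \<in> right_perp B A F"
  then have a: "a \<in> Obj A" and h: "\<And>b. b \<in> Obj B \<Longrightarrow> Hom A (Fobj F b) a = {Zer A (Fobj F b) a}"
    by (auto simp add: right_perp_def)
  have r: "Fobj R a \<in> Obj B" using a by simp
  have "Hom B (Fobj R a) (Fobj R a) = \<phi> (Fobj R a) a ` {Zer A (Fobj F (Fobj R a)) a}"
    using \<phi>_bij[OF r a] unfolding h[OF r] bij_betw_def by blast
  moreover have "Ide B (Fobj R a) \<in> Hom B (Fobj R a) (Fobj R a)" "Zer B (Fobj R a) (Fobj R a) \<in> Hom B (Fobj R a) (Fobj R a)"
    using r by simp_all
  ultimately have "Ide B (Fobj R a) = Zer B (Fobj R a) (Fobj R a)"
    by (metis image_insert image_empty singletonD)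
  then show "a \<in> null" using a by (simp add: null_def)
next
  fix a assume "a \<in> null"
  then have a: "a \<in> Obj A" and z: "Ide B (Fobj R a) = Zer B (Fobj R a) (Fobj R a)"
    by (auto simp add: null_def)
  show "a \<in> right_perp B A F"
    unfolding right_perp_def
  proof (intro CollectI conjI ballI)
    fix x assume x: "x \<in> Obj B"
    have Fx: "Fobj F x \<in> Obj A" using x by simp
    have all: "g = Zer A (Fobj F x) a" if "g \<in> Hom A (Fobj F x) a" for g
    proof (rule \<phi>_inj[OF _ x a that])
      have zz: "Zer A (Fobj F x) a \<in> Hom A (Fobj F x) a" using a Fx by simp
      show "Zer A (Fobj F x) a \<in> Hom A (Fobj F x) a" by (rule zz)
      show "\<phi> x a g = \<phi> x a (Zer A (Fobj F x) a)"
        using B.Zer_Ide_imp(1)[OF z, of "\<phi> x a g"] B.Zer_Ide_imp(1)[OF z, of "\<phi> x a (Zer A (Fobj F x) a)"]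
          \<phi>_in[OF x a that] \<phi>_in[OF x a zz] a by simp
    qed
    moreover have "Zer A (Fobj F x) a \<in> Hom A (Fobj F x) a" using a Fx by simp
    ultimately show "Hom A (Fobj F x) a = {Zer A (Fobj F x) a}"
      by blast
    show "Ext1 A (Fobj F x) a = {Ext1_zero A (Fobj F x) a}"
      unfolding A.Ext1_trivial_iff[OF a Fx]
    proof (intro allI impI)
      fix f g assume "(f, g) \<in> extensions A (Fobj F x) a"
      note E = A.extensionsD[OF this]
      note s = A.sesD[OF E(1)] and s' = B.sesD[OF R_ses[OF E(1)]]
      note [simp] = s(1-4) E(2,3) s'(1-4) x
      have "is_mono B (Fmap R g)"
      proof (rule B.monoI)
        fix y assume y: "y \<in> Arr B" "Cod B y = Dom B (Fmap R g)" "Fmap R g \<cdot>\<^bsub>B\<^esub> y = Zer B (Dom B y) (Cod B (Fmap R g))"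
        then obtain t where t: "t \<in> Arr B" "Dom B t = Dom B y" "Cod B t = Dom B (Fmap R f)" "Fmap R f \<cdot>\<^bsub>B\<^esub> t = y"
          by - (rule B.kernel_lift[OF s'(7), of y], (assumption | simp)+)
        have "t = Zer B (Dom B y) (Fobj R a)"
          using B.Zer_Ide_imp(1)[OF z, of t] t a by simp
        then show "y = Zer B (Dom B y) (Dom B (Fmap R g))"
          using t(4) y by simp
      qed simp
      then obtain r where r: "r \<in> Arr B" "Dom B r = Cod B (Fmap R g)" "Cod B r = Dom B (Fmap R g)"
        "r \<cdot>\<^bsub>B\<^esub> Fmap R g = Ide B (Dom B (Fmap R g))" "Fmap R g \<cdot>\<^bsub>B\<^esub> r = Ide B (Cod B (Fmap R g))"
        using B.mono_epi_inverse[OF _ s'(6)] by blast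
      have e: "Dom A g \<in> Obj A" by simp
      note c = counit[OF e]
      note u = unit[OF x]
      have re: "Fobj R (Dom A g) \<in> Obj B" by simp
      \<comment> \<open>As \<open>R a\<close> is zero, \<open>R g\<close> has an inverse
        \<open>r\<close>. Composed with the unit it corresponds under the adjunction to
        \<open>?s\<close>, and the unit corresponds to the identity, so \<open>?s\<close> is a
        section of \<open>g\<close>.\<close>
      let ?t = "r \<cdot>\<^bsub>B\<^esub> unit x"
      let ?s = "counit (Dom A g) \<cdot>\<^bsub>A\<^esub> Fmap F ?t"
      have t: "?t \<in> Arr B" "Dom B ?t = x" "Cod B ?t = Fobj R (Dom A g)"
        using r u by simp_all
      have "\<phi> x (Fobj F x) (g \<cdot>\<^bsub>A\<^esub> counit (Dom A g) \<cdot>\<^bsub>A\<^esub> Fmap F ?t)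
          = Fmap R g \<cdot>\<^bsub>B\<^esub> \<phi> (Fobj R (Dom A g)) (Dom A g) (counit (Dom A g)) \<cdot>\<^bsub>B\<^esub> ?t"
        by (rule \<phi>_nat[OF re x e Fx]) (use t c in simp_all)
      also have "\<dots> = unit x"
        using c(4) r u by (simp add: B.comp_subst[OF r(5)])
      finally have "\<phi> x (Fobj F x) (g \<cdot>\<^bsub>A\<^esub> ?s) = \<phi> x (Fobj F x) (Ide A (Fobj F x))"
        using t c by (simp add: unit_def)
      then have "g \<cdot>\<^bsub>A\<^esub> ?s = Ide A (Fobj F x)"
        by (rule \<phi>_inj[OF _ x Fx]) (use t c in simp_all)
      moreover have "?s \<in> Hom A (Cod A g) (Dom A g)" using t c by simp
      ultimately show "split_epi A g"
        by (auto simp add: split_epi_def intro!: bexI[of _ ?s])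
    qed
  qed (rule a)
qed

end

section \<open>Left adjoints and left perpendicular categories by duality\<close>

lemma adjoint_pair_op:
  assumes "abelian_category A" "abelian_category B" "exact_functor A B L" "adjunction A B L F" "fully_faithful B A F"
  obtains \<phi> where "adjoint_pair (op_cat A) (op_cat B) F L \<phi>"
proof -
  interpret A: abelian_category A by fact
  interpret B: abelian_category B by fact
  obtain \<psi> where F: "is_functor B A F" and L: "is_functor A B L"
    and bij: "\<And>x y. \<lbrakk>x \<in> Obj A; y \<in> Obj B\<rbrakk> \<Longrightarrow> bij_betw (\<psi> x y) (Hom B (Fobj L x) y) (Hom A x (Fobj F y))"
    and nat: "\<And>x x' y y' f h g. \<lbrakk>x \<in> Obj A; x' \<in> Obj A; y \<in> Obj B; y' \<in> Obj B; f \<in> Hom A x' x; h \<in> Hom B y y'; g \<in> Hom B (Fobj L x) y\<rbrakk>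
       \<Longrightarrow> \<psi> x' y' (h \<cdot>\<^bsub>B\<^esub> g \<cdot>\<^bsub>B\<^esub> Fmap L f) = Fmap F h \<cdot>\<^bsub>A\<^esub> \<psi> x y g \<cdot>\<^bsub>A\<^esub> f"
    using assms(4) unfolding adjunction_def by metis
  \<comment> \<open>Reversing arrows exchanges the two sides of the adjunction, so the bijection has
    to be inverted.\<close>
  define \<phi> where "\<phi> x y = the_inv_into (Hom B (Fobj L y) x) (\<psi> y x)" for x y
  have \<phi>bij: "bij_betw (\<phi> x y) (Hom A y (Fobj F x)) (Hom B (Fobj L y) x)" if "x \<in> Obj B" "y \<in> Obj A" for x y
    unfolding \<phi>_def by (rule bij_betw_the_inv_into[OF bij[OF that(2,1)]])
  have \<psi>\<phi>: "\<psi> y x (\<phi> x y g) = g" if "x \<in> Obj B" "y \<in> Obj A" "g \<in> Hom A y (Fobj F x)" for x y g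
    unfolding \<phi>_def by (rule f_the_inv_into_f_bij_betw[OF bij[OF that(2,1)]]) (use that in blast)
  have \<phi>\<psi>: "\<phi> x y (\<psi> y x g) = g" if "x \<in> Obj B" "y \<in> Obj A" "g \<in> Hom B (Fobj L y) x" for x y g
    unfolding \<phi>_def by (rule the_inv_into_f_f) (use bij[OF that(2,1)] that(3) in \<open>simp_all only: bij_betw_def\<close>)
  have "adjoint_pair (op_cat A) (op_cat B) F L \<phi>"
  proof (intro adjoint_pair.intro adjoint_pair_axioms.intro A.op_abelian B.op_abelian exact_functor_op fully_faithful_op assms(3,5))
    show "is_functor (op_cat B) (op_cat A) F" using F by (simp add: functor_op)
    show "bij_betw (\<phi> x y) (Hom (op_cat A) (Fobj F x) y) (Hom (op_cat B) x (Fobj L y))"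
      if "x \<in> Obj (op_cat B)" "y \<in> Obj (op_cat A)" for x y
      using \<phi>bij that by (simp del: in_Hom)
    fix x x' y y' f h g
    assume o': "x \<in> Obj (op_cat B)" "x' \<in> Obj (op_cat B)" "y \<in> Obj (op_cat A)" "y' \<in> Obj (op_cat A)"
      and f': "f \<in> Hom (op_cat B) x' x" and h': "h \<in> Hom (op_cat A) y y'" and g': "g \<in> Hom (op_cat A) (Fobj F x) y"
    have o: "x \<in> Obj B" "x' \<in> Obj B" "y \<in> Obj A" "y' \<in> Obj A" using o' by simp_all
    have f: "f \<in> Hom B x x'" and h: "h \<in> Hom A y' y" and g: "g \<in> Hom A y (Fobj F x)" using f' h' g' by simp_all
    have pg: "\<phi> x y g \<in> Hom B (Fobj L y) x" using \<phi>bij[OF o(1,3)] g bij_betwE by blast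
    have Lh: "Fmap L h \<in> Hom B (Fobj L y') (Fobj L y)" using L h o unfolding is_functor_def by blast
    have Ff: "Fmap F f \<in> Hom A (Fobj F x) (Fobj F x')" using F f o unfolding is_functor_def by blast
    have "\<psi> y' x' (f \<cdot>\<^bsub>B\<^esub> \<phi> x y g \<cdot>\<^bsub>B\<^esub> Fmap L h) = Fmap F f \<cdot>\<^bsub>A\<^esub> g \<cdot>\<^bsub>A\<^esub> h"
      using nat[OF o(3,4,1,2) h f pg] \<psi>\<phi>[OF o(1,3) g] by simp
    then have "\<phi> x' y' (Fmap F f \<cdot>\<^bsub>A\<^esub> g \<cdot>\<^bsub>A\<^esub> h) = f \<cdot>\<^bsub>B\<^esub> \<phi> x y g \<cdot>\<^bsub>B\<^esub> Fmap L h"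
      using \<phi>\<psi>[OF o(2,4), of "f \<cdot>\<^bsub>B\<^esub> \<phi> x y g \<cdot>\<^bsub>B\<^esub> Fmap L h"] f pg Lh by simp
    then show "\<phi> x' y' (h \<cdot>\<^bsub>op_cat A\<^esub> g \<cdot>\<^bsub>op_cat A\<^esub> Fmap F f) = Fmap L h \<cdot>\<^bsub>op_cat B\<^esub> \<phi> x y g \<cdot>\<^bsub>op_cat B\<^esub> f"
      using f g h pg Lh Ff by simp
  qed
  then show ?thesis by (rule that)
qed

lemma right_perp_op:
  fixes A :: "('o, 'm) cat" and B :: "('p, 'n) cat"
  assumes "abelian_category A"
  shows "right_perp (op_cat B) (op_cat A) F = left_perp B A F"
proof -
  interpret A: abelian_category A by fact
  have "(converse ` X = {Y\<inverse>}) = (X = {Y})" for X :: "('m \<times> 'm) set set" and Y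
  proof
    assume "converse ` X = {Y\<inverse>}"
    then have "converse ` converse ` X = {Y}" by simp
    then show "X = {Y}" by (simp add: image_image)
  qed simp
  then show ?thesis
    unfolding right_perp_def left_perp_def by (simp add: A.Ext1_op A.Ext1_zero_op)
qed

section \<open>Equivalences with module categories\<close>

lemma full_sub_simps [simp]:
  "Obj (full_sub C S) = S" "f \<in> Arr (full_sub C S) \<longleftrightarrow> f \<in> Arr C \<and> Dom C f \<in> S \<and> Cod C f \<in> S"
  "Dom (full_sub C S) = Dom C" "Cod (full_sub C S) = Cod C" "Ide (full_sub C S) = Ide C"
  "Comp (full_sub C S) = Comp C" "Add (full_sub C S) = Add C" "Zer (full_sub C S) = Zer C"
  by (simp_all add: full_sub_def)

lemma Hom_full_sub: "\<lbrakk>x \<in> S; y \<in> S\<rbrakk> \<Longrightarrow> Hom (full_sub C S) x y = Hom C x y"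
  by auto

lemma (in preadditive_category) preadditive_full_sub:
  assumes "S \<subseteq> Obj C"
  shows "preadditive_category (full_sub C S)"
proof (intro preadditive_category.intro category.intro preadditive_category_axioms.intro)
  fix x y assume "x \<in> Obj (full_sub C S)" "y \<in> Obj (full_sub C S)"
  then have xy: "x \<in> S" "y \<in> S" "x \<in> Obj C" "y \<in> Obj C" using assms by auto
  have "Hom_group (full_sub C S) x y = Hom_group C x y"
    unfolding Hom_group_def Hom_full_sub[OF xy(1,2)] by simp
  then show "comm_group (Hom_group (full_sub C S) x y)"
    using Hom_comm_group[OF xy(3,4)] by simp
qed (use assms in auto)

section \<open>Equivalences are fully faithful\<close>

context category
begin

lemma nat_iso_faithful:
  assumes "category D" "is_functor C D F" "is_functor D C G" "nat_isomorphic C C (comp_func G F) id_func"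
    "f \<in> Hom C x y" "g \<in> Hom C x y" "Fmap F f = Fmap F g"
  shows "f = g"
proof -
  obtain \<tau> where \<tau>: "\<And>x. x \<in> Obj C \<Longrightarrow> \<tau> x \<in> Hom C (Fobj G (Fobj F x)) x \<and> is_iso C (\<tau> x)"
    and nat: "\<And>x y f. \<lbrakk>x \<in> Obj C; y \<in> Obj C; f \<in> Hom C x y\<rbrakk> \<Longrightarrow> \<tau> y \<cdot> Fmap G (Fmap F f) = f \<cdot> \<tau> x"
    using assms(4) unfolding nat_isomorphic_def comp_func_def id_func_def by (simp del: in_Hom) blast
  have xy: "x \<in> Obj C" "y \<in> Obj C" using assms(5) by auto
  obtain r where r: "r \<in> Arr C" "Dom C r = x" "\<tau> x \<cdot> r = Ide C x" "Cod C r = Fobj G (Fobj F x)"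
    using \<tau>[OF xy(1)] unfolding is_iso_def by auto
  have "f \<cdot> \<tau> x = g \<cdot> \<tau> x"
    using nat[OF xy assms(5)] nat[OF xy assms(6)] assms(7) by simp
  then have "(f \<cdot> \<tau> x) \<cdot> r = (g \<cdot> \<tau> x) \<cdot> r" by simp
  then show ?thesis
    using r \<tau>[OF xy(1)] assms(5,6) by simp
qed

lemma equivalence_fully_faithful:
  assumes "category D" "equivalent_cats C D"
  obtains F where "is_functor C D F" "fully_faithful C D F"
proof -
  interpret D: category D by fact
  obtain F G where F: "is_functor C D F" and G: "is_functor D C G"
    and n1: "nat_isomorphic C C (comp_func G F) id_func" and n2: "nat_isomorphic D D (comp_func F G) id_func"
    using assms(2) unfolding equivalent_cats_def by blast
  obtain \<tau> where \<tau>: "\<And>x. x \<in> Obj C \<Longrightarrow> \<tau> x \<in> Hom C (Fobj G (Fobj F x)) x \<and> is_iso C (\<tau> x)"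
    and nat: "\<And>x y f. \<lbrakk>x \<in> Obj C; y \<in> Obj C; f \<in> Hom C x y\<rbrakk> \<Longrightarrow> \<tau> y \<cdot> Fmap G (Fmap F f) = f \<cdot> \<tau> x"
    using n1 unfolding nat_isomorphic_def comp_func_def id_func_def by (simp del: in_Hom) blast
  note FD = functorD[OF F] and GD = D.functorD[OF G]
  have "fully_faithful C D F"
    unfolding fully_faithful_def
  proof (intro ballI)
    fix x y assume xy: "x \<in> Obj C" "y \<in> Obj C"
    have inj: "inj_on (Fmap F) (Hom C x y)"
      by (rule inj_onI) (rule nat_iso_faithful[OF assms(1) F G n1])
    have "g \<in> Fmap F ` Hom C x y" if g: "g \<in> Hom D (Fobj F x) (Fobj F y)" for g
    proof -
      obtain r where r: "r \<in> Arr C" "Dom C r = x" "r \<cdot> \<tau> x = Ide C (Fobj G (Fobj F x))" "Cod C r = Fobj G (Fobj F x)"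
        using \<tau>[OF xy(1)] unfolding is_iso_def by auto
      obtain r' where r': "r' \<in> Arr C" "Dom C r' = y" "r' \<cdot> \<tau> y = Ide C (Fobj G (Fobj F y))" "Cod C r' = Fobj G (Fobj F y)"
        using \<tau>[OF xy(2)] unfolding is_iso_def by auto
      note t = \<tau>[OF xy(1)] \<tau>[OF xy(2)]
      have g': "g \<in> Arr D" "Dom D g = Fobj F x" "Cod D g = Fobj F y" using g by simp_all
      \<comment> \<open>\<open>Fmap G g\<close> conjugated by the natural isomorphism. Naturality
        gives it the same image under \<open>G\<close> after \<open>F\<close> as \<open>g\<close>
        has under \<open>G\<close>, and \<open>G\<close> is faithful.\<close>
      let ?f = "\<tau> y \<cdot> (Fmap G g \<cdot> r)"
      have f: "?f \<in> Hom C x y" using t g' r GD(3-5)[OF g'(1)] by simp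
      have "\<tau> y \<cdot> Fmap G (Fmap F ?f) = ?f \<cdot> \<tau> x"
        by (rule nat[OF xy f])
      also have "\<dots> = \<tau> y \<cdot> Fmap G g"
        using t g' r GD(3-5)[OF g'(1)] xy FD(1) GD(1) by simp
      finally have e: "\<tau> y \<cdot> Fmap G (Fmap F ?f) = \<tau> y \<cdot> Fmap G g" .
      have f': "?f \<in> Arr C" "Dom C ?f = x" "Cod C ?f = y" using f by simp_all
      note Ff = FD(3-5)[OF f'(1)] and GF = GD(3-5)[OF FD(3)[OF f'(1)]]
      have "r' \<cdot> (\<tau> y \<cdot> Fmap G (Fmap F ?f)) = Fmap G (Fmap F ?f)"
        by (subst comp_subst[OF r'(3)]) (use t r' Ff GF f' in simp_all)
      moreover have "r' \<cdot> (\<tau> y \<cdot> Fmap G g) = Fmap G g"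
        by (subst comp_subst[OF r'(3)]) (use t r' GD(3-5)[OF g'(1)] g' in simp_all)
      ultimately have GG: "Fmap G (Fmap F ?f) = Fmap G g" using e by simp
      have "Fmap F ?f = g"
        by (rule D.nat_iso_faithful[OF category_axioms G F n2 _ g GG]) (use Ff f' in simp)
      then show ?thesis by (rule image_eqI[OF sym f])
    qed
    moreover have "Fmap F f \<in> Hom D (Fobj F x) (Fobj F y)" if "f \<in> Hom C x y" for f
      using FD(3-5)[of f] that by simp
    ultimately have "Fmap F ` Hom C x y = Hom D (Fobj F x) (Fobj F y)" by blast
    with inj show "bij_betw (Fmap F) (Hom C x y) (Hom D (Fobj F x) (Fobj F y))"
      by (simp only: bij_betw_def)
  qed
  then show ?thesis by (rule that[OF F])
qed

end

text \<open>An equivalence with a module category is not assumed to be additive. Additivity is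
  derived here from full faithfulness and biproducts in the source, and is what carries sums and
  endomorphism rings back.\<close>

locale ff_functor = C: preadditive_category C + D: preadditive_category D
  for C :: "('o, 'm) cat" and D :: "('p, 'n) cat" +
  fixes F :: "('o, 'm, 'p, 'n) func"
  assumes F: "is_functor C D F" and ff: "fully_faithful C D F"
    and ex_zero: "\<exists>z. zero_object C z"
    and ex_biprod: "\<lbrakk>x \<in> Obj C; y \<in> Obj C\<rbrakk> \<Longrightarrow> \<exists>p i1 i2 p1 p2. biproduct C x y p i1 i2 p1 p2"
begin

lemmas F_simps [simp] = C.functorD(1-5)[OF F]
lemmas F_comp = C.functorD(6)[OF F]

lemma faithful:
  assumes "Fmap F f = Fmap F g" "f \<in> Arr C" "g \<in> Arr C" "Dom C f = Dom C g" "Cod C f = Cod C g"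
  shows "f = g"
proof -
  have "inj_on (Fmap F) (Hom C (Dom C g) (Cod C g))"
    using ff assms(3) unfolding fully_faithful_def bij_betw_def by (metis C.arr_simps(1,2))
  then show ?thesis using assms by (simp add: inj_on_def)
qed

lemma full:
  assumes "g \<in> Arr D" "Dom D g = Fobj F x" "Cod D g = Fobj F y" "x \<in> Obj C" "y \<in> Obj C"
  obtains f where "f \<in> Arr C" "Dom C f = x" "Cod C f = y" "Fmap F f = g"
proof -
  have "bij_betw (Fmap F) (Hom C x y) (Hom D (Fobj F x) (Fobj F y))"
    using ff assms(4,5) unfolding fully_faithful_def by blast
  moreover have "g \<in> Hom D (Fobj F x) (Fobj F y)" using assms by simp
  ultimately have "g \<in> Fmap F ` Hom C x y" by (simp only: bij_betw_def)
  then show ?thesis using that by auto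
qed

text \<open>By fullness the zero endomorphism of the image of a zero object \<open>z\<close> comes
  from an endomorphism of \<open>z\<close>, which can only be the identity. So the image of
  \<open>z\<close> vanishes, and zero arrows, factoring through \<open>z\<close>, go to
  zero.\<close>

lemma F_zer:
  assumes "x \<in> Obj C" "y \<in> Obj C"
  shows "Fmap F (Zer C x y) = Zer D (Fobj F x) (Fobj F y)"
proof -
  obtain z where z: "zero_object C z" using ex_zero ..
  have zo: "z \<in> Obj C" using z by (simp add: zero_object_def)
  have Fz: "Fobj F z \<in> Obj D" using zo by simp
  obtain f where f: "f \<in> Arr C" "Dom C f = z" "Cod C f = z" "Fmap F f = Zer D (Fobj F z) (Fobj F z)"
    by (rule full[of "Zer D (Fobj F z) (Fobj F z)" z z]) (assumption | simp add: zo Fz)+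
  have "Ide C z \<in> Hom C z z" "f \<in> Hom C z z" using f zo by simp_all
  then have "f = Ide C z"
    using z zo unfolding zero_object_def by (metis (no_types, lifting))
  then have i: "Ide D (Fobj F z) = Zer D (Fobj F z) (Fobj F z)"
    using f(4) zo by simp
  have "Fmap F (Zer C x z) = Zer D (Fobj F x) (Fobj F z)"
    using D.Zer_Ide_imp(1)[OF i Fz, of "Fmap F (Zer C x z)"] assms zo by simp
  moreover have "Zer C x y = Zer C z y \<cdot>\<^bsub>C\<^esub> Zer C x z" using assms zo by simp
  then have "Fmap F (Zer C x y) = Fmap F (Zer C z y) \<cdot>\<^bsub>D\<^esub> Fmap F (Zer C x z)"
    using F_comp[of "Zer C x z" "Zer C z y"] assms zo by simp
  ultimately show ?thesis
    using assms zo Fz by simp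
qed

text \<open>The sum of \<open>f\<close> and \<open>g\<close> is the codiagonal \<open>?s\<close>
  after the pair \<open>?h\<close> with components \<open>f\<close> and \<open>g\<close>. The arrow
  \<open>w\<close> over \<open>?u\<close>, the sum of the images of the injected components, has the
  components of \<open>?h\<close>, as is seen after \<open>F\<close>; so \<open>?h\<close> goes to
  \<open>?u\<close>, and composing with \<open>?s\<close> gives the claim.\<close>

lemma F_add:
  assumes "f \<in> Arr C" "g \<in> Arr C" "Dom C f = Dom C g" "Cod C f = Cod C g"
  shows "Fmap F (Add C f g) = Add D (Fmap F f) (Fmap F g)"
proof -
  have o: "Dom C g \<in> Obj C" "Cod C g \<in> Obj C" using assms by simp_all
  obtain p i1 i2 p1 p2 where b: "biproduct C (Cod C g) (Cod C g) p i1 i2 p1 p2"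
    using ex_biprod[OF o(2) o(2)] by blast
  note [simp] = assms C.biproductD(1-17)[OF b] C.biproduct_red[OF b]
  let ?h = "Add C (i1 \<cdot>\<^bsub>C\<^esub> f) (i2 \<cdot>\<^bsub>C\<^esub> g)" and ?s = "Add C p1 p2"
  let ?u = "Add D (Fmap F (i1 \<cdot>\<^bsub>C\<^esub> f)) (Fmap F (i2 \<cdot>\<^bsub>C\<^esub> g))"
  have u: "?u \<in> Arr D" "Dom D ?u = Fobj F (Dom C g)" "Cod D ?u = Fobj F p" by simp_all
  obtain w where w: "w \<in> Arr C" "Dom C w = Dom C g" "Cod C w = p" "Fmap F w = ?u"
    by (rule full[OF u]) (assumption | simp)+
  have pu: "Fmap F q \<cdot>\<^bsub>D\<^esub> ?u = Add D (Fmap F (q \<cdot>\<^bsub>C\<^esub> (i1 \<cdot>\<^bsub>C\<^esub> f))) (Fmap F (q \<cdot>\<^bsub>C\<^esub> (i2 \<cdot>\<^bsub>C\<^esub> g)))"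
    if "q \<in> Arr C" "Dom C q = p" for q
  proof -
    have "Fmap F q \<cdot>\<^bsub>D\<^esub> ?u = Add D (Fmap F q \<cdot>\<^bsub>D\<^esub> Fmap F (i1 \<cdot>\<^bsub>C\<^esub> f)) (Fmap F q \<cdot>\<^bsub>D\<^esub> Fmap F (i2 \<cdot>\<^bsub>C\<^esub> g))"
      by (rule D.comp_add) (simp_all add: that)
    then show ?thesis
      using F_comp[of "i1 \<cdot>\<^bsub>C\<^esub> f" q] F_comp[of "i2 \<cdot>\<^bsub>C\<^esub> g" q] that by simp
  qed
  have "w = ?h"
  proof (rule C.biproduct_eqI[OF b])
    have "Fmap F (p1 \<cdot>\<^bsub>C\<^esub> w) = Fmap F f"
      using pu[of p1] F_comp[of w p1] w o by (simp add: F_zer)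
    then show "p1 \<cdot>\<^bsub>C\<^esub> w = p1 \<cdot>\<^bsub>C\<^esub> ?h"
      by (rule faithful[THEN trans]) (use w o in simp_all)
    have "Fmap F (p2 \<cdot>\<^bsub>C\<^esub> w) = Fmap F g"
      using pu[of p2] F_comp[of w p2] w o by (simp add: F_zer)
    then show "p2 \<cdot>\<^bsub>C\<^esub> w = p2 \<cdot>\<^bsub>C\<^esub> ?h"
      by (rule faithful[THEN trans]) (use w o in simp_all)
  qed (use w in simp_all)
  then have Fh: "Fmap F ?h = ?u" using w(4) by simp
  have "Add C f g = ?s \<cdot>\<^bsub>C\<^esub> ?h" using o by simp
  then have "Fmap F (Add C f g) = Fmap F ?s \<cdot>\<^bsub>D\<^esub> Fmap F ?h"
    using F_comp[of ?h ?s] by simp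
  also have "\<dots> = Add D (Fmap F (?s \<cdot>\<^bsub>C\<^esub> (i1 \<cdot>\<^bsub>C\<^esub> f))) (Fmap F (?s \<cdot>\<^bsub>C\<^esub> (i2 \<cdot>\<^bsub>C\<^esub> g)))"
    unfolding Fh by (rule pu) simp_all
  also have "\<dots> = Add D (Fmap F f) (Fmap F g)"
    using o by simp
  finally show ?thesis .
qed

lemma thru_reflect:
  assumes "thru D (Fobj F t) (Fobj F p) (Fobj F q) h" "t \<in> Obj C" "p \<in> Obj C" "q \<in> Obj C"
  shows "\<exists>h'. thru C t p q h' \<and> Fmap F h' = h"
  using assms(1)
proof (induction rule: thru.induct)
  case thru_Zer
  show ?case using thru.thru_Zer[of C t p q] F_zer[OF assms(3,4)] by blast
next
  case (thru_Add h f g)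
  then obtain h' where h': "thru C t p q h'" "Fmap F h' = h" by blast
  have hh: "h' \<in> Arr C" "Dom C h' = p" "Cod C h' = q"
    using C.thru_arr[OF h'(1) assms(3,4)] by simp_all
  obtain f' where f: "f' \<in> Arr C" "Dom C f' = p" "Cod C f' = t" "Fmap F f' = f"
    by (rule full[of f p t]) (assumption | use thru_Add(2) assms in simp)+
  obtain g' where g: "g' \<in> Arr C" "Dom C g' = t" "Cod C g' = q" "Fmap F g' = g"
    by (rule full[of g t q]) (assumption | use thru_Add(3) assms in simp)+
  have "Fmap F (Add C h' (g' \<cdot>\<^bsub>C\<^esub> f')) = Add D h (g \<cdot>\<^bsub>D\<^esub> f)"
    using F_add[of h' "g' \<cdot>\<^bsub>C\<^esub> f'"] F_comp[of f' g'] f g hh h'(2) by simp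
  moreover have "thru C t p q (Add C h' (g' \<cdot>\<^bsub>C\<^esub> f'))"
    by (rule thru.thru_Add[OF h'(1)]) (use f g in simp_all)
  ultimately show ?case by blast
qed

lemma thru_Ide_reflect:
  assumes "thru D (Fobj F t) (Fobj F p) (Fobj F p) (Ide D (Fobj F p))" "t \<in> Obj C" "p \<in> Obj C"
  shows "thru C t p p (Ide C p)"
proof -
  obtain h where h: "thru C t p p h" "Fmap F h = Ide D (Fobj F p)"
    using thru_reflect[OF assms(1,2,3,3)] by blast
  then have "h = Ide C p"
    using C.thru_arr[OF h(1) assms(3,3)] assms(3) by (intro faithful) simp_all
  with h(1) show ?thesis by simp
qed

lemma ring_iso_reflect:
  assumes "\<beta> \<in> ring_iso R (End_ring D (Fobj F t))" "t \<in> Obj C" "ring R"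
  shows "\<exists>\<beta>'. \<beta>' \<in> ring_iso R (End_ring C t)"
proof -
  interpret R: ring R by fact
  note \<beta> = ring_iso_EndD[OF assms(1)]
  define \<beta>' where "\<beta>' d = (SOME h. h \<in> Hom C t t \<and> Fmap F h = \<beta> d)" for d
  have b: "\<beta>' d \<in> Hom C t t \<and> Fmap F (\<beta>' d) = \<beta> d" if d: "d \<in> carrier R" for d
  proof -
    obtain h where "h \<in> Arr C" "Dom C h = t" "Cod C h = t" "Fmap F h = \<beta> d"
      by (rule full[OF \<beta>(1)[OF d] \<beta>(2)[OF d] \<beta>(3)[OF d] assms(2,2)])
    then have "\<exists>h. h \<in> Hom C t t \<and> Fmap F h = \<beta> d" by auto
    from someI_ex[OF this] show ?thesis unfolding \<beta>'_def .
  qed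
  have "\<beta>' \<in> ring_iso R (End_ring C t)"
  proof (rule ring_iso_EndI)
    show "\<beta>' d \<in> Hom C t t" if "d \<in> carrier R" for d using b[OF that] by blast
    show "\<beta>' (d \<otimes>\<^bsub>R\<^esub> e) = \<beta>' d \<cdot>\<^bsub>C\<^esub> \<beta>' e" if de: "d \<in> carrier R" "e \<in> carrier R" for d e
      by (rule faithful)
        (use b[OF de(1)] b[OF de(2)] b[of "d \<otimes>\<^bsub>R\<^esub> e"] de \<beta>(4)[OF de] F_comp[of "\<beta>' e" "\<beta>' d"] in simp_all)
    show "\<beta>' (d \<oplus>\<^bsub>R\<^esub> e) = Add C (\<beta>' d) (\<beta>' e)" if de: "d \<in> carrier R" "e \<in> carrier R" for d e
      by (rule faithful)
        (use b[OF de(1)] b[OF de(2)] b[of "d \<oplus>\<^bsub>R\<^esub> e"] de \<beta>(5)[OF de] F_add[of "\<beta>' d" "\<beta>' e"] in simp_all)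
    show "\<beta>' \<one>\<^bsub>R\<^esub> = Ide C t"
      by (rule faithful) (use b[of "\<one>\<^bsub>R\<^esub>"] \<beta>(6) assms(2) in simp_all)
    show "d = e" if "d \<in> carrier R" "e \<in> carrier R" "\<beta>' d = \<beta>' e" for d e
      using b[OF that(1)] b[OF that(2)] that \<beta>(7)[of d e] by simp
    show "\<exists>d \<in> carrier R. \<beta>' d = h" if h: "h \<in> Hom C t t" for h
    proof -
      have "Fmap F h \<in> Hom D (Fobj F t) (Fobj F t)" using h by simp
      then obtain d where d: "d \<in> carrier R" "\<beta> d = Fmap F h" using \<beta>(8) by blast
      have "\<beta>' d = h"
        by (rule faithful) (use b[OF d(1)] d(2) h in simp_all)
      with d(1) show ?thesis by blast
    qed
  qed
  then show ?thesis by blast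
qed

end

section \<open>Idempotents of indecomposable objects\<close>

context abelian_category
begin

text \<open>The kernels of the idempotent and of its complement decompose \<open>s\<close> as a
  biproduct. The summands stay in \<open>P\<close>, which is closed under subobjects, so
  indecomposability makes one of them zero.\<close>

lemma idempotent_trivial:
  assumes "P \<subseteq> Obj C" "\<And>f g. short_exact C f g \<Longrightarrow> Cod C f \<in> P \<longleftrightarrow> Dom C f \<in> P \<and> Cod C g \<in> P"
    "indecomposable (full_sub C P) s" "e \<in> Hom C s s" "e \<cdot> e = e"
  shows "e = Zer C s s \<or> e = Ide C s"
proof -
  have sP: "s \<in> P" using assms(3) by (simp add: indecomposable_def)
  then have s [simp]: "s \<in> Obj C" using assms(1) by auto
  have e [simp]: "e \<in> Arr C" "Dom C e = s" "Cod C e = s" using assms(4) by simp_all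
  let ?e' = "Add C (Ide C s) (neg e)"
  have e': "?e' \<in> Arr C" "Dom C ?e' = s" "Cod C ?e' = s" by simp_all
  obtain k where k: "is_kernel C k e" using ex_kernel[OF e(1)] by blast
  obtain k' where k': "is_kernel C k' ?e'" using ex_kernel[OF e'(1)] by blast
  have [simp]: "k \<in> Arr C" "Cod C k = s" "k' \<in> Arr C" "Cod C k' = s"
    using kernelD[OF k] kernelD[OF k'] e' by simp_all
  have ek: "e \<cdot> k = Zer C (Dom C k) s" using kernelD(4)[OF k] by simp
  have "?e' \<cdot> k' = Zer C (Dom C k') s" using kernelD(4)[OF k'] by simp
  then have "Add C k' (neg (e \<cdot> k')) = Zer C (Dom C k') s" by simp
  then have ek': "e \<cdot> k' = k'"
    by (rule diff_eq_zer[symmetric]) simp_all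
  have ee': "e \<cdot> ?e' = Zer C s s" "?e' \<cdot> e = Zer C s s" by (simp_all add: assms(5))
  obtain p1 where p1: "p1 \<in> Arr C" "Dom C p1 = Dom C e" "Cod C p1 = Dom C k'" "k' \<cdot> p1 = e"
    by (rule kernel_lift[OF k', of e]) (assumption | simp add: assms(5))+
  obtain p2 where p2: "p2 \<in> Arr C" "Dom C p2 = Dom C ?e'" "Cod C p2 = Dom C k" "k \<cdot> p2 = ?e'"
    by (rule kernel_lift[OF k, of ?e']) (assumption | simp add: assms(5))+
  have [simp]: "p1 \<in> Arr C" "Dom C p1 = s" "Cod C p1 = Dom C k'" "p2 \<in> Arr C" "Dom C p2 = s" "Cod C p2 = Dom C k"
    using p1 p2 by simp_all
  have 1: "p1 \<cdot> k' = Ide C (Dom C k')"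
    by (rule monoD[OF kernelD(5)[OF k']]) (simp_all add: comp_subst[OF p1(4)] ek')
  have 2: "p2 \<cdot> k = Ide C (Dom C k)"
    by (rule monoD[OF kernelD(5)[OF k]]) (simp_all add: comp_subst[OF p2(4)] ek)
  have 3: "p1 \<cdot> k = Zer C (Dom C k) (Dom C k')"
    by (rule monoD[OF kernelD(5)[OF k']]) (simp_all add: comp_subst[OF p1(4)] ek)
  have 4: "p2 \<cdot> k' = Zer C (Dom C k') (Dom C k)"
    by (rule monoD[OF kernelD(5)[OF k]]) (simp_all add: comp_subst[OF p2(4)] ek')
  have 5: "Add C (k' \<cdot> p1) (k \<cdot> p2) = Ide C s"
    unfolding p1(4) p2(4) using add_lcomm[of e "Ide C s" "neg e"] by simp
  have b: "biproduct C (Dom C k') (Dom C k) s k' k p1 p2"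
    by (simp add: biproduct_def 1 2 3 4 5)
  have "Dom C k' \<in> P" "Dom C k \<in> P"
    using assms(2)[OF biproduct_ses(1)[OF b]] sP by simp_all
  with b have "biproduct (full_sub C P) (Dom C k') (Dom C k) s k' k p1 p2"
    using sP by (simp add: biproduct_def)
  then have "zero_object (full_sub C P) (Dom C k') \<or> zero_object (full_sub C P) (Dom C k)"
    using assms(3) \<open>Dom C k' \<in> P\<close> \<open>Dom C k \<in> P\<close> unfolding indecomposable_def by (metis full_sub_simps(1))
  then show ?thesis
  proof
    assume z: "zero_object (full_sub C P) (Dom C k')"
    then have "\<exists>!f. f \<in> Hom (full_sub C P) (Dom C k') (Dom C k')"
      using \<open>Dom C k' \<in> P\<close> unfolding zero_object_def by simp
    moreover have "Ide C (Dom C k') \<in> Hom (full_sub C P) (Dom C k') (Dom C k')"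
      "Zer C (Dom C k') (Dom C k') \<in> Hom (full_sub C P) (Dom C k') (Dom C k')"
      using \<open>Dom C k' \<in> P\<close> by simp_all
    ultimately have "Ide C (Dom C k') = Zer C (Dom C k') (Dom C k')" by blast
    then have "p1 = Zer C s (Dom C k')"
      using Zer_Ide_imp(1)[of "Dom C k'" p1] by simp
    then have "e = Zer C s s" using p1(4) by simp
    then show ?thesis ..
  next
    assume z: "zero_object (full_sub C P) (Dom C k)"
    then have "\<exists>!f. f \<in> Hom (full_sub C P) (Dom C k) (Dom C k)"
      using \<open>Dom C k \<in> P\<close> unfolding zero_object_def by simp
    moreover have "Ide C (Dom C k) \<in> Hom (full_sub C P) (Dom C k) (Dom C k)"
      "Zer C (Dom C k) (Dom C k) \<in> Hom (full_sub C P) (Dom C k) (Dom C k)"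
      using \<open>Dom C k \<in> P\<close> by simp_all
    ultimately have "Ide C (Dom C k) = Zer C (Dom C k) (Dom C k)" by blast
    then have "p2 = Zer C s (Dom C k)"
      using Zer_Ide_imp(1)[of "Dom C k" p2] by simp
    then have "?e' = Zer C s s" using p2(4) by simp
    then have "Ide C s = e"
      by (rule diff_eq_zer) simp_all
    then show ?thesis by simp
  qed
qed

lemma indecomposable_nonzero:
  assumes "P \<subseteq> Obj C" "indecomposable (full_sub C P) s"
  shows "Ide C s \<noteq> Zer C s s"
proof
  assume i: "Ide C s = Zer C s s"
  have s: "s \<in> P" "s \<in> Obj C" using assms by (auto simp add: indecomposable_def)
  have "zero_object (full_sub C P) s"
    unfolding zero_object_def full_sub_simps
  proof (intro conjI ballI)
    fix x assume x: "x \<in> P"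
    then have xo: "x \<in> Obj C" using assms(1) by auto
    show "\<exists>!f. f \<in> Hom (full_sub C P) s x"
    proof (rule ex1I[of _ "Zer C s x"])
      show "f = Zer C s x" if "f \<in> Hom (full_sub C P) s x" for f
        using Zer_Ide_imp(2)[OF i s(2), of f] that by simp
    qed (use x xo s in simp)
    show "\<exists>!f. f \<in> Hom (full_sub C P) x s"
    proof (rule ex1I[of _ "Zer C x s"])
      show "f = Zer C x s" if "f \<in> Hom (full_sub C P) x s" for f
        using Zer_Ide_imp(1)[OF i s(2), of f] that by simp
    qed (use x xo s in simp)
  qed (rule s)
  then show False using assms(2) by (simp add: indecomposable_def)
qed

end

section \<open>Finitely generated modules form a preadditive category\<close>

lemma mod_cat_simps [simp]:
  "M \<in> Obj (mod_cat R) \<longleftrightarrow> right_module R M \<and> fin_gen R M"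
  "(M, h, N) \<in> Arr (mod_cat R) \<longleftrightarrow> right_module R M \<and> fin_gen R M \<and> right_module R N \<and> fin_gen R N \<and> h \<in> module_homs R M N"
  "Dom (mod_cat R) (M, h, N) = M" "Cod (mod_cat R) (M, h, N) = N"
  "Ide (mod_cat R) M = (M, \<lambda>x \<in> carrier M. x, M)"
  "Comp (mod_cat R) (M', k, N') (M, h, N) = (M, \<lambda>x \<in> carrier M. k (h x), N')"
  "Add (mod_cat R) (M, h, N) (M', k, N') = (M, \<lambda>x \<in> carrier M. h x \<oplus>\<^bsub>N\<^esub> k x, N)"
  "Zer (mod_cat R) M N = (M, \<lambda>x \<in> carrier M. \<zero>\<^bsub>N\<^esub>, N)"
  by (simp_all add: mod_cat_def)

lemma mod_homE:
  assumes "f \<in> Hom (mod_cat R) M N"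
  obtains h where "f = (M, h, N)" "h \<in> module_homs R M N" "right_module R M" "fin_gen R M" "right_module R N" "fin_gen R N"
  using assms by (cases f) auto

lemma module_homsD:
  assumes "h \<in> module_homs R M N"
  shows "h \<in> carrier M \<rightarrow>\<^sub>E carrier N" "x \<in> carrier M \<Longrightarrow> h x \<in> carrier N"
    "\<lbrakk>x \<in> carrier M; y \<in> carrier M\<rbrakk> \<Longrightarrow> h (x \<oplus>\<^bsub>M\<^esub> y) = h x \<oplus>\<^bsub>N\<^esub> h y"
    "\<lbrakk>r \<in> carrier R; x \<in> carrier M\<rbrakk> \<Longrightarrow> h (r \<odot>\<^bsub>M\<^esub> x) = r \<odot>\<^bsub>N\<^esub> h x"
  using assms unfolding module_homs_def by auto

lemma module_homsI:
  assumes "right_module R M" "\<And>x. x \<in> carrier M \<Longrightarrow> h x \<in> carrier N"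
    "\<And>x y. \<lbrakk>x \<in> carrier M; y \<in> carrier M\<rbrakk> \<Longrightarrow> h (x \<oplus>\<^bsub>M\<^esub> y) = h x \<oplus>\<^bsub>N\<^esub> h y"
    "\<And>r x. \<lbrakk>r \<in> carrier R; x \<in> carrier M\<rbrakk> \<Longrightarrow> h (r \<odot>\<^bsub>M\<^esub> x) = r \<odot>\<^bsub>N\<^esub> h x"
  shows "(\<lambda>x \<in> carrier M. h x) \<in> module_homs R M N"
proof -
  interpret right_module R M by fact
  show ?thesis
    unfolding module_homs_def using assms(2-4) smult_closed by auto
qed

lemma module_homs_eqI:
  assumes "h \<in> carrier M \<rightarrow>\<^sub>E B" "h' \<in> carrier M \<rightarrow>\<^sub>E B'" "\<And>x. x \<in> carrier M \<Longrightarrow> h x = h' x"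
  shows "h = h'"
proof
  fix x show "h x = h' x"
    using assms by (cases "x \<in> carrier M") (auto simp add: PiE_def extensional_def)
qed

context right_module
begin

lemma smult_zero: "r \<in> carrier R \<Longrightarrow> r \<odot> \<zero> = \<zero>"
proof -
  assume r: "r \<in> carrier R"
  have "r \<odot> \<zero> \<oplus> r \<odot> \<zero> = r \<odot> \<zero>"
    using smult_r_distr[OF r, of \<zero> \<zero>] by simp
  then show ?thesis
    using smult_closed[OF r, of \<zero>] by (metis M.add.l_cancel_one M.zero_closed)
qed

lemma smult_minus: "\<lbrakk>r \<in> carrier R; x \<in> carrier M\<rbrakk> \<Longrightarrow> r \<odot> (\<ominus> x) = \<ominus> (r \<odot> x)"
proof -
  assume r: "r \<in> carrier R" "x \<in> carrier M"
  have "r \<odot> (\<ominus> x) \<oplus> r \<odot> x = \<zero>"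
    using smult_r_distr[OF r(1), of "\<ominus> x" x] r smult_zero by (simp add: M.l_neg)
  then show ?thesis
    using M.minus_equality[of "r \<odot> (\<ominus> x)" "r \<odot> x"] r smult_closed by simp
qed

end

lemma preadditive_mod_cat:
  assumes "ring R"
  shows "preadditive_category (mod_cat R)"
proof (intro preadditive_category.intro category.intro preadditive_category_axioms.intro)
  show "Dom (mod_cat R) f \<in> Obj (mod_cat R)" "Cod (mod_cat R) f \<in> Obj (mod_cat R)" if "f \<in> Arr (mod_cat R)" for f
    using that by (cases f; simp)+
  fix M N L K :: "'a fg_mod"
  show "Ide (mod_cat R) M \<in> Hom (mod_cat R) M M" if "M \<in> Obj (mod_cat R)"
    using that by (auto intro!: module_homsI)
  show "g \<cdot>\<^bsub>mod_cat R\<^esub> f \<in> Hom (mod_cat R) M L" if f: "f \<in> Hom (mod_cat R) M N" and g: "g \<in> Hom (mod_cat R) N L" for f g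
  proof (rule mod_homE[OF f], rule mod_homE[OF g])
    fix h k assume h: "f = (M, h, N)" "h \<in> module_homs R M N" "right_module R M" "fin_gen R M"
      and k: "g = (N, k, L)" "k \<in> module_homs R N L" "right_module R L" "fin_gen R L"
    have "(\<lambda>x \<in> carrier M. k (h x)) \<in> module_homs R M L"
      by (rule module_homsI[OF h(3)]) (use module_homsD[OF h(2)] module_homsD[OF k(2)] in auto)
    then show ?thesis using h k by simp
  qed
  show "f \<cdot>\<^bsub>mod_cat R\<^esub> Ide (mod_cat R) M = f" "Ide (mod_cat R) N \<cdot>\<^bsub>mod_cat R\<^esub> f = f" if f: "f \<in> Hom (mod_cat R) M N" for f
  proof -
    obtain h where h: "f = (M, h, N)" "h \<in> module_homs R M N" using f by (rule mod_homE)
    have "(\<lambda>x \<in> carrier M. h ((\<lambda>x \<in> carrier M. x) x)) = h" "(\<lambda>x \<in> carrier M. (\<lambda>x \<in> carrier N. x) (h x)) = h"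
      using module_homsD(1,2)[OF h(2)] by (auto intro!: module_homs_eqI[of _ M _ h])
    then show "f \<cdot>\<^bsub>mod_cat R\<^esub> Ide (mod_cat R) M = f" "Ide (mod_cat R) N \<cdot>\<^bsub>mod_cat R\<^esub> f = f"
      using h(1) by simp_all
  qed
  show "h \<cdot>\<^bsub>mod_cat R\<^esub> g \<cdot>\<^bsub>mod_cat R\<^esub> f = h \<cdot>\<^bsub>mod_cat R\<^esub> (g \<cdot>\<^bsub>mod_cat R\<^esub> f)"
    if f: "f \<in> Hom (mod_cat R) K M" and g: "g \<in> Hom (mod_cat R) M N" and h: "h \<in> Hom (mod_cat R) N L" for f g h
  proof -
    obtain f' g' h' where *: "f = (K, f', M)" "f' \<in> module_homs R K M" "g = (M, g', N)" "h = (N, h', L)"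
      using f g h by (elim mod_homE) blast
    then show ?thesis
      using module_homsD(2)[OF *(2)] by (auto simp add: fun_eq_iff)
  qed
  show "comm_group (Hom_group (mod_cat R) M N)" if "M \<in> Obj (mod_cat R)" "N \<in> Obj (mod_cat R)"
  proof -
    have M: "right_module R M" "fin_gen R M" and N: "right_module R N" "fin_gen R N" using that by simp_all
    interpret M: right_module R M by fact
    interpret N: right_module R N by fact
    have add: "(\<lambda>x \<in> carrier M. h x \<oplus>\<^bsub>N\<^esub> k x) \<in> module_homs R M N" if "h \<in> module_homs R M N" "k \<in> module_homs R M N" for h k
      by (rule module_homsI[OF M(1)])
        (use module_homsD(2-)[OF that(1)] module_homsD(2-)[OF that(2)] in \<open>auto simp add: N.a_ac N.smult_r_distr\<close>)
    have zero: "(\<lambda>x \<in> carrier M. \<zero>\<^bsub>N\<^esub>) \<in> module_homs R M N"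
      by (rule module_homsI[OF M(1)]) (auto simp add: N.smult_zero)
    have neg: "(\<lambda>x \<in> carrier M. \<ominus>\<^bsub>N\<^esub> h x) \<in> module_homs R M N" if "h \<in> module_homs R M N" for h
      by (rule module_homsI[OF M(1)])
        (use module_homsD(2-)[OF that] in \<open>auto simp add: N.minus_add N.smult_minus\<close>)
    show ?thesis
    proof (rule comm_groupI; unfold Hom_group_def monoid.simps partial_object.simps)
      fix f g h assume f: "f \<in> Hom (mod_cat R) M N"
      obtain f' where f': "f = (M, f', N)" "f' \<in> module_homs R M N" using f by (rule mod_homE)
      show "Add (mod_cat R) (Zer (mod_cat R) M N) f = f"
        using f' module_homsD(1,2)[OF f'(2)] by (auto intro!: module_homs_eqI[of _ M _ f'])
      show "\<exists>g \<in> Hom (mod_cat R) M N. Add (mod_cat R) g f = Zer (mod_cat R) M N"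
      proof (rule bexI[of _ "(M, \<lambda>x \<in> carrier M. \<ominus>\<^bsub>N\<^esub> f' x, N)"])
        show "Add (mod_cat R) (M, \<lambda>x \<in> carrier M. \<ominus>\<^bsub>N\<^esub> f' x, N) f = Zer (mod_cat R) M N"
          using f' module_homsD(2)[OF f'(2)] by (auto simp add: fun_eq_iff N.l_neg)
      qed (use neg[OF f'(2)] M N in simp)
      assume g: "g \<in> Hom (mod_cat R) M N"
      obtain g' where g': "g = (M, g', N)" "g' \<in> module_homs R M N" using g by (rule mod_homE)
      show "Add (mod_cat R) f g \<in> Hom (mod_cat R) M N"
        using f' g' add M N by simp
      show "Add (mod_cat R) f g = Add (mod_cat R) g f"
        using f' g' module_homsD(2)[OF f'(2)] module_homsD(2)[OF g'(2)] by (auto simp add: fun_eq_iff N.a_comm)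
      assume h: "h \<in> Hom (mod_cat R) M N"
      obtain h' where h': "h = (M, h', N)" "h' \<in> module_homs R M N" using h by (rule mod_homE)
      show "Add (mod_cat R) (Add (mod_cat R) f g) h = Add (mod_cat R) f (Add (mod_cat R) g h)"
        using f' g' h' module_homsD(2)[OF f'(2)] module_homsD(2)[OF g'(2)] module_homsD(2)[OF h'(2)]
        by (auto simp add: fun_eq_iff N.a_assoc)
    qed (use zero M N in simp)
  qed
  show "Add (mod_cat R) g g' \<cdot>\<^bsub>mod_cat R\<^esub> f = Add (mod_cat R) (g \<cdot>\<^bsub>mod_cat R\<^esub> f) (g' \<cdot>\<^bsub>mod_cat R\<^esub> f)"
    if f: "f \<in> Hom (mod_cat R) M N" and g: "g \<in> Hom (mod_cat R) N L" and g': "g' \<in> Hom (mod_cat R) N L" for f g g'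
  proof -
    obtain f1 g1 g2 where *: "f = (M, f1, N)" "f1 \<in> module_homs R M N" "g = (N, g1, L)" "g' = (N, g2, L)"
      using f g g' by (elim mod_homE) blast
    then show ?thesis
      using module_homsD(2)[OF *(2)] by (auto simp add: fun_eq_iff)
  qed
  show "g \<cdot>\<^bsub>mod_cat R\<^esub> Add (mod_cat R) f f' = Add (mod_cat R) (g \<cdot>\<^bsub>mod_cat R\<^esub> f) (g \<cdot>\<^bsub>mod_cat R\<^esub> f')"
    if f: "f \<in> Hom (mod_cat R) M N" and f': "f' \<in> Hom (mod_cat R) M N" and g: "g \<in> Hom (mod_cat R) N L" for f f' g
  proof -
    obtain f1 f2 g1 where *: "f = (M, f1, N)" "f1 \<in> module_homs R M N" "f' = (M, f2, N)" "f2 \<in> module_homs R M N"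
      "g = (N, g1, L)" "g1 \<in> module_homs R N L"
      using f f' g by (elim mod_homE) blast
    then show ?thesis
      using module_homsD(2)[OF *(2)] module_homsD(2)[OF *(4)] module_homsD(3)[OF *(6)] by (auto simp add: fun_eq_iff)
  qed
qed

section \<open>Bases over a division ring and their consequences\<close>

context right_module
begin

definition comb :: "('v \<Rightarrow> 'r) \<Rightarrow> 'v set \<Rightarrow> 'v" where
  "comb c S = (\<Oplus>s \<in> S. c s \<odot> s)"

definition gen :: "'v set \<Rightarrow> bool" where
  "gen S \<longleftrightarrow> finite S \<and> S \<subseteq> carrier M \<and> (\<forall>x \<in> carrier M. \<exists>c \<in> S \<rightarrow> carrier R. x = comb c S)"

lemma comb_closed: "\<lbrakk>S \<subseteq> carrier M; c \<in> S \<rightarrow> carrier R\<rbrakk> \<Longrightarrow> comb c S \<in> carrier M"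
  unfolding comb_def by (rule M.finsum_closed) (auto intro!: smult_closed)

lemma comb_insert:
  "\<lbrakk>finite S; t \<notin> S; insert t S \<subseteq> carrier M; c \<in> insert t S \<rightarrow> carrier R\<rbrakk> \<Longrightarrow> comb c (insert t S) = c t \<odot> t \<oplus> comb c S"
  unfolding comb_def by (rule M.finsum_insert) (auto intro!: smult_closed)

lemma comb_add:
  assumes "S \<subseteq> carrier M" "c \<in> S \<rightarrow> carrier R" "d \<in> S \<rightarrow> carrier R"
  shows "comb (\<lambda>s. c s \<oplus>\<^bsub>R\<^esub> d s) S = comb c S \<oplus> comb d S"
proof -
  have "comb (\<lambda>s. c s \<oplus>\<^bsub>R\<^esub> d s) S = (\<Oplus>s \<in> S. c s \<odot> s \<oplus> d s \<odot> s)"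
    unfolding comb_def by (rule M.finsum_cong') (use assms in \<open>auto intro!: smult_closed smult_l_distr\<close>)
  also have "\<dots> = comb c S \<oplus> comb d S"
    unfolding comb_def by (rule M.finsum_addf) (use assms in \<open>auto intro!: smult_closed\<close>)
  finally show ?thesis .
qed

lemma comb_smult:
  assumes "finite S" "S \<subseteq> carrier M" "c \<in> S \<rightarrow> carrier R" "r \<in> carrier R"
  shows "comb (\<lambda>s. c s \<otimes>\<^bsub>R\<^esub> r) S = r \<odot> comb c S"
  using assms(1-3)
proof (induction S rule: finite_induct)
  case empty
  show ?case using smult_zero[OF assms(4)] by (simp add: comb_def)
next
  case (insert t S)
  have "comb (\<lambda>s. c s \<otimes>\<^bsub>R\<^esub> r) (insert t S) = (c t \<otimes>\<^bsub>R\<^esub> r) \<odot> t \<oplus> comb (\<lambda>s. c s \<otimes>\<^bsub>R\<^esub> r) S"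
    by (rule comb_insert) (use insert assms(4) in auto)
  also have "\<dots> = r \<odot> (c t \<odot> t) \<oplus> r \<odot> comb c S"
    using insert assms(4) by (auto simp add: smult_assoc)
  also have "\<dots> = r \<odot> (c t \<odot> t \<oplus> comb c S)"
    by (rule smult_r_distr[symmetric]) (use insert assms(4) in \<open>auto intro!: smult_closed comb_closed\<close>)
  also have "c t \<odot> t \<oplus> comb c S = comb c (insert t S)"
    by (rule comb_insert[symmetric]) (use insert in auto)
  finally show ?case .
qed

lemma comb_cong: "\<lbrakk>S \<subseteq> carrier M; d \<in> S \<rightarrow> carrier R; \<And>s. s \<in> S \<Longrightarrow> c s = d s\<rbrakk> \<Longrightarrow> comb c S = comb d S"
  unfolding comb_def by (rule M.finsum_cong') (auto intro!: smult_closed)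

text \<open>The coordinate functions of a generating set of minimal cardinality.\<close>

lemma basis_ex:
  assumes "is_division_ring R" "fin_gen R M"
  obtains S p where "finite S" "S \<subseteq> carrier M"
    "\<And>s x. \<lbrakk>s \<in> S; x \<in> carrier M\<rbrakk> \<Longrightarrow> p s x \<in> carrier R"
    "\<And>s x y. \<lbrakk>s \<in> S; x \<in> carrier M; y \<in> carrier M\<rbrakk> \<Longrightarrow> p s (x \<oplus> y) = p s x \<oplus>\<^bsub>R\<^esub> p s y"
    "\<And>s r x. \<lbrakk>s \<in> S; r \<in> carrier R; x \<in> carrier M\<rbrakk> \<Longrightarrow> p s (r \<odot> x) = p s x \<otimes>\<^bsub>R\<^esub> r"
    "\<And>x. x \<in> carrier M \<Longrightarrow> x = (\<Oplus>s \<in> S. p s x \<odot> s)"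
    "\<And>s. s \<in> S \<Longrightarrow> p s s = \<one>\<^bsub>R\<^esub>"
proof -
  have units: "Units R = carrier R - {\<zero>\<^bsub>R\<^esub>}" using assms(1) by (simp add: is_division_ring_def)
  have "\<exists>S. gen S" using assms(2) unfolding fin_gen_def gen_def comb_def .
  then obtain S where S: "gen S" and min: "\<And>S'. gen S' \<Longrightarrow> card S \<le> card S'"
    using ex_has_least_nat[of gen _ card] by blast
  have fS: "finite S" and cS: "S \<subseteq> carrier M" and g: "\<And>x. x \<in> carrier M \<Longrightarrow> \<exists>c \<in> S \<rightarrow> carrier R. x = comb c S"
    using S by (auto simp add: gen_def)
  have unique: "c t = d t" if c: "c \<in> S \<rightarrow> carrier R" and d: "d \<in> S \<rightarrow> carrier R" and eq: "comb c S = comb d S" and t: "t \<in> S" for c d t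
  \<comment> \<open>If two representations of the same element differ at \<open>t\<close>, dividing
    by the difference of the coefficients expresses \<open>t\<close> through the remaining elements.
    Then \<open>S\<close> without \<open>t\<close> still generates, against minimality.\<close>
  proof (rule ccontr)
    assume ne: "c t \<noteq> d t"
    let ?S = "S - {t}"
    have St: "insert t ?S = S" using t by auto
    have f: "finite ?S" "?S \<subseteq> carrier M" "t \<in> carrier M" using fS cS t by auto
    have ct: "c t \<in> carrier R" "d t \<in> carrier R" using c d t by auto
    have c': "c \<in> ?S \<rightarrow> carrier R" and d': "d \<in> ?S \<rightarrow> carrier R" using c d by auto
    have split: "comb h S = h t \<odot> t \<oplus> comb h ?S" if "h \<in> S \<rightarrow> carrier R" for h
      using comb_insert[of ?S t h] f(1) that cS unfolding St by simp
    let ?b = "c t \<ominus>\<^bsub>R\<^esub> d t"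
    have b: "?b \<in> carrier R" using ct by simp
    have bd: "?b \<oplus>\<^bsub>R\<^esub> d t = c t"
      using ct by (simp add: R.minus_eq R.a_assoc R.l_neg)
    have "?b \<noteq> \<zero>\<^bsub>R\<^esub>"
    proof
      assume "?b = \<zero>\<^bsub>R\<^esub>"
      then show False using bd ne ct(2) by simp
    qed
    then have "?b \<in> Units R" using b units by blast
    then obtain i where i: "i \<in> carrier R" "?b \<otimes>\<^bsub>R\<^esub> i = \<one>\<^bsub>R\<^esub>"
      unfolding Units_def by blast
    let ?e = "\<lambda>s. d s \<ominus>\<^bsub>R\<^esub> c s"
    have e: "?e \<in> ?S \<rightarrow> carrier R" using c' d' by auto
    have bt: "?b \<odot> t \<in> carrier M" "d t \<odot> t \<in> carrier M" and ce: "comb ?e ?S \<in> carrier M" "comb c ?S \<in> carrier M"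
      using b ct f smult_closed comb_closed[OF f(2) e] comb_closed[OF f(2) c'] by auto
    have 1: "c t \<odot> t = ?b \<odot> t \<oplus> d t \<odot> t"
      using smult_l_distr[OF b ct(2) f(3)] unfolding bd .
    have "comb d ?S = comb (\<lambda>s. ?e s \<oplus>\<^bsub>R\<^esub> c s) ?S"
    proof (rule comb_cong[OF f(2), symmetric, OF d'])
      fix s assume "s \<in> ?S"
      then have "d s \<in> carrier R" "c s \<in> carrier R" using c' d' by auto
      then show "?e s \<oplus>\<^bsub>R\<^esub> c s = d s" by (simp add: R.minus_eq R.a_assoc R.l_neg)
    qed
    then have 2: "comb d ?S = comb ?e ?S \<oplus> comb c ?S"
      using comb_add[OF f(2) e c'] by simp
    have "(?b \<odot> t \<oplus> d t \<odot> t) \<oplus> comb c ?S = d t \<odot> t \<oplus> (comb ?e ?S \<oplus> comb c ?S)"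
      using eq split[OF c] split[OF d] 1 2 by simp
    then have "?b \<odot> t \<oplus> (d t \<odot> t \<oplus> comb c ?S) = comb ?e ?S \<oplus> (d t \<odot> t \<oplus> comb c ?S)"
      using bt ce by (simp add: M.a_ac)
    then have bte: "?b \<odot> t = comb ?e ?S"
      using bt ce by (simp only: M.add.right_cancel M.a_closed)
    let ?e' = "\<lambda>s. ?e s \<otimes>\<^bsub>R\<^esub> i"
    have e': "?e' \<in> ?S \<rightarrow> carrier R" using e i by auto
    have "t = (?b \<otimes>\<^bsub>R\<^esub> i) \<odot> t" using i smult_one f by simp
    also have "\<dots> = i \<odot> (?b \<odot> t)" by (rule smult_assoc[OF b i(1) f(3)])
    also have "\<dots> = comb ?e' ?S"
      unfolding bte by (rule comb_smult[OF f(1,2) e i(1), symmetric])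
    finally have te: "t = comb ?e' ?S" .
    have "gen ?S"
      unfolding gen_def
    proof (intro conjI ballI f(1,2))
      fix x assume "x \<in> carrier M"
      then obtain h where h: "h \<in> S \<rightarrow> carrier R" "x = comb h S" using g by blast
      have h': "h \<in> ?S \<rightarrow> carrier R" "h t \<in> carrier R" using h(1) t by auto
      have eh: "(\<lambda>s. ?e' s \<otimes>\<^bsub>R\<^esub> h t) \<in> ?S \<rightarrow> carrier R" using e' h' by auto
      have "x = h t \<odot> comb ?e' ?S \<oplus> comb h ?S"
        using split[OF h(1)] h(2) te by simp
      also have "\<dots> = comb (\<lambda>s. ?e' s \<otimes>\<^bsub>R\<^esub> h t \<oplus>\<^bsub>R\<^esub> h s) ?S"
        using comb_smult[OF f(1,2) e' h'(2)] comb_add[OF f(2) eh h'(1)] by simp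
      finally show "\<exists>c \<in> ?S \<rightarrow> carrier R. x = comb c ?S"
        using eh h'(1) by (intro bexI[of _ "\<lambda>s. ?e' s \<otimes>\<^bsub>R\<^esub> h t \<oplus>\<^bsub>R\<^esub> h s"]) auto
    qed
    then have "card S \<le> card ?S" by (rule min)
    moreover have "card ?S < card S" using fS t by (rule card_Diff1_less)
    ultimately show False by simp
  qed
  define cf where "cf x = (SOME c. c \<in> S \<rightarrow> carrier R \<and> x = comb c S)" for x
  have cf: "cf x \<in> S \<rightarrow> carrier R" "x = comb (cf x) S" if "x \<in> carrier M" for x
  proof -
    have "\<exists>c. c \<in> S \<rightarrow> carrier R \<and> x = comb c S" using g[OF that] by blast
    from someI_ex[OF this] show "cf x \<in> S \<rightarrow> carrier R" "x = comb (cf x) S"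
      unfolding cf_def by blast+
  qed
  have cf_eq: "cf x s = c s" if "c \<in> S \<rightarrow> carrier R" "x = comb c S" "s \<in> S" for c x s
  proof (rule unique)
    have "x \<in> carrier M" using comb_closed[OF cS that(1)] that(2) by simp
    note this[THEN cf(1)] this[THEN cf(2)]
    then show "cf x \<in> S \<rightarrow> carrier R" "comb (cf x) S = comb c S" using that(2) by simp_all
  qed (use that in auto)
  show ?thesis
  proof (rule that[of S "\<lambda>s x. cf x s"])
    show "cf x s \<in> carrier R" if "s \<in> S" "x \<in> carrier M" for s x
      using cf(1)[OF that(2)] that(1) by blast
    show "cf (x \<oplus> y) s = cf x s \<oplus>\<^bsub>R\<^esub> cf y s" if "s \<in> S" "x \<in> carrier M" "y \<in> carrier M" for s x y
    proof (rule cf_eq)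
      show "(\<lambda>s. cf x s \<oplus>\<^bsub>R\<^esub> cf y s) \<in> S \<rightarrow> carrier R"
        using cf(1)[OF that(2)] cf(1)[OF that(3)] by auto
      show "x \<oplus> y = comb (\<lambda>s. cf x s \<oplus>\<^bsub>R\<^esub> cf y s) S"
        using comb_add[OF cS cf(1)[OF that(2)] cf(1)[OF that(3)]] cf(2)[OF that(2)] cf(2)[OF that(3)] by metis
    qed (rule that)
    show "cf (r \<odot> x) s = cf x s \<otimes>\<^bsub>R\<^esub> r" if "s \<in> S" "r \<in> carrier R" "x \<in> carrier M" for s r x
    proof (rule cf_eq)
      show "(\<lambda>s. cf x s \<otimes>\<^bsub>R\<^esub> r) \<in> S \<rightarrow> carrier R"
        using cf(1)[OF that(3)] that(2) by auto
      show "r \<odot> x = comb (\<lambda>s. cf x s \<otimes>\<^bsub>R\<^esub> r) S"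
        using comb_smult[OF fS cS cf(1)[OF that(3)] that(2)] cf(2)[OF that(3)] by metis
    qed (rule that)
    show "x = (\<Oplus>s \<in> S. cf x s \<odot> s)" if "x \<in> carrier M" for x
      using cf(2)[OF that] unfolding comb_def .
    show "cf t t = \<one>\<^bsub>R\<^esub>" if t: "t \<in> S" for t
    proof -
      \<comment> \<open>The indicator function of \<open>t\<close> also represents \<open>t\<close>,
        so by uniqueness it gives the coordinates of \<open>t\<close>.\<close>
      let ?c = "\<lambda>s. if s = t then \<one>\<^bsub>R\<^esub> else \<zero>\<^bsub>R\<^esub>"
      have c: "?c \<in> S \<rightarrow> carrier R" by auto
      let ?S = "S - {t}"
      have f: "finite ?S" "?S \<subseteq> carrier M" "t \<in> carrier M" using fS cS t by auto
      have z: "\<zero>\<^bsub>R\<^esub> \<odot> s = \<zero>" if "s \<in> carrier M" for s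
      proof -
        have "\<zero>\<^bsub>R\<^esub> \<odot> s \<oplus> \<zero>\<^bsub>R\<^esub> \<odot> s = \<zero>\<^bsub>R\<^esub> \<odot> s"
          using smult_l_distr[of "\<zero>\<^bsub>R\<^esub>" "\<zero>\<^bsub>R\<^esub>" s] that by simp
        then show ?thesis
          using smult_closed[of "\<zero>\<^bsub>R\<^esub>" s] that by (metis M.add.l_cancel_one R.zero_closed)
      qed
      have "comb ?c ?S = (\<Oplus>s \<in> ?S. \<zero>)"
        unfolding comb_def by (rule M.finsum_cong') (use f z in auto)
      then have "comb ?c ?S = \<zero>" by simp
      moreover have "comb ?c (insert t ?S) = ?c t \<odot> t \<oplus> comb ?c ?S"
        by (rule comb_insert) (use f t cS in auto)
      moreover have "insert t ?S = S" using t by auto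
      ultimately have "t = comb ?c S"
        using f smult_one by simp
      then have "cf t t = ?c t" by (rule cf_eq[OF c _ t])
      then show ?thesis by simp
    qed
  qed (rule fS cS)+
qed

end

text \<open>A nonzero vector forces a basis of \<open>N\<close> to contain some \<open>t\<close>.
  The expansion of \<open>x\<close> in a basis of \<open>M\<close> is a sum of maps through
  \<open>N\<close>: send \<open>x\<close> to \<open>t\<close> scaled by the coordinate
  \<open>p s x\<close>, then \<open>y\<close> to \<open>s\<close> scaled by the coordinate
  \<open>q t y\<close>.\<close>

lemma thru_mod_cat:
  assumes "is_division_ring R" "M \<in> Obj (mod_cat R)" "N \<in> Obj (mod_cat R)" "y0 \<in> carrier N" "y0 \<noteq> \<zero>\<^bsub>N\<^esub>"
  shows "thru (mod_cat R) N M M (Ide (mod_cat R) M)"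
proof -
  have M: "right_module R M" "fin_gen R M" and N: "right_module R N" "fin_gen R N" using assms(2,3) by simp_all
  interpret M: right_module R M by fact
  interpret N: right_module R N by fact
  obtain S p where S: "finite S" "S \<subseteq> carrier M"
    and p: "\<And>s x. \<lbrakk>s \<in> S; x \<in> carrier M\<rbrakk> \<Longrightarrow> p s x \<in> carrier R"
    "\<And>s x y. \<lbrakk>s \<in> S; x \<in> carrier M; y \<in> carrier M\<rbrakk> \<Longrightarrow> p s (x \<oplus>\<^bsub>M\<^esub> y) = p s x \<oplus>\<^bsub>R\<^esub> p s y"
    "\<And>s r x. \<lbrakk>s \<in> S; r \<in> carrier R; x \<in> carrier M\<rbrakk> \<Longrightarrow> p s (r \<odot>\<^bsub>M\<^esub> x) = p s x \<otimes>\<^bsub>R\<^esub> r"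
    "\<And>x. x \<in> carrier M \<Longrightarrow> x = (\<Oplus>\<^bsub>M\<^esub>s \<in> S. p s x \<odot>\<^bsub>M\<^esub> s)"
    by (rule M.basis_ex[OF assms(1) M(2)]) blast
  obtain S' q where S': "finite S'" "S' \<subseteq> carrier N"
    and q: "\<And>s x. \<lbrakk>s \<in> S'; x \<in> carrier N\<rbrakk> \<Longrightarrow> q s x \<in> carrier R"
    "\<And>s x y. \<lbrakk>s \<in> S'; x \<in> carrier N; y \<in> carrier N\<rbrakk> \<Longrightarrow> q s (x \<oplus>\<^bsub>N\<^esub> y) = q s x \<oplus>\<^bsub>R\<^esub> q s y"
    "\<And>s r x. \<lbrakk>s \<in> S'; r \<in> carrier R; x \<in> carrier N\<rbrakk> \<Longrightarrow> q s (r \<odot>\<^bsub>N\<^esub> x) = q s x \<otimes>\<^bsub>R\<^esub> r"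
    "\<And>x. x \<in> carrier N \<Longrightarrow> x = (\<Oplus>\<^bsub>N\<^esub>s \<in> S'. q s x \<odot>\<^bsub>N\<^esub> s)"
    "\<And>s. s \<in> S' \<Longrightarrow> q s s = \<one>\<^bsub>R\<^esub>"
    by (rule N.basis_ex[OF assms(1) N(2)]) blast
  have "S' \<noteq> {}" using q(4)[OF assms(4)] assms(5) by auto
  then obtain t where t: "t \<in> S'" "t \<in> carrier N" using S'(2) by blast
  have f: "(\<lambda>x \<in> carrier M. p s x \<odot>\<^bsub>N\<^esub> t) \<in> module_homs R M N" if "s \<in> S" for s
    by (rule module_homsI[OF M(1)]) (use p(1-3)[OF that] t in \<open>auto intro!: N.smult_closed N.smult_l_distr N.smult_assoc\<close>)
  have g: "(\<lambda>y \<in> carrier N. q t y \<odot>\<^bsub>M\<^esub> s) \<in> module_homs R N M" if "s \<in> S" for s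
  proof -
    have s: "s \<in> carrier M" using that S by auto
    show ?thesis
      by (rule module_homsI[OF N(1)]) (use q(1-3)[OF t(1)] s in \<open>auto intro!: M.smult_closed M.smult_l_distr M.smult_assoc\<close>)
  qed
  have qt: "q t (r \<odot>\<^bsub>N\<^esub> t) = r" if "r \<in> carrier R" for r
    using q(3)[OF t(1) that t(2)] q(5)[OF t(1)] that by simp
  have "thru (mod_cat R) N M M (M, \<lambda>x \<in> carrier M. \<Oplus>\<^bsub>M\<^esub>s \<in> U. p s x \<odot>\<^bsub>M\<^esub> s, M)" if "finite U" "U \<subseteq> S" for U
    using that
  proof (induction U rule: finite_induct)
    case empty
    show ?case using thru_Zer[of "mod_cat R" N M M] by (simp only: M.finsum_empty mod_cat_simps)
  next
    case (insert s U)
    have s: "s \<in> S" "s \<in> carrier M" "U \<subseteq> carrier M" using insert(4) S(2) by auto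
    have Us: "U \<subseteq> S" using insert(4) by auto
    let ?f = "(M, \<lambda>x \<in> carrier M. p s x \<odot>\<^bsub>N\<^esub> t, N)" and ?g = "(N, \<lambda>y \<in> carrier N. q t y \<odot>\<^bsub>M\<^esub> s, M)"
    have "thru (mod_cat R) N M M (Add (mod_cat R) (M, \<lambda>x \<in> carrier M. \<Oplus>\<^bsub>M\<^esub>s \<in> U. p s x \<odot>\<^bsub>M\<^esub> s, M) (?g \<cdot>\<^bsub>mod_cat R\<^esub> ?f))"
      by (rule thru_Add[OF insert.IH[OF Us]]) (use f[OF s(1)] g[OF s(1)] M N in simp_all)
    moreover have "(\<Oplus>\<^bsub>M\<^esub>s \<in> insert s U. p s x \<odot>\<^bsub>M\<^esub> s) = (\<Oplus>\<^bsub>M\<^esub>s \<in> U. p s x \<odot>\<^bsub>M\<^esub> s) \<oplus>\<^bsub>M\<^esub> p s x \<odot>\<^bsub>M\<^esub> s"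
      if x: "x \<in> carrier M" for x
    proof -
      have c: "(\<lambda>s. p s x \<odot>\<^bsub>M\<^esub> s) \<in> U \<rightarrow> carrier M" "p s x \<odot>\<^bsub>M\<^esub> s \<in> carrier M"
        using p(1)[OF _ x] Us s by (auto intro!: M.smult_closed)
      show ?thesis
        using M.finsum_insert[OF insert(1,2) c] M.a_comm[OF c(2) M.finsum_closed[OF c(1)]] by simp
    qed
    then have eq: "(\<lambda>x \<in> carrier M. \<Oplus>\<^bsub>M\<^esub>s \<in> insert s U. p s x \<odot>\<^bsub>M\<^esub> s) =
      (\<lambda>x \<in> carrier M. (\<lambda>x \<in> carrier M. \<Oplus>\<^bsub>M\<^esub>s \<in> U. p s x \<odot>\<^bsub>M\<^esub> s) x \<oplus>\<^bsub>M\<^esub>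
        (\<lambda>x \<in> carrier M. (\<lambda>y \<in> carrier N. q t y \<odot>\<^bsub>M\<^esub> s) ((\<lambda>x \<in> carrier M. p s x \<odot>\<^bsub>N\<^esub> t) x)) x)"
      using p(1)[OF s(1)] t(2) N.smult_closed qt by (auto intro!: restrict_ext)
    ultimately show ?case
      unfolding eq by (simp only: mod_cat_simps)
  qed
  from this[OF S(1) subset_refl]
  have "thru (mod_cat R) N M M (M, \<lambda>x \<in> carrier M. \<Oplus>\<^bsub>M\<^esub>s \<in> S. p s x \<odot>\<^bsub>M\<^esub> s, M)" .
  moreover have "(\<lambda>x \<in> carrier M. \<Oplus>\<^bsub>M\<^esub>s \<in> S. p s x \<odot>\<^bsub>M\<^esub> s) = (\<lambda>x \<in> carrier M. x)"
    using p(4) by (intro restrict_ext) simp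
  ultimately show ?thesis by simp
qed

text \<open>The projection of \<open>N\<close> onto the line through a basis vector \<open>t\<close>
  is a nonzero idempotent, hence the identity, so \<open>N\<close> is one-dimensional. An
  endomorphism is then determined by the coordinate of the image of \<open>t\<close>; as scalars act
  from the right, these coordinates multiply in the order of composition.\<close>

lemma End_mod_cat_iso:
  assumes "is_division_ring R" "N \<in> Obj (mod_cat R)" "y0 \<in> carrier N" "y0 \<noteq> \<zero>\<^bsub>N\<^esub>"
    "\<And>e. \<lbrakk>e \<in> Hom (mod_cat R) N N; e \<cdot>\<^bsub>mod_cat R\<^esub> e = e\<rbrakk> \<Longrightarrow> e = Zer (mod_cat R) N N \<or> e = Ide (mod_cat R) N"
  shows "\<exists>\<beta>. \<beta> \<in> ring_iso R (End_ring (mod_cat R) N)"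
proof -
  have N: "right_module R N" "fin_gen R N" using assms(2) by simp_all
  interpret N: right_module R N by fact
  obtain S' q where S': "finite S'" "S' \<subseteq> carrier N"
    and q: "\<And>s x. \<lbrakk>s \<in> S'; x \<in> carrier N\<rbrakk> \<Longrightarrow> q s x \<in> carrier R"
    "\<And>s x y. \<lbrakk>s \<in> S'; x \<in> carrier N; y \<in> carrier N\<rbrakk> \<Longrightarrow> q s (x \<oplus>\<^bsub>N\<^esub> y) = q s x \<oplus>\<^bsub>R\<^esub> q s y"
    "\<And>s r x. \<lbrakk>s \<in> S'; r \<in> carrier R; x \<in> carrier N\<rbrakk> \<Longrightarrow> q s (r \<odot>\<^bsub>N\<^esub> x) = q s x \<otimes>\<^bsub>R\<^esub> r"
    "\<And>x. x \<in> carrier N \<Longrightarrow> x = (\<Oplus>\<^bsub>N\<^esub>s \<in> S'. q s x \<odot>\<^bsub>N\<^esub> s)"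
    "\<And>s. s \<in> S' \<Longrightarrow> q s s = \<one>\<^bsub>R\<^esub>"
    by (rule N.basis_ex[OF assms(1) N(2)]) blast
  have "S' \<noteq> {}" using q(4)[OF assms(3)] assms(4) by auto
  then obtain t where t: "t \<in> S'" "t \<in> carrier N" using S'(2) by blast
  note qt' = q(1-3)[OF t(1)]
  have qt: "q t (r \<odot>\<^bsub>N\<^esub> t) = r" if "r \<in> carrier R" for r
    using q(3)[OF t(1) that t(2)] q(5)[OF t(1)] that by simp
  have z: "q t \<zero>\<^bsub>N\<^esub> = \<zero>\<^bsub>R\<^esub>"
    using qt'(2)[of "\<zero>\<^bsub>N\<^esub>" "\<zero>\<^bsub>N\<^esub>"] qt'(1)[of "\<zero>\<^bsub>N\<^esub>"] by (metis N.M.zero_closed N.M.l_zero N.R.add.l_cancel_one)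
  have one: "\<one>\<^bsub>R\<^esub> \<noteq> \<zero>\<^bsub>R\<^esub>"
  proof
    assume "\<one>\<^bsub>R\<^esub> = \<zero>\<^bsub>R\<^esub>"
    then have "\<zero>\<^bsub>R\<^esub> \<in> Units R" by (metis N.R.Units_one_closed)
    then show False using assms(1) by (simp add: is_division_ring_def)
  qed
  have hom: "(\<lambda>y \<in> carrier N. q t y \<odot>\<^bsub>N\<^esub> w) \<in> module_homs R N N" if "w \<in> carrier N" for w
    by (rule module_homsI[OF N(1)]) (use qt' that in \<open>auto intro!: N.smult_closed N.smult_l_distr N.smult_assoc\<close>)
  define E where "E w = (N, \<lambda>y \<in> carrier N. q t y \<odot>\<^bsub>N\<^esub> w, N)" for w
  have E: "E w \<in> Hom (mod_cat R) N N" if "w \<in> carrier N" for w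
    using hom[OF that] N by (simp add: E_def)
  have "E t \<cdot>\<^bsub>mod_cat R\<^esub> E t = E t"
    using qt qt'(1) t N.smult_closed by (auto simp add: E_def intro!: restrict_ext)
  moreover have "E t \<noteq> Zer (mod_cat R) N N"
  proof
    assume "E t = Zer (mod_cat R) N N"
    then have "(\<lambda>y \<in> carrier N. q t y \<odot>\<^bsub>N\<^esub> t) t = (\<lambda>y \<in> carrier N. \<zero>\<^bsub>N\<^esub>) t" by (simp add: E_def)
    then have "t = \<zero>\<^bsub>N\<^esub>" using t q(5)[OF t(1)] N.smult_one by simp
    then show False using q(5)[OF t(1)] z one by simp
  qed
  ultimately have "E t = Ide (mod_cat R) N" using assms(5)[OF E[OF t(2)]] by blast
  then have "(\<lambda>y \<in> carrier N. q t y \<odot>\<^bsub>N\<^esub> t) = (\<lambda>y \<in> carrier N. y)" by (simp add: E_def)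
  note E_id = fun_cong[OF this]
  have span: "q t y \<odot>\<^bsub>N\<^esub> t = y" if "y \<in> carrier N" for y
    using E_id[of y] that by simp
  have dt: "d \<odot>\<^bsub>N\<^esub> t \<in> carrier N" if "d \<in> carrier R" for d using N.smult_closed that t by simp
  have "(\<lambda>d. E (d \<odot>\<^bsub>N\<^esub> t)) \<in> ring_iso R (End_ring (mod_cat R) N)"
  proof (rule ring_iso_EndI)
    show "E (d \<odot>\<^bsub>N\<^esub> t) \<in> Hom (mod_cat R) N N" if "d \<in> carrier R" for d
      by (rule E[OF dt[OF that]])
    show "E ((d \<otimes>\<^bsub>R\<^esub> e) \<odot>\<^bsub>N\<^esub> t) = E (d \<odot>\<^bsub>N\<^esub> t) \<cdot>\<^bsub>mod_cat R\<^esub> E (e \<odot>\<^bsub>N\<^esub> t)" if d: "d \<in> carrier R" "e \<in> carrier R" for d e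
    proof -
      have "q t y \<odot>\<^bsub>N\<^esub> ((d \<otimes>\<^bsub>R\<^esub> e) \<odot>\<^bsub>N\<^esub> t) = q t (q t y \<odot>\<^bsub>N\<^esub> (e \<odot>\<^bsub>N\<^esub> t)) \<odot>\<^bsub>N\<^esub> (d \<odot>\<^bsub>N\<^esub> t)" if y: "y \<in> carrier N" for y
      proof -
        have "q t (q t y \<odot>\<^bsub>N\<^esub> (e \<odot>\<^bsub>N\<^esub> t)) = e \<otimes>\<^bsub>R\<^esub> q t y"
          using qt'(3)[OF qt'(1)[OF y] dt[OF d(2)]] qt[OF d(2)] by simp
        then show ?thesis
          using N.smult_assoc[OF d(2) qt'(1)[OF y] dt[OF d(1)]] N.smult_assoc[OF d t(2)] by simp
      qed
      then show ?thesis
        using qt'(1) dt[OF d(2)] N.smult_closed by (auto simp add: E_def intro!: restrict_ext)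
    qed
    show "E ((d \<oplus>\<^bsub>R\<^esub> e) \<odot>\<^bsub>N\<^esub> t) = Add (mod_cat R) (E (d \<odot>\<^bsub>N\<^esub> t)) (E (e \<odot>\<^bsub>N\<^esub> t))" if d: "d \<in> carrier R" "e \<in> carrier R" for d e
      using N.smult_l_distr[OF d t(2)] N.smult_r_distr[OF qt'(1) dt[OF d(1)] dt[OF d(2)]]
      by (auto simp add: E_def intro!: restrict_ext)
    show "E (\<one>\<^bsub>R\<^esub> \<odot>\<^bsub>N\<^esub> t) = Ide (mod_cat R) N"
      using N.smult_one[OF t(2)] \<open>E t = Ide (mod_cat R) N\<close> by simp
    show "d = e" if "d \<in> carrier R" "e \<in> carrier R" "E (d \<odot>\<^bsub>N\<^esub> t) = E (e \<odot>\<^bsub>N\<^esub> t)" for d e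
    proof -
      have "(\<lambda>y \<in> carrier N. q t y \<odot>\<^bsub>N\<^esub> (d \<odot>\<^bsub>N\<^esub> t)) t = (\<lambda>y \<in> carrier N. q t y \<odot>\<^bsub>N\<^esub> (e \<odot>\<^bsub>N\<^esub> t)) t"
        using that(3) by (simp add: E_def)
      then have "d \<odot>\<^bsub>N\<^esub> t = e \<odot>\<^bsub>N\<^esub> t"
        using t q(5)[OF t(1)] N.smult_one dt that(1,2) by simp
      then show ?thesis using qt that(1,2) by metis
    qed
    show "\<exists>d \<in> carrier R. E (d \<odot>\<^bsub>N\<^esub> t) = f" if f: "f \<in> Hom (mod_cat R) N N" for f
    proof (rule mod_homE[OF f])
      fix h assume h: "f = (N, h, N)" "h \<in> module_homs R N N"
      note h' = module_homsD[OF h(2)]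
      have ht: "h t \<in> carrier N" by (rule h'(2)[OF t(2)])
      have "q t y \<odot>\<^bsub>N\<^esub> (q t (h t) \<odot>\<^bsub>N\<^esub> t) = h y" if "y \<in> carrier N" for y
        using h'(4)[OF qt'(1)[OF that] t(2)] span[OF that] span[OF ht] by simp
      then have "(\<lambda>y \<in> carrier N. q t y \<odot>\<^bsub>N\<^esub> (q t (h t) \<odot>\<^bsub>N\<^esub> t)) = h"
        using h'(1,2) by (auto intro!: module_homs_eqI[of _ N _ h])
      then show ?thesis
        using h(1) qt'(1)[OF ht] by (intro bexI[of _ "q t (h t)"]) (simp_all add: E_def)
    qed
  qed
  then show ?thesis by blast
qed

section \<open>Transport from the module category\<close>

context abelian_category
begin

text \<open>The equivalence sends \<open>s\<close> to a nonzero module without nontrivial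
  idempotents, that is, to a one-dimensional one, through which every finitely generated module is
  covered. Both conclusions are reflected back along the equivalence.\<close>

theorem equivalent_mod_cat_consequences:
  assumes "P \<subseteq> Obj C" "\<And>f g. short_exact C f g \<Longrightarrow> Cod C f \<in> P \<longleftrightarrow> Dom C f \<in> P \<and> Cod C g \<in> P"
    "\<exists>z \<in> P. zero_object C z" "is_division_ring R" "equivalent_cats (full_sub C P) (mod_cat R)"
    "indecomposable (full_sub C P) s"
  shows "\<exists>\<beta>. \<beta> \<in> ring_iso R (End_ring C s)" "\<And>p. p \<in> P \<Longrightarrow> thru C s p p (Ide C p)"
proof -
  have ring: "ring R" using assms(4) by (simp add: is_division_ring_def)
  interpret B: preadditive_category "full_sub C P" by (rule preadditive_full_sub[OF assms(1)])
  interpret D: preadditive_category "mod_cat R" by (rule preadditive_mod_cat[OF ring])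
  obtain F where F: "is_functor (full_sub C P) (mod_cat R) F" "fully_faithful (full_sub C P) (mod_cat R) F"
    by (rule B.equivalence_fully_faithful[OF D.category_axioms assms(5)])
  have zo: "\<exists>z. zero_object (full_sub C P) z"
  proof -
    obtain z where z: "z \<in> P" "zero_object C z" using assms(3) by blast
    have "zero_object (full_sub C P) z"
      unfolding zero_object_def full_sub_simps
    proof (intro conjI ballI)
      fix x assume x: "x \<in> P"
      then have "x \<in> Obj C" using assms(1) by blast
      then show "\<exists>!f. f \<in> Hom (full_sub C P) z x" "\<exists>!f. f \<in> Hom (full_sub C P) x z"
        using z(2) unfolding zero_object_def Hom_full_sub[OF z(1) x] Hom_full_sub[OF x z(1)] by blast+
    qed (rule z)
    then show ?thesis ..
  qed
  have bp: "\<exists>p i1 i2 p1 p2. biproduct (full_sub C P) x y p i1 i2 p1 p2" if "x \<in> Obj (full_sub C P)" "y \<in> Obj (full_sub C P)" for x y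
  proof -
    have xy: "x \<in> P" "y \<in> P" using that by simp_all
    then have "x \<in> Obj C" "y \<in> Obj C" using assms(1) by auto
    then obtain p i1 i2 p1 p2 where b: "biproduct C x y p i1 i2 p1 p2" using ex_biproduct by metis
    note d = biproductD[OF b]
    have "p \<in> P" using assms(2)[OF biproduct_ses(1)[OF b]] d xy by simp
    then have "biproduct (full_sub C P) x y p i1 i2 p1 p2"
      using d xy by (simp add: biproduct_def)
    then show ?thesis by blast
  qed
  interpret F: ff_functor "full_sub C P" "mod_cat R" F
    by (intro ff_functor.intro ff_functor_axioms.intro B.preadditive_category_axioms D.preadditive_category_axioms F zo bp)
  have s: "s \<in> P" using assms(6) by (simp add: indecomposable_def)
  let ?N = "Fobj F s"
  have N: "?N \<in> Obj (mod_cat R)" using F.F_simps(1)[of s] s by simp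
  then have Nm: "right_module R ?N" by simp
  interpret N: right_module R ?N by (rule Nm)
  have "\<exists>y0 \<in> carrier ?N. y0 \<noteq> \<zero>\<^bsub>?N\<^esub>"
  proof (rule ccontr)
    assume "\<not> (\<exists>y0 \<in> carrier ?N. y0 \<noteq> \<zero>\<^bsub>?N\<^esub>)"
    then have "Ide (mod_cat R) ?N = Zer (mod_cat R) ?N ?N"
      by (auto intro!: restrict_ext)
    then have "Fmap F (Ide (full_sub C P) s) = Fmap F (Zer (full_sub C P) s s)"
      using F.F_simps(2)[of s] F.F_zer[of s s] s by simp
    then have "Ide (full_sub C P) s = Zer (full_sub C P) s s"
      by (rule F.faithful) (use s assms(1) in auto)
    then show False
      using indecomposable_nonzero[OF assms(1,6)] by simp
  qed
  then obtain y0 where y0: "y0 \<in> carrier ?N" "y0 \<noteq> \<zero>\<^bsub>?N\<^esub>" by blast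
  have s': "s \<in> Obj (full_sub C P)" using s by simp
  \<comment> \<open>Full faithfulness lifts an idempotent of the module to one of \<open>s\<close>,
    where \<open>idempotent_trivial\<close> applies.\<close>
  have idem: "e = Zer (mod_cat R) ?N ?N \<or> e = Ide (mod_cat R) ?N" if e: "e \<in> Hom (mod_cat R) ?N ?N" "e \<cdot>\<^bsub>mod_cat R\<^esub> e = e" for e
  proof -
    have e1: "e \<in> Arr (mod_cat R)" "Dom (mod_cat R) e = ?N" "Cod (mod_cat R) e = ?N" using e(1) by simp_all
    obtain f where f: "f \<in> Arr (full_sub C P)" "Dom (full_sub C P) f = s" "Cod (full_sub C P) f = s" "Fmap F f = e"
      by (rule F.full[OF e1 s' s'])
    have "Fmap F (f \<cdot>\<^bsub>full_sub C P\<^esub> f) = Fmap F f"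
      using F.F_comp[of f f] f e(2) by simp
    then have "f \<cdot>\<^bsub>full_sub C P\<^esub> f = f"
      by (rule F.faithful) (use f in simp_all)
    then have "f = Zer C s s \<or> f = Ide C s"
      using idempotent_trivial[OF assms(1,2,6), of f] f by simp
    then show ?thesis
      using f(4) F.F_simps(2)[OF s'] F.F_zer[OF s' s'] by auto
  qed
  obtain \<beta> where "\<beta> \<in> ring_iso R (End_ring (mod_cat R) ?N)"
    using End_mod_cat_iso[OF assms(4) N y0 idem] by blast
  then have "\<exists>\<beta>. \<beta> \<in> ring_iso R (End_ring (full_sub C P) s)"
    by (rule F.ring_iso_reflect[OF _ s' ring])
  moreover have "End_ring (full_sub C P) s = End_ring C s"
    using Hom_full_sub[OF s s] by (simp add: End_ring_def)
  ultimately show "\<exists>\<beta>. \<beta> \<in> ring_iso R (End_ring C s)" by simp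
  fix p assume p: "p \<in> P"
  have p': "p \<in> Obj (full_sub C P)" using p by simp
  have "thru (mod_cat R) ?N (Fobj F p) (Fobj F p) (Ide (mod_cat R) (Fobj F p))"
    by (rule thru_mod_cat[OF assms(4) F.F_simps(1)[OF p'] N y0])
  then have "thru (full_sub C P) s p p (Ide C p)"
    using F.thru_Ide_reflect[OF _ s' p'] by simp
  moreover have "thru C s p p h" if "thru (full_sub C P) s p p h" for h
    using that
  proof (induction rule: thru.induct)
    case thru_Zer
    show ?case using thru.thru_Zer[of C s p p] by simp
  next
    case (thru_Add h f g)
    then show ?case using thru.thru_Add[of C s p p h f g] by simp
  qed
  ultimately show "thru C s p p (Ide C p)" by blast
qed

end

section \<open>Expansions\<close>

lemma thru_op_imp: "thru C T p q h \<Longrightarrow> thru (op_cat C) T q p h"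
proof (induction rule: thru.induct)
  case thru_Zer
  show ?case using thru.thru_Zer[of "op_cat C" T q p] by simp
next
  case (thru_Add h f g)
  then show ?case using thru.thru_Add[of "op_cat C" T q p h g f] by simp
qed

lemma (in preadditive_category) division_End:
  assumes "\<beta> \<in> ring_iso R (End_ring C s)" "is_division_ring R" "t \<in> Hom C s s" "t \<noteq> Zer C s s"
  shows "\<exists>t' \<in> Hom C s s. t' \<cdot> t = Ide C s \<and> t \<cdot> t' = Ide C s"
proof -
  interpret ring R using assms(2) by (simp add: is_division_ring_def)
  note \<beta> = ring_iso_EndD[OF assms(1)]
  obtain d where d: "d \<in> carrier R" "\<beta> d = t" using \<beta>(8)[OF assms(3)] by blast
  have "\<beta> \<zero>\<^bsub>R\<^esub> = Zer C s s"
    using \<beta>(5)[of "\<zero>\<^bsub>R\<^esub>" "\<zero>\<^bsub>R\<^esub>"] \<beta>(1-3)[of "\<zero>\<^bsub>R\<^esub>"] add_idem_zer[of "\<beta> \<zero>\<^bsub>R\<^esub>"] by simp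
  then have "d \<noteq> \<zero>\<^bsub>R\<^esub>" using d assms(4) by auto
  then have "d \<in> Units R" using d assms(2) by (simp add: is_division_ring_def)
  then obtain i where i: "i \<in> carrier R" "i \<otimes>\<^bsub>R\<^esub> d = \<one>\<^bsub>R\<^esub>" "d \<otimes>\<^bsub>R\<^esub> i = \<one>\<^bsub>R\<^esub>"
    unfolding Units_def by blast
  then show ?thesis
    using \<beta>(1-3)[OF i(1)] \<beta>(4)[OF i(1) d(1)] \<beta>(4)[OF d(1) i(1)] \<beta>(6) d(2)
    by (intro bexI[of _ "\<beta> i"]) simp_all
qed

context adjoint_pair
begin

lemma null_zero_object: "\<exists>z \<in> null. zero_object A z"
proof -
  obtain z where z: "zero_object A z" using A.ex_zero_object ..
  then have zo: "z \<in> Obj A" by (simp add: zero_object_def)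
  have "\<exists>!f. f \<in> Hom A z z" using z zo by (simp add: zero_object_def)
  moreover have "Ide A z \<in> Hom A z z" "Zer A z z \<in> Hom A z z" using zo by simp_all
  ultimately have "Ide A z = Zer A z z" by blast
  then have "Ide B (Fobj R z) = Zer B (Fobj R z) (Fobj R z)"
    using R_simps(2)[OF zo] R_zer[OF zo zo] by simp
  then show ?thesis using z zo by (auto simp add: null_def)
qed

text \<open>The additive functor \<open>R\<close> kills every arrow through \<open>T\<close>, hence
  the identity of \<open>p\<close>. This serves to show that a whole perpendicular class lies in the
  other one as soon as its indecomposable object does.\<close>

lemma null_thru:
  assumes "T \<in> null" "p \<in> Obj A" "thru A T p p (Ide A p)"
  shows "p \<in> null"
proof -
  have T: "T \<in> Obj A" "Ide B (Fobj R T) = Zer B (Fobj R T) (Fobj R T)" using assms(1) by (simp_all add: null_def)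
  have RT: "Fobj R T \<in> Obj B" using T by simp
  have "h \<in> Hom A p p \<and> Fmap R h = Zer B (Fobj R p) (Fobj R p)" if "thru A T p p h" for h
    using that
  proof (induction rule: thru.induct)
    case thru_Zer
    show ?case using assms(2) R_zer by simp
  next
    case (thru_Add h f g)
    have fg: "f \<in> Arr A" "Dom A f = p" "Cod A f = T" "g \<in> Arr A" "Dom A g = T" "Cod A g = p"
      using thru_Add by simp_all
    have "Fmap R f = Zer B (Fobj R p) (Fobj R T)"
      using B.Zer_Ide_imp(1)[OF T(2) RT, of "Fmap R f"] fg by simp
    then have "Fmap R (g \<cdot>\<^bsub>A\<^esub> f) = Zer B (Fobj R p) (Fobj R p)"
      using R_comp[of f g] fg assms(2) by simp
    then show ?case
      using thru_Add fg assms(2) R_add[of h "g \<cdot>\<^bsub>A\<^esub> f"] by simp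
  qed
  from this[OF assms(3)] show ?thesis
    using assms(2) by (simp add: null_def)
qed

lemma perp_resolution_null:
  assumes "T \<in> null" "\<And>p q f g h. \<lbrakk>p \<in> null; q \<in> null; (f, g, h) \<in> extensions2 A p q\<rbrakk> \<Longrightarrow> splits2 A f g"
    "\<And>p. p \<in> null \<Longrightarrow> thru A T p p (Ide A p)" "Ide A T \<noteq> Zer A T T"
    "\<And>t. \<lbrakk>t \<in> Hom A T T; t \<noteq> Zer A T T\<rbrakk> \<Longrightarrow> \<exists>t' \<in> Hom A T T. t' \<cdot>\<^bsub>A\<^esub> t = Ide A T \<and> t \<cdot>\<^bsub>A\<^esub> t' = Ide A T"
  shows "perp_resolution A (Fobj F ` Obj B) null counit (\<lambda>a. SOME k. is_kernel A k (counit a)) T"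
proof -
  have k: "is_kernel A (SOME k. is_kernel A k (counit a)) (counit a)" if "a \<in> Obj A" for a
    using A.ex_kernel[OF counit(1)[OF that]] by (rule someI_ex)
  have nP: "a \<in> right_perp B A F" if "a \<in> null" for a using that null_eq_right_perp by simp
  show ?thesis
  proof (intro perp_resolution.intro perp_resolution_axioms.intro A.abelian_category_axioms k assms(1,3,4))
    show "null \<subseteq> Obj A" by (auto simp add: null_def)
    show "counit a \<in> Arr A" "Cod A (counit a) = a" "Dom A (counit a) \<in> Fobj F ` Obj B" if "a \<in> Obj A" for a
      using counit[OF that] that by auto
    show "\<exists>g. g \<in> Arr A \<and> Dom A g = Dom A f \<and> Cod A g = Dom A (counit (Cod A f)) \<and> counit (Cod A f) \<cdot>\<^bsub>A\<^esub> g = f"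
      if f: "f \<in> Arr A" "Dom A f \<in> Fobj F ` Obj B" for f
    proof -
      obtain x where "x \<in> Obj B" "Dom A f = Fobj F x" using f(2) by blast
      then show ?thesis using counit_lift[of f x] f(1) by blast
    qed
    show "g = g'" if h: "a \<in> Obj A" "g \<in> Arr A" "g' \<in> Arr A" "Dom A g = Dom A g'" "Dom A g' \<in> Fobj F ` Obj B"
      "Cod A g = Dom A (counit a)" "Cod A g' = Dom A (counit a)" "counit a \<cdot>\<^bsub>A\<^esub> g = counit a \<cdot>\<^bsub>A\<^esub> g'" for a g g'
    proof -
      obtain x where "Dom A g' = Fobj F x" "x \<in> Obj B" using h(5) by blast
      from counit_unique[OF h(1-4) this h(6-8)] show ?thesis .
    qed
    show "Dom A (SOME k. is_kernel A k (counit a)) \<in> null" if "a \<in> Obj A" for a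
      by (rule counit_null(1)[OF that k[OF that]])
    show "Cod A h \<in> null" if "a \<in> Obj A" "is_cokernel A h (counit a)" for a h
      by (rule counit_null(2)[OF that])
    show "f = Zer A (Dom A f) (Cod A f)" if f: "f \<in> Arr A" "Dom A f \<in> Fobj F ` Obj B" "Cod A f \<in> null" for f
    proof -
      obtain x where x: "x \<in> Obj B" "Dom A f = Fobj F x" using f(2) by blast
      have "Hom A (Fobj F x) (Cod A f) = {Zer A (Fobj F x) (Cod A f)}"
        using nP[OF f(3)] x(1) unfolding right_perp_def by blast
      moreover have "f \<in> Hom A (Fobj F x) (Cod A f)" using f x by simp
      ultimately show ?thesis unfolding x(2) by blast
    qed
    show "split_epi A g" if s: "short_exact A f g" "Cod A g \<in> Fobj F ` Obj B" "Dom A f \<in> null" for f g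
    proof -
      obtain x where x: "x \<in> Obj B" "Cod A g = Fobj F x" using s(2) by blast
      have "Ext1 A (Fobj F x) (Dom A f) = {Ext1_zero A (Fobj F x) (Dom A f)}"
        using nP[OF s(3)] x(1) unfolding right_perp_def by blast
      moreover have "(f, g) \<in> extensions A (Fobj F x) (Dom A f)" using s(1) x(2) by (simp add: extensions_def)
      moreover have o: "Dom A f \<in> Obj A" "Fobj F x \<in> Obj A" using A.sesD(1)[OF s(1)] x(1) by simp_all
      ultimately show ?thesis unfolding A.Ext1_trivial_iff[OF o] by blast
    qed
    show "Cod A f \<in> null" if "short_exact A f g" "Dom A f \<in> null" "Cod A g \<in> null" for f g
      using null_ses[OF that(1)] that(2,3) by blast
    show "splits2 A f g" if "p \<in> null" "q \<in> null" "(f, g, h) \<in> extensions2 A p q" for p q f g h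
      by (rule assms(2)[OF that])
    show "\<exists>t' \<in> Hom A T T. t' \<cdot>\<^bsub>A\<^esub> t = Ide A T \<and> t \<cdot>\<^bsub>A\<^esub> t' = Ide A T" if "t \<in> Hom A T T" "t \<noteq> Zer A T T" for t
      by (rule assms(5)[OF that])
  qed
qed

end

section \<open>Orthogonality of S and T\<close>

context perp_resolution
begin

text \<open>The image of \<open>f\<close> is a subobject of \<open>T\<close>, hence in
  \<open>P\<close>, and it is nonzero. Its inclusion therefore has a right inverse and is
  epi.\<close>

lemma nonzero_to_T_epi:
  assumes "\<And>f g. short_exact A f g \<Longrightarrow> Cod A f \<in> P \<Longrightarrow> Dom A f \<in> P" "f \<in> Arr A" "Cod A f = T" "f \<noteq> Zer A (Dom A f) T"
  shows "is_epi A f"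
proof -
  note [simp] = assms(2,3)
  obtain k' where k: "is_kernel A k' f" using ex_kernel[OF assms(2)] by blast
  note [simp] = kernelD(1-3)[OF k]
  obtain e where e: "is_cokernel A e k'" using ex_cokernel[of k'] by auto
  note [simp] = cokernelD(1-3)[OF e]
  obtain m where m: "is_mono A m" "Dom A m = Cod A e" "Cod A m = Cod A f" "m \<cdot> e = f"
    by (rule image_factor[OF assms(2) k e])
  note [simp] = mono_arr[OF m(1)] m(2,3)
  obtain h where h: "is_cokernel A h m" using ex_cokernel[of m] by auto
  have mP: "Dom A m \<in> P"
    by (rule assms(1)[OF ses_monoI[OF m(1) h]]) (simp add: T_P)
  have "m \<noteq> Zer A (Dom A m) T"
  proof
    assume "m = Zer A (Dom A m) T"
    then have "f = Zer A (Dom A m) T \<cdot> e" using m(4) by metis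
    then show False using assms(4) by simp
  qed
  then obtain s where s: "s \<in> Arr A" "Dom A s = T" "Cod A s = Dom A m" "m \<cdot> s = Ide A T"
    using mP by - (rule to_T_split[of m], (assumption | simp)+)
  have "is_epi A m"
  proof (rule epiI)
    fix g assume g: "g \<in> Arr A" "Dom A g = Cod A m" "g \<cdot> m = Zer A (Dom A m) (Cod A g)"
    have "g \<cdot> (m \<cdot> s) = Zer A (Dom A m) (Cod A g) \<cdot> s"
      by (rule comp_subst[OF g(3)]) (use g s in simp_all)
    then show "g = Zer A (Cod A m) (Cod A g)"
      using g s by simp
  qed simp
  then have "is_epi A (m \<cdot> e)"
    by (intro epi_comp cokernelD(5)[OF e]) simp_all
  then show ?thesis by (simp only: m(4))
qed

text \<open>Arrows to \<open>T\<close> detect arrows into any object of \<open>P\<close>, so the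
  vanishing of arrows from \<open>S\<close> to \<open>P\<close> need only be known for
  \<open>T\<close>.\<close>

lemma perp_pairingI:
  assumes "S \<in> Obj A" "\<And>f. \<lbrakk>f \<in> Arr A; Dom A f = S; Cod A f \<in> Bs\<rbrakk> \<Longrightarrow> f = Zer A S (Cod A f)"
    "\<And>f g. \<lbrakk>short_exact A f g; Cod A g = S; Dom A f \<in> Bs\<rbrakk> \<Longrightarrow> split_epi A g"
    "Hom A S T = {Zer A S T}" "Ide A S \<noteq> Zer A S S"
    "\<And>t. \<lbrakk>t \<in> Hom A S S; t \<noteq> Zer A S S\<rbrakk> \<Longrightarrow> \<exists>t' \<in> Hom A S S. t' \<cdot> t = Ide A S \<and> t \<cdot> t' = Ide A S"
  shows "perp_pairing A Bs P c k T S"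
proof (intro perp_pairing.intro perp_pairing_axioms.intro perp_resolution_axioms assms(1,5))
  show "f = Zer A S (Cod A f)" if f: "f \<in> Arr A" "Dom A f = S" "Cod A f \<in> P" for f
  proof -
    have "g \<cdot> f = Zer A (Dom A f) T" if "g \<in> Hom A (Cod A f) T" for g
    proof -
      have "g \<cdot> f \<in> Hom A S T" using f that by simp
      then show ?thesis using assms(4) f(2) by auto
    qed
    from zero_by_T_targets[OF f(1,3) this] show ?thesis using f(2) by simp
  qed
  show "f = Zer A S (Cod A f)" if "f \<in> Arr A" "Dom A f = S" "Cod A f \<in> Bs" for f
    by (rule assms(2)[OF that])
  show "split_epi A g" if "short_exact A f g" "Cod A g = S" "Dom A f \<in> Bs" for f g
    by (rule assms(3)[OF that])
  show "\<exists>t' \<in> Hom A S S. t' \<cdot> t = Ide A S \<and> t \<cdot> t' = Ide A S" if "t \<in> Hom A S S" "t \<noteq> Zer A S S" for t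
    by (rule assms(6)[OF that])
qed

end

text \<open>The development is instantiated twice: in \<open>A\<close> with \<open>T\<close> the
  object S_rho, \<open>S\<close> the object S_lam and the counit of the right adjoint, and in
  \<open>op_cat A\<close> with these two objects exchanged and the left adjoint in its place. Each
  instance yields one isomorphism and one of the two lifting properties of an almost split
  sequence.\<close>

theorem proposition3p7p1:
  fixes A :: "('o, 'm) cat" and B :: "('p, 'n) cat" and F :: "('p, 'n, 'o, 'm) func"
    and \<Delta> :: "'r ring" and S_lam S_rho :: 'o
  assumes "nonsplit_expansion B A F"
    and "associated_division_ring B A F \<Delta>"
    and "indecomposable (left_perp_cat B A F) S_lam"
    and "indecomposable (right_perp_cat B A F) S_rho"
  shows "(\<exists>\<alpha> \<beta>. compatible_identification A \<Delta> S_lam S_rho \<alpha> \<beta>) \<and>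
    (\<forall>\<alpha> \<beta>. compatible_identification A \<Delta> S_lam S_rho \<alpha> \<beta> \<longrightarrow>
       mod_func_iso A \<Delta> (D_Ext_to A \<Delta> \<beta> S_rho) (Hom_from A \<alpha> S_lam) \<and>
       mod_func_iso (op_cat A) \<Delta> (D_Ext_from A \<Delta> \<alpha> S_lam) (Hom_to A \<beta> S_rho)) \<and>
    (\<forall>e \<in> extensions A S_lam S_rho. \<not> split_ext A e \<longrightarrow> almost_split A e)"
proof -
  have exp: "expansion B A F" and nonsplit: "right_perp B A F \<noteq> left_perp B A F"
    using assms(1) by (auto simp add: nonsplit_expansion_def split_expansion_def)
  have lexp: "left_expansion B A F" and rexp: "right_expansion B A F"
    using exp by (simp_all add: expansion_def)
  have div: "is_division_ring \<Delta>" and eql: "equivalent_cats (left_perp_cat B A F) (mod_cat \<Delta>)"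
    and eqr: "equivalent_cats (right_perp_cat B A F) (mod_cat \<Delta>)"
    using assms(2) by (simp_all add: associated_division_ring_def)
  have ring: "ring \<Delta>" using div by (simp add: is_division_ring_def)
  have abA: "abelian_category A" and abB: "abelian_category B" and ff: "fully_faithful B A F"
    using lexp by (simp_all add: left_expansion_def)
  have Ff: "is_functor B A F" using lexp by (simp add: left_expansion_def exact_functor_def)
  obtain L where L: "exact_functor A B L" "adjunction A B L F" using lexp by (auto simp add: left_expansion_def)
  obtain R where R: "exact_functor A B R" "adjunction B A F R" using rexp by (auto simp add: right_expansion_def)
  have Ext2l: "Ext2 A a b = {Ext2_zero A a b}" if "a \<in> left_perp B A F" "b \<in> left_perp B A F" for a b
    using lexp that unfolding left_expansion_def by blast
  have Ext2r: "Ext2 A a b = {Ext2_zero A a b}" if "a \<in> right_perp B A F" "b \<in> right_perp B A F" for a b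
    using rexp that unfolding right_expansion_def by blast
  let ?S = S_lam and ?T = S_rho
  let ?Bs = "Fobj F ` Obj B"
  interpret A: abelian_category A by (rule abA)
  interpret opA: abelian_category "op_cat A" by (rule A.op_abelian)
  obtain \<phi> where "adjoint_pair A B F R \<phi>"
  proof -
    obtain \<phi> where "\<forall>x \<in> Obj B. \<forall>y \<in> Obj A. bij_betw (\<phi> x y) (Hom A (Fobj F x) y) (Hom B x (Fobj R y))"
      "\<forall>x \<in> Obj B. \<forall>x' \<in> Obj B. \<forall>y \<in> Obj A. \<forall>y' \<in> Obj A. \<forall>f \<in> Hom B x' x. \<forall>h \<in> Hom A y y'. \<forall>g \<in> Hom A (Fobj F x) y.
        \<phi> x' y' (h \<cdot>\<^bsub>A\<^esub> g \<cdot>\<^bsub>A\<^esub> Fmap F f) = Fmap R h \<cdot>\<^bsub>B\<^esub> \<phi> x y g \<cdot>\<^bsub>B\<^esub> f"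
      using R(2) unfolding adjunction_def by blast
    then have "adjoint_pair A B F R \<phi>"
      by (intro adjoint_pair.intro adjoint_pair_axioms.intro abA abB Ff ff R(1)) blast+
    then show ?thesis by (rule that)
  qed
  then interpret r: adjoint_pair A B F R \<phi> .
  obtain \<psi> where "adjoint_pair (op_cat A) (op_cat B) F L \<psi>"
    by (rule adjoint_pair_op[OF abA abB L ff])
  then interpret l: adjoint_pair "op_cat A" "op_cat B" F L \<psi> .
  define P where "P = right_perp B A F"
  define Q where "Q = left_perp B A F"
  have P_null: "P = r.null" unfolding P_def by (rule r.null_eq_right_perp)
  have Q_null: "Q = l.null" unfolding Q_def l.null_eq_right_perp[symmetric] by (rule right_perp_op[OF abA, symmetric])
  have PO: "P \<subseteq> Obj A" and QO: "Q \<subseteq> Obj A"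
    unfolding P_def Q_def right_perp_def left_perp_def by blast+
  have Ps: "Cod A f \<in> P \<longleftrightarrow> Dom A f \<in> P \<and> Cod A g \<in> P" if "short_exact A f g" for f g
    unfolding P_null by (rule r.null_ses[OF that])
  have Qs: "Cod A f \<in> Q \<longleftrightarrow> Dom A f \<in> Q \<and> Cod A g \<in> Q" if s: "short_exact A f g" for f g
    unfolding Q_null using l.null_ses[of g f] s A.sesD(3)[OF s] by auto
  have Pz: "\<exists>z \<in> P. zero_object A z" unfolding P_null by (rule r.null_zero_object)
  have Qz: "\<exists>z \<in> Q. zero_object A z" unfolding Q_null using l.null_zero_object by simp
  note iT = assms(4)[folded P_def] and iS = assms(3)[folded Q_def]
  note eP = eqr[folded P_def] and eQ = eql[folded Q_def]
  have TP: "?T \<in> P" and SQ: "?S \<in> Q" using iT iS by (simp_all add: indecomposable_def)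
  obtain \<beta>0 where \<beta>0: "\<beta>0 \<in> ring_iso \<Delta> (End_ring A ?T)"
    using A.equivalent_mod_cat_consequences(1)[OF PO Ps Pz div eP iT] by blast
  obtain \<alpha>0 where \<alpha>0: "\<alpha>0 \<in> ring_iso \<Delta> (End_ring A ?S)"
    using A.equivalent_mod_cat_consequences(1)[OF QO Qs Qz div eQ iS] by blast
  have thP: "thru A ?T p p (Ide A p)" if "p \<in> P" for p
    using A.equivalent_mod_cat_consequences(2)[OF PO Ps Pz div eP iT that] .
  have thQ: "thru A ?S p p (Ide A p)" if "p \<in> Q" for p
    using A.equivalent_mod_cat_consequences(2)[OF QO Qs Qz div eQ iS that] .
  have Tn: "Ide A ?T \<noteq> Zer A ?T ?T" by (rule A.indecomposable_nonzero[OF PO iT])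
  have Sn: "Ide A ?S \<noteq> Zer A ?S ?S" by (rule A.indecomposable_nonzero[OF QO iS])
  have Td: "\<exists>t' \<in> Hom A ?T ?T. t' \<cdot>\<^bsub>A\<^esub> t = Ide A ?T \<and> t \<cdot>\<^bsub>A\<^esub> t' = Ide A ?T" if "t \<in> Hom A ?T ?T" "t \<noteq> Zer A ?T ?T" for t
    by (rule A.division_End[OF \<beta>0 div that])
  have Sd: "\<exists>t' \<in> Hom A ?S ?S. t' \<cdot>\<^bsub>A\<^esub> t = Ide A ?S \<and> t \<cdot>\<^bsub>A\<^esub> t' = Ide A ?S" if "t \<in> Hom A ?S ?S" "t \<noteq> Zer A ?S ?S" for t
    by (rule A.division_End[OF \<alpha>0 div that])
  have rres: "perp_resolution A ?Bs P r.counit (\<lambda>a. SOME k. is_kernel A k (r.counit a)) ?T"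
    unfolding P_null
  proof (rule r.perp_resolution_null)
    show "splits2 A f g" if "p \<in> r.null" "q \<in> r.null" "(f, g, h) \<in> extensions2 A p q" for p q f g h
      using A.Ext2_zero_splits2[OF Ext2r that(3)] that(1,2) unfolding P_null[symmetric] P_def by blast
  qed (use TP thP Tn Td in \<open>unfold P_null[symmetric], blast+\<close>)
  \<comment> \<open>Read in \<open>A\<close>, the arrow \<open>l.counit a\<close> is the universal
    arrow from \<open>a\<close> to an object of \<open>B\<close>, and \<open>l.null\<close> is the
    left perpendicular class.\<close>
  have lres: "perp_resolution (op_cat A) ?Bs Q l.counit (\<lambda>a. SOME k. is_kernel (op_cat A) k (l.counit a)) ?S"
    unfolding Q_null
  proof -
    have "perp_resolution (op_cat A) (Fobj F ` Obj (op_cat B)) l.null l.counit (\<lambda>a. SOME k. is_kernel (op_cat A) k (l.counit a)) ?S"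
    proof (rule l.perp_resolution_null)
      show "splits2 (op_cat A) f g" if h: "p \<in> l.null" "q \<in> l.null" "(f, g, h) \<in> extensions2 (op_cat A) p q" for p q f g h
      proof -
        have e: "(h, g, f) \<in> extensions2 A q p"
          using h(3) A.extensions2_op[of f g h p q] by simp
        \<comment> \<open>The second Ext is assumed to vanish in \<open>A\<close>; self-duality of
          triviality carries the conclusion to \<open>op_cat A\<close>.\<close>
        have "splits2 A h g"
          using A.Ext2_zero_splits2[OF Ext2l e] h(1,2) unfolding Q_null[symmetric] Q_def by blast
        then show ?thesis by (rule A.splits2_dual[OF e])
      qed
      show "?S \<in> l.null" using SQ unfolding Q_null .
      show "thru (op_cat A) ?S p p (Ide (op_cat A) p)" if "p \<in> l.null" for p
        using thru_op_imp[OF thQ[of p]] that unfolding Q_null by simp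
      show "Ide (op_cat A) ?S \<noteq> Zer (op_cat A) ?S ?S" using Sn by simp
      show "\<exists>t' \<in> Hom (op_cat A) ?S ?S. t' \<cdot>\<^bsub>op_cat A\<^esub> t = Ide (op_cat A) ?S \<and> t \<cdot>\<^bsub>op_cat A\<^esub> t' = Ide (op_cat A) ?S"
        if "t \<in> Hom (op_cat A) ?S ?S" "t \<noteq> Zer (op_cat A) ?S ?S" for t
        using Sd[of t] that by auto
    qed
    then show "perp_resolution (op_cat A) ?Bs l.null l.counit (\<lambda>a. SOME k. is_kernel (op_cat A) k (l.counit a)) ?S"
      by simp
  qed
  have SO: "?S \<in> Obj A" and TO: "?T \<in> Obj A" using SQ TP QO PO by auto
  \<comment> \<open>The place where non-splitness is used. A nonzero arrow would be epi by
    \<open>nonzero_to_T_epi\<close>, and mono by the same lemma in \<open>op_cat A\<close>. Closure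
    under quotients and subobjects then puts both indecomposable objects into both classes.\<close>
  have hom: "f = Zer A ?S ?T" if f: "f \<in> Hom A ?S ?T" for f
  proof (rule ccontr)
    assume n: "f \<noteq> Zer A ?S ?T"
    have f': "f \<in> Arr A" "Dom A f = ?S" "Cod A f = ?T" using f by simp_all
    have epi: "is_epi A f"
      by (rule perp_resolution.nonzero_to_T_epi[OF rres _ f'(1,3)]) (use Ps n f'(2) in auto)
    have "is_epi (op_cat A) f"
    proof (rule perp_resolution.nonzero_to_T_epi[OF lres])
      show "Dom (op_cat A) h \<in> Q" if s: "short_exact (op_cat A) h g" "Cod (op_cat A) h \<in> Q" for h g
        using Qs[of g h] s A.sesD(3)[of g h] by simp
    qed (use n f' in simp_all)
    then have mono: "is_mono A f" by simp
    obtain k where k: "is_kernel A k f" using A.ex_kernel[OF f'(1)] by blast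
    have TQ: "?T \<in> Q"
      using Qs[OF A.ses_epiI[OF epi k]] A.kernelD(3)[OF k] f' SQ by simp
    obtain h where h: "is_cokernel A h f" using A.ex_cokernel[OF f'(1)] by blast
    have SP: "?S \<in> P"
      using Ps[OF A.ses_monoI[OF mono h]] f' TP by simp
    \<comment> \<open>The identity of an object of \<open>P\<close> is a sum of arrows through
      \<open>?T\<close>, which now lies in \<open>Q\<close> as well; symmetrically for objects of
      \<open>Q\<close> and \<open>?S\<close>.\<close>
    have "P \<subseteq> Q"
    proof
      fix p assume p: "p \<in> P"
      have "thru (op_cat A) ?T p p (Ide (op_cat A) p)" using thru_op_imp[OF thP[OF p]] by simp
      then show "p \<in> Q"
        using l.null_thru[of ?T p] TQ p PO unfolding Q_null by auto
    qed
    moreover have "Q \<subseteq> P"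
    proof
      fix p assume p: "p \<in> Q"
      show "p \<in> P"
        using r.null_thru[of ?S p] SP thQ[OF p] p QO unfolding P_null by auto
    qed
    ultimately show False using nonsplit unfolding P_def Q_def by blast
  qed
  have rpair: "perp_pairing A ?Bs P r.counit (\<lambda>a. SOME k. is_kernel A k (r.counit a)) ?T ?S"
  proof (rule perp_resolution.perp_pairingI[OF rres SO _ _ _ Sn Sd])
    show "f = Zer A ?S (Cod A f)" if f: "f \<in> Arr A" "Dom A f = ?S" "Cod A f \<in> ?Bs" for f
    proof -
      obtain x where x: "x \<in> Obj B" "Cod A f = Fobj F x" using f(3) by blast
      have "Hom A ?S (Fobj F x) = {Zer A ?S (Fobj F x)}"
        using SQ x(1) unfolding Q_def left_perp_def by blast
      moreover have "f \<in> Hom A ?S (Fobj F x)" using f x by simp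
      ultimately show ?thesis unfolding x(2) by blast
    qed
    show "split_epi A g" if s: "short_exact A f g" "Cod A g = ?S" "Dom A f \<in> ?Bs" for f g
    proof -
      obtain x where x: "x \<in> Obj B" "Dom A f = Fobj F x" using s(3) by blast
      have "Ext1 A ?S (Fobj F x) = {Ext1_zero A ?S (Fobj F x)}"
        using SQ x(1) unfolding Q_def left_perp_def by blast
      moreover have "(f, g) \<in> extensions A ?S (Fobj F x)" using s x by (simp add: extensions_def)
      moreover have o: "Fobj F x \<in> Obj A" using x by simp
      ultimately show ?thesis unfolding A.Ext1_trivial_iff[OF o SO] by blast
    qed
    show "Hom A ?S ?T = {Zer A ?S ?T}" using hom SO TO by (blast intro: in_Hom[THEN iffD2] A.zer_simps)
  qed
  have lpair: "perp_pairing (op_cat A) ?Bs Q l.counit (\<lambda>a. SOME k. is_kernel (op_cat A) k (l.counit a)) ?S ?T"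
  proof (rule perp_resolution.perp_pairingI[OF lres])
    show "?T \<in> Obj (op_cat A)" using TO by simp
    show "f = Zer (op_cat A) ?T (Cod (op_cat A) f)" if f: "f \<in> Arr (op_cat A)" "Dom (op_cat A) f = ?T" "Cod (op_cat A) f \<in> ?Bs" for f
    proof -
      obtain x where x: "x \<in> Obj B" "Dom A f = Fobj F x" using f(3) by auto
      have "Hom A (Fobj F x) ?T = {Zer A (Fobj F x) ?T}"
        using TP x(1) unfolding P_def right_perp_def by blast
      moreover have "f \<in> Hom A (Fobj F x) ?T" using f x by simp
      ultimately have "f = Zer A (Fobj F x) ?T" by blast
      then show ?thesis using x(2) by simp
    qed
    show "split_epi (op_cat A) g" if s: "short_exact (op_cat A) f g" "Cod (op_cat A) g = ?T" "Dom (op_cat A) f \<in> ?Bs" for f g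
    proof -
      have s': "short_exact A g f" "Dom A g = ?T" "Cod A f \<in> ?Bs" using s by simp_all
      obtain x where x: "x \<in> Obj B" "Cod A f = Fobj F x" using s'(3) by blast
      have "Ext1 A (Fobj F x) ?T = {Ext1_zero A (Fobj F x) ?T}"
        using TP x(1) unfolding P_def right_perp_def by blast
      moreover have "(g, f) \<in> extensions A (Fobj F x) ?T" using s' x by (simp add: extensions_def)
      moreover have o: "Fobj F x \<in> Obj A" using x by simp
      ultimately have "split_epi A f" unfolding A.Ext1_trivial_iff[OF TO o] by blast
      then show ?thesis using A.split_epi_iff_split_mono[OF s'(1)] by simp
    qed
    show "Hom (op_cat A) ?T ?S = {Zer (op_cat A) ?T ?S}"
      using hom SO TO unfolding Hom_op op_cat_simps by (blast intro: in_Hom[THEN iffD2] A.zer_simps)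
    show "Ide (op_cat A) ?T \<noteq> Zer (op_cat A) ?T ?T" using Tn by simp
    show "\<exists>t' \<in> Hom (op_cat A) ?T ?T. t' \<cdot>\<^bsub>op_cat A\<^esub> t = Ide (op_cat A) ?T \<and> t \<cdot>\<^bsub>op_cat A\<^esub> t' = Ide (op_cat A) ?T"
      if "t \<in> Hom (op_cat A) ?T ?T" "t \<noteq> Zer (op_cat A) ?T ?T" for t
      using Td[of t] that by auto
  qed
  show ?thesis
  proof (intro conjI allI impI ballI)
    show "\<exists>\<alpha> \<beta>. compatible_identification A \<Delta> ?S ?T \<alpha> \<beta>"
      using perp_pairing.compatible_identification_ex[OF rpair \<beta>0 ring] by blast
    fix \<alpha> \<beta> assume c: "compatible_identification A \<Delta> ?S ?T \<alpha> \<beta>"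
    show "mod_func_iso A \<Delta> (D_Ext_to A \<Delta> \<beta> ?T) (Hom_from A \<alpha> ?S)"
    proof (rule perp_pairing.compatible_perp_duality[OF rpair ring c])
      fix u v assume "perp_duality A ?Bs P r.counit (\<lambda>a. SOME k. is_kernel A k (r.counit a)) ?T ?S \<Delta> \<alpha> \<beta> u v"
      then show ?thesis by (rule perp_duality.D_Ext_to_iso_Hom_from)
    qed
    \<comment> \<open>The instance in \<open>op_cat A\<close> speaks of the opposite of
      \<open>op_cat A\<close>, which is \<open>A\<close> again.\<close>
    show "mod_func_iso (op_cat A) \<Delta> (D_Ext_from A \<Delta> \<alpha> ?S) (Hom_to A \<beta> ?T)"
      using perp_pairing.D_Ext_from_op_iso_Hom_to_op[OF lpair ring, of \<alpha> \<beta>] c by simp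
  next
    fix e assume e: "e \<in> extensions A ?S ?T" "\<not> split_ext A e"
    obtain f g where fg: "e = (f, g)" by force
    have ex: "(f, g) \<in> extensions A ?S ?T" and ns: "\<not> split_epi A g" using e by (simp_all add: fg split_ext_def)
    note E = A.extensionsD[OF ex]
    have ex': "(g, f) \<in> extensions (op_cat A) ?T ?S" using ex A.extensions_op by simp
    have ns': "\<not> split_epi (op_cat A) f" using ns A.split_epi_iff_split_mono[OF E(1)] by simp
    have "\<exists>h' \<in> Hom A a (Dom A g). g \<cdot>\<^bsub>A\<^esub> h' = h" if "h \<in> Hom A a (Cod A g)" "\<not> split_epi A h" for a h
      using perp_pairing.almost_split_right[OF rpair ex ns, of h] that E by auto
    moreover have "\<exists>h' \<in> Hom A (Cod A f) a. h' \<cdot>\<^bsub>A\<^esub> f = h" if "h \<in> Hom A (Dom A f) a" "\<not> split_mono A h" for a h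
      using perp_pairing.almost_split_right[OF lpair ex' ns', of h] that E by auto
    ultimately show "almost_split A e"
      using E(1) e(2) unfolding almost_split_def fg by auto
  qed
qed

end
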